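(* Let $m\ge 2$ and $c>-1$, and for $\omega\in\mathbb{C}$ with $\operatorname{Re}\omega\ge 0$ let $\mathcal{F}_{\mathbf{D}}^{\omega}=e^{\omega\delta/2}\,e^{-\frac{\omega}{2(1+c)^2}L}$, with $L=\mathbf{D}^2-(1+c)^2\underline{x}^2$, acting on $\mathcal{L}^2_{0,c}(\mathbb{R}^m)$. Then: 1. For all $t,\ell\in\mathbb{N}$ and $j\in\{1,\dots,\dim\mathcal{M}_\ell\}$, the function $\phi_{t,\ell,j}$ is an eigenfunction of $\mathcal{F}_{\mathbf{D}}^{\omega}$: $$\mathcal{F}_{\mathbf{D}}^{\omega}(\phi_{t,\ell,j})=e^{-\omega t}e^{-\frac{\omega\ell}{1+c}}\phi_{t,\ell,j}.$$ 2. $\mathcal{F}_{\mathbf{D}}^{\omega}$ is a continuous operator on $\mathcal{L}^2_{0,c}(\mathbb{R}^m)$ for all $\omega$ with $\operatorname{Re}\omega\ge0$; in particular $\|\mathcal{F}_{\mathbf{D}}^{\omega}(f)\|\le\|f\|$ for all $f\in\mathcal{L}^2_{0,c}(\mathbb{R}^m)$. 3. If $\operatorname{Re}\omega>0$, then $\mathcal{F}_{\mathbf{D}}^{\omega}$ is a Hilbert--Schmidt operator on $\mathcal{L}^2_{0,c}(\mathbb{R}^m)$. 4. If $\operatorname{Re}\omega=0$, then $\mathcal{F}_{\mathbf{D}}^{\omega}$ is a unitary operator on $\mathcal{L}^2_{0,c}(\mathbb{R}^m)$.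
   Context: $\mathcal{C}l_m$ is the real associative Clifford algebra generated by $e_1,\dots,e_m$ with $e_ie_j+e_je_i=0$ ($i\ne j$), $e_i^2=-1$. Functions take values in $\mathbb{C}\otimes\mathcal{C}l_m$. $\overline{\,\cdot\,}$ is the ($\mathbb{C}$-linear) anti-involution with $\overline{ab}=\overline{b}\,\overline{a}$, $\overline{e_i}=-e_i$; $f^c$ is complex conjugation of the complex coefficients; $[\cdot]_0$ is the scalar part. A point $x\in\mathbb{R}^m$ is identified with $\underline{x}=\sum_i e_ix_i$ and $r=|x|$, so $\underline{x}^2=-r^2$. $\partial_{\underline{x}}=\sum_i e_i\partial_{x_i}$, $\mathbb{E}=\sum_i x_i\partial_{x_i}$, and $\mathbf{D}=\partial_{\underline{x}}+c\,r^{-2}\underline{x}\,\mathbb{E}$. Operators in the Clifford algebra act by left multiplication. Constants: $\delta=1+\frac{m-1}{1+c}$, $\beta_\ell=-\frac{c}{1+c}\ell$, $\gamma_\ell=\frac{2}{1+c}\left(\ell+\frac{m-2}{2}\right)+\frac{c+2}{1+c}$. $h(r)=r^{1-\frac{1+mc}{1+c}}$; $\mathcal{L}^2_{0,c}(\mathbb{R}^m)=L^2(\mathbb{R}^m,h(r)dx)\otimes\mathcal{C}l_m$ with inner product $\langle f,g\rangle=\left[\int_{\mathbb{R}^m}\overline{f^c}\,g\,h(r)\,dx\right]_0$ and norm $\|f\|^2=\langle f,f\rangle$. $\mathcal{M}_\ell$ is the (real) space of $\mathcal{C}l_m$-valued homogeneous polynomials $M$ of degree $\ell$ with $\partial_{\underline{x}}M=0$;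 $\{M_\ell^{(j)}\}_{j=1}^{\dim\mathcal{M}_\ell}$ is a basis of it, orthonormal for $[\int_{\mathbb{S}^{m-1}}\overline{M}N\,d\sigma]_0$. With $L_t^{\alpha}$ the generalized Laguerre polynomials, $$\phi_{2t,\ell,j}=2^{2t}(1+c)^{2t}t!\,L_t^{\frac{\gamma_\ell}{2}-1}(r^2)\,r^{\beta_\ell}M_\ell^{(j)}e^{-r^2/2},\qquad \phi_{2t+1,\ell,j}=-2^{2t+1}(1+c)^{2t+1}t!\,L_t^{\frac{\gamma_\ell}{2}}(r^2)\,\underline{x}\,r^{\beta_\ell}M_\ell^{(j)}e^{-r^2/2}.$$ These functions form an orthogonal basis of $\mathcal{L}^2_{0,c}(\mathbb{R}^m)$. The operator $L$, initially defined on their linear span, is essentially selfadjoint, and $e^{-\frac{\omega}{2(1+c)^2}L}$ is understood through the functional calculus of its closure. *)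

theory Defs
  imports "HOL-Analysis.Analysis"
begin

section \<open>The complexified Clifford algebra\<close>

text \<open>
  An element of the complexified Clifford algebra over the Euclidean space indexed by \<open>'n\<close> is
  the vector of its coefficients with respect to the basis
  \<open>e_A = e_{a_1} ... e_{a_k}\<close>, \<open>A = {a_1 < ... < a_k}\<close>. The componentwise product that the
  library puts on this vector type is never used; the Clifford product is \<open>\<odot>\<close>.
\<close>

type_synonym 'n cl = "complex ^ ('n set)"

text \<open>
  \<open>e_A e_B = cl_sign A B e_{sym_diff A B}\<close>: one sign for every transposition of different
  generators (\<open>b < a\<close>) and one for every square \<open>e_a e_a = -1\<close> (\<open>b = a\<close>).
\<close>

definition cl_sign :: "('n::{finite,linorder}) set \<Rightarrow> 'n set \<Rightarrow> complex" where
  "cl_sign A B = (- 1) ^ card {(a, b). a \<in> A \<and> b \<in> B \<and> b \<le> a}"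

definition cl_mult :: "('n::{finite,linorder}) cl \<Rightarrow> 'n cl \<Rightarrow> 'n cl" (infixl "\<odot>" 70) where
  "u \<odot> v = (\<Sum>A\<in>UNIV. \<Sum>B\<in>UNIV. (cl_sign A B * (u $ A) * (v $ B)) *s axis (sym_diff A B) 1)"

definition cl_gen :: "'n::{finite,linorder} \<Rightarrow> 'n cl" where
  "cl_gen i = axis {i} 1"

text \<open>The scalar unit \<open>e_{}\<close>.\<close>

definition cl_one :: "('n::{finite,linorder}) cl" where
  "cl_one = axis {} 1"

text \<open>Reversing \<open>e_A\<close> and changing the sign of each of its \<open>k = card A\<close> generators yields the
  sign \<open>(-1)^{k(k-1)/2 + k}\<close>.\<close>

definition cl_bar :: "('n::{finite,linorder}) cl \<Rightarrow> 'n cl" where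
  "cl_bar u = (\<chi> A. (- 1) ^ (card A * (card A + 1) div 2) * (u $ A))"

definition cl_cnj :: "('n::{finite,linorder}) cl \<Rightarrow> 'n cl" where
  "cl_cnj u = (\<chi> A. cnj (u $ A))"

definition cl_scalar :: "('n::{finite,linorder}) cl \<Rightarrow> complex" where
  "cl_scalar u = u $ {}"

definition cl_vec :: "real ^ ('n::{finite,linorder}) \<Rightarrow> 'n cl" where
  "cl_vec x = (\<Sum>i\<in>UNIV. (x $ i) *\<^sub>R cl_gen i)"

lemma cl_sign_prod:
  "cl_sign A B = (\<Prod>a\<in>A. \<Prod>b\<in>B. if b \<le> a then - 1 else 1)"
proof -
  have "{(a, b). a \<in> A \<and> b \<in> B \<and> b \<le> a} = {p \<in> A \<times> B. snd p \<le> fst p}" by auto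
  moreover have "(\<Prod>a\<in>A. \<Prod>b\<in>B. if b \<le> a then - 1 else 1)
      = (\<Prod>p\<in>A \<times> B. if snd p \<le> fst p then - 1 else (1::complex))"
    by (simp add: prod.cartesian_product case_prod_unfold)
  moreover have "\<dots> = (\<Prod>p\<in>{p \<in> A \<times> B. snd p \<le> fst p}. - 1)"
    by (rule prod.inter_filter [symmetric]) simp
  ultimately show ?thesis by (simp add: cl_sign_def)
qed

lemma prod_sym_diff_sign:
  fixes f :: "'a::finite \<Rightarrow> complex"
  assumes "\<And>a. f a * f a = 1"
  shows "prod f (sym_diff A B) = prod f A * prod f B"
proof -
  have 1: "prod f A = prod f (A - B) * prod f (A \<inter> B)"
    by (metis (no_types) Int_Diff_Un Int_Diff_disjoint finite mult.commute prod.union_disjoint)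
  have 2: "prod f B = prod f (B - A) * prod f (A \<inter> B)"
    by (metis (no_types) Int_Diff_Un Int_Diff_disjoint Int_commute finite mult.commute prod.union_disjoint)
  have 3: "prod f (A \<inter> B) * prod f (A \<inter> B) = 1"
    by (simp add: prod.distrib [symmetric] assms)
  have "prod f (sym_diff A B) = prod f (A - B) * prod f (B - A)"
    by (rule prod.union_disjoint) auto
  with 1 2 3 show ?thesis by (simp add: algebra_simps)
qed

lemma cl_sign_sym_diff_left: "cl_sign (sym_diff A B) C = cl_sign A C * cl_sign B C"
  unfolding cl_sign_prod
  by (rule prod_sym_diff_sign) (simp add: prod.distrib [symmetric] if_distrib cong: if_cong)

lemma cl_sign_sym_diff_right: "cl_sign A (sym_diff B C) = cl_sign A B * cl_sign A C"
proof -
  have "(\<Prod>b\<in>sym_diff B C. if b \<le> a then - 1 else (1::complex))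
      = (\<Prod>b\<in>B. if b \<le> a then - 1 else 1) * (\<Prod>b\<in>C. if b \<le> a then - 1 else 1)" for a
    by (rule prod_sym_diff_sign) auto
  then show ?thesis unfolding cl_sign_prod by (simp add: prod.distrib)
qed

lemma cl_mult_axis:
  "axis A a \<odot> axis B b = axis (sym_diff A B) (cl_sign A B * a * b)"
proof -
  have "axis A a \<odot> axis B b = (\<Sum>A'\<in>UNIV. \<Sum>B'\<in>UNIV. if B' = B then (if A' = A then
      axis (sym_diff A B) (cl_sign A B * a * b) else 0) else 0)"
    unfolding cl_mult_def
    by (intro sum.cong refl) (auto simp: axis_def vec_eq_iff)
  then show ?thesis by simp
qed

lemma cl_axis_sum: "u = (\<Sum>A\<in>UNIV. axis A (u $ A))" for u :: "('n::{finite,linorder}) cl"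
  by (simp add: vec_eq_iff axis_def)

lemma cl_mult_nth:
  "(u \<odot> v) $ C = (\<Sum>A\<in>UNIV. \<Sum>B\<in>UNIV. if sym_diff A B = C then cl_sign A B * (u $ A) * (v $ B) else 0)"
  unfolding cl_mult_def by (auto intro!: sum.cong simp: axis_def)

lemma cl_mult_add_left: "(u + v) \<odot> w = u \<odot> w + v \<odot> w"
  by (auto simp: vec_eq_iff cl_mult_nth sum.distrib [symmetric] algebra_simps intro!: sum.cong)

lemma cl_mult_add_right: "u \<odot> (v + w) = u \<odot> v + u \<odot> w"
  by (auto simp: vec_eq_iff cl_mult_nth sum.distrib [symmetric] algebra_simps intro!: sum.cong)

lemma cl_mult_scale_left: "(a *s u) \<odot> v = a *s (u \<odot> v)"
  by (auto simp: vec_eq_iff cl_mult_nth sum_distrib_left algebra_simps intro!: sum.cong)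

lemma cl_mult_scale_right: "u \<odot> (a *s v) = a *s (u \<odot> v)"
  by (auto simp: vec_eq_iff cl_mult_nth sum_distrib_left algebra_simps intro!: sum.cong)

lemma cl_mult_zero [simp]: "0 \<odot> v = 0" "v \<odot> 0 = 0"
  by (simp_all add: vec_eq_iff cl_mult_nth cong: if_cong)

lemma cl_mult_sum_left: "(\<Sum>i\<in>I. f i) \<odot> v = (\<Sum>i\<in>I. f i \<odot> v)"
  by (induction I rule: infinite_finite_induct) (simp_all add: cl_mult_add_left)

lemma cl_mult_sum_right: "v \<odot> (\<Sum>i\<in>I. f i) = (\<Sum>i\<in>I. v \<odot> f i)"
  by (induction I rule: infinite_finite_induct) (simp_all add: cl_mult_add_right)

theorem cl_mult_assoc: "(u \<odot> v) \<odot> w = u \<odot> (v \<odot> w)"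
proof -
  have sd: "sym_diff (sym_diff A B) C = sym_diff A (sym_diff B C)" for A B C :: "'a set"
    by auto
  have ax: "(axis A a \<odot> axis B b) \<odot> axis C k = axis A a \<odot> (axis B b \<odot> axis C k)"
    for A B C :: "'a set" and a b k
    by (simp add: cl_mult_axis cl_sign_sym_diff_left cl_sign_sym_diff_right sd mult_ac)
  have "((\<Sum>A\<in>UNIV. axis A (u $ A)) \<odot> (\<Sum>B\<in>UNIV. axis B (v $ B))) \<odot> (\<Sum>C\<in>UNIV. axis C (w $ C))
      = (\<Sum>A\<in>UNIV. axis A (u $ A)) \<odot> ((\<Sum>B\<in>UNIV. axis B (v $ B)) \<odot> (\<Sum>C\<in>UNIV. axis C (w $ C)))"
    by (simp add: cl_mult_sum_left cl_mult_sum_right ax)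
  then show ?thesis by (simp flip: cl_axis_sum)
qed

lemma cl_mult_one: "cl_one \<odot> u = u" "u \<odot> cl_one = u"
proof -
  have "cl_sign {} A = 1" "cl_sign A {} = 1" for A :: "'a set"
    by (simp_all add: cl_sign_def)
  then have "cl_one \<odot> (\<Sum>A\<in>UNIV. axis A (u $ A)) = (\<Sum>A\<in>UNIV. axis A (u $ A))"
    "(\<Sum>A\<in>UNIV. axis A (u $ A)) \<odot> cl_one = (\<Sum>A\<in>UNIV. axis A (u $ A))"
    by (simp_all add: cl_one_def cl_mult_sum_left cl_mult_sum_right cl_mult_axis)
  then show "cl_one \<odot> u = u" "u \<odot> cl_one = u" by (simp_all flip: cl_axis_sum)
qed

theorem cl_gen_square: "cl_gen i \<odot> cl_gen i = - cl_one"
proof -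
  have "cl_gen i \<odot> cl_gen i = axis {} (cl_sign {i} {i})"
    using cl_mult_axis [of "{i}" 1 "{i}" 1] by (simp add: cl_gen_def)
  then show ?thesis by (simp add: cl_one_def cl_sign_prod axis_def vec_eq_iff)
qed

theorem cl_gen_anticommute: "i \<noteq> j \<Longrightarrow> cl_gen i \<odot> cl_gen j + cl_gen j \<odot> cl_gen i = 0"
proof -
  assume "i \<noteq> j"
  then have "cl_sign {i} {j} + cl_sign {j} {i} = 0" "sym_diff {i} {j} = {i, j}" "sym_diff {j} {i} = {i, j}"
    by (auto simp: cl_sign_prod)
  then show ?thesis
    by (simp add: cl_gen_def cl_mult_axis) (simp add: axis_def vec_eq_iff)
qed

theorem cl_gen_generate:
  assumes "\<And>a. a \<in> A \<Longrightarrow> i < a"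
  shows "axis (insert i A) 1 = cl_gen i \<odot> axis A 1"
proof -
  have "cl_sign {i} A = 1" using assms by (force simp: cl_sign_prod intro!: prod.neutral)
  moreover have "sym_diff {i} A = insert i A" using assms by auto
  ultimately show ?thesis by (simp add: cl_gen_def cl_mult_axis)
qed

theorem cl_bar_gen: "cl_bar (cl_gen i) = - cl_gen i"
  by (auto simp: cl_bar_def cl_gen_def axis_def vec_eq_iff)

lemma cl_sign_self: "cl_sign A A = (- 1) ^ (card A * (card A + 1) div 2)"
proof -
  have "finite A" by simp
  then show ?thesis
  proof (induction A rule: finite_linorder_max_induct)
    case empty
    then show ?case by (simp add: cl_sign_def)
  next
    case (insert b A)
    have nin: "b \<notin> A" using insert.hyps by auto
    have 0: "insert b A = sym_diff {b} A" using nin by auto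
    have 1: "cl_sign {b} {b} = - 1" by (simp add: cl_sign_prod)
    have 2: "cl_sign A {b} = 1"
      using insert.hyps by (auto simp: cl_sign_prod dest: leD intro!: prod.neutral)
    have "(\<Prod>a\<in>A. if a \<le> b then - 1 else 1) = (\<Prod>a\<in>A. - 1 :: complex)"
      using insert.hyps by (intro prod.cong) auto
    then have "cl_sign {b} A = (\<Prod>a\<in>A. - 1)" by (simp add: cl_sign_prod)
    then have 3: "cl_sign {b} A = (- 1) ^ card A" by simp
    have "cl_sign (insert b A) (insert b A) = - ((- 1) ^ card A * cl_sign A A)"
      unfolding 0 cl_sign_sym_diff_left cl_sign_sym_diff_right using 1 2 3 by simp
    also have "\<dots> = (- 1) ^ (Suc (card A) + card A * (card A + 1) div 2)"
      by (simp add: insert.IH power_add)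
    also have "Suc (card A) + card A * (card A + 1) div 2
        = card (insert b A) * (card (insert b A) + 1) div 2"
      using nin insert.hyps by simp
    finally show ?case .
  qed
qed

theorem cl_bar_mult: "cl_bar (u \<odot> v) = cl_bar v \<odot> cl_bar u"
proof -
  have bar_sum: "cl_bar (\<Sum>i\<in>I. f i) = (\<Sum>i\<in>I. cl_bar (f i))"
    for f :: "'a set \<Rightarrow> 'a cl" and I
    by (simp add: cl_bar_def vec_eq_iff sum_distrib_left)
  have bar_axis: "cl_bar (axis A a) = axis A (cl_sign A A * a)" for A :: "'a set" and a
    by (auto simp: cl_bar_def cl_sign_self axis_def vec_eq_iff)
  have sq: "cl_sign A B * cl_sign A B = 1" for A B :: "'a set"
    by (simp add: cl_sign_def power_mult_distrib [symmetric])
  have comm: "sym_diff A B = sym_diff B A" for A B :: "'a set" by auto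
  have ax: "cl_bar (axis A a \<odot> axis B b) = cl_bar (axis B b) \<odot> cl_bar (axis A a)"
    for A B :: "'a set" and a b
  proof -
    have "cl_sign (sym_diff A B) (sym_diff A B) * (cl_sign A B * a * b)
        = (cl_sign A B * cl_sign A B) * (cl_sign B A * (cl_sign B B * b) * (cl_sign A A * a))"
      unfolding cl_sign_sym_diff_left cl_sign_sym_diff_right by (simp only: mult_ac)
    then have "cl_sign (sym_diff A B) (sym_diff A B) * (cl_sign A B * a * b)
        = cl_sign B A * (cl_sign B B * b) * (cl_sign A A * a)"
      unfolding sq by simp
    then show ?thesis
      unfolding cl_mult_axis bar_axis comm [of B A] by (rule arg_cong)
  qed
  have "cl_bar ((\<Sum>A\<in>UNIV. axis A (u $ A)) \<odot> (\<Sum>B\<in>UNIV. axis B (v $ B)))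
      = (\<Sum>A\<in>UNIV. \<Sum>B\<in>UNIV. cl_bar (axis B (v $ B)) \<odot> cl_bar (axis A (u $ A)))"
    by (simp only: cl_mult_sum_left cl_mult_sum_right [of "axis _ _"] bar_sum ax)
  also have "\<dots> = cl_bar (\<Sum>B\<in>UNIV. axis B (v $ B)) \<odot> cl_bar (\<Sum>A\<in>UNIV. axis A (u $ A))"
    by (simp only: cl_mult_sum_left cl_mult_sum_right bar_sum)
  finally show ?thesis by (simp flip: cl_axis_sum)
qed


section \<open>Differential operators\<close>

type_synonym 'n cl_fun = "real ^ 'n \<Rightarrow> 'n cl"

definition partial :: "'n::{finite,linorder} \<Rightarrow> 'n cl_fun \<Rightarrow> 'n cl_fun" where
  "partial i f x = vector_derivative (\<lambda>s. f (x + s *\<^sub>R axis i 1)) (at 0)"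

definition dirac :: "('n::{finite,linorder}) cl_fun \<Rightarrow> 'n cl_fun" where
  "dirac f x = (\<Sum>i\<in>UNIV. cl_gen i \<odot> partial i f x)"

definition euler :: "('n::{finite,linorder}) cl_fun \<Rightarrow> 'n cl_fun" where
  "euler f x = (\<Sum>i\<in>UNIV. (x $ i) *\<^sub>R partial i f x)"

definition op_D :: "real \<Rightarrow> ('n::{finite,linorder}) cl_fun \<Rightarrow> 'n cl_fun" where
  "op_D c f x = dirac f x + (c * norm x powi (- 2)) *\<^sub>R (cl_vec x \<odot> euler f x)"

definition op_L :: "real \<Rightarrow> ('n::{finite,linorder}) cl_fun \<Rightarrow> 'n cl_fun" where
  "op_L c f x = op_D c (op_D c f) x - (1 + c)\<^sup>2 *\<^sub>R (cl_vec x \<odot> (cl_vec x \<odot> f x))"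


section \<open>The Hilbert space\<close>

text \<open>
  Elements of \<open>L2 c\<close> are functions; two of them represent the same vector of the Hilbert space
  iff they agree almost everywhere, i.e. iff their difference has norm 0. An operator is
  a relation between functions (its graph).
\<close>

definition weight :: "real \<Rightarrow> real ^ ('n::{finite,linorder}) \<Rightarrow> real" where
  "weight c x = norm x powr (1 - (1 + real CARD('n) * c) / (1 + c))"

definition L2 :: "real \<Rightarrow> ('n::{finite,linorder}) cl_fun set" where
  "L2 c = {f. f \<in> borel_measurable borel \<and>
     (\<forall>A. integrable lborel (\<lambda>x. (cmod (f x $ A))\<^sup>2 * weight c x))}"

definition inner_c :: "real \<Rightarrow> ('n::{finite,linorder}) cl_fun \<Rightarrow> 'n cl_fun \<Rightarrow> complex" where
  "inner_c c f g = cl_scalar (LINT x|lborel. weight c x *\<^sub>R (cl_bar (cl_cnj (f x)) \<odot> g x))"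

definition norm_c :: "real \<Rightarrow> ('n::{finite,linorder}) cl_fun \<Rightarrow> real" where
  "norm_c c f = sqrt (Re (inner_c c f f))"

definition ae_eq :: "('n::{finite,linorder}) cl_fun \<Rightarrow> 'n cl_fun \<Rightarrow> bool" where
  "ae_eq f g \<longleftrightarrow> (AE x in lborel. f x = g x)"

definition lspan :: "('n::{finite,linorder}) cl_fun set \<Rightarrow> 'n cl_fun set" where
  "lspan S = {f. \<exists>T a. finite T \<and> T \<subseteq> S \<and> f = (\<lambda>x. \<Sum>u\<in>T. a u *s u x)}"

definition orthonormal_basis :: "real \<Rightarrow> ('n::{finite,linorder}) cl_fun set \<Rightarrow> bool" where
  "orthonormal_basis c B \<longleftrightarrow> B \<subseteq> L2 c \<and>
     (\<forall>f\<in>B. \<forall>g\<in>B. inner_c c f g = (if f = g then 1 else 0)) \<and>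
     (\<forall>f\<in>L2 c. \<forall>\<epsilon>>0. \<exists>g\<in>lspan B. norm_c c (\<lambda>x. f x - g x) < \<epsilon>)"

type_synonym 'n operator = "('n cl_fun \<times> 'n cl_fun) set"

definition everywhere_defined_operator :: "real \<Rightarrow> ('n::{finite,linorder}) operator \<Rightarrow> bool" where
  "everywhere_defined_operator c T \<longleftrightarrow> T \<subseteq> L2 c \<times> L2 c \<and>
     (\<forall>f\<in>L2 c. \<exists>k. (f, k) \<in> T) \<and>
     (\<forall>f g k l. (f, k) \<in> T \<longrightarrow> (g, l) \<in> T \<longrightarrow> ae_eq f g \<longrightarrow> ae_eq k l) \<and>
     (\<forall>f g k l a b. (f, k) \<in> T \<longrightarrow> (g, l) \<in> T \<longrightarrow>
        (\<lambda>x. a *s f x + b *s g x, \<lambda>x. a *s k x + b *s l x) \<in> T)"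

definition continuous_operator :: "real \<Rightarrow> ('n::{finite,linorder}) operator \<Rightarrow> bool" where
  "continuous_operator c T \<longleftrightarrow> everywhere_defined_operator c T \<and>
     (\<forall>(f, k)\<in>T. \<forall>\<epsilon>>0. \<exists>\<delta>>0. \<forall>(g, l)\<in>T.
        norm_c c (\<lambda>x. g x - f x) < \<delta> \<longrightarrow> norm_c c (\<lambda>x. l x - k x) < \<epsilon>)"

definition unitary_operator :: "real \<Rightarrow> ('n::{finite,linorder}) operator \<Rightarrow> bool" where
  "unitary_operator c T \<longleftrightarrow> everywhere_defined_operator c T \<and>
     (\<forall>(f, k)\<in>T. \<forall>(g, l)\<in>T. inner_c c k l = inner_c c f g) \<and>
     (\<forall>k\<in>L2 c. \<exists>f. (f, k) \<in> T)"

definition hilbert_schmidt_operator :: "real \<Rightarrow> ('n::{finite,linorder}) operator \<Rightarrow> bool" where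
  "hilbert_schmidt_operator c T \<longleftrightarrow> continuous_operator c T \<and>
     (\<exists>B k. orthonormal_basis c B \<and> (\<forall>f\<in>B. (f, k f) \<in> T) \<and>
        (\<lambda>f. (norm_c c (k f))\<^sup>2) summable_on B)"

definition eigenfunction :: "real \<Rightarrow> ('n::{finite,linorder}) operator \<Rightarrow> complex \<Rightarrow> 'n cl_fun \<Rightarrow> bool" where
  "eigenfunction c T a f \<longleftrightarrow> f \<in> L2 c \<and> \<not> ae_eq f (\<lambda>x. 0) \<and> (f, \<lambda>x. a *s f x) \<in> T"

definition op_closure :: "real \<Rightarrow> ('n::{finite,linorder}) operator \<Rightarrow> 'n operator" where
  "op_closure c T = {(f, g). f \<in> L2 c \<and> g \<in> L2 c \<and> (\<exists>p. (\<forall>n::nat. p n \<in> T) \<and>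
     (\<lambda>n. norm_c c (\<lambda>x. fst (p n) x - f x)) \<longlonglongrightarrow> 0 \<and>
     (\<lambda>n. norm_c c (\<lambda>x. snd (p n) x - g x)) \<longlonglongrightarrow> 0)}"


section \<open>Functional calculus of an unbounded selfadjoint operator\<close>

definition orthogonal_projection :: "real \<Rightarrow> (('n::{finite,linorder}) cl_fun \<Rightarrow> 'n cl_fun) \<Rightarrow> bool" where
  "orthogonal_projection c P \<longleftrightarrow>
     (\<forall>f\<in>L2 c. P f \<in> L2 c \<and> ae_eq (P (P f)) (P f)) \<and>
     (\<forall>f\<in>L2 c. \<forall>g\<in>L2 c. \<forall>a b.
        ae_eq (P (\<lambda>x. a *s f x + b *s g x)) (\<lambda>x. a *s P f x + b *s P g x)) \<and>
     (\<forall>f\<in>L2 c. \<forall>g\<in>L2 c. inner_c c (P f) g = inner_c c f (P g))"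

text \<open>Projection-valued measures on the Borel sets of the real line; countable additivity is
  with respect to the strong operator topology.\<close>

definition projection_valued_measure ::
    "real \<Rightarrow> (real set \<Rightarrow> ('n::{finite,linorder}) cl_fun \<Rightarrow> 'n cl_fun) \<Rightarrow> bool" where
  "projection_valued_measure c E \<longleftrightarrow>
     (\<forall>X\<in>sets borel. orthogonal_projection c (E X)) \<and>
     (\<forall>f\<in>L2 c. ae_eq (E UNIV f) f) \<and>
     (\<forall>f\<in>L2 c. \<forall>X::nat \<Rightarrow> real set. range X \<subseteq> sets borel \<longrightarrow> disjoint_family X \<longrightarrow>
        (\<lambda>N. norm_c c (\<lambda>x. (\<Sum>n<N. E (X n) f x) - E (\<Union>n. X n) f x)) \<longlonglongrightarrow> 0)"

text \<open>The finite measure \<open>X \<mapsto> \<langle>f, E X f\<rangle>\<close>.\<close>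

definition spectral_measure ::
    "real \<Rightarrow> (real set \<Rightarrow> ('n::{finite,linorder}) cl_fun \<Rightarrow> 'n cl_fun) \<Rightarrow> 'n cl_fun \<Rightarrow> real measure" where
  "spectral_measure c E f = measure_of UNIV (sets borel) (\<lambda>X. ennreal (Re (inner_c c f (E X f))))"

definition simple_spectral_integral ::
    "(real set \<Rightarrow> ('n::{finite,linorder}) cl_fun \<Rightarrow> 'n cl_fun) \<Rightarrow> (real \<Rightarrow> complex) \<Rightarrow> 'n cl_fun \<Rightarrow> 'n cl_fun" where
  "simple_spectral_integral E s f = (\<lambda>x. \<Sum>y\<in>range s. y *s E (s -` {y}) f x)"

text \<open>
  The graph of \<open>\<integral> g dE\<close> for a Borel function \<open>g\<close>. Since
  \<open>\<parallel>(\<integral> s dE) f\<parallel>\<^sup>2 = \<integral> |s|\<^sup>2 d\<langle>f, E f\<rangle>\<close> for simple \<open>s\<close>, the integral of \<open>g\<close>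
  is defined at \<open>f\<close> by approximating \<open>g\<close> by simple functions in
  \<open>L\<^sup>2(\<langle>f, E f\<rangle>)\<close>; the domain consists of the \<open>f\<close> with
  \<open>\<integral> |g|\<^sup>2 d\<langle>f, E f\<rangle> < \<infinity>\<close>.
\<close>

definition spectral_integral ::
    "real \<Rightarrow> (real set \<Rightarrow> ('n::{finite,linorder}) cl_fun \<Rightarrow> 'n cl_fun) \<Rightarrow> (real \<Rightarrow> complex) \<Rightarrow> 'n operator" where
  "spectral_integral c E g = {(f, k). f \<in> L2 c \<and> k \<in> L2 c \<and>
     (\<exists>s::nat \<Rightarrow> real \<Rightarrow> complex. (\<forall>n. simple_function borel (s n)) \<and>
        (\<lambda>n. \<integral>\<^sup>+u. ennreal ((cmod (s n u - g u))\<^sup>2) \<partial>spectral_measure c E f) \<longlonglongrightarrow> 0 \<and>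
        (\<lambda>n. norm_c c (\<lambda>x. simple_spectral_integral E (s n) f x - k x)) \<longlonglongrightarrow> 0)}"

definition spectral_resolution ::
    "real \<Rightarrow> ('n::{finite,linorder}) operator \<Rightarrow> (real set \<Rightarrow> 'n cl_fun \<Rightarrow> 'n cl_fun) \<Rightarrow> bool" where
  "spectral_resolution c A E \<longleftrightarrow>
     projection_valued_measure c E \<and> A = spectral_integral c E complex_of_real"

text \<open>
  \<open>g(A) = \<integral> g dE\<close> where \<open>A = \<integral> u dE(u)\<close>. By the spectral theorem a selfadjoint \<open>A\<close>
  has exactly one spectral resolution \<open>E\<close> (up to equality almost everywhere), so the existential
  quantifier makes no choice; an \<open>A\<close> that is not selfadjoint has no spectral resolution and
  the relation is then empty.
\<close>

definition functional_calculus ::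
    "real \<Rightarrow> ('n::{finite,linorder}) operator \<Rightarrow> (real \<Rightarrow> complex) \<Rightarrow> 'n operator" where
  "functional_calculus c A g =
     {(f, k). \<exists>E. spectral_resolution c A E \<and> (f, k) \<in> spectral_integral c E g}"


section \<open>Monogenic polynomials and the basis functions\<close>

definition monogenics :: "nat \<Rightarrow> ('n::{finite,linorder}) cl_fun set" where
  "monogenics l = {M. polynomial_function M \<and> (\<forall>x A. M x $ A \<in> \<real>) \<and>
     (\<forall>s x. M (s *\<^sub>R x) = s ^ l *\<^sub>R M x) \<and> (\<forall>x. dirac M x = 0)}"

text \<open>Surface measure of the unit sphere: \<open>m\<close> times the volume of the cone over a set.\<close>

definition sphere_measure :: "(real ^ ('n::{finite,linorder})) measure" where
  "sphere_measure = scale_measure (of_nat CARD('n))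
     (distr (restrict_space lborel (ball 0 1 - {0})) borel (\<lambda>x. x /\<^sub>R norm x))"

definition sphere_inner :: "('n::{finite,linorder}) cl_fun \<Rightarrow> 'n cl_fun \<Rightarrow> complex" where
  "sphere_inner M N = cl_scalar (LINT x|sphere_measure. cl_bar (M x) \<odot> N x)"

text \<open>\<open>M 1, \<dots>, M d\<close> is an orthonormal basis of the real vector space \<open>monogenics l\<close>; in
  particular \<open>d\<close> is its dimension.\<close>

definition monogenic_orthonormal_basis :: "nat \<Rightarrow> nat \<Rightarrow> (nat \<Rightarrow> ('n::{finite,linorder}) cl_fun) \<Rightarrow> bool" where
  "monogenic_orthonormal_basis l d M \<longleftrightarrow>
     (\<forall>j\<in>{1..d}. M j \<in> monogenics l) \<and>
     (\<forall>a::nat \<Rightarrow> real. (\<lambda>x. \<Sum>j=1..d. a j *\<^sub>R M j x) = (\<lambda>x. 0) \<longrightarrow> (\<forall>j\<in>{1..d}. a j = 0)) \<and>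
     (\<forall>N\<in>monogenics l. \<exists>a::nat \<Rightarrow> real. N = (\<lambda>x. \<Sum>j=1..d. a j *\<^sub>R M j x)) \<and>
     (\<forall>i\<in>{1..d}. \<forall>j\<in>{1..d}. sphere_inner (M i) (M j) = (if i = j then 1 else 0))"

definition laguerre :: "nat \<Rightarrow> real \<Rightarrow> real \<Rightarrow> real" where
  "laguerre t \<alpha> u = (\<Sum>k\<le>t. (- 1) ^ k * ((real t + \<alpha>) gchoose (t - k)) * u ^ k / fact k)"

definition delta :: "nat \<Rightarrow> real \<Rightarrow> real" where
  "delta m c = 1 + (real m - 1) / (1 + c)"

definition beta :: "real \<Rightarrow> nat \<Rightarrow> real" where
  "beta c l = - (c / (1 + c)) * real l"

definition gamma :: "nat \<Rightarrow> real \<Rightarrow> nat \<Rightarrow> real" where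
  "gamma m c l = 2 / (1 + c) * (real l + (real m - 2) / 2) + (c + 2) / (1 + c)"

text \<open>The value at the origin, where \<open>powr\<close> is 0, plays no role.\<close>

definition phi :: "real \<Rightarrow> (nat \<Rightarrow> nat \<Rightarrow> ('n::{finite,linorder}) cl_fun) \<Rightarrow> nat \<Rightarrow> nat \<Rightarrow> nat \<Rightarrow> 'n cl_fun" where
  "phi c M n l j x = (let t = n div 2; r = norm x in
     if even n
     then (2 ^ (2 * t) * (1 + c) ^ (2 * t) * fact t * laguerre t (gamma CARD('n) c l / 2 - 1) (r\<^sup>2)
             * r powr beta c l * exp (- r\<^sup>2 / 2)) *\<^sub>R M l j x
     else (- (2 ^ (2 * t + 1) * (1 + c) ^ (2 * t + 1) * fact t * laguerre t (gamma CARD('n) c l / 2) (r\<^sup>2)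
             * r powr beta c l * exp (- r\<^sup>2 / 2))) *\<^sub>R (cl_vec x \<odot> M l j x))"

definition phi_span :: "real \<Rightarrow> (nat \<Rightarrow> nat) \<Rightarrow> (nat \<Rightarrow> nat \<Rightarrow> ('n::{finite,linorder}) cl_fun) \<Rightarrow> 'n cl_fun set" where
  "phi_span c d M = lspan {phi c M t l j |t l j. j \<in> {1..d l}}"

definition closure_L :: "real \<Rightarrow> (nat \<Rightarrow> nat) \<Rightarrow> (nat \<Rightarrow> nat \<Rightarrow> ('n::{finite,linorder}) cl_fun) \<Rightarrow> 'n operator" where
  "closure_L c d M = op_closure c {(f, op_L c f) |f. f \<in> phi_span c d M}"

definition fourier_D ::
    "real \<Rightarrow> (nat \<Rightarrow> nat) \<Rightarrow> (nat \<Rightarrow> nat \<Rightarrow> ('n::{finite,linorder}) cl_fun) \<Rightarrow> complex \<Rightarrow> 'n operator" where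
  "fourier_D c d M \<omega> =
     {(f, \<lambda>x. exp (\<omega> * of_real (delta CARD('n) c) / 2) *s k x) |f k.
        (f, k) \<in> functional_calculus c (closure_L c d M)
          (\<lambda>u. exp (- (\<omega> / (2 * (1 + of_real c)\<^sup>2)) * of_real u))}"

end

theory Submission
  imports Defs "HOL-Computational_Algebra.Polynomial" "HOL-Real_Asymp.Real_Asymp"
begin

text \<open>
  \<open>L\<close> has pure point spectrum. With \<open>r\<^sup>\<beta>\<close> pulled out, \<open>D\<close> acts on \<open>a(r\<^sup>2) r\<^sup>\<beta> M\<close> and
  \<open>a(r\<^sup>2) r\<^sup>\<beta> x M\<close>, \<open>M\<close> monogenic, as an ordinary differential operator in \<open>u = r\<^sup>2\<close>; the
  oscillator equation of the Laguerre functions then makes \<open>phi c M n l j\<close> an eigenfunction of \<open>L\<close>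
  with eigenvalue \<open>(1 + c)\<^sup>2 (\<delta> + 2 n + 2 l / (1 + c))\<close>.

  The eigenfunctions are orthogonal: polar coordinates separate the radial part, where Laguerre
  functions are orthogonal by a Sturm--Liouville argument, from the spherical part, where
  Stokes' theorem makes monogenics of different degrees, and \<open>M\<close> and \<open>x N\<close>, orthogonal. They are complete:
  if \<open>f\<close> is orthogonal to all of them, its moments against all \<open>r\<^sup>2\<^sup>t exp (- r\<^sup>2 / 2)\<close> in each
  spherical component vanish, hence so does its integral against any compactly supported function of
  \<open>r\<close> times \<open>x\<^sup>s M\<close>; by the Fischer decomposition these span all polynomials, and Stone--Weierstrass
  gives \<open>f = 0\<close>.

  Therefore the closure of \<open>L\<close> is the maximal diagonal operator in the normalised basis. A spectral
  resolution of a diagonal operator is determined by the eigenvectors, since each of them must lie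
  in the range of the projection of its eigenvalue, so the functional calculus is diagonal too and \<open>fourier_D\<close> has the
  multipliers \<open>exp (- \<omega> (n + l / (1 + c)))\<close>. They have modulus at most 1, and modulus 1 if
  \<open>Re \<omega> = 0\<close>; if \<open>Re \<omega> > 0\<close> they are square summable because the number of monogenics of degree
  \<open>l\<close> grows polynomially in \<open>l\<close>.
\<close>

section \<open>Scalar product and norm of the Hilbert space\<close>

text \<open>The exponents are tuned to one another. \<open>beta\<close> is the power that cancels
  the undifferentiated term when D meets r^beta M, so D differentiates only the profile. The weight
  exponent then gives every radial integral within one degree the density r^(gamma-1), up to the
  shift by 2 caused by a factor x, under which Laguerre functions of parameter gamma/2 - 1 are
  orthogonal; \<open>gamma\<close> thus acts as a possibly fractional dimension. The prefactor with
  \<delta> removes the ground-state energy: the eigenvalue over 2 (1 + c)^2 equals \<delta>/2 + n +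
  l/(1 + c).

  Three obstacles shape the work. Hilbert space vectors are functions, so \<open>norm_c\<close> is a
  seminorm and identities hold almost everywhere only. The factor r^beta varies with the degree and
  may be singular at the origin, so completeness is tested on annuli. And
  \<open>functional_calculus\<close> ranges over all spectral resolutions of the closure, so one has
  to be built and all others have to agree with it.\<close>

definition cl_dot :: "('n::{finite,linorder}) cl \<Rightarrow> 'n cl \<Rightarrow> complex" where
  "cl_dot u v = (\<Sum>A\<in>UNIV. cnj (u $ A) * v $ A)"

lemma cl_sign_square: "cl_sign A B * cl_sign A B = 1"
  by (simp add: cl_sign_def power_mult_distrib [symmetric])

text \<open>Only pairs with \<open>sym_diff A B = {}\<close>, that is \<open>A = B\<close>, reach
  the scalar part, and the sign that \<open>cl_bar\<close> puts on e_A is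
  \<open>cl_sign A A\<close>, the sign of e_A e_A. Hence the e_A are orthonormal.\<close>

lemma cl_scalar_bar_mult: "cl_scalar (cl_bar u \<odot> v) = (\<Sum>A\<in>UNIV. u $ A * v $ A)"
proof -
  have e: "sym_diff A B = {} \<longleftrightarrow> B = A" for A B :: "'a set" by auto
  have b: "cl_bar u $ A = cl_sign A A * u $ A" for A
    by (simp add: cl_bar_def cl_sign_self)
  have "cl_scalar (cl_bar u \<odot> v) = (\<Sum>A\<in>UNIV. (cl_sign A A * cl_sign A A) * (u $ A * v $ A))"
    by (simp only: cl_scalar_def cl_mult_nth e b) (simp add: mult_ac)
  then show ?thesis by (simp add: cl_sign_square)
qed

lemma cl_scalar_bar_cnj_mult: "cl_scalar (cl_bar (cl_cnj u) \<odot> v) = cl_dot u v"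
  by (simp add: cl_scalar_bar_mult cl_dot_def cl_cnj_def)

lemma cl_cnj_mult: "cl_cnj (u \<odot> v) = cl_cnj u \<odot> cl_cnj v"
proof -
  have "cnj (cl_sign A B) = cl_sign A B" for A B :: "'a set" by (simp add: cl_sign_def)
  then show ?thesis
    by (simp add: vec_eq_iff cl_cnj_def cl_mult_nth if_distrib cong: if_cong)
qed

lemma cl_cnj_gen: "cl_cnj (cl_gen i) = cl_gen i"
  by (simp add: vec_eq_iff cl_cnj_def cl_gen_def axis_def)

text \<open>\<open>cl_bar\<close> reverses products and negates generators, while
  \<open>cl_cnj\<close> fixes them, so a generator acts skew-adjointly. This sign compensates the
  one from integration by parts and makes the Dirac operator formally symmetric.\<close>

lemma cl_dot_gen_left: "cl_dot (cl_gen i \<odot> u) v = - cl_dot u (cl_gen i \<odot> v)"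
proof -
  have "cl_bar (cl_cnj (cl_gen i \<odot> u)) \<odot> v = cl_bar (cl_cnj u) \<odot> (- cl_gen i) \<odot> v"
    by (simp add: cl_cnj_mult cl_cnj_gen cl_bar_mult cl_bar_gen)
  also have "\<dots> = cl_bar (cl_cnj u) \<odot> ((- 1) *s (cl_gen i \<odot> v))"
    by (metis cl_mult_assoc cl_mult_scale_left vector_sneg_minus1)
  finally have "cl_dot (cl_gen i \<odot> u) v = cl_dot u ((- 1) *s (cl_gen i \<odot> v))"
    by (simp only: cl_scalar_bar_cnj_mult flip: cl_scalar_bar_cnj_mult)
  then show ?thesis by (simp add: cl_dot_def sum_negf)
qed

lemma cl_dot_add_left: "cl_dot (u + v) z = cl_dot u z + cl_dot v z"
  and cl_dot_add_right: "cl_dot z (u + v) = cl_dot z u + cl_dot z v"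
  and cl_dot_scaleR_left: "cl_dot (a *\<^sub>R u) z = a *\<^sub>R cl_dot u z"
  and cl_dot_scaleR_right: "cl_dot z (a *\<^sub>R u) = a *\<^sub>R cl_dot z u"
  and cl_dot_scale_left: "cl_dot (b *s u) z = cnj b * cl_dot u z"
  and cl_dot_scale_right: "cl_dot z (b *s u) = b * cl_dot z u"
  by (simp_all add: cl_dot_def sum.distrib algebra_simps scaleR_sum_right sum_distrib_left)

lemma cl_dot_zero [simp]: "cl_dot 0 u = 0" "cl_dot u 0 = 0"
  by (simp_all add: cl_dot_def)

lemma cl_dot_sum_left: "cl_dot (\<Sum>i\<in>I. f i) v = (\<Sum>i\<in>I. cl_dot (f i) v)"
  by (induction I rule: infinite_finite_induct) (simp_all add: cl_dot_add_left)

lemma cl_dot_sum_right: "cl_dot v (\<Sum>i\<in>I. f i) = (\<Sum>i\<in>I. cl_dot v (f i))"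
  by (induction I rule: infinite_finite_induct) (simp_all add: cl_dot_add_right)

lemma cl_dot_commute: "cl_dot v u = cnj (cl_dot u v)"
  by (simp add: cl_dot_def mult.commute)

lemma cl_dot_self: "cl_dot u u = of_real ((norm u)\<^sup>2)"
proof -
  have "(norm u)\<^sup>2 = (\<Sum>A\<in>UNIV. (cmod (u $ A))\<^sup>2)"
    by (simp add: norm_vec_def L2_set_def sum_nonneg)
  then show ?thesis
    by (simp add: cl_dot_def complex_norm_square mult.commute flip: of_real_power)
qed

lemma norm_cl_square: "(norm (u :: ('n::{finite,linorder}) cl))\<^sup>2 = (\<Sum>A\<in>UNIV. (cmod (u $ A))\<^sup>2)"
  by (simp add: norm_vec_def L2_set_def sum_nonneg)

lemma norm_cl_dot_le: "cmod (cl_dot u v) \<le> norm u * norm v"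
proof -
  have "cmod (cl_dot u v) \<le> (\<Sum>A\<in>UNIV. cmod (u $ A) * cmod (v $ A))"
    unfolding cl_dot_def by (rule order_trans [OF norm_sum]) (simp add: norm_mult)
  also have "\<dots> \<le> L2_set (\<lambda>A. cmod (u $ A)) UNIV * L2_set (\<lambda>A. cmod (v $ A)) UNIV"
    using L2_set_mult_ineq [of "\<lambda>A. cmod (u $ A)" "\<lambda>A. cmod (v $ A)" UNIV] by simp
  finally show ?thesis by (simp add: norm_vec_def)
qed

lemma cl_mult_scaleR_left: "(a *\<^sub>R u) \<odot> v = a *\<^sub>R (u \<odot> v)"
  and cl_mult_scaleR_right: "u \<odot> (a *\<^sub>R v) = a *\<^sub>R (u \<odot> v)"
  by (auto simp: vec_eq_iff cl_mult_nth scaleR_sum_right intro!: sum.cong)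

lemma cl_mult_minus_left: "(- u) \<odot> v = - (u \<odot> v)"
  and cl_mult_minus_right: "u \<odot> (- v) = - (u \<odot> v)"
  using cl_mult_scaleR_left [of "- 1" u v] cl_mult_scaleR_right [of u "- 1" v] by simp_all

lemma bounded_linear_cl_mult_right: "bounded_linear (\<lambda>v. u \<odot> v)"
  by (intro linear_conv_bounded_linear [THEN iffD1] linearI)
    (simp_all add: cl_mult_add_right cl_mult_scaleR_right)

lemma linear_cl_vec: "linear cl_vec"
  by (intro linearI) (simp_all add: cl_vec_def scaleR_add_left sum.distrib scaleR_sum_right)

lemma cl_dot_vec_left: "cl_dot (cl_vec x \<odot> u) v = - cl_dot u (cl_vec x \<odot> v)"
  by (simp add: cl_vec_def cl_mult_sum_left cl_dot_sum_left cl_dot_sum_right cl_mult_scaleR_left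
      cl_dot_scaleR_left cl_dot_scaleR_right cl_dot_gen_left sum_negf)

text \<open>The double sum is added to its transpose, so that only anticommutators of generators
  remain.\<close>

lemma cl_vec_square: "cl_vec x \<odot> cl_vec x = (- (norm x)\<^sup>2) *\<^sub>R cl_one"
proof -
  let ?g = "\<lambda>i j. (x $ i * x $ j) *\<^sub>R (cl_gen i \<odot> cl_gen j)"
  have anti: "cl_gen i \<odot> cl_gen j + cl_gen j \<odot> cl_gen i = (if i = j then - 2 else 0) *\<^sub>R cl_one" for i j :: 'a
    using cl_gen_anticommute [of i j] cl_gen_square [of i] by (auto simp: scaleR_2)
  have 1: "cl_vec x \<odot> cl_vec x = (\<Sum>i\<in>UNIV. \<Sum>j\<in>UNIV. ?g i j)"
    by (subst sum.swap)
      (simp add: cl_vec_def cl_mult_sum_left cl_mult_sum_right cl_mult_scaleR_left cl_mult_scaleR_right scaleR_sum_right mult.commute)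
  then have 2: "cl_vec x \<odot> cl_vec x = (\<Sum>i\<in>UNIV. \<Sum>j\<in>UNIV. ?g j i)"
    by (subst sum.swap)
  have "2 *\<^sub>R (cl_vec x \<odot> cl_vec x) = (\<Sum>i\<in>UNIV. \<Sum>j\<in>UNIV. ?g i j) + (\<Sum>i\<in>UNIV. \<Sum>j\<in>UNIV. ?g j i)"
    using 1 2 by (simp only: scaleR_2)
  also have "\<dots> = (\<Sum>i\<in>UNIV. \<Sum>j\<in>UNIV. (x $ i * x $ j) *\<^sub>R (cl_gen i \<odot> cl_gen j + cl_gen j \<odot> cl_gen i))"
    by (simp add: sum.distrib scaleR_add_right mult.commute)
  also have "\<dots> = (\<Sum>i\<in>UNIV. - (2 * (x $ i * x $ i)) *\<^sub>R cl_one)"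
    unfolding anti by (intro sum.cong refl) (simp add: if_distrib [of "\<lambda>t. _ * t *\<^sub>R _"] if_distrib if_distribR cong: if_cong)
  also have "\<dots> = 2 *\<^sub>R ((- (norm x)\<^sup>2) *\<^sub>R cl_one)"
    by (simp add: power2_norm_eq_inner inner_vec_def sum_negf sum_distrib_left flip: scaleR_sum_left)
  finally show ?thesis by (subst (asm) scaleR_cancel_left) simp
qed

lemma cl_vec_mult_vec: "cl_vec x \<odot> (cl_vec x \<odot> u) = (- (norm x)\<^sup>2) *\<^sub>R u"
  by (simp only: cl_mult_assoc [symmetric] cl_vec_square cl_mult_scaleR_left cl_mult_one)

lemma cl_dot_vec_vec: "cl_dot (cl_vec x \<odot> u) (cl_vec x \<odot> v) = (norm x)\<^sup>2 *\<^sub>R cl_dot u v"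
  unfolding cl_dot_vec_left cl_vec_mult_vec cl_dot_scaleR_right by simp

section \<open>The weighted space \<open>L2 c\<close>: membership, inner product, Cauchy--Schwarz
  inequality\<close>

lemma weight_nonneg [simp]: "0 \<le> weight c x"
  by (simp add: weight_def)

lemma weight_pos: "x \<noteq> 0 \<Longrightarrow> 0 < weight c x"
  by (simp add: weight_def)

lemma weight_measurable [measurable]: "weight c \<in> borel_measurable borel"
  unfolding weight_def by measurable

lemma cl_nth_measurable [measurable (raw)]:
  "f \<in> borel_measurable M \<Longrightarrow> (\<lambda>x. (f x :: ('n::finite) cl) $ A) \<in> borel_measurable M"
  by (rule borel_measurable_continuous_on [of "\<lambda>u. u $ A"]) (auto intro: continuous_intros)

lemma cl_axis_measurable:
  "f \<in> borel_measurable M \<Longrightarrow> (\<lambda>x. axis A (f x) :: ('n::finite) cl) \<in> borel_measurable M"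
  by (rule borel_measurable_continuous_on [of "axis A"])
     (auto intro!: linear_continuous_on linear_linear [THEN iffD2] linearI
       simp: axis_def vec_eq_iff linear_linear)

lemma cl_measurable_iff:
  "f \<in> borel_measurable M \<longleftrightarrow> (\<forall>A. (\<lambda>x. (f x :: ('n::{finite,linorder}) cl) $ A) \<in> borel_measurable M)"
proof
  assume *: "\<forall>A. (\<lambda>x. f x $ A) \<in> borel_measurable M"
  have "(\<lambda>x. \<Sum>A\<in>UNIV. axis A (f x $ A)) \<in> borel_measurable M"
    using * by (intro borel_measurable_sum cl_axis_measurable) auto
  then show "f \<in> borel_measurable M" by (simp flip: cl_axis_sum)
qed (auto intro: cl_nth_measurable)

lemma cl_scale_measurable [measurable (raw)]:
  "f \<in> borel_measurable M \<Longrightarrow> (\<lambda>x. a *s (f x :: ('n::{finite,linorder}) cl)) \<in> borel_measurable M"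
  by (subst cl_measurable_iff) simp

lemma cl_dot_measurable [measurable (raw)]:
  assumes [measurable]: "f \<in> borel_measurable M" "g \<in> borel_measurable M"
  shows "(\<lambda>x. cl_dot (f x) (g x :: ('n::{finite,linorder}) cl)) \<in> borel_measurable M"
proof -
  have [measurable]: "cnj \<in> borel_measurable borel"
    by (intro borel_measurable_continuous_onI continuous_intros)
  show ?thesis by (simp add: cl_dot_def)
qed

lemma norm_cl_scale: "norm (a *s (u :: ('n::{finite,linorder}) cl)) = cmod a * norm u"
proof -
  have "(norm (a *s u))\<^sup>2 = (cmod a * norm u)\<^sup>2"
    by (simp add: norm_cl_square norm_mult power_mult_distrib sum_distrib_left)
  then show ?thesis by (simp add: power2_eq_iff_nonneg)
qed

lemma L2_iff: "f \<in> L2 c \<longleftrightarrow> f \<in> borel_measurable borel \<and> integrable lborel (\<lambda>x. weight c x * (norm (f x))\<^sup>2)"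
proof (intro iffI conjI)
  assume *: "f \<in> L2 c"
  then show "f \<in> borel_measurable borel" by (simp add: L2_def)
  have "integrable lborel (\<lambda>x. \<Sum>A\<in>UNIV. (cmod (f x $ A))\<^sup>2 * weight c x)"
    using * by (intro Bochner_Integration.integrable_sum) (simp add: L2_def)
  then show "integrable lborel (\<lambda>x. weight c x * (norm (f x))\<^sup>2)"
    by (simp add: norm_cl_square sum_distrib_left mult.commute)
next
  assume *: "f \<in> borel_measurable borel \<and> integrable lborel (\<lambda>x. weight c x * (norm (f x))\<^sup>2)"
  then have [measurable]: "f \<in> borel_measurable borel" by simp
  have "integrable lborel (\<lambda>x. (cmod (f x $ A))\<^sup>2 * weight c x)" for A
  proof (rule Bochner_Integration.integrable_bound [OF conjunct2 [OF *]])
    show "AE x in lborel. norm ((cmod (f x $ A))\<^sup>2 * weight c x) \<le> norm (weight c x * (norm (f x))\<^sup>2)"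
      by (rule AE_I2) (auto intro!: mult_mono simp: mult.commute Finite_Cartesian_Product.norm_nth_le)
  qed simp
  then show "f \<in> L2 c" by (simp add: L2_def)
qed

lemma L2_measurable [measurable_dest]: "f \<in> L2 c \<Longrightarrow> f \<in> borel_measurable borel"
  by (simp add: L2_iff)

lemma L2_integrable: "f \<in> L2 c \<Longrightarrow> integrable lborel (\<lambda>x. weight c x * (norm (f x))\<^sup>2)"
  by (simp add: L2_iff)

lemma L2_bound:
  assumes "g \<in> L2 c" "f \<in> borel_measurable borel" "AE x in lborel. norm (f x) \<le> a * norm (g x)"
  shows "f \<in> L2 c"
proof -
  note [measurable] = assms(2)
  have "integrable lborel (\<lambda>x. weight c x * (norm (f x))\<^sup>2)"
  proof (rule Bochner_Integration.integrable_bound)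
    show "integrable lborel (\<lambda>x. a\<^sup>2 * (weight c x * (norm (g x))\<^sup>2))"
      using assms(1) by (simp add: L2_iff)
    show "AE x in lborel. norm (weight c x * (norm (f x))\<^sup>2) \<le> norm (a\<^sup>2 * (weight c x * (norm (g x))\<^sup>2))"
      using assms(3)
    proof eventually_elim
      case (elim x)
      then have "(norm (f x))\<^sup>2 \<le> (a * norm (g x))\<^sup>2" by (intro power_mono) auto
      then have "weight c x * (norm (f x))\<^sup>2 \<le> weight c x * (a * norm (g x))\<^sup>2"
        by (intro mult_left_mono) auto
      then show ?case by (simp add: power_mult_distrib mult_ac)
    qed
  qed simp
  then show ?thesis using assms by (simp add: L2_iff)
qed

lemma L2_scale: "f \<in> L2 c \<Longrightarrow> (\<lambda>x. a *s f x) \<in> L2 c"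
  by (rule L2_bound [where a = "cmod a"]) (auto simp: norm_cl_scale)

lemma L2_zero: "(\<lambda>x. 0) \<in> L2 c"
  by (simp add: L2_iff)

lemma L2_add: assumes "f \<in> L2 c" "g \<in> L2 c" shows "(\<lambda>x. f x + g x) \<in> L2 c"
proof -
  note [measurable] = assms
  have "integrable lborel (\<lambda>x. weight c x * (norm (f x + g x))\<^sup>2)"
  proof (rule Bochner_Integration.integrable_bound)
    show "integrable lborel (\<lambda>x. 2 * (weight c x * (norm (f x))\<^sup>2) + 2 * (weight c x * (norm (g x))\<^sup>2))"
      using assms by (simp add: L2_iff)
    have "(norm (f x + g x))\<^sup>2 \<le> 2 * (norm (f x))\<^sup>2 + 2 * (norm (g x))\<^sup>2" for x
    proof -
      have "(norm (f x + g x))\<^sup>2 \<le> (norm (f x) + norm (g x))\<^sup>2"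
        by (intro power_mono norm_triangle_ineq) auto
      also have "\<dots> \<le> 2 * (norm (f x))\<^sup>2 + 2 * (norm (g x))\<^sup>2"
        using sum_squares_bound [of "norm (f x)" "norm (g x)"] by (simp add: power2_sum)
      finally show ?thesis .
    qed
    then have "weight c x * (norm (f x + g x))\<^sup>2 \<le> weight c x * (2 * (norm (f x))\<^sup>2 + 2 * (norm (g x))\<^sup>2)" for x
      by (intro mult_left_mono) auto
    then show "AE x in lborel. norm (weight c x * (norm (f x + g x))\<^sup>2)
        \<le> norm (2 * (weight c x * (norm (f x))\<^sup>2) + 2 * (weight c x * (norm (g x))\<^sup>2))"
      by (intro AE_I2) (simp add: algebra_simps)
  qed simp
  then show ?thesis by (simp add: L2_iff)
qed

lemma L2_diff: "f \<in> L2 c \<Longrightarrow> g \<in> L2 c \<Longrightarrow> (\<lambda>x. f x - g x) \<in> L2 c"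
  using L2_add [of f c "\<lambda>x. (- 1) *s g x"] L2_scale [of g c "- 1"] by (simp add: vector_sneg_minus1 [symmetric])

lemma L2_sum: "(\<And>i. i \<in> I \<Longrightarrow> f i \<in> L2 c) \<Longrightarrow> (\<lambda>x. \<Sum>i\<in>I. f i x) \<in> L2 c"
  by (induction I rule: infinite_finite_induct) (simp_all add: L2_zero L2_add)

lemma L2_integrable_dot:
  assumes "f \<in> L2 c" "g \<in> L2 c"
  shows "integrable lborel (\<lambda>x. weight c x *\<^sub>R cl_dot (f x) (g x))"
proof (rule Bochner_Integration.integrable_bound)
  note [measurable] = assms
  show "integrable lborel (\<lambda>x. weight c x * (norm (f x))\<^sup>2 + weight c x * (norm (g x))\<^sup>2)"
    using assms by (simp add: L2_iff)
  have "cmod (cl_dot (f x) (g x)) \<le> (norm (f x))\<^sup>2 + (norm (g x))\<^sup>2" for x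
    using norm_cl_dot_le [of "f x" "g x"] sum_squares_bound [of "norm (f x)" "norm (g x)"]
      mult_nonneg_nonneg [OF norm_ge_zero norm_ge_zero, of "f x" "g x"]
    unfolding mult.assoc by linarith
  then have "weight c x * cmod (cl_dot (f x) (g x)) \<le> weight c x * ((norm (f x))\<^sup>2 + (norm (g x))\<^sup>2)" for x
    by (intro mult_left_mono) auto
  then show "AE x in lborel. norm (weight c x *\<^sub>R cl_dot (f x) (g x))
      \<le> norm (weight c x * (norm (f x))\<^sup>2 + weight c x * (norm (g x))\<^sup>2)"
    by (intro AE_I2) (simp add: algebra_simps)
  show "(\<lambda>x. weight c x *\<^sub>R cl_dot (f x) (g x)) \<in> borel_measurable lborel" by measurable
qed

text \<open>Moving one coefficient into an otherwise zero vector reduces the integrability of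
  products of single coefficients to that of \<open>cl_dot\<close>.\<close>

lemma L2_nth_axis: "f \<in> L2 c \<Longrightarrow> (\<lambda>x. axis A (f x $ B)) \<in> L2 c"
proof (rule L2_bound [where a = 1])
  assume [measurable]: "f \<in> L2 c"
  show "(\<lambda>x. axis A (f x $ B)) \<in> borel_measurable borel"
    by (intro cl_axis_measurable) simp
  have "norm (axis A a :: 'a cl) = cmod a" for a
    by (simp add: norm_vec_def L2_set_def axis_def if_distrib [of cmod] if_distrib [of "\<lambda>t. t\<^sup>2"] cong: if_cong)
  then show "AE x in lborel. norm (axis A (f x $ B) :: 'a cl) \<le> 1 * norm (f x)"
    by (simp add: Finite_Cartesian_Product.norm_nth_le)
qed

lemma L2_integrable_nth_mult:
  assumes "f \<in> L2 c" "g \<in> L2 c"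
  shows "integrable lborel (\<lambda>x. weight c x *\<^sub>R (cnj (f x $ A) * g x $ B))"
proof -
  have "cl_dot (axis {} (f x $ A) :: 'a cl) (axis {} (g x $ B)) = cnj (f x $ A) * g x $ B" for x
    by (simp add: cl_dot_def axis_def if_distrib [of "\<lambda>t. t * _"] if_distrib [of cnj] cong: if_cong)
  then show ?thesis
    using L2_integrable_dot [OF L2_nth_axis [OF assms(1), of "{}" A] L2_nth_axis [OF assms(2), of "{}" B]]
    by simp
qed

lemma cl_integrable_iff:
  "integrable M f \<longleftrightarrow> (\<forall>A. integrable M (\<lambda>x. (f x :: ('n::{finite,linorder}) cl) $ A))"
proof
  assume *: "\<forall>A. integrable M (\<lambda>x. f x $ A)"
  have "bounded_linear (\<lambda>a. axis A a :: 'n cl)" for A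
    by (intro linear_conv_bounded_linear [THEN iffD1] linearI) (auto simp: axis_def vec_eq_iff)
  then have "integrable M (\<lambda>x. axis A (f x $ A) :: 'n cl)" for A
    using * integrable_bounded_linear [of "axis A" M "\<lambda>x. f x $ A"] by blast
  then have "integrable M (\<lambda>x. \<Sum>A\<in>UNIV. axis A (f x $ A))"
    by (intro Bochner_Integration.integrable_sum)
  then show "integrable M f" by (simp flip: cl_axis_sum)
qed (intro allI integrable_bounded_linear [OF bounded_linear_vec_nth, of M f])

lemma cl_integral_nth:
  "integrable M f \<Longrightarrow> (LINT x|M. (f x :: ('n::{finite,linorder}) cl)) $ A = (LINT x|M. f x $ A)"
  using integral_bounded_linear [OF bounded_linear_vec_nth, of M f A] by simp

text \<open>The scalar part passes under the integral only if the whole Clifford-valued integrand is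
  integrable. Each of its coefficients is a finite combination of products of a coefficient of
  \<open>f\<close> and one of \<open>g\<close>.\<close>

lemma inner_c_eq:
  assumes "f \<in> L2 c" "g \<in> L2 c"
  shows "inner_c c f g = (LINT x|lborel. weight c x *\<^sub>R cl_dot (f x) (g x))"
proof -
  have i: "integrable lborel (\<lambda>x. weight c x *\<^sub>R (cl_bar (cl_cnj (f x)) \<odot> g x))"
  proof (subst cl_integrable_iff, intro allI)
    fix C
    have "(weight c x *\<^sub>R (cl_bar (cl_cnj (f x)) \<odot> g x)) $ C = (\<Sum>A\<in>UNIV. \<Sum>B\<in>UNIV. (if sym_diff A B = C
       then cl_sign A B * (- 1) ^ (card A * (card A + 1) div 2) else 0) * (weight c x *\<^sub>R (cnj (f x $ A) * g x $ B)))" for x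
      by (simp add: cl_mult_nth cl_bar_def cl_cnj_def scaleR_sum_right)
        (intro sum.cong refl, auto)
    then show "integrable lborel (\<lambda>x. (weight c x *\<^sub>R (cl_bar (cl_cnj (f x)) \<odot> g x)) $ C)"
      using L2_integrable_nth_mult [OF assms]
      by (simp only:) (intro Bochner_Integration.integrable_sum Bochner_Integration.integrable_mult_right, auto)
  qed
  show ?thesis
    unfolding inner_c_def cl_scalar_def cl_integral_nth [OF i]
    by (simp add: cl_scalar_bar_cnj_mult [unfolded cl_scalar_def])
qed

lemma inner_c_self:
  assumes "f \<in> L2 c"
  shows "inner_c c f f = of_real (LINT x|lborel. weight c x * (norm (f x))\<^sup>2)"
  unfolding inner_c_eq [OF assms assms] cl_dot_self
  by (simp add: scaleR_conv_of_real flip: integral_complex_of_real)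

lemma norm_c_square: "f \<in> L2 c \<Longrightarrow> (norm_c c f)\<^sup>2 = (LINT x|lborel. weight c x * (norm (f x))\<^sup>2)"
  by (simp add: norm_c_def inner_c_self)

lemma inner_c_self_norm: "f \<in> L2 c \<Longrightarrow> inner_c c f f = of_real ((norm_c c f)\<^sup>2)"
  by (simp only: norm_c_square inner_c_self)

lemma norm_c_nonneg: "f \<in> L2 c \<Longrightarrow> 0 \<le> norm_c c f"
  by (simp add: norm_c_def inner_c_self)

lemma norm_c_nn: "f \<in> L2 c \<Longrightarrow>
    (\<integral>\<^sup>+x. ennreal (weight c x * (norm (f x))\<^sup>2) \<partial>lborel) = ennreal ((norm_c c f)\<^sup>2)"
  by (subst nn_integral_eq_integral) (simp_all add: L2_integrable norm_c_square)

lemma inner_c_cong_AE: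
  assumes "f \<in> L2 c" "g \<in> L2 c" "f' \<in> L2 c" "g' \<in> L2 c" "ae_eq f f'" "ae_eq g g'"
  shows "inner_c c f g = inner_c c f' g'"
proof -
  note [measurable] = assms(1-4)
  show ?thesis
    unfolding inner_c_eq [OF assms(1,2)] inner_c_eq [OF assms(3,4)]
    by (rule integral_cong_AE) (use assms(5,6) in \<open>auto simp: ae_eq_def\<close>)
qed

lemma norm_c_cong_AE: "f \<in> L2 c \<Longrightarrow> g \<in> L2 c \<Longrightarrow> ae_eq f g \<Longrightarrow> norm_c c f = norm_c c g"
  by (simp add: norm_c_def inner_c_cong_AE [of f c f g g])

lemma inner_c_commute: assumes "f \<in> L2 c" "g \<in> L2 c" shows "inner_c c g f = cnj (inner_c c f g)"
  unfolding inner_c_eq [OF assms] inner_c_eq [OF assms(2,1)] cl_dot_commute [of "g _" "f _"]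
  using Bochner_Integration.integral_cnj [of lborel "\<lambda>x. weight c x *\<^sub>R cl_dot (f x) (g x)"] by simp

lemma inner_c_add_right:
  "f \<in> L2 c \<Longrightarrow> g \<in> L2 c \<Longrightarrow> h \<in> L2 c \<Longrightarrow> inner_c c h (\<lambda>x. f x + g x) = inner_c c h f + inner_c c h g"
  by (simp add: inner_c_eq L2_add cl_dot_add_right scaleR_add_right L2_integrable_dot)

lemma inner_c_scale_right:
  "f \<in> L2 c \<Longrightarrow> h \<in> L2 c \<Longrightarrow> inner_c c h (\<lambda>x. a *s f x) = a * inner_c c h f"
  by (simp add: inner_c_eq L2_scale cl_dot_scale_right mult_scaleR_right [symmetric] del: mult_scaleR_right)

lemma inner_c_diff_right:
  "f \<in> L2 c \<Longrightarrow> g \<in> L2 c \<Longrightarrow> h \<in> L2 c \<Longrightarrow> inner_c c h (\<lambda>x. f x - g x) = inner_c c h f - inner_c c h g"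
  using inner_c_add_right [of f c "\<lambda>x. (- 1) *s g x" h] inner_c_scale_right [of g c h "- 1"] L2_scale [of g c "- 1"]
  by (simp add: vector_sneg_minus1 [symmetric])

lemma inner_c_zero_right: "h \<in> L2 c \<Longrightarrow> inner_c c h (\<lambda>x. 0) = 0"
  by (simp add: inner_c_eq L2_zero)

lemma inner_c_sum_right:
  "(\<And>i. i \<in> I \<Longrightarrow> f i \<in> L2 c) \<Longrightarrow> h \<in> L2 c \<Longrightarrow> inner_c c h (\<lambda>x. \<Sum>i\<in>I. f i x) = (\<Sum>i\<in>I. inner_c c h (f i))"
  by (induction I rule: infinite_finite_induct)
    (simp_all add: inner_c_zero_right inner_c_add_right L2_sum)

lemma inner_c_add_left:
  "f \<in> L2 c \<Longrightarrow> g \<in> L2 c \<Longrightarrow> h \<in> L2 c \<Longrightarrow> inner_c c (\<lambda>x. f x + g x) h = inner_c c f h + inner_c c g h"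
  by (simp add: inner_c_eq L2_add cl_dot_add_left scaleR_add_right L2_integrable_dot)

lemma inner_c_scale_left:
  "f \<in> L2 c \<Longrightarrow> h \<in> L2 c \<Longrightarrow> inner_c c (\<lambda>x. a *s f x) h = cnj a * inner_c c f h"
  by (simp add: inner_c_eq L2_scale cl_dot_scale_left mult_scaleR_right [symmetric] del: mult_scaleR_right)

lemma inner_c_diff_left:
  "f \<in> L2 c \<Longrightarrow> g \<in> L2 c \<Longrightarrow> h \<in> L2 c \<Longrightarrow> inner_c c (\<lambda>x. f x - g x) h = inner_c c f h - inner_c c g h"
  using inner_c_add_left [of f c "\<lambda>x. (- 1) *s g x" h] inner_c_scale_left [of g c h "- 1"] L2_scale [of g c "- 1"]
  by (simp add: vector_sneg_minus1 [symmetric])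

lemma inner_c_zero_left: "h \<in> L2 c \<Longrightarrow> inner_c c (\<lambda>x. 0) h = 0"
  by (simp add: inner_c_eq L2_zero)

lemma inner_c_sum_left:
  "(\<And>i. i \<in> I \<Longrightarrow> f i \<in> L2 c) \<Longrightarrow> h \<in> L2 c \<Longrightarrow> inner_c c (\<lambda>x. \<Sum>i\<in>I. f i x) h = (\<Sum>i\<in>I. inner_c c (f i) h)"
  by (induction I rule: infinite_finite_induct)
    (simp_all add: inner_c_zero_left inner_c_add_left L2_sum)

lemma norm_c_eq_0_iff:
  fixes f :: "('n::{finite,linorder}) cl_fun"
  shows "f \<in> L2 c \<Longrightarrow> norm_c c f = 0 \<longleftrightarrow> ae_eq f (\<lambda>x. 0)"
proof
  assume f: "f \<in> L2 c" and "norm_c c f = 0"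
  then have "(LINT x|lborel. weight c x * (norm (f x))\<^sup>2) = 0"
    using norm_c_square [OF f] by simp
  then have "AE x in lborel. weight c x * (norm (f x))\<^sup>2 = 0"
    by (subst (asm) integral_nonneg_eq_0_iff_AE) (auto simp: L2_integrable f)
  \<comment> \<open>At the origin the weight is 0 because \<open>powr\<close> is; everywhere else it
    is positive.\<close>
  moreover have "AE x in lborel. x \<noteq> (0 :: (real, 'n) vec)"
    by (rule AE_lborel_singleton)
  ultimately show "ae_eq f (\<lambda>x. 0)"
    unfolding ae_eq_def
  proof eventually_elim
    case (elim x) then show ?case using weight_pos [of x c] by auto
  qed
next
  assume f: "f \<in> L2 c" and "ae_eq f (\<lambda>x. 0)"
  then show "norm_c c f = 0" using norm_c_cong_AE [OF f L2_zero]
    by (simp add: norm_c_def inner_c_zero_right L2_zero)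
qed

lemma norm_c_scale: "f \<in> L2 c \<Longrightarrow> norm_c c (\<lambda>x. a *s f x) = cmod a * norm_c c f"
proof -
  assume f: "f \<in> L2 c"
  have "weight c x * (norm (a *s f x))\<^sup>2 = (cmod a)\<^sup>2 * (weight c x * (norm (f x))\<^sup>2)" for x
    by (simp add: norm_cl_scale power_mult_distrib)
  note * = this
  have "(norm_c c (\<lambda>x. a *s f x))\<^sup>2 = (cmod a * norm_c c f)\<^sup>2"
    unfolding power_mult_distrib norm_c_square [OF f] norm_c_square [OF L2_scale [OF f]] * by simp
  then show ?thesis using f by (simp add: power2_eq_iff_nonneg norm_c_nonneg L2_scale)
qed

lemma inner_c_Cauchy_Schwarz:
  assumes f: "f \<in> L2 c" and g: "g \<in> L2 c"
  shows "cmod (inner_c c f g) \<le> norm_c c f * norm_c c g"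
proof (cases "norm_c c g = 0")
  case True
  then have "ae_eq g (\<lambda>x. 0)" using g norm_c_eq_0_iff by blast
  then have "inner_c c f g = inner_c c f (\<lambda>x. 0)"
    by (intro inner_c_cong_AE f g L2_zero) (auto simp: ae_eq_def)
  then show ?thesis by (simp add: True inner_c_zero_right f)
next
  case False
  define n where "n = (norm_c c g)\<^sup>2"
  define a where "a = inner_c c g f"
  \<comment> \<open>\<open>b\<close> is the coefficient of the orthogonal projection of
    \<open>f\<close> onto \<open>g\<close>; the inequality is the nonnegativity of the squared norm
    of the remainder.\<close>
  define b where "b = a / of_real n"
  have n: "n > 0" using False by (simp add: n_def)
  have fg: "inner_c c f g = cnj a" unfolding a_def by (rule inner_c_commute [OF g f])
  let ?h = "\<lambda>x. f x - b *s g x"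
  have bg: "(\<lambda>x. b *s g x) \<in> L2 c" by (rule L2_scale [OF g])
  have h: "?h \<in> L2 c" by (rule L2_diff [OF f bg])
  have "of_real ((norm_c c ?h)\<^sup>2) = inner_c c ?h ?h" using inner_c_self_norm [OF h] by simp
  also have "\<dots> = inner_c c f f - b * inner_c c f g - cnj b * inner_c c g f + cnj b * b * inner_c c g g"
    by (simp add: inner_c_diff_left inner_c_diff_right inner_c_scale_left inner_c_scale_right f g bg h algebra_simps)
  also have "\<dots> = of_real ((norm_c c f)\<^sup>2) - of_real ((cmod a)\<^sup>2 / n)"
    using n unfolding fg inner_c_self_norm [OF f] inner_c_self_norm [OF g] b_def n_def [symmetric] a_def [symmetric]
    by (simp add: complex_norm_square [symmetric] field_simps)
  finally have "(norm_c c ?h)\<^sup>2 = (norm_c c f)\<^sup>2 - (cmod a)\<^sup>2 / n"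
    by (metis of_real_diff of_real_eq_iff)
  then have "(cmod a)\<^sup>2 = (norm_c c f * norm_c c g)\<^sup>2 - n * (norm_c c ?h)\<^sup>2"
    using n by (simp add: n_def power_mult_distrib field_simps)
  moreover have "0 \<le> n * (norm_c c ?h)\<^sup>2" using n by simp
  ultimately have "(cmod a)\<^sup>2 \<le> (norm_c c f * norm_c c g)\<^sup>2" by linarith
  then have "cmod a \<le> norm_c c f * norm_c c g"
    by (rule power2_le_imp_le) (simp add: norm_c_nonneg f g)
  then show ?thesis by (simp add: fg)
qed

text \<open>Read off from the integrand, in which the two signs cancel, so that it applies to
  arbitrary functions.\<close>

lemma norm_c_minus_commute: "norm_c c (\<lambda>x. f x - g x) = norm_c c (\<lambda>x. g x - f x)"
proof -
  have "cl_bar (cl_cnj (f x - g x)) \<odot> (f x - g x) = cl_bar (cl_cnj (g x - f x)) \<odot> (g x - f x)" for x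
  proof -
    have "cl_bar (cl_cnj (f x - g x)) = - cl_bar (cl_cnj (g x - f x))"
      by (simp add: cl_bar_def cl_cnj_def vec_eq_iff algebra_simps)
    then show ?thesis by (simp add: cl_mult_minus_left flip: cl_mult_minus_right)
  qed
  then show ?thesis by (simp add: norm_c_def inner_c_def)
qed

lemma norm_c_diff_eq_0_iff: "f \<in> L2 c \<Longrightarrow> g \<in> L2 c \<Longrightarrow> norm_c c (\<lambda>x. f x - g x) = 0 \<longleftrightarrow> ae_eq f g"
  by (simp add: norm_c_eq_0_iff L2_diff ae_eq_def)

lemma inner_c_tendsto:
  assumes "\<And>n. f n \<in> L2 c" "f' \<in> L2 c" "g \<in> L2 c" "(\<lambda>n. norm_c c (\<lambda>x. f n x - f' x)) \<longlonglongrightarrow> 0"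
  shows "(\<lambda>n. inner_c c g (f n)) \<longlonglongrightarrow> inner_c c g f'"
proof (rule LIM_zero_cancel, rule Lim_null_comparison)
  show "\<forall>\<^sub>F n in sequentially. norm (inner_c c g (f n) - inner_c c g f') \<le> norm_c c g * norm_c c (\<lambda>x. f n x - f' x)"
    by (simp add: inner_c_diff_right [symmetric] assms(1-3) inner_c_Cauchy_Schwarz L2_diff)
  show "(\<lambda>n. norm_c c g * norm_c c (\<lambda>x. f n x - f' x)) \<longlonglongrightarrow> 0"
    using tendsto_mult_left [OF assms(4), of "norm_c c g"] by simp
qed

section \<open>Completeness, orthonormal expansions and diagonal operators\<close>

text \<open>The classical argument: a rapidly convergent subsequence converges pointwise almost
  everywhere, and Fatou's lemma carries the Cauchy estimate over to the limit.\<close>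

theorem L2_complete:
  fixes g :: "nat \<Rightarrow> ('n::{finite,linorder}) cl_fun"
  assumes g: "\<And>n. g n \<in> L2 c"
    and Cauchy: "\<And>e. e > 0 \<Longrightarrow> \<exists>N. \<forall>m\<ge>N. \<forall>n\<ge>N. norm_c c (\<lambda>x. g m x - g n x) < e"
  obtains h where "h \<in> L2 c" "(\<lambda>n. norm_c c (\<lambda>x. g n x - h x)) \<longlonglongrightarrow> 0"
proof -
  note [measurable] = g
  have "\<exists>N. \<forall>k. \<forall>m\<ge>N k. \<forall>n\<ge>N k. norm_c c (\<lambda>x. g m x - g n x) < (1 / 2) ^ k"
    using Cauchy by (intro choice allI) simp
  then obtain N where N: "m \<ge> N k \<Longrightarrow> n \<ge> N k \<Longrightarrow> norm_c c (\<lambda>x. g m x - g n x) < (1 / 2) ^ k" for k m n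
    by blast
  \<comment> \<open>A sum instead of a maximum: it dominates every \<open>N j\<close> with
    \<open>j \<le> k\<close>, so the subsequence obeys all the earlier estimates as well.\<close>
  define r where "r k = (\<Sum>i\<le>k. N i)" for k
  have r: "N j \<le> r k" if "j \<le> k" for j k
    unfolding r_def using that by (intro member_le_sum) auto
  define h where "h x = lim (\<lambda>k. g (r k) x)" for x
  have h_meas [measurable]: "h \<in> borel_measurable borel"
    unfolding h_def by (rule borel_measurable_lim_metric) simp
  have norm_small: "(norm_c c (\<lambda>x. g m x - g n x))\<^sup>2 \<le> (1 / 4) ^ k" if "m \<ge> N k" "n \<ge> N k" for m n k
  proof -
    have "(norm_c c (\<lambda>x. g m x - g n x))\<^sup>2 \<le> ((1 / 2) ^ k)\<^sup>2"
      using N [OF that] by (intro power_mono norm_c_nonneg L2_diff g) simp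
    also have "\<dots> = (1 / 4 :: real) ^ k" by (simp add: power_mult [symmetric] mult.commute [of k]) (simp add: power_mult power2_eq_square)
    finally show ?thesis .
  qed
  \<comment> \<open>The integral of \<open>d k\<close> is at most (1/4)^k, so it still sums after
    multiplication by 2^k; pointwise this factor forces the increments below a geometric sequence of
    ratio sqrt (1/2).\<close>
  define d where "d k x = weight c x * (norm (g (r (Suc k)) x - g (r k) x))\<^sup>2" for k x
  have d_nonneg: "d k x \<ge> 0" for k x by (simp add: d_def)
  have "(\<integral>\<^sup>+x. (\<Sum>k. ennreal (2 ^ k * d k x)) \<partial>lborel) = (\<Sum>k. \<integral>\<^sup>+x. ennreal (2 ^ k * d k x) \<partial>lborel)"
    unfolding d_def by (rule nn_integral_suminf) measurable
  also have "\<dots> \<le> (\<Sum>k. ennreal ((1 / 2) ^ k))"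
  proof (rule suminf_le)
    fix k
    have "(\<integral>\<^sup>+x. ennreal (2 ^ k * d k x) \<partial>lborel) = (\<integral>\<^sup>+x. ennreal (2 ^ k) * ennreal (d k x) \<partial>lborel)"
      by (simp add: ennreal_mult d_nonneg)
    also have "\<dots> = ennreal (2 ^ k) * (\<integral>\<^sup>+x. ennreal (d k x) \<partial>lborel)"
      unfolding d_def by (rule nn_integral_cmult) measurable
    also have "\<dots> = ennreal (2 ^ k) * ennreal ((norm_c c (\<lambda>x. g (r (Suc k)) x - g (r k) x))\<^sup>2)"
      unfolding d_def by (subst norm_c_nn) (auto intro: L2_diff g)
    also have "\<dots> \<le> ennreal (2 ^ k) * ennreal ((1 / 4) ^ k)"
      by (intro mult_left_mono ennreal_leI norm_small r) auto
    also have "\<dots> = ennreal ((1 / 2) ^ k)"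
      by (simp add: ennreal_mult [symmetric] power_mult_distrib [symmetric])
    finally show "(\<integral>\<^sup>+x. ennreal (2 ^ k * d k x) \<partial>lborel) \<le> ennreal ((1 / 2) ^ k)" .
  qed auto
  also have "\<dots> < \<infinity>"
    by (subst suminf_ennreal2) (auto intro: summable_geometric)
  finally have "AE x in lborel. (\<Sum>k. ennreal (2 ^ k * d k x)) \<noteq> \<infinity>"
    by (intro nn_integral_noteq_infinite) (auto simp: d_def)
  moreover have "AE x in lborel. x \<noteq> (0 :: (real, 'n) vec)"
    by (rule AE_lborel_singleton)
  ultimately have conv: "AE x in lborel. (\<lambda>k. g (r k) x) \<longlonglongrightarrow> h x"
  proof eventually_elim
    case (elim x)
    define C where "C = enn2real (\<Sum>k. ennreal (2 ^ k * d k x))"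
    have w: "weight c x > 0" using elim weight_pos by blast
    have bound: "norm (g (r (Suc k)) x - g (r k) x) \<le> sqrt (C / weight c x) * sqrt (1 / 2) ^ k" for k
    proof -
      have "ennreal (2 ^ k * d k x) \<le> (\<Sum>k. ennreal (2 ^ k * d k x))"
        using sum_le_suminf [of "\<lambda>k. ennreal (2 ^ k * d k x)" "{k}"] by simp
      also have "\<dots> = ennreal C" using elim by (simp add: C_def less_top)
      finally have "2 ^ k * d k x \<le> C" by (subst (asm) ennreal_le_iff) (auto simp: C_def)
      then have "(norm (g (r (Suc k)) x - g (r k) x))\<^sup>2 \<le> C / weight c x * (1 / 2) ^ k"
        using w by (simp add: d_def field_simps)
      then have "norm (g (r (Suc k)) x - g (r k) x) \<le> sqrt (C / weight c x * (1 / 2) ^ k)"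
        by (rule real_le_rsqrt)
      then show ?thesis by (simp only: real_sqrt_mult real_sqrt_power)
    qed
    have "summable (\<lambda>k. sqrt (C / weight c x) * sqrt (1 / 2) ^ k)"
      by (intro summable_mult summable_geometric) (simp add: real_sqrt_lt_1_iff)
    then have "summable (\<lambda>k. g (r (Suc k)) x - g (r k) x)"
      by (rule summable_comparison_test') (use bound in auto)
    then have "(\<lambda>n. \<Sum>k<n. g (r (Suc k)) x - g (r k) x) \<longlonglongrightarrow> (\<Sum>k. g (r (Suc k)) x - g (r k) x)"
      by (rule summable_LIMSEQ)
    then have "(\<lambda>n. g (r n) x - g (r 0) x) \<longlonglongrightarrow> (\<Sum>k. g (r (Suc k)) x - g (r k) x)"
      by (simp add: sum_lessThan_telescope [of "\<lambda>k. g (r k) x"])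
    from tendsto_add [OF this tendsto_const [of "g (r 0) x"]]
    have "convergent (\<lambda>k. g (r k) x)" by (simp add: convergent_def) blast
    then show ?case by (simp add: h_def convergent_LIMSEQ_iff)
  qed
  \<comment> \<open>The second index runs to infinity along the subsequence. The one estimate yields
    both membership of \<open>h\<close> and convergence of the full sequence.\<close>
  have fatou: "(\<integral>\<^sup>+x. ennreal (weight c x * (norm (g n x - h x))\<^sup>2) \<partial>lborel) \<le> ennreal ((1 / 4) ^ j)"
    if "n \<ge> N j" for n j
  proof -
    have "(\<integral>\<^sup>+x. ennreal (weight c x * (norm (g n x - h x))\<^sup>2) \<partial>lborel)
       = (\<integral>\<^sup>+x. liminf (\<lambda>k. ennreal (weight c x * (norm (g n x - g (r k) x))\<^sup>2)) \<partial>lborel)"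
    proof (rule nn_integral_cong_AE, use conv in eventually_elim)
      case (elim x)
      have "(\<lambda>k. ennreal (weight c x * (norm (g n x - g (r k) x))\<^sup>2)) \<longlonglongrightarrow> ennreal (weight c x * (norm (g n x - h x))\<^sup>2)"
        by (intro tendsto_intros elim)
      then show ?case by (rule lim_imp_Liminf [OF trivial_limit_sequentially, symmetric])
    qed
    also have "\<dots> \<le> liminf (\<lambda>k. \<integral>\<^sup>+x. ennreal (weight c x * (norm (g n x - g (r k) x))\<^sup>2) \<partial>lborel)"
      by (rule nn_integral_liminf) measurable
    also have "\<dots> = liminf (\<lambda>k. ennreal ((norm_c c (\<lambda>x. g n x - g (r k) x))\<^sup>2))"
      by (subst norm_c_nn) (auto intro: L2_diff g)
    also have "\<dots> \<le> liminf (\<lambda>k::nat. ennreal ((1 / 4) ^ j))"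
      by (rule Liminf_mono, rule eventually_sequentiallyI [of j]) (intro ennreal_leI norm_small that r)
    also have "\<dots> = ennreal ((1 / 4) ^ j)" by (simp add: Liminf_const)
    finally show ?thesis .
  qed
  \<comment> \<open>The difference is square integrable first; \<open>h\<close> follows by
    subtracting it from \<open>g (N 0)\<close>.\<close>
  have diff_L2: "(\<lambda>x. g (N 0) x - h x) \<in> L2 c"
    unfolding L2_iff
  proof (intro conjI integrableI_bounded)
    have "(\<integral>\<^sup>+x. ennreal (norm (weight c x * (norm (g (N 0) x - h x))\<^sup>2)) \<partial>lborel) \<le> ennreal ((1 / 4) ^ 0)"
      using fatou [of 0 "N 0"] by simp
    then show "(\<integral>\<^sup>+x. ennreal (norm (weight c x * (norm (g (N 0) x - h x))\<^sup>2)) \<partial>lborel) < \<infinity>"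
      by (rule le_less_trans) simp
  qed measurable
  have h: "h \<in> L2 c" using L2_diff [OF g [of "N 0"] diff_L2] by simp
  have "(\<lambda>n. norm_c c (\<lambda>x. g n x - h x)) \<longlonglongrightarrow> 0"
  proof (rule LIMSEQ_I)
    fix e :: real assume "e > 0"
    then obtain j where j: "(1 / 4 :: real) ^ j < e\<^sup>2"
      using real_arch_pow_inv [of "e\<^sup>2" "1 / 4"] by auto
    have "norm (norm_c c (\<lambda>x. g n x - h x) - 0) < e" if "n \<ge> N j" for n
    proof -
      have "ennreal ((norm_c c (\<lambda>x. g n x - h x))\<^sup>2) \<le> ennreal ((1 / 4) ^ j)"
        using fatou [OF that] by (subst (asm) norm_c_nn) (auto intro: L2_diff g h)
      then have "(norm_c c (\<lambda>x. g n x - h x))\<^sup>2 < e\<^sup>2" using j by (simp add: ennreal_le_iff)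
      then show ?thesis using \<open>e > 0\<close> norm_c_nonneg [OF L2_diff [OF g h], of n]
        by (simp add: power_less_imp_less_base)
    qed
    then show "\<exists>no. \<forall>n\<ge>no. norm (norm_c c (\<lambda>x. g n x - h x) - 0) < e" by blast
  qed
  with h that show ?thesis by blast
qed

text \<open>Indices outside \<open>J\<close> carry null vectors. This allows one fixed enumeration
  by the natural numbers, and ordinary series, although only some of the indices are genuine basis
  indices. Completeness is stated as triviality of the orthogonal complement, the form in which it
  is later proved.\<close>

locale L2_basis =
  fixes c :: real and \<psi> :: "nat \<Rightarrow> ('n::{finite,linorder}) cl_fun" and J :: "nat set"
  assumes psi_L2: "\<psi> k \<in> L2 c"
    and ortho: "inner_c c (\<psi> i) (\<psi> j) = (if i = j \<and> i \<in> J then 1 else 0)"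
    and complete: "f \<in> L2 c \<Longrightarrow> (\<And>k. inner_c c (\<psi> k) f = 0) \<Longrightarrow> ae_eq f (\<lambda>x. 0)"
begin

definition coef :: "'n cl_fun \<Rightarrow> nat \<Rightarrow> complex" where
  "coef f k = inner_c c (\<psi> k) f"

definition expan :: "(nat \<Rightarrow> complex) \<Rightarrow> nat set \<Rightarrow> 'n cl_fun" where
  "expan b S = (\<lambda>x. \<Sum>k\<in>S. b k *s \<psi> k x)"

lemma expan_L2: "expan b S \<in> L2 c"
  unfolding expan_def by (intro L2_sum L2_scale psi_L2)

lemma coef_add: "f \<in> L2 c \<Longrightarrow> g \<in> L2 c \<Longrightarrow> coef (\<lambda>x. f x + g x) k = coef f k + coef g k"
  by (simp add: coef_def inner_c_add_right psi_L2)

lemma coef_diff: "f \<in> L2 c \<Longrightarrow> g \<in> L2 c \<Longrightarrow> coef (\<lambda>x. f x - g x) k = coef f k - coef g k"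
  by (simp add: coef_def inner_c_diff_right psi_L2)

lemma coef_scale: "f \<in> L2 c \<Longrightarrow> coef (\<lambda>x. a *s f x) k = a * coef f k"
  by (simp add: coef_def inner_c_scale_right psi_L2)

lemma coef_sum: "(\<And>i. i \<in> I \<Longrightarrow> f i \<in> L2 c) \<Longrightarrow> coef (\<lambda>x. \<Sum>i\<in>I. f i x) k = (\<Sum>i\<in>I. coef (f i) k)"
  by (simp add: coef_def inner_c_sum_right psi_L2)

lemma coef_psi: "coef (\<psi> j) k = (if k = j \<and> k \<in> J then 1 else 0)"
  by (simp add: coef_def ortho)

lemma coef_cong_AE: "f \<in> L2 c \<Longrightarrow> g \<in> L2 c \<Longrightarrow> ae_eq f g \<Longrightarrow> coef f k = coef g k"
  unfolding coef_def by (rule inner_c_cong_AE) (auto simp: psi_L2 ae_eq_def)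

lemma coef_outside: "f \<in> L2 c \<Longrightarrow> k \<notin> J \<Longrightarrow> coef f k = 0"
proof -
  assume f: "f \<in> L2 c" and "k \<notin> J"
  then have "norm_c c (\<psi> k) = 0" by (simp add: norm_c_def ortho)
  then have "cmod (coef f k) \<le> 0"
    using inner_c_Cauchy_Schwarz [OF psi_L2 [of k] f] by (simp add: coef_def)
  then show ?thesis by simp
qed

lemma ae_eqI: "f \<in> L2 c \<Longrightarrow> g \<in> L2 c \<Longrightarrow> (\<And>k. coef f k = coef g k) \<Longrightarrow> ae_eq f g"
  using complete [OF L2_diff [of f c g]] by (simp add: coef_def inner_c_diff_right psi_L2 ae_eq_def)

lemma inner_expan: "f \<in> L2 c \<Longrightarrow> inner_c c (expan b S) f = (\<Sum>k\<in>S. cnj (b k) * coef f k)"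
  unfolding expan_def coef_def
  by (simp add: inner_c_sum_left inner_c_scale_left L2_scale psi_L2)

lemma coef_expan: "finite S \<Longrightarrow> coef (expan b S) k = (if k \<in> S \<inter> J then b k else 0)"
proof -
  assume S: "finite S"
  have "coef (expan b S) k = (\<Sum>j\<in>S. b j * (if k = j \<and> k \<in> J then 1 else 0))"
    unfolding expan_def by (subst coef_sum) (auto intro: L2_scale psi_L2 simp: coef_scale psi_L2 coef_psi)
  also have "\<dots> = (\<Sum>j\<in>S. if j = k then (if k \<in> J then b k else 0) else 0)"
    by (intro sum.cong) auto
  finally show ?thesis using S by simp
qed

lemma norm_expan: "finite S \<Longrightarrow> (norm_c c (expan b S))\<^sup>2 = (\<Sum>k\<in>S \<inter> J. (cmod (b k))\<^sup>2)"
proof -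
  assume S: "finite S"
  have "of_real ((norm_c c (expan b S))\<^sup>2) = (\<Sum>k\<in>S. cnj (b k) * (if k \<in> S \<inter> J then b k else 0))"
    by (simp add: inner_c_self_norm [symmetric] expan_L2 inner_expan coef_expan S del: of_real_power)
  also have "\<dots> = (\<Sum>k\<in>S \<inter> J. cnj (b k) * b k)"
    using S by (simp add: sum.inter_restrict if_distrib cong: if_cong sum.cong)
  also have "\<dots> = of_real (\<Sum>k\<in>S \<inter> J. (cmod (b k))\<^sup>2)"
    by (simp add: complex_norm_square mult.commute del: of_real_power)
  finally show ?thesis by (simp only: of_real_eq_iff)
qed

lemma expan_diff: "finite S \<Longrightarrow> T \<subseteq> S \<Longrightarrow> (\<lambda>x. expan b S x - expan b T x) = expan b (S - T)"
  by (simp add: expan_def fun_eq_iff sum_diff)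

text \<open>By Pythagoras the partial sums are Cauchy; completeness provides the limit and
  continuity of the inner product its coefficients.\<close>

lemma Riesz_Fischer:
  assumes "summable (\<lambda>k. (cmod (b k))\<^sup>2)" and "\<And>k. k \<notin> J \<Longrightarrow> b k = 0"
  obtains f where "f \<in> L2 c" "\<And>k. coef f k = b k" "(\<lambda>n. norm_c c (\<lambda>x. expan b {..<n} x - f x)) \<longlonglongrightarrow> 0"
proof -
  have 1: "(norm_c c (\<lambda>x. expan b {..<n} x - expan b {..<m} x))\<^sup>2 \<le> (\<Sum>k\<in>{m..<n}. (cmod (b k))\<^sup>2)" if "m \<le> n" for m n
  proof -
    have "(\<lambda>x. expan b {..<n} x - expan b {..<m} x) = expan b ({..<n} - {..<m})"
      using that by (intro expan_diff) auto
    moreover have "{..<n} - {..<m} = {m..<n}" using that by auto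
    ultimately have "(norm_c c (\<lambda>x. expan b {..<n} x - expan b {..<m} x))\<^sup>2 = (\<Sum>k\<in>{m..<n} \<inter> J. (cmod (b k))\<^sup>2)"
      by (simp add: norm_expan)
    also have "\<dots> \<le> (\<Sum>k\<in>{m..<n}. (cmod (b k))\<^sup>2)" by (rule sum_mono2) auto
    finally show ?thesis .
  qed
  have "\<exists>N. \<forall>m\<ge>N. \<forall>n\<ge>N. norm_c c (\<lambda>x. expan b {..<m} x - expan b {..<n} x) < e" if "e > 0" for e
  proof -
    from assms(1) have "\<exists>N. \<forall>m\<ge>N. \<forall>n. norm (\<Sum>k\<in>{m..<n}. (cmod (b k))\<^sup>2) < e\<^sup>2"
      unfolding summable_Cauchy using that by simp
    then obtain N where N': "\<And>m n. m \<ge> N \<Longrightarrow> norm (\<Sum>k\<in>{m..<n}. (cmod (b k))\<^sup>2) < e\<^sup>2"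
      by blast
    have N: "(\<Sum>k\<in>{m..<n}. (cmod (b k))\<^sup>2) < e\<^sup>2" if "m \<ge> N" for m n
      using N' [OF that, of n] unfolding real_norm_def by (rule abs_less_iff [THEN iffD1, THEN conjunct1])
    have *: "norm_c c (\<lambda>x. expan b {..<n} x - expan b {..<m} x) < e" if "N \<le> m" "m \<le> n" for m n
      by (rule power_less_imp_less_base [OF le_less_trans [OF 1 [OF that(2)] N [OF that(1)]]])
        (use \<open>e > 0\<close> in simp)
    have "norm_c c (\<lambda>x. expan b {..<m} x - expan b {..<n} x) < e" if "N \<le> m" "N \<le> n" for m n
    proof (cases "m \<le> n")
      case True
      from * [OF that(1) True] show ?thesis by (subst norm_c_minus_commute)
    next
      case False
      then have "n \<le> m" by simp
      from * [OF that(2) this] show ?thesis .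
    qed
    then show ?thesis by blast
  qed
  from L2_complete [OF expan_L2 this] obtain f
    where f: "f \<in> L2 c" "(\<lambda>n. norm_c c (\<lambda>x. expan b {..<n} x - f x)) \<longlonglongrightarrow> 0" by blast
  have "coef f k = b k" for k
  proof (rule LIMSEQ_unique)
    show "(\<lambda>n. coef (expan b {..<n}) k) \<longlonglongrightarrow> coef f k"
      unfolding coef_def by (rule inner_c_tendsto) (auto intro: expan_L2 f psi_L2)
    have "coef (expan b {..<n}) k = b k" if "n \<ge> Suc k" for n
      using that assms(2) [of k] by (simp add: coef_expan)
    then show "(\<lambda>n. coef (expan b {..<n}) k) \<longlonglongrightarrow> b k"
      by (intro tendsto_eventually eventually_sequentiallyI)
  qed
  with f that show ?thesis by blast
qed

text \<open>For the partial expansion e of \<open>f\<close>, the inner product of e and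
  \<open>f\<close> is the squared norm of e; Cauchy--Schwarz then bounds the norm of e by that of
  \<open>f\<close>.\<close>

lemma Bessel: "f \<in> L2 c \<Longrightarrow> finite S \<Longrightarrow> (\<Sum>k\<in>S. (cmod (coef f k))\<^sup>2) \<le> (norm_c c f)\<^sup>2"
proof -
  assume f: "f \<in> L2 c" and S: "finite S"
  let ?e = "expan (coef f) S"
  have "(\<Sum>k\<in>S. (cmod (coef f k))\<^sup>2) = (\<Sum>k\<in>S \<inter> J. (cmod (coef f k))\<^sup>2)"
    using S coef_outside [OF f] by (intro sum.mono_neutral_right) auto
  then have n: "(norm_c c ?e)\<^sup>2 = (\<Sum>k\<in>S. (cmod (coef f k))\<^sup>2)"
    by (simp add: norm_expan S)
  have "inner_c c ?e f = of_real (\<Sum>k\<in>S. (cmod (coef f k))\<^sup>2)"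
    unfolding inner_expan [OF f] by (simp add: complex_norm_square mult.commute del: of_real_power)
  then have "(norm_c c ?e)\<^sup>2 = cmod (inner_c c ?e f)" unfolding n by (simp add: sum_nonneg del: of_real_sum of_real_power)
  also have "\<dots> \<le> norm_c c ?e * norm_c c f" by (rule inner_c_Cauchy_Schwarz [OF expan_L2 f])
  finally have "norm_c c ?e \<le> norm_c c f"
    using norm_c_nonneg [OF expan_L2, of "coef f" S] norm_c_nonneg [OF f]
    by (cases "norm_c c ?e = 0") (auto simp: power2_eq_square)
  then have "(norm_c c ?e)\<^sup>2 \<le> (norm_c c f)\<^sup>2"
    by (intro power_mono norm_c_nonneg expan_L2)
  then show ?thesis by (simp add: n)
qed

lemma coef_summable: "f \<in> L2 c \<Longrightarrow> summable (\<lambda>k. (cmod (coef f k))\<^sup>2)"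
  by (rule bounded_imp_summable [of _ "(norm_c c f)\<^sup>2"]) (auto intro: Bessel)

text \<open>\<open>Riesz_Fischer\<close> produces some vector with the coefficients of
  \<open>f\<close>; the completeness axiom identifies it with \<open>f\<close> almost
  everywhere.\<close>

lemma expansion: "f \<in> L2 c \<Longrightarrow> (\<lambda>n. norm_c c (\<lambda>x. expan (coef f) {..<n} x - f x)) \<longlonglongrightarrow> 0"
proof -
  assume f: "f \<in> L2 c"
  obtain g where g: "g \<in> L2 c" "\<And>k. coef g k = coef f k"
    "(\<lambda>n. norm_c c (\<lambda>x. expan (coef f) {..<n} x - g x)) \<longlonglongrightarrow> 0"
    using Riesz_Fischer [OF coef_summable [OF f] coef_outside [OF f]] by blast
  have "ae_eq g f" by (rule ae_eqI) (auto simp: f g)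
  then have "norm_c c (\<lambda>x. expan (coef f) {..<n} x - g x) = norm_c c (\<lambda>x. expan (coef f) {..<n} x - f x)" for n
    by (intro norm_c_cong_AE L2_diff expan_L2 f g) (auto simp: ae_eq_def)
  with g(3) show ?thesis by simp
qed

lemma Parseval_inner: "f \<in> L2 c \<Longrightarrow> g \<in> L2 c \<Longrightarrow> (\<lambda>k. cnj (coef f k) * coef g k) sums inner_c c f g"
proof -
  assume f: "f \<in> L2 c" and g: "g \<in> L2 c"
  have "(\<lambda>n. inner_c c g (expan (coef f) {..<n})) \<longlonglongrightarrow> inner_c c g f"
    by (rule inner_c_tendsto) (auto intro: expan_L2 f g expansion)
  then have "(\<lambda>n. cnj (inner_c c g (expan (coef f) {..<n}))) \<longlonglongrightarrow> cnj (inner_c c g f)"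
    by (rule tendsto_cnj)
  then show ?thesis
    unfolding sums_def inner_c_commute [OF g expan_L2, symmetric] inner_c_commute [OF g f, symmetric] inner_expan [OF g] .
qed

lemma Parseval: "f \<in> L2 c \<Longrightarrow> (\<lambda>k. (cmod (coef f k))\<^sup>2) sums (norm_c c f)\<^sup>2"
proof -
  assume f: "f \<in> L2 c"
  have "(\<lambda>k. complex_of_real ((cmod (coef f k))\<^sup>2)) sums of_real ((norm_c c f)\<^sup>2)"
    using Parseval_inner [OF f f] inner_c_self_norm [OF f]
    by (simp add: complex_norm_square mult.commute del: of_real_power)
  then show ?thesis by (simp only: sums_of_real_iff)
qed

lemma Parseval_nn: "f \<in> L2 c \<Longrightarrow> (\<Sum>k. ennreal ((cmod (coef f k))\<^sup>2)) = ennreal ((norm_c c f)\<^sup>2)"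
  using Parseval [of f] by (subst suminf_ennreal2) (auto simp: sums_iff)

text \<open>The maximal domain is implicit: asking for \<open>k\<close> in \<open>L2 c\<close> with
  these coefficients forces the products \<open>a i * coef f i\<close> to be square summable. All
  representatives of a class are included, as in a graph of relations between functions.\<close>

definition diag_op :: "(nat \<Rightarrow> complex) \<Rightarrow> 'n operator" where
  "diag_op a = {(f, k). f \<in> L2 c \<and> k \<in> L2 c \<and> (\<forall>i\<in>J. coef k i = a i * coef f i)}"

lemma diag_opD: "(f, k) \<in> diag_op a \<Longrightarrow> f \<in> L2 c \<and> k \<in> L2 c \<and> coef k i = a i * coef f i"
  by (cases "i \<in> J") (auto simp: diag_op_def coef_outside)

lemma diag_opI: "f \<in> L2 c \<Longrightarrow> k \<in> L2 c \<Longrightarrow> (\<And>i. i \<in> J \<Longrightarrow> coef k i = a i * coef f i) \<Longrightarrow> (f, k) \<in> diag_op a"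
  by (auto simp: diag_op_def)

lemma diag_op_total:
  assumes a: "\<And>i. cmod (a i) \<le> C" and f: "f \<in> L2 c"
  obtains k where "(f, k) \<in> diag_op a"
proof -
  have "summable (\<lambda>k. (cmod (a k * coef f k))\<^sup>2)"
  proof (rule summable_comparison_test')
    show "summable (\<lambda>k. C\<^sup>2 * (cmod (coef f k))\<^sup>2)" by (intro summable_mult coef_summable f)
    show "norm ((cmod (a k * coef f k))\<^sup>2) \<le> C\<^sup>2 * (cmod (coef f k))\<^sup>2" for k
      using a [of k] by (auto simp: norm_mult power_mult_distrib intro!: mult_right_mono power_mono)
  qed
  then obtain k where "k \<in> L2 c" "\<And>i. coef k i = a i * coef f i"
    by (rule Riesz_Fischer) (auto simp: coef_outside f)
  then show ?thesis using that f by (auto simp: diag_op_def)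
qed

end

section \<open>Functional calculus of a diagonal operator\<close>

lemma ae_eq_sym: "ae_eq f g \<Longrightarrow> ae_eq g f"
  by (auto simp: ae_eq_def)

lemma inner_c_cong_AE_right:
  "f \<in> L2 c \<Longrightarrow> g \<in> L2 c \<Longrightarrow> h \<in> L2 c \<Longrightarrow> ae_eq g h \<Longrightarrow> inner_c c f g = inner_c c f h"
  by (rule inner_c_cong_AE) (auto simp: ae_eq_def)

section \<open>General projection-valued measures\<close>

locale pvm =
  fixes c :: real and E :: "real set \<Rightarrow> ('n::{finite,linorder}) cl_fun \<Rightarrow> 'n cl_fun"
  assumes pvm: "projection_valued_measure c E"
begin

lemma E_L2: "X \<in> sets borel \<Longrightarrow> f \<in> L2 c \<Longrightarrow> E X f \<in> L2 c"
  and E_idem: "X \<in> sets borel \<Longrightarrow> f \<in> L2 c \<Longrightarrow> ae_eq (E X (E X f)) (E X f)"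
  and E_self: "X \<in> sets borel \<Longrightarrow> f \<in> L2 c \<Longrightarrow> g \<in> L2 c \<Longrightarrow> inner_c c (E X f) g = inner_c c f (E X g)"
  and E_UNIV: "f \<in> L2 c \<Longrightarrow> ae_eq (E UNIV f) f"
  and E_sums: "f \<in> L2 c \<Longrightarrow> range Y \<subseteq> sets borel \<Longrightarrow> disjoint_family Y \<Longrightarrow>
      (\<lambda>N. norm_c c (\<lambda>x. (\<Sum>n<N. E (Y n) f x) - E (\<Union>n. Y n) f x)) \<longlonglongrightarrow> 0"
  using pvm unfolding projection_valued_measure_def orthogonal_projection_def by blast+

lemma E_inner: "X \<in> sets borel \<Longrightarrow> f \<in> L2 c \<Longrightarrow> inner_c c f (E X f) = of_real ((norm_c c (E X f))\<^sup>2)"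
proof -
  assume X: "X \<in> sets borel" and f: "f \<in> L2 c"
  have "inner_c c f (E X f) = inner_c c f (E X (E X f))"
    by (intro inner_c_cong_AE_right ae_eq_sym [OF E_idem] E_L2 X f)
  also have "\<dots> = inner_c c (E X f) (E X f)"
    by (rule E_self [symmetric]) (auto intro: X f E_L2)
  finally show ?thesis by (simp add: inner_c_self_norm E_L2 X f)
qed

lemma E_norm_le: "X \<in> sets borel \<Longrightarrow> f \<in> L2 c \<Longrightarrow> norm_c c (E X f) \<le> norm_c c f"
proof -
  assume X: "X \<in> sets borel" and f: "f \<in> L2 c"
  have "(norm_c c (E X f))\<^sup>2 = cmod (inner_c c f (E X f))"
    by (simp add: E_inner X f norm_power)
  also have "\<dots> \<le> norm_c c f * norm_c c (E X f)"
    by (intro inner_c_Cauchy_Schwarz E_L2 X f)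
  finally show ?thesis using norm_c_nonneg [OF f] norm_c_nonneg [OF E_L2 [OF X f]]
    by (cases "norm_c c (E X f) = 0") (auto simp: power2_eq_square)
qed

text \<open>The constant sequence {} is disjoint, so countable additivity makes N times the norm of
  \<open>E {} f\<close> tend to 0; consecutive terms differ by that norm.\<close>

lemma E_empty: "f \<in> L2 c \<Longrightarrow> ae_eq (E {} f) (\<lambda>x. 0)"
proof -
  assume f: "f \<in> L2 c"
  define e where "e = norm_c c (E {} f)"
  have L: "E {} f \<in> L2 c" by (simp add: E_L2 f)
  have eq: "norm_c c (\<lambda>x. (\<Sum>n<Suc N. E {} f x) - E {} f x) = real N * e" for N
  proof -
    have "(\<Sum>n<Suc N. E {} f x) - E {} f x = of_nat N *s E {} f x" for x
      by (induction N) (simp_all add: vec_eq_iff algebra_simps del: sum_constant)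
    then have "(\<lambda>x. (\<Sum>n<Suc N. E {} f x) - E {} f x) = (\<lambda>x. of_nat N *s E {} f x)"
      by (simp only:)
    then show ?thesis by (simp add: norm_c_scale L e_def)
  qed
  have "(\<lambda>N. real N * e) \<longlonglongrightarrow> 0"
    using LIMSEQ_Suc [OF E_sums [OF f, of "\<lambda>_. {}"]] unfolding eq [symmetric]
    by (simp add: disjoint_family_on_def)
  from tendsto_diff [OF LIMSEQ_Suc [OF this] this]
  have "(\<lambda>N::nat. e) \<longlonglongrightarrow> 0" by (simp add: algebra_simps)
  then have "e = 0" by (simp add: LIMSEQ_const_iff)
  then show ?thesis using norm_c_eq_0_iff [OF L] by (simp add: e_def)
qed

text \<open>Countable additivity for the sequence X, Y, {}, {}, ...; by \<open>E_empty\<close> the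
  tail contributes nothing, so the sequence of norms is constant from the second term on.\<close>

lemma E_Un:
  assumes f: "f \<in> L2 c" and X: "X \<in> sets borel" and Y: "Y \<in> sets borel" and XY: "X \<inter> Y = {}"
  shows "ae_eq (E (X \<union> Y) f) (\<lambda>x. E X f x + E Y f x)"
proof -
  let ?B = "binaryset X Y"
  have L: "E X f \<in> L2 c" "E Y f \<in> L2 c" "E (X \<union> Y) f \<in> L2 c" by (auto intro: E_L2 f X Y)
  have lim: "(\<lambda>N. norm_c c (\<lambda>x. (\<Sum>n<N. E (?B n) f x) - E (X \<union> Y) f x)) \<longlonglongrightarrow> 0"
  proof -
    have "range ?B \<subseteq> sets borel" using X Y by (simp add: range_binaryset_eq)
    moreover have "disjoint_family ?B" using XY by (auto simp: disjoint_family_on_def binaryset_def)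
    ultimately show ?thesis using E_sums [OF f, of ?B] by (simp add: UN_binaryset_eq)
  qed
  have eq: "norm_c c (\<lambda>x. (\<Sum>n<N + 2. E (?B n) f x) - E (X \<union> Y) f x)
      = norm_c c (\<lambda>x. (E X f x + E Y f x) - E (X \<union> Y) f x)" for N
  proof (rule norm_c_cong_AE)
    show "(\<lambda>x. (\<Sum>n<N + 2. E (?B n) f x) - E (X \<union> Y) f x) \<in> L2 c"
      by (intro L2_diff L2_sum L E_L2 f) (auto simp: binaryset_def X Y)
    have s: "(\<Sum>n<N + 2. E (?B n) f x) = E X f x + E Y f x + of_nat N *s E {} f x" for x
      by (induction N) (simp_all add: numeral_2_eq_2 binaryset_def vec_eq_iff algebra_simps)
    show "ae_eq (\<lambda>x. (\<Sum>n<N + 2. E (?B n) f x) - E (X \<union> Y) f x)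
       (\<lambda>x. (E X f x + E Y f x) - E (X \<union> Y) f x)"
      using E_empty [OF f] unfolding ae_eq_def s by eventually_elim simp
  qed (intro L2_diff L2_add L)
  have "(\<lambda>N::nat. norm_c c (\<lambda>x. (E X f x + E Y f x) - E (X \<union> Y) f x)) \<longlonglongrightarrow> 0"
    using LIMSEQ_ignore_initial_segment [OF lim, of 2] unfolding eq .
  then have "norm_c c (\<lambda>x. (E X f x + E Y f x) - E (X \<union> Y) f x) = 0"
    by (simp add: LIMSEQ_const_iff)
  then show ?thesis
    using norm_c_diff_eq_0_iff [OF L2_add [OF L(1,2)] L(3)] ae_eq_sym by blast
qed

lemma E_UN:
  assumes f: "f \<in> L2 c" and "finite F" and "\<And>y. y \<in> F \<Longrightarrow> X y \<in> sets borel" and "disjoint_family_on X F"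
  shows "ae_eq (E (\<Union>y\<in>F. X y) f) (\<lambda>x. \<Sum>y\<in>F. E (X y) f x)"
  using assms(2-)
proof (induction F)
  case empty
  then show ?case using E_empty [OF f] by simp
next
  case (insert y F)
  have d: "X y \<inter> (\<Union>z\<in>F. X z) = {}"
    using insert.prems(2) insert.hyps(2) by (auto simp: disjoint_family_on_def)
  have 1: "ae_eq (E (\<Union>y\<in>F. X y) f) (\<lambda>x. \<Sum>y\<in>F. E (X y) f x)"
    using insert.prems by (intro insert.IH) (auto simp: disjoint_family_on_def)
  have 2: "ae_eq (E (X y \<union> (\<Union>z\<in>F. X z)) f) (\<lambda>x. E (X y) f x + E (\<Union>z\<in>F. X z) f x)"
    using insert.prems insert.hyps by (intro E_Un f d sets.finite_UN) auto
  from 1 2 show ?case unfolding ae_eq_def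
    by eventually_elim (use insert.hyps in simp)
qed

text \<open>On the range of \<open>E Y\<close> the projection \<open>E (X \<union> Y) = E X + E Y\<close> is \<open>E X + 1\<close>, and it does not
  increase norms, so \<open>E X\<close> vanishes there.\<close>

lemma E_orthogonal:
  assumes f: "f \<in> L2 c" and X: "X \<in> sets borel" and Y: "Y \<in> sets borel" and XY: "X \<inter> Y = {}"
  shows "inner_c c (E X f) (E Y f) = 0"
proof -
  define h where "h = E Y f"
  have h: "h \<in> L2 c" by (simp add: h_def E_L2 f Y)
  have XYb: "X \<union> Y \<in> sets borel" using X Y by simp
  have "ae_eq (E (X \<union> Y) h) (\<lambda>x. E X h x + h x)"
    using E_Un [OF h X Y XY] E_idem [OF Y f] unfolding ae_eq_def h_def by eventually_elim simp
  then have "inner_c c h (E (X \<union> Y) h) = inner_c c h (\<lambda>x. E X h x + h x)"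
    by (intro inner_c_cong_AE_right h E_L2 XYb L2_add X) auto
  also have "\<dots> = inner_c c h (E X h) + inner_c c h h"
    by (intro inner_c_add_right h E_L2 X)
  finally have "complex_of_real ((norm_c c (E (X \<union> Y) h))\<^sup>2) = of_real ((norm_c c (E X h))\<^sup>2) + of_real ((norm_c c h)\<^sup>2)"
    by (simp only: E_inner X XYb h inner_c_self_norm)
  then have "(norm_c c (E (X \<union> Y) h))\<^sup>2 = (norm_c c (E X h))\<^sup>2 + (norm_c c h)\<^sup>2"
    by (metis of_real_add of_real_eq_iff)
  moreover have "(norm_c c (E (X \<union> Y) h))\<^sup>2 \<le> (norm_c c h)\<^sup>2"
    by (intro power_mono E_norm_le norm_c_nonneg E_L2 XYb h)
  ultimately have "(norm_c c (E X h))\<^sup>2 \<le> 0" by linarith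
  then have "norm_c c (E X h) = 0" by simp
  then have "ae_eq (E X h) (\<lambda>x. 0)" using norm_c_eq_0_iff E_L2 X h by blast
  then have "inner_c c f (E X h) = inner_c c f (\<lambda>x. 0)"
    by (intro inner_c_cong_AE_right f E_L2 X h L2_zero)
  then show ?thesis
    by (simp add: E_self [OF X f h, unfolded h_def] inner_c_zero_right f h_def)
qed

text \<open>\<open>measure_of\<close> yields the intended values only after additivity is checked;
  it follows from continuity of the inner product in its second argument.\<close>

lemma emeasure_spectral_measure:
  assumes f: "f \<in> L2 c" and X: "X \<in> sets borel"
  shows "emeasure (spectral_measure c E f) X = ennreal ((norm_c c (E X f))\<^sup>2)"
proof -
  let ?\<mu> = "\<lambda>X. ennreal (Re (inner_c c f (E X f)))"
  have "emeasure (spectral_measure c E f) X = ?\<mu> X"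
  proof (rule emeasure_measure_of [OF spectral_measure_def])
    show "positive (sets (spectral_measure c E f)) ?\<mu>"
      using inner_c_cong_AE_right [OF f E_L2 L2_zero E_empty] f by (simp add: positive_def inner_c_zero_right)
    show "countably_additive (sets (spectral_measure c E f)) ?\<mu>"
    proof (rule countably_additiveI)
      fix A :: "nat \<Rightarrow> real set"
      assume "range A \<subseteq> sets (spectral_measure c E f)" and d: "disjoint_family A"
      then have A: "range A \<subseteq> sets borel" by (simp add: spectral_measure_def sets.sigma_sets_eq [of borel, simplified])
      then have A': "A n \<in> sets borel" for n by auto
      have U: "(\<Union>n. A n) \<in> sets borel" using A by auto
      have "(\<lambda>N. inner_c c f (\<lambda>x. \<Sum>n<N. E (A n) f x)) \<longlonglongrightarrow> inner_c c f (E (\<Union>n. A n) f)"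
        by (intro inner_c_tendsto L2_sum E_L2 A' U f E_sums A d)
      then have "(\<lambda>n. inner_c c f (E (A n) f)) sums inner_c c f (E (\<Union>n. A n) f)"
        by (simp add: sums_def inner_c_sum_right E_L2 A' f)
      then have "(\<lambda>n. Re (inner_c c f (E (A n) f))) sums Re (inner_c c f (E (\<Union>n. A n) f))"
        by (rule sums_Re)
      then show "(\<Sum>n. ?\<mu> (A n)) = ?\<mu> (\<Union>n. A n)"
        by (subst suminf_ennreal2) (auto simp: sums_iff E_inner A' f simp flip: of_real_power)
    qed
  qed (use X in \<open>auto simp: spectral_measure_def sets.sigma_sets_eq [of borel, simplified]\<close>)
  then show ?thesis by (simp add: E_inner X f flip: of_real_power)
qed

lemma sets_spectral_measure [measurable_cong]: "sets (spectral_measure c E f) = sets borel"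
  by (simp add: spectral_measure_def sets.sigma_sets_eq [of borel, simplified])

text \<open>Preimages of different values are disjoint, so \<open>E_orthogonal\<close> removes the
  cross terms. The coefficients \<open>b y\<close> are decoupled from the values \<open>y\<close> so
  that \<open>s\<close> minus a constant is covered by the same level sets.\<close>

lemma norm_simple_integral:
  assumes f: "f \<in> L2 c" and s: "simple_function borel s"
  shows "ennreal ((norm_c c (\<lambda>x. \<Sum>y\<in>range s. b y *s E (s -` {y}) f x))\<^sup>2)
    = (\<integral>\<^sup>+u. ennreal ((cmod (b (s u)))\<^sup>2) \<partial>spectral_measure c E f)"
proof -
  have fin: "finite (range s)" and m: "s -` {y} \<in> sets borel" for y
    using simple_functionD [OF s] by auto
  let ?g = "\<lambda>x. \<Sum>y\<in>range s. b y *s E (s -` {y}) f x"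
  have L: "(\<lambda>x. b y *s E (s -` {y}) f x) \<in> L2 c" for y by (intro L2_scale E_L2 m f)
  have g: "?g \<in> L2 c" by (intro L2_sum L)
  have "inner_c c ?g ?g = (\<Sum>y\<in>range s. \<Sum>z\<in>range s. cnj (b y) * (b z * inner_c c (E (s -` {y}) f) (E (s -` {z}) f)))"
    by (simp add: inner_c_sum_left inner_c_sum_right L g inner_c_scale_left inner_c_scale_right E_L2 m f sum_distrib_left L2_sum)
  also have "\<dots> = (\<Sum>y\<in>range s. \<Sum>z\<in>range s. if z = y then of_real ((cmod (b y))\<^sup>2 * (norm_c c (E (s -` {y}) f))\<^sup>2) else 0)"
  proof (intro sum.cong refl)
    fix y z
    have "inner_c c (E (s -` {y}) f) (E (s -` {z}) f) = 0" if "z \<noteq> y"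
      using that by (intro E_orthogonal f m) auto
    then show "cnj (b y) * (b z * inner_c c (E (s -` {y}) f) (E (s -` {z}) f))
      = (if z = y then of_real ((cmod (b y))\<^sup>2 * (norm_c c (E (s -` {y}) f))\<^sup>2) else 0)"
      using complex_norm_square [of "b y"] by (auto simp: inner_c_self_norm E_L2 m f mult_ac)
  qed
  also have "\<dots> = of_real (\<Sum>y\<in>range s. (cmod (b y))\<^sup>2 * (norm_c c (E (s -` {y}) f))\<^sup>2)"
    using fin by simp
  finally have "(norm_c c ?g)\<^sup>2 = (\<Sum>y\<in>range s. (cmod (b y))\<^sup>2 * (norm_c c (E (s -` {y}) f))\<^sup>2)"
    unfolding inner_c_self_norm [OF g] by (simp only: of_real_eq_iff)
  then have "ennreal ((norm_c c ?g)\<^sup>2) = (\<Sum>y\<in>range s. ennreal ((cmod (b y))\<^sup>2) * emeasure (spectral_measure c E f) (s -` {y}))"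
    by (simp add: emeasure_spectral_measure f m ennreal_mult sum_ennreal flip: ennreal_mult)
  also have "\<dots> = (\<integral>\<^sup>+u. (\<Sum>y\<in>range s. ennreal ((cmod (b y))\<^sup>2) * indicator (s -` {y}) u) \<partial>spectral_measure c E f)"
    by (subst nn_integral_sum) (auto simp: nn_integral_cmult_indicator sets_spectral_measure m
        intro!: borel_measurable_times_ennreal borel_measurable_indicator)
  also have "\<dots> = (\<integral>\<^sup>+u. ennreal ((cmod (b (s u)))\<^sup>2) \<partial>spectral_measure c E f)"
  proof (rule nn_integral_cong)
    fix u
    have "(\<Sum>y\<in>range s. ennreal ((cmod (b y))\<^sup>2) * indicator (s -` {y}) u)
      = (\<Sum>y\<in>range s. if y = s u then ennreal ((cmod (b (s u)))\<^sup>2) else 0)"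
      by (intro sum.cong refl) auto
    then show "(\<Sum>y\<in>range s. ennreal ((cmod (b y))\<^sup>2) * indicator (s -` {y}) u) = ennreal ((cmod (b (s u)))\<^sup>2)"
      using fin by simp
  qed
  finally show ?thesis .
qed

text \<open>The approximating simple functions converge in L2 of the spectral measure to the
  identity by definition of the integral, and to the constant \<open>l\<close> by the eigenvalue
  equation. Hence the identity equals \<open>l\<close> almost everywhere for that measure, which is
  therefore concentrated at \<open>l\<close>.\<close>

lemma eigenvector_spectral_measure:
  assumes "(\<psi>, \<lambda>x. of_real l *s \<psi> x) \<in> spectral_integral c E complex_of_real" and X: "X \<in> sets borel"
  shows "ae_eq (E X \<psi>) (\<lambda>x. if l \<in> X then \<psi> x else 0)"
proof -
  from assms(1) obtain s where psi: "\<psi> \<in> L2 c" and s: "\<And>n. simple_function borel (s n)"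
    and 1: "(\<lambda>n. \<integral>\<^sup>+u. ennreal ((cmod (s n u - of_real u))\<^sup>2) \<partial>spectral_measure c E \<psi>) \<longlonglongrightarrow> 0"
    and 2: "(\<lambda>n. norm_c c (\<lambda>x. simple_spectral_integral E (s n) \<psi> x - of_real l *s \<psi> x)) \<longlonglongrightarrow> 0"
    unfolding spectral_integral_def by blast
  let ?\<mu> = "spectral_measure c E \<psi>"
  have fin: "finite (range (s n))" and m: "s n -` {y} \<in> sets borel" for y n
    using simple_functionD [OF s] by auto
  have [measurable]: "s n \<in> borel_measurable borel" for n
    using s by (rule borel_measurable_simple_function)
  \<comment> \<open>The level sets of \<open>s n\<close> partition the line, so
    \<open>\<psi>\<close> is the sum of its projections and \<open>l \<psi>\<close> can be
    subtracted inside the simple integral.\<close>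
  have norm_eq: "ennreal ((norm_c c (\<lambda>x. simple_spectral_integral E (s n) \<psi> x - of_real l *s \<psi> x))\<^sup>2)
     = (\<integral>\<^sup>+u. ennreal ((cmod (s n u - of_real l))\<^sup>2) \<partial>?\<mu>)" for n
  proof -
    have "ae_eq (E (\<Union>y\<in>range (s n). s n -` {y}) \<psi>) (\<lambda>x. \<Sum>y\<in>range (s n). E (s n -` {y}) \<psi> x)"
      by (intro E_UN psi fin m) (auto simp: disjoint_family_on_def)
    moreover have "(\<Union>y\<in>range (s n). s n -` {y}) = UNIV" by auto
    ultimately have "ae_eq (E UNIV \<psi>) (\<lambda>x. \<Sum>y\<in>range (s n). E (s n -` {y}) \<psi> x)" by (simp only:)
    then have "ae_eq (\<lambda>x. \<Sum>y\<in>range (s n). E (s n -` {y}) \<psi> x) \<psi>"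
      using E_UNIV [OF psi] unfolding ae_eq_def by eventually_elim simp
    then have "ae_eq (\<lambda>x. simple_spectral_integral E (s n) \<psi> x - of_real l *s \<psi> x)
        (\<lambda>x. \<Sum>y\<in>range (s n). (y - of_real l) *s E (s n -` {y}) \<psi> x)"
      unfolding ae_eq_def
    proof eventually_elim
      case (elim x)
      show ?case
        unfolding simple_spectral_integral_def elim [symmetric]
        by (simp add: vec_eq_iff sum_subtractf sum_distrib_left algebra_simps)
    qed
    then have "norm_c c (\<lambda>x. simple_spectral_integral E (s n) \<psi> x - of_real l *s \<psi> x)
        = norm_c c (\<lambda>x. \<Sum>y\<in>range (s n). (y - of_real l) *s E (s n -` {y}) \<psi> x)"
      unfolding simple_spectral_integral_def
      by (intro norm_c_cong_AE L2_diff L2_sum L2_scale E_L2 m psi) auto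
    then show ?thesis using norm_simple_integral [OF psi s, of "\<lambda>y. y - of_real l"] by simp
  qed
  have "(\<lambda>n. ennreal ((norm_c c (\<lambda>x. simple_spectral_integral E (s n) \<psi> x - of_real l *s \<psi> x))\<^sup>2)) \<longlonglongrightarrow> ennreal (0\<^sup>2)"
    by (intro tendsto_intros 2)
  then have 3: "(\<lambda>n. \<integral>\<^sup>+u. ennreal ((cmod (s n u - of_real l))\<^sup>2) \<partial>?\<mu>) \<longlonglongrightarrow> 0"
    unfolding norm_eq by simp
  have "(\<integral>\<^sup>+u. ennreal ((u - l)\<^sup>2) \<partial>?\<mu>) \<le> 0"
  proof (rule tendsto_lowerbound)
    show "(\<lambda>n. 2 * (\<integral>\<^sup>+u. ennreal ((cmod (s n u - of_real u))\<^sup>2) \<partial>?\<mu>)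
        + 2 * (\<integral>\<^sup>+u. ennreal ((cmod (s n u - of_real l))\<^sup>2) \<partial>?\<mu>)) \<longlonglongrightarrow> 0"
      using tendsto_add [OF ennreal_tendsto_cmult [OF _ 1, of 2] ennreal_tendsto_cmult [OF _ 3, of 2]] by simp
    show "\<forall>\<^sub>F n in sequentially. (\<integral>\<^sup>+u. ennreal ((u - l)\<^sup>2) \<partial>?\<mu>)
       \<le> 2 * (\<integral>\<^sup>+u. ennreal ((cmod (s n u - of_real u))\<^sup>2) \<partial>?\<mu>)
        + 2 * (\<integral>\<^sup>+u. ennreal ((cmod (s n u - of_real l))\<^sup>2) \<partial>?\<mu>)"
    proof (intro always_eventually allI)
      fix n
      have *: "(u - l)\<^sup>2 \<le> 2 * (cmod (s n u - of_real u))\<^sup>2 + 2 * (cmod (s n u - of_real l))\<^sup>2" for u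
      proof -
        have "\<bar>u - l\<bar> = cmod ((s n u - of_real l) - (s n u - of_real u))"
          by (simp flip: of_real_diff)
        also have "\<dots> \<le> cmod (s n u - of_real l) + cmod (s n u - of_real u)"
          by (rule norm_triangle_ineq4)
        finally have "\<bar>u - l\<bar>\<^sup>2 \<le> (cmod (s n u - of_real l) + cmod (s n u - of_real u))\<^sup>2"
          by (rule power_mono) simp
        then show ?thesis
          using sum_squares_bound [of "cmod (s n u - of_real l)" "cmod (s n u - of_real u)"]
          by (simp add: power2_sum)
      qed
      have "(\<integral>\<^sup>+u. ennreal ((u - l)\<^sup>2) \<partial>?\<mu>)
        \<le> (\<integral>\<^sup>+u. 2 * ennreal ((cmod (s n u - of_real u))\<^sup>2) + 2 * ennreal ((cmod (s n u - of_real l))\<^sup>2) \<partial>?\<mu>)"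
      proof (rule nn_integral_mono)
        fix u
        have "ennreal ((u - l)\<^sup>2) \<le> ennreal (2 * (cmod (s n u - of_real u))\<^sup>2 + 2 * (cmod (s n u - of_real l))\<^sup>2)"
          by (intro ennreal_leI *)
        then show "ennreal ((u - l)\<^sup>2) \<le> 2 * ennreal ((cmod (s n u - of_real u))\<^sup>2) + 2 * ennreal ((cmod (s n u - of_real l))\<^sup>2)"
          by (simp add: ennreal_mult)
      qed
      also have "\<dots> = 2 * (\<integral>\<^sup>+u. ennreal ((cmod (s n u - of_real u))\<^sup>2) \<partial>?\<mu>)
          + 2 * (\<integral>\<^sup>+u. ennreal ((cmod (s n u - of_real l))\<^sup>2) \<partial>?\<mu>)"
        by (simp add: nn_integral_add nn_integral_cmult)
      finally show "(\<integral>\<^sup>+u. ennreal ((u - l)\<^sup>2) \<partial>?\<mu>)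
       \<le> 2 * (\<integral>\<^sup>+u. ennreal ((cmod (s n u - of_real u))\<^sup>2) \<partial>?\<mu>)
        + 2 * (\<integral>\<^sup>+u. ennreal ((cmod (s n u - of_real l))\<^sup>2) \<partial>?\<mu>)" .
    qed
  qed simp
  then have "(\<integral>\<^sup>+u. ennreal ((u - l)\<^sup>2) \<partial>?\<mu>) = 0" by simp
  then have ae: "AE u in ?\<mu>. u = l"
    by (subst (asm) nn_integral_0_iff_AE) (auto simp: ennreal_eq_0_iff)
  have zero: "ae_eq (E Y \<psi>) (\<lambda>x. 0)" if Y: "Y \<in> sets borel" "l \<notin> Y" for Y
  proof -
    have "AE u in ?\<mu>. u \<notin> Y" using ae by eventually_elim (use that in auto)
    then have "emeasure ?\<mu> Y = 0"
      by (subst (asm) AE_iff_measurable [of Y]) (auto simp: sets_spectral_measure Y spectral_measure_def)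
    then have "norm_c c (E Y \<psi>) = 0" by (simp add: emeasure_spectral_measure psi Y ennreal_eq_0_iff)
    then show ?thesis using norm_c_eq_0_iff E_L2 Y psi by blast
  qed
  show ?thesis
  proof (cases "l \<in> X")
    case False
    then show ?thesis using zero [OF X] by simp
  next
    case True
    have "ae_eq (E (- X) \<psi>) (\<lambda>x. 0)" by (rule zero) (use X True in auto)
    moreover have "ae_eq (E (X \<union> - X) \<psi>) (\<lambda>x. E X \<psi> x + E (- X) \<psi> x)"
      using X by (intro E_Un psi) auto
    moreover have "ae_eq (E (X \<union> - X) \<psi>) \<psi>" using E_UNIV [OF psi] by simp
    ultimately show ?thesis unfolding ae_eq_def by eventually_elim (use True in simp)
  qed
qed

end

section \<open>Diagonal projection-valued measures and their integrals\<close>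

context L2_basis begin

text \<open>Phrased through coefficients, the property fits both the resolution that is constructed
  and an arbitrary one that is to be recognised.\<close>

definition diag_pvm :: "(nat \<Rightarrow> real) \<Rightarrow> (real set \<Rightarrow> 'n cl_fun \<Rightarrow> 'n cl_fun) \<Rightarrow> bool" where
  "diag_pvm lam E \<longleftrightarrow> (\<forall>X\<in>sets borel. \<forall>f\<in>L2 c. E X f \<in> L2 c \<and>
     (\<forall>k. coef (E X f) k = indicator X (lam k) * coef f k))"

lemma diag_pvmD: "diag_pvm lam E \<Longrightarrow> X \<in> sets borel \<Longrightarrow> f \<in> L2 c \<Longrightarrow> E X f \<in> L2 c"
  "diag_pvm lam E \<Longrightarrow> X \<in> sets borel \<Longrightarrow> f \<in> L2 c \<Longrightarrow> coef (E X f) k = indicator X (lam k) * coef f k"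
  by (auto simp: diag_pvm_def)

text \<open>By Parseval the mass of a set is the sum of the squared coefficients whose eigenvalue
  lies in it. Eigenvalues may repeat, which the image measure under \<open>lam\<close> takes into
  account.\<close>

lemma spectral_measure_diag:
  assumes E: "diag_pvm lam E" and f: "f \<in> L2 c"
  shows "spectral_measure c E f = distr (density (count_space UNIV) (\<lambda>k. ennreal ((cmod (coef f k))\<^sup>2))) borel lam"
    (is "_ = ?N")
proof -
  have eq: "ennreal (Re (inner_c c f (E X f))) = emeasure ?N X" if X: "X \<in> sets borel" for X
  proof -
    have "(\<lambda>k. cnj (coef f k) * (indicator X (lam k) * coef f k)) sums inner_c c f (E X f)"
      using Parseval_inner [OF f diag_pvmD(1) [OF E X f]] by (simp add: diag_pvmD(2) [OF E X f])
    then have "(\<lambda>k. Re (cnj (coef f k) * (indicator X (lam k) * coef f k))) sums Re (inner_c c f (E X f))"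
      by (rule sums_Re)
    moreover have "Re (cnj (coef f k) * (indicator X (lam k) * coef f k)) = (cmod (coef f k))\<^sup>2 * indicator X (lam k)" for k
      by (cases "lam k \<in> X") (simp_all add: cmod_power2, simp add: power2_eq_square)
    ultimately have s: "(\<lambda>k. (cmod (coef f k))\<^sup>2 * indicator X (lam k)) sums Re (inner_c c f (E X f))" by simp
    have "emeasure ?N X = (\<integral>\<^sup>+k. ennreal ((cmod (coef f k))\<^sup>2) * indicator (lam -` X) k \<partial>count_space UNIV)"
      using X by (subst emeasure_distr) (auto simp: emeasure_density)
    also have "\<dots> = (\<Sum>k. ennreal ((cmod (coef f k))\<^sup>2 * indicator X (lam k)))"
      by (subst nn_integral_count_space_nat) (auto intro!: suminf_cong simp: indicator_def)
    also have "\<dots> = ennreal (Re (inner_c c f (E X f)))"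
      using s by (subst suminf_ennreal2) (auto simp: sums_iff)
    finally show ?thesis by simp
  qed
  have "spectral_measure c E f = measure_of UNIV (sets borel) (emeasure ?N)"
    unfolding spectral_measure_def
    by (rule measure_of_eq) (auto simp: eq sets.sigma_sets_eq [of borel, simplified])
  also have "\<dots> = ?N" using measure_of_of_measure [of ?N] by simp
  finally show ?thesis .
qed

lemma nn_integral_spectral_measure_diag:
  assumes E: "diag_pvm lam E" and f: "f \<in> L2 c" and G [measurable]: "G \<in> borel_measurable borel"
    and G0: "\<And>u. 0 \<le> G u"
  shows "(\<integral>\<^sup>+u. ennreal (G u) \<partial>spectral_measure c E f) = (\<Sum>k. ennreal ((cmod (coef f k))\<^sup>2 * G (lam k)))"
  unfolding spectral_measure_diag [OF E f]
  by (subst nn_integral_distr, simp, simp, subst nn_integral_density)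
    (auto simp: nn_integral_count_space_nat ennreal_mult G0)

lemma simple_spectral_integral_diag:
  assumes E: "diag_pvm lam E" and f: "f \<in> L2 c" and s: "simple_function borel s"
  shows "simple_spectral_integral E s f \<in> L2 c"
    and "coef (simple_spectral_integral E s f) k = s (lam k) * coef f k"
proof -
  have fin: "finite (range s)" and m: "s -` {y} \<in> sets borel" for y
    using simple_functionD [OF s] by auto
  show "simple_spectral_integral E s f \<in> L2 c"
    unfolding simple_spectral_integral_def by (intro L2_sum L2_scale diag_pvmD(1) [OF E] m f)
  have "coef (simple_spectral_integral E s f) k = (\<Sum>y\<in>range s. y * (indicator (s -` {y}) (lam k) * coef f k))"
    unfolding simple_spectral_integral_def
    by (simp add: coef_sum coef_scale L2_scale diag_pvmD [OF E] m f)
  also have "\<dots> = (\<Sum>y\<in>range s. if y = s (lam k) then s (lam k) * coef f k else 0)"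
    by (intro sum.cong refl) (auto simp: indicator_def)
  also have "\<dots> = s (lam k) * coef f k" using fin by simp
  finally show "coef (simple_spectral_integral E s f) k = s (lam k) * coef f k" .
qed

text \<open>Integrals against the spectral measure are series over the coefficients. From left to
  right, a single summand is bounded by the whole series; from right to left, simple functions
  dominated by \<open>2 * cmod (g u)\<close> converge, with a majorant that is finite because
  \<open>k\<close> is in \<open>L2 c\<close>.\<close>

theorem spectral_integral_diag:
  assumes E: "diag_pvm lam E" and g [measurable]: "g \<in> borel_measurable borel"
  shows "spectral_integral c E g = diag_op (\<lambda>k. g (lam k))"
proof (intro set_eqI iffI; clarify)
  fix f k assume "(f, k) \<in> spectral_integral c E g"
  then obtain s where f: "f \<in> L2 c" and k: "k \<in> L2 c" and s: "\<And>n. simple_function borel (s n)"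
    and 1: "(\<lambda>n. \<integral>\<^sup>+u. ennreal ((cmod (s n u - g u))\<^sup>2) \<partial>spectral_measure c E f) \<longlonglongrightarrow> 0"
    and 2: "(\<lambda>n. norm_c c (\<lambda>x. simple_spectral_integral E (s n) f x - k x)) \<longlonglongrightarrow> 0"
    unfolding spectral_integral_def by blast
  have [measurable]: "s n \<in> borel_measurable borel" for n
    using s by (rule borel_measurable_simple_function)
  show "(f, k) \<in> diag_op (\<lambda>k. g (lam k))"
  proof (rule diag_opI [OF f k])
    fix i
    have lim: "(\<lambda>n. s n (lam i) * coef f i) \<longlonglongrightarrow> coef k i"
      using inner_c_tendsto [OF simple_spectral_integral_diag(1) [OF E f s] k psi_L2 2, of i]
      by (simp add: coef_def [symmetric] simple_spectral_integral_diag(2) [OF E f s])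
    \<comment> \<open>The squared coefficient stays as a factor, since \<open>s n (lam i)\<close>
      need not converge to \<open>g (lam i)\<close> where \<open>coef f i\<close> is 0.\<close>
    have "(\<lambda>n. ennreal ((cmod (coef f i))\<^sup>2 * (cmod (s n (lam i) - g (lam i)))\<^sup>2)) \<longlonglongrightarrow> 0"
    proof (rule tendsto_sandwich [OF _ _ tendsto_const 1])
      show "\<forall>\<^sub>F n in sequentially. ennreal ((cmod (coef f i))\<^sup>2 * (cmod (s n (lam i) - g (lam i)))\<^sup>2)
        \<le> (\<integral>\<^sup>+u. ennreal ((cmod (s n u - g u))\<^sup>2) \<partial>spectral_measure c E f)"
      proof (intro always_eventually allI)
        fix n
        show "ennreal ((cmod (coef f i))\<^sup>2 * (cmod (s n (lam i) - g (lam i)))\<^sup>2)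
          \<le> (\<integral>\<^sup>+u. ennreal ((cmod (s n u - g u))\<^sup>2) \<partial>spectral_measure c E f)"
        proof -
          have "(\<Sum>k\<in>{i}. ennreal ((cmod (coef f k))\<^sup>2 * (cmod (s n (lam k) - g (lam k)))\<^sup>2))
            \<le> (\<Sum>k. ennreal ((cmod (coef f k))\<^sup>2 * (cmod (s n (lam k) - g (lam k)))\<^sup>2))"
            by (rule sum_le_suminf) auto
          then show ?thesis
            by (subst nn_integral_spectral_measure_diag [OF E f]) simp_all
        qed
      qed
    qed simp
    then have "(\<lambda>n. (cmod (coef f i))\<^sup>2 * (cmod (s n (lam i) - g (lam i)))\<^sup>2) \<longlonglongrightarrow> 0"
      by (subst (asm) ennreal_0 [symmetric], subst (asm) tendsto_ennreal_iff) auto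
    then have "(\<lambda>n. sqrt ((cmod (coef f i))\<^sup>2 * (cmod (s n (lam i) - g (lam i)))\<^sup>2)) \<longlonglongrightarrow> sqrt 0"
      by (rule tendsto_real_sqrt)
    then have "(\<lambda>n. cmod (s n (lam i) * coef f i - g (lam i) * coef f i)) \<longlonglongrightarrow> 0"
      by (simp add: real_sqrt_mult norm_mult mult.commute flip: left_diff_distrib)
    then have "(\<lambda>n. s n (lam i) * coef f i) \<longlonglongrightarrow> g (lam i) * coef f i"
      by (rule LIM_zero_cancel [OF tendsto_norm_zero_cancel])
    with lim show "coef k i = g (lam i) * coef f i" by (rule LIMSEQ_unique)
  qed
next
  fix f k assume fk: "(f, k) \<in> diag_op (\<lambda>k. g (lam k))"
  then have f: "f \<in> L2 c" and k: "k \<in> L2 c" and ck: "\<And>i. coef k i = g (lam i) * coef f i"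
    using diag_opD [OF fk] by auto
  let ?\<mu> = "spectral_measure c E f"
  have sets_mu [measurable_cong]: "sets ?\<mu> = sets borel" by (simp add: spectral_measure_diag [OF E f])
  obtain s where s: "\<And>n. simple_function borel (s n)" and lim: "\<And>u. (\<lambda>n. s n u) \<longlonglongrightarrow> g u"
    and bound: "\<And>n u. cmod (s n u) \<le> 2 * cmod (g u)"
    using borel_measurable_implies_sequence_metric [OF g, of 0] by auto
  have [measurable]: "s n \<in> borel_measurable borel" for n
    using s by (rule borel_measurable_simple_function)
  have int: "(\<integral>\<^sup>+u. ennreal ((cmod (s n u - g u))\<^sup>2) \<partial>?\<mu>)
     = ennreal ((norm_c c (\<lambda>x. simple_spectral_integral E (s n) f x - k x))\<^sup>2)" for n
  proof -
    note L = simple_spectral_integral_diag(1) [OF E f s]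
    have "(\<integral>\<^sup>+u. ennreal ((cmod (s n u - g u))\<^sup>2) \<partial>?\<mu>)
      = (\<Sum>i. ennreal ((cmod (coef f i))\<^sup>2 * (cmod (s n (lam i) - g (lam i)))\<^sup>2))"
      by (intro nn_integral_spectral_measure_diag [OF E f]) auto
    also have "\<dots> = (\<Sum>i. ennreal ((cmod (coef (\<lambda>x. simple_spectral_integral E (s n) f x - k x) i))\<^sup>2))"
      by (simp add: coef_diff L k simple_spectral_integral_diag(2) [OF E f s] ck left_diff_distrib [symmetric]
         norm_mult power_mult_distrib mult.commute)
    also have "\<dots> = ennreal ((norm_c c (\<lambda>x. simple_spectral_integral E (s n) f x - k x))\<^sup>2)"
      by (intro Parseval_nn L2_diff L k)
    finally show ?thesis .
  qed
  \<comment> \<open>Dominated convergence with majorant 9 |g|^2: the difference is at most |g| + 2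
    |g|, and the integral of the majorant is the squared norm of \<open>3 *s k\<close>.\<close>
  have 1: "(\<lambda>n. \<integral>\<^sup>+u. ennreal ((cmod (s n u - g u))\<^sup>2) \<partial>?\<mu>) \<longlonglongrightarrow> (\<integral>\<^sup>+u. 0 \<partial>?\<mu>)"
  proof (rule nn_integral_dominated_convergence)
    have "cmod (s n u - g u) \<le> 3 * cmod (g u)" for n u
      using norm_triangle_ineq4 [of "s n u" "g u"] bound [of n u] by linarith
    then have "(cmod (s n u - g u))\<^sup>2 \<le> (3 * cmod (g u))\<^sup>2" for n u
      by (intro power_mono) auto
    then show "AE u in ?\<mu>. ennreal ((cmod (s n u - g u))\<^sup>2) \<le> ennreal (9 * (cmod (g u))\<^sup>2)" for n
      by (intro AE_I2 ennreal_leI) (simp add: power_mult_distrib)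
    have "(\<integral>\<^sup>+u. ennreal (9 * (cmod (g u))\<^sup>2) \<partial>?\<mu>) = (\<Sum>i. ennreal ((cmod (coef f i))\<^sup>2 * (9 * (cmod (g (lam i)))\<^sup>2)))"
      by (intro nn_integral_spectral_measure_diag [OF E f]) auto
    also have "\<dots> = (\<Sum>i. ennreal ((cmod (coef (\<lambda>x. 3 *s k x) i))\<^sup>2))"
      by (simp add: coef_scale k ck norm_mult power_mult_distrib mult_ac)
    also have "\<dots> = ennreal ((norm_c c (\<lambda>x. 3 *s k x))\<^sup>2)"
      by (intro Parseval_nn L2_scale k)
    finally show "(\<integral>\<^sup>+u. ennreal (9 * (cmod (g u))\<^sup>2) \<partial>?\<mu>) < \<infinity>" by simp
    have "(\<lambda>n. ennreal ((cmod (s n u - g u))\<^sup>2)) \<longlonglongrightarrow> ennreal ((cmod (g u - g u))\<^sup>2)" for u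
      by (intro tendsto_intros lim)
    then show "AE u in ?\<mu>. (\<lambda>n. ennreal ((cmod (s n u - g u))\<^sup>2)) \<longlonglongrightarrow> 0" by simp
  qed simp_all
  then have "(\<lambda>n. ennreal ((norm_c c (\<lambda>x. simple_spectral_integral E (s n) f x - k x))\<^sup>2)) \<longlonglongrightarrow> 0"
    unfolding int by simp
  then have "(\<lambda>n. (norm_c c (\<lambda>x. simple_spectral_integral E (s n) f x - k x))\<^sup>2) \<longlonglongrightarrow> 0"
    by (subst (asm) ennreal_0 [symmetric], subst (asm) tendsto_ennreal_iff) auto
  then have "(\<lambda>n. sqrt ((norm_c c (\<lambda>x. simple_spectral_integral E (s n) f x - k x))\<^sup>2)) \<longlonglongrightarrow> sqrt 0"
    by (rule tendsto_real_sqrt)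
  then have 2: "(\<lambda>n. norm_c c (\<lambda>x. simple_spectral_integral E (s n) f x - k x)) \<longlonglongrightarrow> 0"
    by (simp add: norm_c_nonneg L2_diff simple_spectral_integral_diag(1) [OF E f s] k)
  show "(f, k) \<in> spectral_integral c E g"
    unfolding spectral_integral_def using f k s 1 2 by auto
qed

lemma diag_pvm_exists: obtains E where "diag_pvm lam E"
proof -
  have "\<exists>k. f \<in> L2 c \<longrightarrow> (f, k) \<in> diag_op (\<lambda>k. indicator X (lam k))" for X f
  proof (cases "f \<in> L2 c")
    case True
    show ?thesis
      by (rule diag_op_total [of "\<lambda>k. indicator X (lam k)" 1, OF _ True]) (auto simp: indicator_def)
  qed simp
  note * = someI_ex [OF this]
  define E where "E X f = (SOME k. f \<in> L2 c \<longrightarrow> (f, k) \<in> diag_op (\<lambda>k. indicator X (lam k)))" for X f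
  have "(f, E X f) \<in> diag_op (\<lambda>k. indicator X (lam k))" if "f \<in> L2 c" for X f
    using * [of f X] that unfolding E_def by blast
  then have "diag_pvm lam E"
    unfolding diag_pvm_def using diag_opD by blast
  then show ?thesis using that by blast
qed

lemma diag_pvm_projection_valued_measure:
  assumes E: "diag_pvm lam E"
  shows "projection_valued_measure c E"
  unfolding projection_valued_measure_def orthogonal_projection_def
proof (intro conjI ballI allI impI)
  fix X :: "real set" assume X: "X \<in> sets borel"
  note L = diag_pvmD(1) [OF E X] and C = diag_pvmD(2) [OF E X]
  fix f :: "'n cl_fun" assume f: "f \<in> L2 c"
  show "E X f \<in> L2 c" by (rule L [OF f])
  show "ae_eq (E X (E X f)) (E X f)"
    by (rule ae_eqI) (auto simp: L C f indicator_def)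
  fix g :: "'n cl_fun" assume g: "g \<in> L2 c"
  show "ae_eq (E X (\<lambda>x. a *s f x + b *s g x)) (\<lambda>x. a *s E X f x + b *s E X g x)" for a b
    by (rule ae_eqI) (auto simp: L C f g L2_add L2_scale coef_add coef_scale algebra_simps)
  have "cnj (coef (E X f) k) * coef g k = cnj (coef f k) * coef (E X g) k" for k
    by (simp add: C f g indicator_def)
  then show "inner_c c (E X f) g = inner_c c f (E X g)"
    using Parseval_inner [OF L [OF f] g] Parseval_inner [OF f L [OF g]] by (simp add: sums_iff)
next
  fix f :: "'n cl_fun" assume f: "f \<in> L2 c"
  show "ae_eq (E UNIV f) f"
    by (rule ae_eqI) (auto simp: diag_pvmD [OF E] f)
next
  fix f :: "'n cl_fun" and X :: "nat \<Rightarrow> real set"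
  assume f: "f \<in> L2 c" and "range X \<subseteq> sets borel" and d: "disjoint_family X"
  then have X: "X n \<in> sets borel" and U: "(\<Union>n. X n) \<in> sets borel" for n by auto
  let ?d = "\<lambda>N x. (\<Sum>n<N. E (X n) f x) - E (\<Union>n. X n) f x"
  have dL: "?d N \<in> L2 c" for N by (intro L2_diff L2_sum diag_pvmD [OF E] X U f)
  \<comment> \<open>The remainder of the partial sum is minus the projection belonging to the union
    of the sets not yet summed.\<close>
  have cd: "coef (?d N) k = - indicator (\<Union>n\<in>{N..}. X n) (lam k) * coef f k" for N k
  proof -
    have "(\<Sum>n<N. indicator (X n) (lam k)) = (indicator (\<Union>n\<in>{..<N}. X n) (lam k) :: complex)"
      by (rule indicator_UN_disjoint [symmetric]) (use d in \<open>auto simp: disjoint_family_on_def\<close>)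
    moreover have "indicator (\<Union>n. X n) (lam k) = (indicator (\<Union>n\<in>{..<N}. X n) (lam k) + indicator (\<Union>n\<in>{N..}. X n) (lam k) :: complex)"
    proof -
      have "(\<Union>n. X n) = (\<Union>n\<in>{..<N}. X n) \<union> (\<Union>n\<in>{N..}. X n)"
        by (auto simp: not_less) (metis atLeast_iff lessThan_iff not_less)
      moreover have "(\<Union>n\<in>{..<N}. X n) \<inter> (\<Union>n\<in>{N..}. X n) = {}"
      proof -
        have "X i \<inter> X j = {}" if "i \<in> {..<N}" "j \<in> {N..}" for i j
          using d that by (auto simp: disjoint_family_on_def)
        then show ?thesis by blast
      qed
      ultimately show ?thesis by (auto simp: indicator_def)
    qed
    ultimately show ?thesis
      by (simp add: coef_diff coef_sum L2_sum diag_pvmD [OF E] X U f algebra_simps flip: sum_distrib_right sum_distrib_left)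
  qed
  \<comment> \<open>Tannery's theorem with the coefficients of \<open>f\<close> as majorant: each
    \<open>lam k\<close> lies in at most one of the disjoint sets, so it leaves the remaining union
    eventually.\<close>
  have "(\<lambda>N. \<Sum>k. (cmod (coef (?d N) k))\<^sup>2) \<longlonglongrightarrow> (\<Sum>k. 0)"
  proof (rule tannerys_theorem [THEN conjunct2, THEN conjunct2, OF _ _ coef_summable [OF f]])
    show "\<forall>\<^sub>F (k, N) in at_top \<times>\<^sub>F sequentially. norm ((cmod (coef (?d N) k))\<^sup>2) \<le> (cmod (coef f k))\<^sup>2"
      by (rule always_eventually) (auto simp: cd indicator_def)
    show "(\<lambda>N. (cmod (coef (?d N) k))\<^sup>2) \<longlonglongrightarrow> 0" for k
    proof (rule tendsto_eventually)
      obtain n0 where "\<And>n. n > n0 \<Longrightarrow> lam k \<notin> X n"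
      proof (cases "\<exists>n. lam k \<in> X n")
        case True
        then obtain n where "lam k \<in> X n" by blast
        then have "lam k \<notin> X i" if "i > n" for i
          using d that by (auto simp: disjoint_family_on_def) (metis disjoint_iff less_irrefl)
        then show ?thesis using that by blast
      qed (use that in blast)
      then show "\<forall>\<^sub>F N in sequentially. (cmod (coef (?d N) k))\<^sup>2 = 0"
        unfolding cd by (intro eventually_sequentiallyI [of "Suc n0"]) (auto simp: indicator_def)
    qed
  qed simp
  then have "(\<lambda>N. (norm_c c (?d N))\<^sup>2) \<longlonglongrightarrow> 0"
    using Parseval [OF dL] by (simp add: sums_iff)
  then have "(\<lambda>N. sqrt ((norm_c c (?d N))\<^sup>2)) \<longlonglongrightarrow> sqrt 0"
    by (rule tendsto_real_sqrt)
  then show "(\<lambda>N. norm_c c (?d N)) \<longlonglongrightarrow> 0" by (simp add: norm_c_nonneg dL)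
qed

text \<open>Uniqueness of the resolution: selfadjointness moves \<open>E X\<close> from
  \<open>f\<close> to \<open>\<psi> k\<close>, and on an eigenvector \<open>E X\<close> is known
  from \<open>eigenvector_spectral_measure\<close>.\<close>

lemma pvm_of_diag_op:
  assumes pvm: "projection_valued_measure c E" and eq: "diag_op (\<lambda>k. of_real (lam k)) = spectral_integral c E complex_of_real"
  shows "diag_pvm lam E"
  unfolding diag_pvm_def
proof (intro ballI conjI allI)
  interpret pvm c E by unfold_locales (rule pvm)
  fix X :: "real set" and f :: "'n cl_fun" assume X: "X \<in> sets borel" and f: "f \<in> L2 c"
  show L: "E X f \<in> L2 c" by (rule E_L2 [OF X f])
  fix k
  show "coef (E X f) k = indicator X (lam k) * coef f k"
  proof (cases "k \<in> J")
    case False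
    then show ?thesis by (simp add: coef_outside f L)
  next
    case True
    have "(\<psi> k, \<lambda>x. of_real (lam k) *s \<psi> k x) \<in> diag_op (\<lambda>k. of_real (lam k))"
      by (intro diag_opI psi_L2 L2_scale) (auto simp: coef_scale psi_L2 coef_psi)
    then have e: "ae_eq (E X (\<psi> k)) (\<lambda>x. if lam k \<in> X then \<psi> k x else 0)"
      unfolding eq by (rule eigenvector_spectral_measure [OF _ X])
    have "(\<lambda>x. if lam k \<in> X then \<psi> k x else 0) \<in> L2 c" by (cases "lam k \<in> X") (simp_all add: psi_L2 L2_zero)
    with e have "inner_c c (E X (\<psi> k)) f = inner_c c (\<lambda>x. if lam k \<in> X then \<psi> k x else 0) f"
      by (intro inner_c_cong_AE E_L2 X psi_L2 f) (auto simp: ae_eq_def)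
    then show ?thesis
      by (simp add: coef_def E_self X f psi_L2 indicator_def inner_c_zero_left)
  qed
qed

text \<open>Existence of a resolution keeps the relation from being empty; uniqueness makes the
  union over all resolutions equal to the contribution of one.\<close>

theorem functional_calculus_diag:
  assumes g: "g \<in> borel_measurable borel"
  shows "functional_calculus c (diag_op (\<lambda>k. of_real (lam k))) g = diag_op (\<lambda>k. g (lam k))"
proof -
  obtain E0 where E0: "diag_pvm lam E0" by (rule diag_pvm_exists)
  have "spectral_resolution c (diag_op (\<lambda>k. of_real (lam k))) E0"
    unfolding spectral_resolution_def
    using diag_pvm_projection_valued_measure [OF E0] spectral_integral_diag [OF E0, of complex_of_real] by simp
  moreover have "diag_pvm lam E" if "spectral_resolution c (diag_op (\<lambda>k. of_real (lam k))) E" for E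
    using that pvm_of_diag_op unfolding spectral_resolution_def by blast
  ultimately show ?thesis
    unfolding functional_calculus_def using spectral_integral_diag [OF _ g] E0 by blast
qed

end

section \<open>Fischer decomposition\<close>

lemma partial_eqI:
  assumes "(f has_derivative f') (at x)"
  shows "partial i f x = f' (axis i 1)"
  unfolding partial_def
proof (rule vector_derivative_at)
  have "((\<lambda>s. x + s *\<^sub>R axis i 1) has_derivative (\<lambda>s. s *\<^sub>R axis i (1::real))) (at (0::real))"
    by (auto intro!: derivative_eq_intros)
  moreover have "(f has_derivative f') (at (x + 0 *\<^sub>R axis i 1))" using assms by simp
  ultimately have "(f \<circ> (\<lambda>s. x + s *\<^sub>R axis i 1) has_derivative f' \<circ> (\<lambda>s. s *\<^sub>R axis i 1)) (at 0)"
    by (rule diff_chain_at)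
  then show "((\<lambda>s. f (x + s *\<^sub>R axis i 1)) has_vector_derivative f' (axis i 1)) (at 0)"
    using linear_scale [OF has_derivative_linear [OF assms]]
    by (simp add: has_vector_derivative_def o_def)
qed

lemma partial_add: "f differentiable (at x) \<Longrightarrow> g differentiable (at x) \<Longrightarrow>
    partial i (\<lambda>x. f x + g x) x = partial i f x + partial i g x"
  unfolding differentiable_def
  by (elim exE) (simp add: partial_eqI [OF has_derivative_add] partial_eqI)

lemma partial_scaleR: "f differentiable (at x) \<Longrightarrow> partial i (\<lambda>x. a *\<^sub>R f x) x = a *\<^sub>R partial i f x"
  unfolding differentiable_def
  by (elim exE) (simp add: partial_eqI [OF has_derivative_scaleR_right] partial_eqI)

lemma partial_scale: "f differentiable (at x) \<Longrightarrow> partial i (\<lambda>x. a *s f x) x = a *s partial i f x"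
proof -
  assume "f differentiable (at x)"
  then obtain f' where f': "(f has_derivative f') (at x)" by (auto simp: differentiable_def)
  have "bounded_linear (\<lambda>v :: 'a cl. a *s v)"
    by (intro linear_conv_bounded_linear [THEN iffD1] linearI) (simp_all add: vec_eq_iff algebra_simps)
  from bounded_linear.has_derivative [OF this f'] show ?thesis
    by (simp add: partial_eqI f' partial_eqI [OF f'])
qed

lemma differentiable_cl_scale: "f differentiable (at x) \<Longrightarrow> (\<lambda>x. a *s (f x :: ('n::{finite,linorder}) cl)) differentiable (at x)"
proof -
  assume "f differentiable (at x)"
  then obtain f' where f': "(f has_derivative f') (at x)" by (auto simp: differentiable_def)
  have "bounded_linear (\<lambda>v :: 'n cl. a *s v)"
    by (intro linear_conv_bounded_linear [THEN iffD1] linearI) (simp_all add: vec_eq_iff algebra_simps)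
  from bounded_linear.has_derivative [OF this f'] show ?thesis by (auto simp: differentiable_def)
qed

lemma has_derivative_cl_vec_mult:
  fixes f :: "('n::{finite,linorder}) cl_fun"
  assumes "(f has_derivative f') (at x)"
  shows "((\<lambda>x. cl_vec x \<odot> f x) has_derivative (\<lambda>h. cl_vec h \<odot> f x + cl_vec x \<odot> f' h)) (at x)"
proof -
  have 1: "bounded_linear (\<lambda>h :: (real, 'n) vec. h $ i)" for i by (rule bounded_linear_vec_nth)
  have "((\<lambda>x. \<Sum>i\<in>UNIV. (x $ i) *\<^sub>R (cl_gen i \<odot> f x)) has_derivative
    (\<lambda>h. \<Sum>i\<in>UNIV. (x $ i) *\<^sub>R (cl_gen i \<odot> f' h) + (h $ i) *\<^sub>R (cl_gen i \<odot> f x))) (at x)"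
    by (intro has_derivative_sum has_derivative_scaleR bounded_linear.has_derivative [OF bounded_linear_cl_mult_right] assms
       bounded_linear_imp_has_derivative 1)
  then show ?thesis
    by (simp add: cl_vec_def cl_mult_sum_left cl_mult_scaleR_left sum.distrib add.commute)
qed

lemma cl_vec_axis: "cl_vec (axis i 1) = cl_gen i"
  by (simp add: cl_vec_def axis_def if_distrib [of "\<lambda>t. t *\<^sub>R _"] cong: if_cong)

lemma partial_cl_vec_mult: "f differentiable (at x) \<Longrightarrow>
    partial i (\<lambda>x. cl_vec x \<odot> f x) x = cl_gen i \<odot> f x + cl_vec x \<odot> partial i f x"
  unfolding differentiable_def
  by (elim exE) (simp add: partial_eqI [OF has_derivative_cl_vec_mult] partial_eqI cl_vec_axis)

lemma dirac_add: "f differentiable (at x) \<Longrightarrow> g differentiable (at x) \<Longrightarrow>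
    dirac (\<lambda>x. f x + g x) x = dirac f x + dirac g x"
  by (simp add: dirac_def partial_add cl_mult_add_right sum.distrib)

lemma dirac_scaleR: "f differentiable (at x) \<Longrightarrow> dirac (\<lambda>x. a *\<^sub>R f x) x = a *\<^sub>R dirac f x"
  by (simp add: dirac_def partial_scaleR cl_mult_scaleR_right scaleR_sum_right)

lemma dirac_diff: "f differentiable (at x) \<Longrightarrow> g differentiable (at x) \<Longrightarrow>
    dirac (\<lambda>x. f x - g x) x = dirac f x - dirac g x"
  using dirac_add [of f x "\<lambda>x. (- 1) *\<^sub>R g x"] dirac_scaleR [of g x "- 1"] by simp

lemma partial_const: "partial i (\<lambda>x. a) x = 0"
  by (rule partial_eqI [OF has_derivative_const])

lemma dirac_zero: "dirac (\<lambda>x. 0) x = 0"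
  by (simp add: dirac_def partial_const)

lemma dirac_sum: "(\<And>k. k \<in> K \<Longrightarrow> f k differentiable (at x)) \<Longrightarrow>
    dirac (\<lambda>x. \<Sum>k\<in>K. f k x) x = (\<Sum>k\<in>K. dirac (f k) x)"
proof (induction K rule: infinite_finite_induct)
  case (insert k K)
  then have "dirac (\<lambda>x. f k x + (\<Sum>k\<in>K. f k x)) x = dirac (f k) x + dirac (\<lambda>x. \<Sum>k\<in>K. f k x) x"
    by (intro dirac_add differentiable_sum) auto
  with insert show ?case by simp
qed (simp_all add: dirac_zero)

lemma cl_gen_vec: "cl_gen i \<odot> cl_vec x = - (cl_vec x \<odot> cl_gen i) - (2 * x $ i) *\<^sub>R cl_one"
proof -
  have "cl_gen i \<odot> cl_vec x + cl_vec x \<odot> cl_gen i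
    = (\<Sum>j\<in>UNIV. x $ j *\<^sub>R (cl_gen i \<odot> cl_gen j + cl_gen j \<odot> cl_gen i))"
    by (simp add: cl_vec_def cl_mult_sum_left cl_mult_sum_right cl_mult_scaleR_left cl_mult_scaleR_right
        scaleR_add_right sum.distrib)
  also have "\<dots> = (\<Sum>j\<in>UNIV. if j = i then - (2 * x $ i) *\<^sub>R cl_one else 0)"
  proof (intro sum.cong refl)
    fix j
    have "- cl_one - cl_one = - (2 *\<^sub>R cl_one :: 'a cl)" by (simp add: scaleR_2)
    then show "x $ j *\<^sub>R (cl_gen i \<odot> cl_gen j + cl_gen j \<odot> cl_gen i) = (if j = i then - (2 * x $ i) *\<^sub>R cl_one else 0)"
      using cl_gen_anticommute [of i j] by (auto simp: cl_gen_square)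
  qed
  finally have "cl_gen i \<odot> cl_vec x + cl_vec x \<odot> cl_gen i = - ((2 * x $ i) *\<^sub>R cl_one)" by simp
  then show ?thesis by (simp add: eq_diff_eq' eq_neg_iff_add_eq_0 algebra_simps)
qed

text \<open>Moving each generator past x by \<open>cl_gen_vec\<close> costs a term - 2 x_i; summed
  against the partial derivatives these terms form the Euler operator, while the squares of the
  generators give the dimension.\<close>

lemma dirac_cl_vec_mult:
  fixes f :: "('n::{finite,linorder}) cl_fun"
  assumes "f differentiable (at x)"
  shows "dirac (\<lambda>x. cl_vec x \<odot> f x) x
    = - (real CARD('n) *\<^sub>R f x) - 2 *\<^sub>R euler f x - cl_vec x \<odot> dirac f x"
proof -
  have "cl_gen i \<odot> (cl_gen i \<odot> f x + cl_vec x \<odot> partial i f x)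
    = - f x - cl_vec x \<odot> (cl_gen i \<odot> partial i f x) - (2 * x $ i) *\<^sub>R partial i f x" for i
  proof -
    have "cl_gen i \<odot> (cl_vec x \<odot> partial i f x) = (- (cl_vec x \<odot> cl_gen i) - (2 * x $ i) *\<^sub>R cl_one) \<odot> partial i f x"
      by (simp only: cl_gen_vec flip: cl_mult_assoc)
    also have "\<dots> = - (cl_vec x \<odot> cl_gen i) \<odot> partial i f x + (- (2 * x $ i) *\<^sub>R cl_one) \<odot> partial i f x"
      by (simp flip: cl_mult_add_left)
    also have "\<dots> = - (cl_vec x \<odot> (cl_gen i \<odot> partial i f x)) - (2 * x $ i) *\<^sub>R partial i f x"
      by (simp add: cl_mult_minus_left cl_mult_assoc cl_mult_scaleR_left cl_mult_one)
    finally show ?thesis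
      by (simp add: cl_mult_add_right cl_gen_square cl_mult_minus_left cl_mult_one flip: cl_mult_assoc)
  qed
  then show ?thesis
    unfolding dirac_def partial_cl_vec_mult [OF assms] euler_def
    by (simp add: sum_subtractf cl_mult_sum_right scaleR_sum_right sum_negf)
      (simp add: vec_eq_iff scaleR_conv_of_real)
qed

section \<open>Homogeneous Clifford-valued polynomials\<close>

lemma polynomial_function_bounded_linear_compose:
  fixes L :: "'b::real_normed_vector \<Rightarrow> 'c::real_normed_vector" and Q :: "'a::real_normed_vector \<Rightarrow> 'b"
  shows "bounded_linear L \<Longrightarrow> polynomial_function Q \<Longrightarrow> polynomial_function (\<lambda>x. L (Q x))"
  unfolding polynomial_function_def
proof (intro allI impI)
  fix h :: "'c \<Rightarrow> real"
  assume L: "bounded_linear L" and Q: "\<forall>f. bounded_linear f \<longrightarrow> real_polynomial_function (f \<circ> Q)" and h: "bounded_linear h"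
  have "bounded_linear (h \<circ> L)" using h L by (simp add: o_def bounded_linear_compose)
  with Q have "real_polynomial_function ((h \<circ> L) \<circ> Q)" by blast
  then show "real_polynomial_function (h \<circ> (\<lambda>x. L (Q x)))" by (simp add: o_def)
qed

lemma polynomial_function_nth: "polynomial_function (\<lambda>x :: real ^ 'n. x $ i)"
  by (rule polynomial_function_bounded_linear) (rule bounded_linear_vec_nth)

lemma polynomial_function_cl_vec_mult:
  assumes "polynomial_function Q"
  shows "polynomial_function (\<lambda>x. cl_vec x \<odot> Q x)"
proof -
  have "polynomial_function (\<lambda>x. \<Sum>i\<in>UNIV. (x $ i) *\<^sub>R (cl_gen i \<odot> Q x))"
    by (intro polynomial_function_sum polynomial_function_mult polynomial_function_nth
        polynomial_function_bounded_linear_compose [OF bounded_linear_cl_mult_right assms]) simp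
  then show ?thesis by (simp add: cl_vec_def cl_mult_sum_left cl_mult_scaleR_left)
qed

text \<open>Structural induction keeps the derivative polynomial: one \<open>q\<close> has to serve
  all points, which pointwise differentiability would not provide.\<close>

lemma real_polynomial_function_directional_derivative:
  fixes p :: "'a::real_normed_vector \<Rightarrow> real"
  assumes "real_polynomial_function p"
  shows "\<exists>q. real_polynomial_function q \<and> (\<forall>x. ((\<lambda>s. p (x + s *\<^sub>R e)) has_vector_derivative q x) (at 0))"
  using assms
proof (induction p rule: real_polynomial_function.induct)
  case (linear f)
  have "((\<lambda>s. f x + s *\<^sub>R f e) has_vector_derivative f e) (at 0)" for x
    by (auto intro!: derivative_eq_intros)
  then have "((\<lambda>s. f (x + s *\<^sub>R e)) has_vector_derivative f e) (at 0)" for x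
    using linear by (simp add: bounded_linear.linear linear_add linear_scale)
  then show ?case by (intro exI [of _ "\<lambda>x. f e"]) (auto intro: real_polynomial_function.intros(2))
next
  case (const a)
  then show ?case by (intro exI [of _ "\<lambda>x. 0"]) (auto intro: real_polynomial_function.intros(2))
next
  case (add f g)
  then obtain f' g' where "real_polynomial_function f'" "real_polynomial_function g'"
    "\<And>x. ((\<lambda>s. f (x + s *\<^sub>R e)) has_vector_derivative f' x) (at 0)"
    "\<And>x. ((\<lambda>s. g (x + s *\<^sub>R e)) has_vector_derivative g' x) (at 0)" by blast
  then show ?case
    by (intro exI [of _ "\<lambda>x. f' x + g' x"]) (auto intro: real_polynomial_function.intros(3) has_vector_derivative_add)
next
  case (mult f g)
  then obtain f' g' where fg: "real_polynomial_function f'" "real_polynomial_function g'"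
    "\<And>x. ((\<lambda>s. f (x + s *\<^sub>R e)) has_vector_derivative f' x) (at 0)"
    "\<And>x. ((\<lambda>s. g (x + s *\<^sub>R e)) has_vector_derivative g' x) (at 0)" by blast
  have "((\<lambda>s. f (x + s *\<^sub>R e) * g (x + s *\<^sub>R e)) has_vector_derivative f x * g' x + f' x * g x) (at 0)" for x
    using has_vector_derivative_mult [OF fg(3,4), of x x] by simp
  then show ?case
    by (intro exI [of _ "\<lambda>x. f x * g' x + f' x * g x"])
      (auto intro!: real_polynomial_function.intros(3) real_polynomial_function.intros(4) fg mult)
qed

lemma polynomial_function_partial:
  fixes P :: "('n::{finite,linorder}) cl_fun"
  assumes "polynomial_function P"
  shows "polynomial_function (partial i P)"
proof -
  have "\<forall>b\<in>Basis. \<exists>q. real_polynomial_function q \<and>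
      (\<forall>x. ((\<lambda>s. P (x + s *\<^sub>R axis i 1) \<bullet> b) has_vector_derivative q x) (at 0))"
  proof
    fix b :: "'n cl" assume "b \<in> Basis"
    then have "real_polynomial_function (\<lambda>x. P x \<bullet> b)"
      using assms polynomial_function_iff_Basis_inner by blast
    from real_polynomial_function_directional_derivative [OF this, of "axis i 1"]
    show "\<exists>q. real_polynomial_function q \<and> (\<forall>x. ((\<lambda>s. P (x + s *\<^sub>R axis i 1) \<bullet> b) has_vector_derivative q x) (at 0))" .
  qed
  from bchoice [OF this] obtain q where q: "\<And>b. b \<in> Basis \<Longrightarrow> real_polynomial_function (q b)"
    "\<And>b x. b \<in> Basis \<Longrightarrow> ((\<lambda>s. P (x + s *\<^sub>R axis i 1) \<bullet> b) has_vector_derivative q b x) (at 0)"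
    by blast
  have "((\<lambda>s. \<Sum>b\<in>Basis. (P (x + s *\<^sub>R axis i 1) \<bullet> b) *\<^sub>R b) has_vector_derivative (\<Sum>b\<in>Basis. q b x *\<^sub>R b)) (at 0)" for x
    by (intro has_vector_derivative_sum bounded_linear.has_vector_derivative [OF bounded_linear_scaleR_left] q(2))
  then have "partial i P x = (\<Sum>b\<in>Basis. q b x *\<^sub>R b)" for x
    by (simp add: euclidean_representation partial_def vector_derivative_at)
  then have eq: "partial i P = (\<lambda>x. \<Sum>b\<in>Basis. q b x *\<^sub>R b)" by (rule ext)
  show "polynomial_function (partial i P)"
    unfolding eq
  proof -
    show "polynomial_function (\<lambda>x. \<Sum>b\<in>Basis. q b x *\<^sub>R b)"
    by (intro polynomial_function_sum polynomial_function_mult)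
       (auto simp: q(1) real_polynomial_function_eq [symmetric])
  qed
qed

definition hom_poly :: "nat \<Rightarrow> ('n::{finite,linorder}) cl_fun \<Rightarrow> bool" where
  "hom_poly k P \<longleftrightarrow> polynomial_function P \<and> (\<forall>x A. P x $ A \<in> \<real>) \<and> (\<forall>s x. P (s *\<^sub>R x) = s ^ k *\<^sub>R P x)"

lemma Reals_scaleR: "z \<in> \<real> \<Longrightarrow> a *\<^sub>R z \<in> (\<real> :: complex set)"
  by (simp add: scaleR_conv_of_real)

lemma monogenics_iff: "M \<in> monogenics l \<longleftrightarrow> hom_poly l M \<and> (\<forall>x. dirac M x = 0)"
  by (auto simp: monogenics_def hom_poly_def)

lemma hom_poly_differentiable: "hom_poly k P \<Longrightarrow> P differentiable (at x)"
  by (simp add: hom_poly_def differentiable_at_polynomial_function)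

lemma hom_poly_add: "hom_poly k P \<Longrightarrow> hom_poly k Q \<Longrightarrow> hom_poly k (\<lambda>x. P x + Q x)"
  by (auto simp: hom_poly_def scaleR_add_right)

lemma hom_poly_scaleR: "hom_poly k P \<Longrightarrow> hom_poly k (\<lambda>x. a *\<^sub>R P x)"
  by (auto simp: hom_poly_def Reals_scaleR)

lemma hom_poly_zero: "hom_poly k (\<lambda>x. 0)"
  by (auto simp: hom_poly_def)

lemma hom_poly_sum: "(\<And>i. i \<in> I \<Longrightarrow> hom_poly k (P i)) \<Longrightarrow> hom_poly k (\<lambda>x. \<Sum>i\<in>I. P i x)"
  by (induction I rule: infinite_finite_induct) (auto intro: hom_poly_zero hom_poly_add)

lemma hom_poly_diff: "hom_poly k P \<Longrightarrow> hom_poly k Q \<Longrightarrow> hom_poly k (\<lambda>x. P x - Q x)"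
  using hom_poly_add [of k P "\<lambda>x. (- 1) *\<^sub>R Q x"] hom_poly_scaleR [of k Q "- 1"] by simp

lemma cl_sign_Reals: "cl_sign A B \<in> \<real>"
  by (simp add: cl_sign_def)

lemma cl_mult_Reals: "(\<And>A. u $ A \<in> \<real>) \<Longrightarrow> (\<And>A. v $ A \<in> \<real>) \<Longrightarrow> (u \<odot> v) $ C \<in> \<real>"
  by (auto simp: cl_mult_nth cl_sign_Reals intro!: sum_in_Reals Reals_mult)

lemma cl_gen_Reals: "cl_gen i $ A \<in> \<real>"
  by (simp add: cl_gen_def axis_def)

lemma cl_vec_Reals: "cl_vec x $ A \<in> \<real>"
  by (auto simp: cl_vec_def cl_gen_Reals Reals_scaleR intro!: sum_in_Reals)

lemma hom_poly_cl_vec_mult: "hom_poly k P \<Longrightarrow> hom_poly (Suc k) (\<lambda>x. cl_vec x \<odot> P x)"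
  by (auto simp: hom_poly_def polynomial_function_cl_vec_mult cl_vec_Reals linear_scale [OF linear_cl_vec]
      cl_mult_scaleR_left cl_mult_scaleR_right intro!: cl_mult_Reals)

lemma hom_poly_partial:
  assumes "hom_poly (Suc k) P"
  shows "hom_poly k (partial i P)"
proof -
  have P: "polynomial_function P" "\<And>x A. P x $ A \<in> \<real>" "\<And>s x. P (s *\<^sub>R x) = s ^ Suc k *\<^sub>R P x"
    using assms by (auto simp: hom_poly_def)
  have der: "((\<lambda>s. P (x + s *\<^sub>R axis i 1)) has_vector_derivative partial i P x) (at 0)" for x
  proof -
    have "P differentiable (at (x + 0 *\<^sub>R axis i 1))" by (rule hom_poly_differentiable [OF assms])
    moreover have "(\<lambda>s. x + s *\<^sub>R axis i (1::real)) differentiable (at (0::real))"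
      by (auto intro!: derivative_intros)
    ultimately have "(\<lambda>s. P (x + s *\<^sub>R axis i 1)) differentiable (at 0)"
      using differentiable_chain_at [of "\<lambda>s. x + s *\<^sub>R axis i 1" 0 P] by (simp add: o_def)
    then show ?thesis unfolding partial_def by (simp add: vector_derivative_works)
  qed
  have real: "partial i P x $ A \<in> \<real>" for x A
  proof -
    have "((\<lambda>s. Im (P (x + s *\<^sub>R axis i 1) $ A)) has_vector_derivative Im (partial i P x $ A)) (at 0)"
      using bounded_linear.has_vector_derivative [OF bounded_linear_compose [OF bounded_linear_Im bounded_linear_vec_nth] der]
      by (simp add: o_def)
    moreover have "Im (P y $ A) = 0" for y using P(2) complex_is_Real_iff by blast
    ultimately have "((\<lambda>s::real. 0::real) has_vector_derivative Im (partial i P x $ A)) (at 0)" by simp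
    then have "Im (partial i P x $ A) = 0"
      using vector_derivative_unique_at has_vector_derivative_const by blast
    then show ?thesis by (simp add: complex_is_Real_iff)
  qed
  have hom: "partial i P (s *\<^sub>R x) = s ^ k *\<^sub>R partial i P x" if "s \<noteq> 0" for s x
  proof -
    have 1: "((\<lambda>t. P (x + t *\<^sub>R axis i 1)) has_vector_derivative partial i P x) (at (0 / s))"
      using der by simp
    have 2: "((\<lambda>t. t / s) has_vector_derivative (1 / s)) (at 0)"
      using that by (auto intro!: derivative_eq_intros simp: has_real_derivative_iff_has_vector_derivative [symmetric])
    have "((\<lambda>t. P (x + (t / s) *\<^sub>R axis i 1)) has_vector_derivative (1 / s) *\<^sub>R partial i P x) (at 0)"
      using vector_diff_chain_at [OF 2 1] by (simp add: o_def)
    then have "((\<lambda>t. s ^ Suc k *\<^sub>R P (x + (t / s) *\<^sub>R axis i 1)) has_vector_derivative s ^ Suc k *\<^sub>R ((1 / s) *\<^sub>R partial i P x)) (at 0)"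
      using bounded_linear.has_vector_derivative [OF bounded_linear_scaleR_right] by blast
    moreover have "s ^ Suc k *\<^sub>R P (x + (t / s) *\<^sub>R axis i 1) = P (s *\<^sub>R x + t *\<^sub>R axis i 1)" for t
      using that by (simp only: P(3) [symmetric]) (simp add: scaleR_add_right)
    moreover have "s ^ Suc k *\<^sub>R ((1 / s) *\<^sub>R partial i P x) = s ^ k *\<^sub>R partial i P x" using that by simp
    ultimately show ?thesis unfolding partial_def by (simp add: vector_derivative_at)
  qed
  have cont: "continuous_on UNIV (partial i P)"
    by (intro continuous_on_polymonial_function polynomial_function_partial P)
  \<comment> \<open>The chain rule argument divides by \<open>s\<close>; the case
    \<open>s = 0\<close> is its limit. For \<open>k = 0\<close> this says that the derivative is
    constant, because 0 ^ 0 = 1.\<close>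
  have hom0: "partial i P (0 *\<^sub>R x) = 0 ^ k *\<^sub>R partial i P x" for x
  proof (rule tendsto_unique [of "at (0::real)"])
    have "isCont (\<lambda>s. partial i P (s *\<^sub>R x)) 0"
      using continuous_on_compose2 [OF cont, of UNIV "\<lambda>s. s *\<^sub>R x"]
      by (simp add: continuous_on_eq_continuous_at continuous_intros)
    then show "((\<lambda>s. partial i P (s *\<^sub>R x)) \<longlongrightarrow> partial i P (0 *\<^sub>R x)) (at 0)"
      by (simp add: isCont_def)
    have "((\<lambda>s::real. s ^ k *\<^sub>R partial i P x) \<longlongrightarrow> 0 ^ k *\<^sub>R partial i P x) (at 0)"
      by (intro tendsto_intros)
    then show "((\<lambda>s. partial i P (s *\<^sub>R x)) \<longlongrightarrow> 0 ^ k *\<^sub>R partial i P x) (at 0)"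
      by (rule Lim_transform_eventually) (auto simp: eventually_at_filter hom)
  qed simp
  show ?thesis
    unfolding hom_poly_def
  proof (intro conjI allI real polynomial_function_partial P)
    fix s x show "partial i P (s *\<^sub>R x) = s ^ k *\<^sub>R partial i P x"
      using hom hom0 by (cases "s = 0") auto
  qed
qed

lemma hom_poly_dirac: assumes "hom_poly (Suc k) P" shows "hom_poly k (dirac P)"
proof -
  have "hom_poly k (\<lambda>x. cl_gen i \<odot> partial i P x)" for i
    using hom_poly_partial [OF assms, of i]
    by (auto simp: hom_poly_def cl_gen_Reals cl_mult_scaleR_right intro!: cl_mult_Reals
       polynomial_function_bounded_linear_compose [OF bounded_linear_cl_mult_right])
  then show ?thesis unfolding dirac_def [abs_def] by (intro hom_poly_sum)
qed

text \<open>The derivative of s -> P (s x) at s = 1 is computed twice, by the chain rule and from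
  homogeneity.\<close>

lemma euler_hom_poly:
  assumes "hom_poly k P"
  shows "euler P x = real k *\<^sub>R P x"
proof -
  obtain P' where P': "(P has_derivative P') (at x)"
    using hom_poly_differentiable [OF assms] by (auto simp: differentiable_def)
  have lin: "linear P'" using P' by (rule has_derivative_linear)
  have "P' x = P' (\<Sum>i\<in>UNIV. x $ i *\<^sub>R axis i 1)"
    by (rule arg_cong [of _ _ P']) (simp add: vec_eq_iff axis_def if_distrib cong: if_cong)
  also have "\<dots> = euler P x"
    unfolding euler_def partial_eqI [OF P'] by (simp add: linear_sum [OF lin] linear_scale [OF lin])
  finally have e: "euler P x = P' x" by simp
  have "((\<lambda>s. s *\<^sub>R x) has_derivative (\<lambda>h. h *\<^sub>R x)) (at (1::real))"
    by (auto intro!: derivative_eq_intros)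
  moreover have "(P has_derivative P') (at (1 *\<^sub>R x))" using P' by simp
  ultimately have "(P \<circ> (\<lambda>s. s *\<^sub>R x) has_derivative P' \<circ> (\<lambda>h. h *\<^sub>R x)) (at 1)"
    by (rule diff_chain_at)
  moreover have "P \<circ> (\<lambda>s. s *\<^sub>R x) = (\<lambda>s. s ^ k *\<^sub>R P x)"
    using assms by (auto simp: hom_poly_def)
  ultimately have 1: "((\<lambda>s. s ^ k *\<^sub>R P x) has_vector_derivative P' x) (at 1)"
    by (simp add: has_vector_derivative_def o_def linear_scale [OF lin])
  have 2: "((\<lambda>s. s ^ k *\<^sub>R P x) has_vector_derivative (real k *\<^sub>R P x)) (at (1::real))"
    by (auto intro!: derivative_eq_intros)
  show ?thesis using vector_derivative_unique_at [OF 1 2] e by simp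
qed

definition vpow :: "nat \<Rightarrow> ('n::{finite,linorder}) cl_fun \<Rightarrow> 'n cl_fun" where
  "vpow s F x = ((\<odot>) (cl_vec x) ^^ s) (F x)"

lemma vpow_0: "vpow 0 F = F" and vpow_Suc: "vpow (Suc s) F = (\<lambda>x. cl_vec x \<odot> vpow s F x)"
  by (simp_all add: vpow_def fun_eq_iff)

lemma hom_poly_vpow: "hom_poly l F \<Longrightarrow> hom_poly (s + l) (vpow s F)"
  by (induction s) (auto simp: vpow_0 vpow_Suc intro: hom_poly_cl_vec_mult)

lemma vpow_scaleR: "vpow s (\<lambda>x. a *\<^sub>R F x) = (\<lambda>x. a *\<^sub>R vpow s F x)"
  by (induction s) (simp_all add: vpow_0 vpow_Suc cl_mult_scaleR_right)

text \<open>Simultaneous induction: multiplying the second identity for \<open>s\<close> by x gives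
  the first for \<open>Suc s\<close>, and that is the term which \<open>dirac_cl_vec_mult\<close>
  needs for the second identity at \<open>Suc s\<close>.\<close>

lemma dirac_vpow:
  fixes F :: "('n::{finite,linorder}) cl_fun"
  assumes "F \<in> monogenics l"
  shows "cl_vec x \<odot> dirac (vpow s F) x
      = (if even s then - real s else - (real s - 1 + 2 * real l + real CARD('n))) *\<^sub>R vpow s F x"
    and "dirac (vpow (Suc s) F) x
      = (if even s then - (real s + 2 * real l + real CARD('n)) else - real (Suc s)) *\<^sub>R vpow s F x"
proof (induction s)
  case 0
  have F: "hom_poly l F" "\<And>x. dirac F x = 0" using assms by (auto simp: monogenics_iff)
  {
    case 1
    show ?case using F by (simp add: vpow_0)
  next
    case 2
    show ?case using dirac_cl_vec_mult [OF hom_poly_differentiable [OF F(1)], of x] euler_hom_poly [OF F(1), of x] F(2)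
      by (simp add: vpow_0 vpow_Suc algebra_simps)
  }
next
  case (Suc s)
  have F: "hom_poly l F" using assms by (simp add: monogenics_iff)
  have a: "cl_vec x \<odot> dirac (vpow (Suc s) F) x
      = (if even (Suc s) then - real (Suc s) else - (real (Suc s) - 1 + 2 * real l + real CARD('n))) *\<^sub>R vpow (Suc s) F x"
    by (simp add: Suc cl_mult_scaleR_right cl_mult_minus_right) (simp add: vpow_Suc)
  {
    case 1
    show ?case by (rule a)
  next
    case 2
    have h: "hom_poly (Suc s + l) (vpow (Suc s) F)" by (rule hom_poly_vpow [OF F])
    show ?case
      unfolding vpow_Suc [of "Suc s" F] dirac_cl_vec_mult [OF hom_poly_differentiable [OF h]] euler_hom_poly [OF h] a
        scaleR_scaleR scaleR_minus_left [symmetric] scaleR_diff_left [symmetric]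
      by (rule arg_cong [where f = "\<lambda>t. t *\<^sub>R _"]) (simp add: algebra_simps)
  }
qed

lemma monogenics_scaleR: "F \<in> monogenics l \<Longrightarrow> (\<lambda>x. a *\<^sub>R F x) \<in> monogenics l"
  by (auto simp: monogenics_iff hom_poly_scaleR dirac_scaleR hom_poly_differentiable)

text \<open>Fischer decomposition. Since \<open>dirac\<close> maps \<open>x\<^sup>s\<^sup>+\<^sup>1 M\<close> to a nonzero multiple of \<open>x\<^sup>s M\<close>, a
  decomposition of \<open>dirac P\<close> can be integrated termwise; what remains of \<open>P\<close> is monogenic.\<close>

theorem Fischer_decomposition:
  fixes P :: "('n::{finite,linorder}) cl_fun"
  assumes "hom_poly k P"
  shows "\<exists>N. (\<forall>s\<le>k. N s \<in> monogenics (k - s)) \<and> P = (\<lambda>x. \<Sum>s\<le>k. vpow s (N s) x)"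
  using assms
proof (induction k arbitrary: P)
  case 0
  have "\<And>s x. P (s *\<^sub>R x) = s ^ 0 *\<^sub>R P x" using 0 by (simp add: hom_poly_def)
  then have c: "P x = P 0" for x by (metis power_0 scaleR_one scaleR_zero_left)
  have "dirac P x = dirac (\<lambda>x. P 0) x" for x
    by (rule arg_cong [of P _ "\<lambda>f. dirac f x"], rule ext, rule c)
  then have "dirac P x = 0" for x by (simp add: dirac_def partial_const)
  then show ?case using 0 by (intro exI [of _ "\<lambda>_. P"]) (simp add: monogenics_iff vpow_0)
next
  case (Suc k)
  obtain N where N: "\<And>s. s \<le> k \<Longrightarrow> N s \<in> monogenics (k - s)" "dirac P = (\<lambda>x. \<Sum>s\<le>k. vpow s (N s) x)"
    using Suc.IH [OF hom_poly_dirac [OF Suc.prems]] by blast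
  \<comment> \<open>The factor of \<open>dirac_vpow(2)\<close> for a monogenic of degree
    \<open>k - s\<close>. It is strictly negative, so it can be divided out.\<close>
  define a where "a s = (if even s then - (real s + 2 * real (k - s) + real CARD('n)) else - real (Suc s))" for s
  have m0: "0 < real CARD('n)" by simp
  have a: "a s \<noteq> 0" for s
  proof (cases "even s")
    case True
    then have "a s = - (real s + 2 * real (k - s) + real CARD('n))" by (simp add: a_def)
    with m0 show ?thesis by linarith
  qed (simp add: a_def)
  define N' where "N' s = (\<lambda>x. (1 / a s) *\<^sub>R N s x)" for s
  have N': "N' s \<in> monogenics (k - s)" if "s \<le> k" for s
    unfolding N'_def using N(1) [OF that] by (rule monogenics_scaleR)
  have h: "hom_poly (Suc k) (vpow (Suc s) (N' s))" if "s \<le> k" for s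
    using hom_poly_vpow [of "k - s" "N' s" "Suc s"] N' [OF that] that by (simp add: monogenics_iff)
  have d: "dirac (vpow (Suc s) (N' s)) x = vpow s (N s) x" if "s \<le> k" for s x
    using dirac_vpow(2) [OF N' [OF that], of s x] a [of s] by (simp add: N'_def vpow_scaleR a_def [symmetric] split: if_splits)
  define R where "R = (\<lambda>x. P x - (\<Sum>s\<le>k. vpow (Suc s) (N' s) x))"
  have hR: "hom_poly (Suc k) R"
    unfolding R_def by (intro hom_poly_diff hom_poly_sum Suc.prems h) simp
  have "dirac R x = dirac P x - (\<Sum>s\<le>k. dirac (vpow (Suc s) (N' s)) x)" for x
    unfolding R_def
    by (subst dirac_diff, auto intro!: hom_poly_differentiable Suc.prems hom_poly_sum h)
       (subst dirac_sum, auto intro!: hom_poly_differentiable h)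
  then have "dirac R x = 0" for x by (simp add: d N(2))
  with hR have R: "R \<in> monogenics (Suc k)" by (simp add: monogenics_iff)
  show ?case
  proof (intro exI [of _ "\<lambda>s. case s of 0 \<Rightarrow> R | Suc s \<Rightarrow> N' s"] conjI allI impI)
    fix s assume "s \<le> Suc k"
    then show "(case s of 0 \<Rightarrow> R | Suc s \<Rightarrow> N' s) \<in> monogenics (Suc k - s)"
      using R N' by (cases s) auto
  next
    show "P = (\<lambda>x. \<Sum>s\<le>Suc k. vpow s (case s of 0 \<Rightarrow> R | Suc s \<Rightarrow> N' s) x)"
      by (simp add: sum.atMost_Suc_shift vpow_0 R_def del: sum.atMost_Suc)
  qed
qed

text \<open>The components beyond \<open>n\<close> are kept and required to vanish, so that a
  product of two decompositions is a Cauchy product of finitely supported sequences.\<close>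

lemma real_polynomial_function_homogeneous:
  fixes p :: "'a::real_normed_vector \<Rightarrow> real"
  assumes "real_polynomial_function p"
  shows "\<exists>n q. (\<forall>k. real_polynomial_function (q k) \<and> (\<forall>s x. q k (s *\<^sub>R x) = s ^ k * q k x)) \<and>
      (\<forall>k>n. q k = (\<lambda>x. 0)) \<and> (\<forall>x. p x = (\<Sum>k\<le>n. q k x))"
  using assms
proof (induction p rule: real_polynomial_function.induct)
  case (linear f)
  show ?case
    by (intro exI [of _ 1] exI [of _ "\<lambda>k. if k = 1 then f else (\<lambda>x. 0)"])
       (use linear in \<open>auto simp: bounded_linear.linear linear_scale intro: real_polynomial_function.intros\<close>)
next
  case (const a)
  show ?case
    by (intro exI [of _ 0] exI [of _ "\<lambda>k. if k = 0 then (\<lambda>x. a) else (\<lambda>x. 0)"])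
       (auto intro: real_polynomial_function.intros)
next
  case (add f g)
  from add.IH(1) obtain m p where
    p: "\<And>k. real_polynomial_function (p k)" "\<And>k s x. p k (s *\<^sub>R x) = s ^ k * p k x" "\<And>k. k > m \<Longrightarrow> p k = (\<lambda>x. 0)"
      "\<And>x. f x = (\<Sum>k\<le>m. p k x)" by blast
  from add.IH(2) obtain n q where
    q: "\<And>k. real_polynomial_function (q k)" "\<And>k s x. q k (s *\<^sub>R x) = s ^ k * q k x" "\<And>k. k > n \<Longrightarrow> q k = (\<lambda>x. 0)"
      "\<And>x. g x = (\<Sum>k\<le>n. q k x)" by blast
  have "f x = (\<Sum>k\<le>max m n. p k x)" for x
    unfolding p(4) by (rule sum.mono_neutral_left) (use p(3) in auto)
  moreover have "g x = (\<Sum>k\<le>max m n. q k x)" for x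
    unfolding q(4) by (rule sum.mono_neutral_left) (use q(3) in auto)
  ultimately show ?case
    by (intro exI [of _ "max m n"] exI [of _ "\<lambda>k x. p k x + q k x"])
       (auto simp: p q sum.distrib distrib_left intro: real_polynomial_function.intros)
next
  case (mult f g)
  from mult.IH(1) obtain m p where
    p: "\<And>k. real_polynomial_function (p k)" "\<And>k s x. p k (s *\<^sub>R x) = s ^ k * p k x" "\<And>k. k > m \<Longrightarrow> p k = (\<lambda>x. 0)"
      "\<And>x. f x = (\<Sum>k\<le>m. p k x)" by blast
  from mult.IH(2) obtain n q where
    q: "\<And>k. real_polynomial_function (q k)" "\<And>k s x. q k (s *\<^sub>R x) = s ^ k * q k x" "\<And>k. k > n \<Longrightarrow> q k = (\<lambda>x. 0)"
      "\<And>x. g x = (\<Sum>k\<le>n. q k x)" by blast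
  \<comment> \<open>For fixed \<open>x\<close> the components are treated as coefficients of
    polynomials in one variable, evaluated at 1.\<close>
  have e: "f x * g x = (\<Sum>r\<le>m + n. \<Sum>k\<le>r. p k x * q (r - k) x)" for x
    using polynomial_product [of m "\<lambda>k. p k x" n "\<lambda>k. q k x" 1] p(3) q(3) by (simp add: p(4) q(4))
  have z: "(\<Sum>k\<le>r. p k x * q (r - k) x) = 0" if "r > m + n" for r x
  proof (intro sum.neutral ballI)
    fix k
    show "p k x * q (r - k) x = 0" using p(3) [of k] q(3) [of "r - k"] that by (cases "k > m") auto
  qed
  have h: "(\<Sum>k\<le>r. p k (s *\<^sub>R x) * q (r - k) (s *\<^sub>R x)) = s ^ r * (\<Sum>k\<le>r. p k x * q (r - k) x)" for r s x
    unfolding sum_distrib_left p(2) q(2)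
    by (intro sum.cong refl) (simp add: power_add [symmetric])
  show ?case
    by (intro exI [of _ "m + n"] exI [of _ "\<lambda>r x. \<Sum>k\<le>r. p k x * q (r - k) x"] conjI allI impI ext z e h
       real_polynomial_function_sum real_polynomial_function.intros(4) p q) simp
qed

section \<open>Laguerre functions\<close>

text \<open>As a \<open>poly\<close> the function admits \<open>pderiv\<close> and comparison of
  coefficients.\<close>

definition laguerre_poly :: "nat \<Rightarrow> real \<Rightarrow> real poly" where
  "laguerre_poly t \<alpha> = (\<Sum>k\<le>t. monom ((- 1) ^ k * ((real t + \<alpha>) gchoose (t - k)) / fact k) k)"

lemma coeff_laguerre_poly:
  "coeff (laguerre_poly t \<alpha>) k = (if k \<le> t then (- 1) ^ k * ((real t + \<alpha>) gchoose (t - k)) / fact k else 0)"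
  by (simp add: laguerre_poly_def coeff_sum)

lemma laguerre_poly_poly: "laguerre t \<alpha> u = poly (laguerre_poly t \<alpha>) u"
  by (simp add: laguerre_def laguerre_poly_def poly_sum poly_monom)

text \<open>In coefficients the equation is the two-term recursion \<open>rec\<close> of a confluent
  hypergeometric series; it stops at \<open>k = t\<close>, where the right-hand side
  vanishes.\<close>

lemma laguerre_poly_ode:
  "[:0, 1:] * pderiv (pderiv (laguerre_poly t \<alpha>)) + [:\<alpha> + 1, - 1:] * pderiv (laguerre_poly t \<alpha>)
     + smult (real t) (laguerre_poly t \<alpha>) = 0"
proof (rule poly_eqI)
  fix n
  define a where "a k = coeff (laguerre_poly t \<alpha>) k" for k
  have rec: "real (Suc k) * (real k + \<alpha> + 1) * a (Suc k) = (real k - real t) * a k" for k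
  proof -
    consider "k < t" | "k = t" | "k > t" by linarith
    then show ?thesis
    proof cases
      case 1
      define j where "j = t - Suc k"
      have j: "t - k = Suc j" "t - Suc k = j" "real t = real j + real k + 1" using 1 by (auto simp: j_def)
      have "(real t + \<alpha> - real j) * ((real t + \<alpha>) gchoose j) = real (Suc j) * ((real t + \<alpha>) gchoose Suc j)"
        using gbinomial_mult_1 [of "real t + \<alpha>" j] by (simp add: algebra_simps)
      then have "(real k + \<alpha> + 1) * ((real t + \<alpha>) gchoose j) = (real t - real k) * ((real t + \<alpha>) gchoose Suc j)"
        by (simp add: j(3) algebra_simps)
      then have *: "(real k + \<alpha> + 1) * ((real t + \<alpha>) gchoose j) = (real t - real k) * ((real t + \<alpha>) gchoose Suc j)" .
      have a: "a (Suc k) = - ((- 1) ^ k) * ((real t + \<alpha>) gchoose j) / (real (Suc k) * fact k)"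
        "a k = (- 1) ^ k * ((real t + \<alpha>) gchoose Suc j) / fact k"
        using 1 by (auto simp: a_def coeff_laguerre_poly j)
      have "real (Suc k) * (real k + \<alpha> + 1) * a (Suc k) = - ((- 1) ^ k) * ((real k + \<alpha> + 1) * ((real t + \<alpha>) gchoose j)) / fact k"
        unfolding a(1) by (simp del: of_nat_Suc)
      then show ?thesis unfolding * a(2) by (simp add: algebra_simps)
    qed (auto simp: a_def coeff_laguerre_poly)
  qed
  show "coeff ([:0, 1:] * pderiv (pderiv (laguerre_poly t \<alpha>)) + [:\<alpha> + 1, - 1:] * pderiv (laguerre_poly t \<alpha>)
     + smult (real t) (laguerre_poly t \<alpha>)) n = coeff 0 n"
  proof (cases n)
    case 0
    then show ?thesis using rec [of 0]
      by (simp add: coeff_pderiv a_def mult_pCons_left algebra_simps)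
  next
    case (Suc k)
    then show ?thesis using rec [of "Suc k"]
      by (simp add: coeff_pderiv a_def mult_pCons_left algebra_simps)
  qed
qed

lemma laguerre_ode:
  "u * poly (pderiv (pderiv (laguerre_poly t \<alpha>))) u + (\<alpha> + 1 - u) * poly (pderiv (laguerre_poly t \<alpha>)) u
     + real t * poly (laguerre_poly t \<alpha>) u = 0"
  using arg_cong [OF laguerre_poly_ode [of t \<alpha>], of "\<lambda>p. poly p u"] by (simp add: algebra_simps)

text \<open>The degree \<open>t\<close> polynomial has a nonzero leading coefficient, so the system
  is triangular and leading terms can be removed one after another.\<close>

lemma laguerre_poly_span: "\<exists>a. monom 1 k = (\<Sum>t\<le>k. smult (a t) (laguerre_poly t \<alpha>))"
proof -
  have "\<exists>a. p = (\<Sum>t\<le>k. smult (a t) (laguerre_poly t \<alpha>))" if "degree p \<le> k" for p and k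
    using that
  proof (induction k arbitrary: p)
    case 0
    then obtain b where p: "p = [:b:]" by (metis degree_0_id le_zero_eq degree_eq_zeroE)
    have "laguerre_poly 0 \<alpha> = [:1:]" by (simp add: laguerre_poly_def monom_0)
    then show ?case using p by (intro exI [of _ "\<lambda>_. b"]) simp
  next
    case (Suc k)
    let ?L = "laguerre_poly (Suc k) \<alpha>"
    define b where "b = coeff p (Suc k) / coeff ?L (Suc k)"
    have L: "coeff ?L (Suc k) \<noteq> 0" by (simp add: coeff_laguerre_poly)
    have "degree (p - smult b ?L) \<le> k"
    proof (rule degree_le, intro allI impI)
      fix i assume "k < i"
      then consider "i = Suc k" | "i > Suc k" by linarith
      then show "coeff (p - smult b ?L) i = 0"
        using L Suc.prems by cases (auto simp: b_def coeff_laguerre_poly coeff_eq_0)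
    qed
    from Suc.IH [OF this] obtain a where "p - smult b ?L = (\<Sum>t\<le>k. smult (a t) (laguerre_poly t \<alpha>))" by blast
    then have "p = (\<Sum>t\<le>k. smult (a t) (laguerre_poly t \<alpha>)) + smult b ?L" by (simp add: algebra_simps)
    then show ?case by (intro exI [of _ "\<lambda>t. if t = Suc k then b else a t"]) simp
  qed
  then show ?thesis by (simp add: degree_monom_le)
qed

text \<open>\<open>g\<close> is read as a dimension: r^(g-1) is the matching radial density. It is
  \<open>gamma\<close> for even basis functions and \<open>gamma + 2\<close> for odd ones.\<close>

definition lag :: "nat \<Rightarrow> real \<Rightarrow> real \<Rightarrow> real" where
  "lag t g u = laguerre t (g / 2 - 1) u * exp (- u / 2)"

definition lag' :: "nat \<Rightarrow> real \<Rightarrow> real \<Rightarrow> real" where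
  "lag' t g u = (poly (pderiv (laguerre_poly t (g / 2 - 1))) u - laguerre t (g / 2 - 1) u / 2) * exp (- u / 2)"

definition lag'' :: "nat \<Rightarrow> real \<Rightarrow> real \<Rightarrow> real" where
  "lag'' t g u = (poly (pderiv (pderiv (laguerre_poly t (g / 2 - 1)))) u - poly (pderiv (laguerre_poly t (g / 2 - 1))) u
      + laguerre t (g / 2 - 1) u / 4) * exp (- u / 2)"

lemma lag_deriv: "(lag t g has_real_derivative lag' t g u) (at u)"
  unfolding lag_def [abs_def] lag'_def laguerre_poly_poly
  by (auto intro!: derivative_eq_intros poly_DERIV simp: field_simps)

lemma lag'_deriv: "(lag' t g has_real_derivative lag'' t g u) (at u)"
  unfolding lag'_def [abs_def] lag''_def laguerre_poly_poly
  by (auto intro!: derivative_eq_intros poly_DERIV simp: field_simps)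

text \<open>With u = r^2 the expression 4 u a'' + 2 g a' is the radial Laplacian in dimension
  \<open>g\<close>, so this is the harmonic oscillator equation at energy 4 t + g. It is the
  Laguerre equation after multiplication by the Gaussian.\<close>

lemma lag_ode: "4 * u * lag'' t g u + 2 * g * lag' t g u - u * lag t g u = - (4 * real t + g) * lag t g u"
proof -
  let ?p = "laguerre_poly t (g / 2 - 1)"
  have "u * poly (pderiv (pderiv ?p)) u + (g / 2 - u) * poly (pderiv ?p) u + real t * poly ?p u = 0"
    using laguerre_ode [of u t "g / 2 - 1"] by simp
  then have "u * poly (pderiv (pderiv ?p)) u = - (g / 2 - u) * poly (pderiv ?p) u - real t * poly ?p u"
    unfolding mult_minus_left by linarith
  then have "4 * (u * poly (pderiv (pderiv ?p)) u) * exp (- u / 2)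
     = 4 * (- (g / 2 - u) * poly (pderiv ?p) u - real t * poly ?p u) * exp (- u / 2)" by simp
  then show ?thesis
    unfolding lag_def lag'_def lag''_def laguerre_poly_poly by (simp add: algebra_simps)
qed

text \<open>Completing the square bounds exp (- b r^2) by a multiple of exp (- r), which leaves a
  Gamma integral.\<close>

lemma integrable_powr_exp:
  fixes s b :: real
  assumes s: "s > 0" and b: "b > 0"
  shows "integrable lborel (\<lambda>r. indicator {0<..} r * (r powr (s - 1) * exp (- b * r\<^sup>2)))"
proof (rule Bochner_Integration.integrable_bound)
  let ?G = "\<lambda>t. indicator {0..} t * t powr (s - 1) / exp t"
  have "(\<integral>\<^sup>+t. ennreal (norm (?G t)) \<partial>lborel) = ennreal (Gamma s)"
    unfolding Gamma_conv_nn_integral_real [OF s] by (intro nn_integral_cong) (simp add: indicator_def)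
  then have "integrable lborel ?G" by (intro integrableI_bounded) auto
  then show "integrable lborel (\<lambda>t. exp (1 / (4 * b)) * ?G t)" by (rule integrable_mult_right)
  show "AE r in lborel. norm (indicator {0<..} r * (r powr (s - 1) * exp (- b * r\<^sup>2))) \<le> norm (exp (1 / (4 * b)) * ?G r)"
  proof (rule AE_I2)
    fix r :: real
    have "0 \<le> b * (r - 1 / (2 * b))\<^sup>2" using b by simp
    also have "\<dots> = b * r\<^sup>2 - r + 1 / (4 * b)" using b by (simp add: power2_eq_square field_simps)
    finally have "exp (- b * r\<^sup>2) \<le> exp (1 / (4 * b) - r)" by simp
    then have "r powr (s - 1) * exp (- b * r\<^sup>2) \<le> r powr (s - 1) * (exp (1 / (4 * b)) / exp r)"
      by (intro mult_left_mono) (auto simp: exp_diff)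
    then show "norm (indicator {0<..} r * (r powr (s - 1) * exp (- b * r\<^sup>2))) \<le> norm (exp (1 / (4 * b)) * ?G r)"
      by (auto simp: indicator_def mult.commute)
  qed
qed simp

lemma integrable_powr_poly_exp:
  fixes s b :: real
  assumes s: "s > 0" and b: "b > 0"
  shows "integrable lborel (\<lambda>r. indicator {0<..} r * (r powr (s - 1) * poly p (r\<^sup>2) * exp (- b * r\<^sup>2)))"
proof -
  have "indicator {0<..} r * (r powr (s - 1) * poly p (r\<^sup>2) * exp (- b * r\<^sup>2))
    = (\<Sum>i\<le>degree p. coeff p i * (indicator {0<..} r * (r powr ((s + 2 * real i) - 1) * exp (- b * r\<^sup>2))))" for r :: real
  proof (cases "r > 0")
    case True
    have "r powr ((s + 2 * real i) - 1) = r powr (s - 1) * (r\<^sup>2) ^ i" for i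
    proof -
      have "r powr ((s + 2 * real i) - 1) = r powr ((s - 1) + real (2 * i))" by (rule arg_cong [of _ _ "(powr) r"]) simp
      also have "\<dots> = r powr (s - 1) * r ^ (2 * i)" using True by (simp only: powr_add powr_realpow)
      finally show ?thesis by (simp add: power_mult)
    qed
    then show ?thesis using True by (simp add: poly_altdef sum_distrib_left sum_distrib_right mult_ac)
  qed simp
  then show ?thesis
    using integrable_powr_exp [OF _ b, of "s + 2 * real _"] s
    by (simp only:) (intro Bochner_Integration.integrable_sum integrable_mult_right, simp)
qed

lemma powr_poly_exp_at_top:
  fixes g :: real
  shows "((\<lambda>r. r powr g * poly p (r\<^sup>2) * exp (- r\<^sup>2)) \<longlongrightarrow> 0) at_top"
proof -
  have "((\<lambda>r::real. r powr g * (r\<^sup>2) ^ i * exp (- r\<^sup>2)) \<longlongrightarrow> 0) at_top" for i :: nat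
    by real_asymp
  then have "((\<lambda>r. \<Sum>i\<le>degree p. coeff p i * (r powr g * (r\<^sup>2) ^ i * exp (- r\<^sup>2))) \<longlongrightarrow> (\<Sum>i\<le>degree p. coeff p i * 0)) at_top"
    by (intro tendsto_intros)
  moreover have "(\<Sum>i\<le>degree p. coeff p i * (r powr g * (r\<^sup>2) ^ i * exp (- r\<^sup>2))) = r powr g * poly p (r\<^sup>2) * exp (- r\<^sup>2)" for r
    by (simp add: poly_altdef sum_distrib_left sum_distrib_right mult_ac)
  ultimately show ?thesis by simp
qed

lemma powr_poly_exp_at_right_0:
  fixes g :: real
  assumes "g > 0"
  shows "((\<lambda>r. r powr g * poly p (r\<^sup>2) * exp (- r\<^sup>2)) \<longlongrightarrow> 0) (at_right 0)"
proof -
  have "((\<lambda>r::real. r powr g) \<longlongrightarrow> 0) (at_right 0)" using assms by real_asymp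
  moreover have "((\<lambda>r. poly p (r\<^sup>2) * exp (- r\<^sup>2)) \<longlongrightarrow> poly p (0\<^sup>2) * exp (- 0\<^sup>2)) (at_right 0)"
    by (intro tendsto_intros)
  ultimately have "((\<lambda>r. r powr g * (poly p (r\<^sup>2) * exp (- r\<^sup>2))) \<longlongrightarrow> 0 * (poly p (0\<^sup>2) * exp (- 0\<^sup>2))) (at_right 0)"
    by (rule tendsto_mult)
  then show ?thesis by (simp add: mult.assoc)
qed

text \<open>Sturm--Liouville: the integrand is, up to the factor \<open>2 (s - t)\<close>, the derivative of a
  weighted Wronskian that vanishes at both ends.\<close>

lemma laguerre_orthogonal:
  fixes g :: real
  assumes g: "g > 0" and st: "s \<noteq> t"
  shows "(LINT r|lborel. indicator {0<..} r * (r powr (g - 1) * lag t g (r\<^sup>2) * lag s g (r\<^sup>2))) = 0"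
proof -
  let ?P = "laguerre_poly t (g / 2 - 1)" and ?Q = "laguerre_poly s (g / 2 - 1)"
  \<comment> \<open>\<open>H\<close> is the Wronskian of the polynomials; the factor r^g exp (- r^2)
    in \<open>W\<close> is u^(g/2) exp (- u), the integrating factor of the Laguerre
    equation.\<close>
  define H where "H = pderiv ?P * ?Q - pderiv ?Q * ?P"
  define W where "W r = r powr g * poly H (r\<^sup>2) * exp (- r\<^sup>2)" for r
  define f where "f r = r powr (g - 1) * poly (smult (2 * (real s - real t)) (?P * ?Q)) (r\<^sup>2) * exp (- 1 * r\<^sup>2)" for r
  have ode: "u * poly (pderiv H) u + (g / 2 - u) * poly H u = (real s - real t) * (poly ?P u * poly ?Q u)" for u
  proof -
    have P: "u * poly (pderiv (pderiv ?P)) u = - (g / 2 - u) * poly (pderiv ?P) u - real t * poly ?P u"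
      using laguerre_ode [of u t "g / 2 - 1"] unfolding mult_minus_left diff_add_cancel by linarith
    have Q: "u * poly (pderiv (pderiv ?Q)) u = - (g / 2 - u) * poly (pderiv ?Q) u - real s * poly ?Q u"
      using laguerre_ode [of u s "g / 2 - 1"] unfolding mult_minus_left diff_add_cancel by linarith
    have "u * poly (pderiv H) u = (u * poly (pderiv (pderiv ?P)) u) * poly ?Q u - (u * poly (pderiv (pderiv ?Q)) u) * poly ?P u"
      by (simp add: H_def pderiv_diff pderiv_mult algebra_simps)
    then show ?thesis unfolding P Q by (simp add: H_def algebra_simps)
  qed
  have der: "(W has_real_derivative f r) (at r)" if "r > 0" for r
  proof -
    have d1: "(W has_real_derivative (g * r powr (g - 1) * poly H (r\<^sup>2) * exp (- r\<^sup>2)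
       + r powr g * (poly (pderiv H) (r\<^sup>2) * (2 * r)) * exp (- r\<^sup>2) - r powr g * poly H (r\<^sup>2) * (exp (- r\<^sup>2) * (2 * r)))) (at r)"
      unfolding W_def [abs_def] using that
      by (auto intro!: derivative_eq_intros DERIV_chain' [OF _ poly_DERIV] simp: algebra_simps)
    have "r powr g = r powr (g - 1) * r" using that by (simp add: powr_diff)
    then have e1: "g * r powr (g - 1) * poly H (r\<^sup>2) * exp (- r\<^sup>2)
       + r powr g * (poly (pderiv H) (r\<^sup>2) * (2 * r)) * exp (- r\<^sup>2) - r powr g * poly H (r\<^sup>2) * (exp (- r\<^sup>2) * (2 * r))
       = 2 * r powr (g - 1) * exp (- r\<^sup>2) * (r\<^sup>2 * poly (pderiv H) (r\<^sup>2) + (g / 2 - r\<^sup>2) * poly H (r\<^sup>2))"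
      by (simp add: algebra_simps power2_eq_square)
    have e2: "2 * r powr (g - 1) * exp (- r\<^sup>2) * ((real s - real t) * (poly ?P (r\<^sup>2) * poly ?Q (r\<^sup>2))) = f r"
      by (simp add: f_def)
    show ?thesis using d1 unfolding e1 ode e2 .
  qed
  have "(LBINT r=0..\<infinity>. f r) = 0 - 0"
  proof (rule interval_integral_FTC_integrable [of _ _ W])
    show "(W has_vector_derivative f r) (at r)" if "0 < ereal r" for r
      using der that by (simp add: has_real_derivative_iff_has_vector_derivative zero_ereal_def)
    show "isCont f r" if "0 < ereal r" for r
      using that unfolding f_def by (intro continuous_intros) (auto simp: zero_ereal_def)
    have "einterval 0 \<infinity> = {0<..}" by (auto simp: einterval_def zero_ereal_def)
    then show "set_integrable lborel (einterval 0 \<infinity>) f"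
      using integrable_powr_poly_exp [OF g, of 1 "smult (2 * (real s - real t)) (?P * ?Q)"]
      by (simp add: set_integrable_def f_def)
    show "((W \<circ> real_of_ereal) \<longlongrightarrow> 0) (at_right 0)"
      unfolding zero_ereal_def ereal_tendsto_simps W_def by (rule powr_poly_exp_at_right_0 [OF g])
    show "((W \<circ> real_of_ereal) \<longlongrightarrow> 0) (at_left \<infinity>)"
      unfolding ereal_tendsto_simps W_def by (rule powr_poly_exp_at_top)
  qed simp
  moreover have "(LBINT r=0..\<infinity>. f r) = (LINT r|lborel. indicator {0<..} r * f r)"
    by (simp add: interval_lebesgue_integral_0_infty set_lebesgue_integral_def)
  moreover have "indicator {0<..} r * f r = 2 * (real s - real t) *
     (indicator {0<..} r * (r powr (g - 1) * lag t g (r\<^sup>2) * lag s g (r\<^sup>2)))" for r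
  proof -
    have "exp (- r\<^sup>2) = exp (- r\<^sup>2 / 2) * exp (- r\<^sup>2 / 2)" by (simp add: exp_add [symmetric])
    then show ?thesis by (simp add: f_def lag_def laguerre_poly_poly mult_ac)
  qed
  ultimately show ?thesis using st by simp
qed

section \<open>Polar coordinates\<close>

lemma nn_integral_lborel_scaleR:
  fixes f :: "'a::euclidean_space \<Rightarrow> ennreal"
  assumes [measurable]: "f \<in> borel_measurable borel" and "R > 0"
  shows "(\<integral>\<^sup>+x. f x \<partial>lborel) = ennreal (R ^ DIM('a)) * (\<integral>\<^sup>+x. f (R *\<^sub>R x) \<partial>lborel)"
  using \<open>R > 0\<close>
  by (subst lborel_affine [of R 0])
    (simp_all add: nn_integral_density nn_integral_distr nn_integral_cmult)

text \<open>Scaling gives the ball of radius R the mass C R^m, which is the integral of C m r^(m-1)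
  over [0, R], and half-lines determine the image measure. The angular factor \<open>F\<close>
  enters only through the constant \<open>C\<close>.\<close>

lemma distr_norm_homogeneous:
  fixes F :: "'a::euclidean_space \<Rightarrow> ennreal"
  assumes F [measurable]: "F \<in> borel_measurable borel"
    and hom: "\<And>s x. s > 0 \<Longrightarrow> F (s *\<^sub>R x) = F x"
    and fin: "(\<integral>\<^sup>+x. F x * indicator (ball 0 1) x \<partial>lborel) = ennreal C" and C: "0 \<le> C"
  shows "distr (density lborel F) borel norm
    = density lborel (\<lambda>r. indicator {0..} r * ennreal (C * real DIM('a) * r ^ (DIM('a) - 1)))"
    (is "?M = ?N")
proof (rule measure_eqI_generator_eq [where E = "range lessThan" and \<Omega> = UNIV and A = "\<lambda>n. {..<real n}"])
  have "{..<a} \<inter> {..<b} = {..<min a b}" for a b :: real by auto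
  then show "Int_stable (range lessThan :: real set set)" by (auto simp: Int_stable_def)
  show "sets ?M = sigma_sets UNIV (range lessThan)" "sets ?N = sigma_sets UNIV (range lessThan)"
    by (simp_all add: borel_Iio)
  show "(\<Union>i. {..<real i}) = UNIV" using reals_Archimedean2 by auto
  have M: "emeasure ?M {..<R} = (if R > 0 then ennreal (R ^ DIM('a)) * ennreal C else 0)" for R
  proof -
    have [measurable]: "norm -` {..<R} \<in> sets (borel :: 'a measure)"
      using measurable_sets [of norm "borel :: 'a measure" borel "{..<R}"] by simp
    have "emeasure ?M {..<R} = (\<integral>\<^sup>+x. F x * indicator (norm -` {..<R}) x \<partial>lborel)"
      by (subst emeasure_distr) (auto simp: emeasure_density)
    also have "\<dots> = (\<integral>\<^sup>+x. F x * indicator (ball 0 R) x \<partial>lborel)"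
      by (intro nn_integral_cong) (auto simp: indicator_def)
    also have "\<dots> = (if R > 0 then ennreal (R ^ DIM('a)) * ennreal C else 0)"
    proof (cases "R > 0")
      case True
      have "(\<integral>\<^sup>+x. F x * indicator (ball 0 R) x \<partial>lborel)
        = ennreal (R ^ DIM('a)) * (\<integral>\<^sup>+x. F (R *\<^sub>R x) * indicator (ball 0 R) (R *\<^sub>R x) \<partial>lborel)"
        using True by (intro nn_integral_lborel_scaleR) (auto intro!: borel_measurable_times_ennreal borel_measurable_indicator)
      also have "(\<integral>\<^sup>+x. F (R *\<^sub>R x) * indicator (ball 0 R) (R *\<^sub>R x) \<partial>lborel)
        = (\<integral>\<^sup>+x. F x * indicator (ball 0 1) x \<partial>lborel)"
        using True by (intro nn_integral_cong) (auto simp: hom indicator_def)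
      finally show ?thesis using True by (simp add: fin)
    qed (simp add: ball_empty)
    finally show ?thesis .
  qed
  have N: "emeasure ?N {..<R} = (if R > 0 then ennreal (R ^ DIM('a)) * ennreal C else 0)" for R
  proof -
    have "emeasure ?N {..<R} = (\<integral>\<^sup>+r. indicator {0..} r * ennreal (C * real DIM('a) * r ^ (DIM('a) - 1)) * indicator {..<R} r \<partial>lborel)"
      by (simp add: emeasure_density)
    also have "\<dots> = (\<integral>\<^sup>+r. ennreal (C * real DIM('a) * r ^ (DIM('a) - 1)) * indicator {0..R} r \<partial>lborel)"
      using AE_lborel_singleton [of R]
      by (intro nn_integral_cong_AE) (auto elim!: eventually_mono simp: indicator_def)
    also have "\<dots> = (if R > 0 then ennreal (R ^ DIM('a)) * ennreal C else 0)"
    proof (cases "R > 0")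
      case True
      have "(\<integral>\<^sup>+r. ennreal (C * real DIM('a) * r ^ (DIM('a) - 1)) * indicator {0..R} r \<partial>lborel)
        = ennreal (C * R ^ DIM('a) - C * 0 ^ DIM('a))"
        using True C by (intro nn_integral_FTC_Icc) (auto intro!: derivative_eq_intros)
      also have "\<dots> = ennreal (R ^ DIM('a)) * ennreal C"
        using True C by (simp add: ennreal_mult mult.commute zero_power [OF DIM_positive])
      finally show ?thesis using True by (simp only: if_True)
    next
      case False
      \<comment> \<open>For \<open>R \<le> 0\<close> the interval {0..R} contains at most the null
        point 0.\<close>
      then have "(\<integral>\<^sup>+r. ennreal (C * real DIM('a) * r ^ (DIM('a) - 1)) * indicator {0..R} r \<partial>lborel) = (\<integral>\<^sup>+r. 0 \<partial>(lborel :: real measure))"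
        using AE_lborel_singleton [of "0::real"]
        by (intro nn_integral_cong_AE) (auto elim!: eventually_mono simp: indicator_def)
      then show ?thesis using False by simp
    qed
    finally show ?thesis .
  qed
  show "emeasure ?M X = emeasure ?N X" if "X \<in> range lessThan" for X
    using that M N by auto
  show "emeasure ?M {..<real n} \<noteq> \<infinity>" for n
    unfolding M by (simp add: ennreal_mult_eq_top_iff)
qed auto

lemma nn_integral_sphere_measure:
  assumes [measurable]: "G \<in> borel_measurable borel"
  shows "(\<integral>\<^sup>+x. G x \<partial>(sphere_measure :: (real ^ 'n::{finite,linorder}) measure))
    = of_nat CARD('n) * (\<integral>\<^sup>+x. G (x /\<^sub>R norm x) * indicator (ball 0 1) x \<partial>lborel)"
proof -
  have m: "(\<lambda>x. x /\<^sub>R norm x) \<in> restrict_space lborel (ball 0 1 - {0 :: (real, 'n) vec}) \<rightarrow>\<^sub>M borel"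
    by (rule measurable_restrict_space1) simp
  have "(\<integral>\<^sup>+x. G x \<partial>(sphere_measure :: (real, 'n) vec measure))
    = of_nat CARD('n) * (\<integral>\<^sup>+x. G (x /\<^sub>R norm x) * indicator (ball 0 1 - {0}) x \<partial>lborel)"
    unfolding sphere_measure_def
    by (simp add: nn_integral_scale_measure nn_integral_distr [OF m] nn_integral_restrict_space)
  also have "(\<integral>\<^sup>+x. G (x /\<^sub>R norm x) * indicator (ball 0 1 - {0}) x \<partial>lborel)
    = (\<integral>\<^sup>+x. G (x /\<^sub>R norm x) * indicator (ball 0 1) x \<partial>lborel)"
    by (rule nn_integral_cong_AE, use AE_lborel_singleton [of "0 :: (real, 'n) vec"] in eventually_elim)
      (simp add: indicator_def)
  finally show ?thesis .
qed

lemma sets_sphere_measure [measurable_cong, simp]: "sets (sphere_measure :: (real ^ 'n::{finite,linorder}) measure) = sets borel"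
  by (simp add: sphere_measure_def)

lemma AE_sphere_measure: "AE x in (sphere_measure :: (real ^ 'n::{finite,linorder}) measure). norm x = 1"
proof -
  let ?S = "sphere_measure :: (real, 'n) vec measure"
  have m: "{x :: (real, 'n) vec. norm x \<noteq> 1} \<in> sets borel" by measurable
  have "emeasure ?S {x. norm x \<noteq> 1} = (\<integral>\<^sup>+x. indicator {x. norm x \<noteq> 1} x \<partial>?S)" using m by simp
  also have "\<dots> = of_nat CARD('n) * (\<integral>\<^sup>+x. indicator {x :: (real, 'n) vec. norm x \<noteq> 1} (x /\<^sub>R norm x) * indicator (ball 0 1) x \<partial>lborel)"
    using m by (intro nn_integral_sphere_measure) auto
  also have "(\<integral>\<^sup>+x. indicator {x :: (real, 'n) vec. norm x \<noteq> 1} (x /\<^sub>R norm x) * indicator (ball 0 1) x \<partial>lborel)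
     = (\<integral>\<^sup>+x. 0 \<partial>(lborel :: (real, 'n) vec measure))"
    using AE_lborel_singleton [of "0 :: (real, 'n) vec"]
    by (intro nn_integral_cong_AE) (auto elim!: eventually_mono simp: indicator_def)
  finally show ?thesis using m
    by (intro AE_I [of _ _ "{x. norm x \<noteq> 1}"]) (auto simp: sphere_measure_def space_scale_measure)
qed

text \<open>\<open>F\<close> serves as a density of Lebesgue measure, and the function of the radius
  is integrated against the image under \<open>norm\<close>. Boundedness of \<open>F\<close> makes
  the mass of the unit ball finite.\<close>

lemma polar_nonneg:
  fixes F :: "real ^ 'n::{finite,linorder} \<Rightarrow> real" and g :: "real \<Rightarrow> 'b::{banach,second_countable_topology}"
  assumes F [measurable]: "F \<in> borel_measurable borel" and g [measurable]: "g \<in> borel_measurable borel"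
    and hom: "\<And>s x. s > 0 \<Longrightarrow> F (s *\<^sub>R x) = F x" and F0: "\<And>x. 0 \<le> F x" and B: "\<And>x. F x \<le> B"
    and int: "integrable lborel (\<lambda>r. indicator {0<..} r *\<^sub>R (r ^ (CARD('n) - 1) *\<^sub>R g r))"
  shows "integrable lborel (\<lambda>x. F x *\<^sub>R g (norm x))"
    and "(LINT x|lborel. F x *\<^sub>R g (norm x))
      = (LINT x|sphere_measure. F x) *\<^sub>R (LINT r|lborel. indicator {0<..} r *\<^sub>R (r ^ (CARD('n) - 1) *\<^sub>R g r))"
    and "integrable sphere_measure F"
proof -
  let ?S = "sphere_measure :: (real, 'n) vec measure"
  define c where "c = (\<integral>\<^sup>+x. ennreal (F x) * indicator (ball 0 1) x \<partial>lborel)"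
  have "c \<le> (\<integral>\<^sup>+x. ennreal B * indicator (ball 0 1) x \<partial>(lborel :: (real, 'n) vec measure))"
    unfolding c_def by (intro nn_integral_mono mult_right_mono ennreal_leI B) simp
  also have "\<dots> = ennreal B * emeasure lborel (ball 0 1 :: (real, 'n) vec set)"
    by (simp add: nn_integral_cmult_indicator)
  also have "\<dots> < \<infinity>"
    using emeasure_lborel_ball_finite [of "0 :: (real, 'n) vec" 1] by (simp add: ennreal_mult_less_top less_top)
  finally have "c < \<infinity>" .
  then obtain C where C: "c = ennreal C" "0 \<le> C" by (cases c) auto
  have "(\<integral>\<^sup>+x. ennreal (F x) \<partial>?S) = of_nat CARD('n) * (\<integral>\<^sup>+x. ennreal (F (x /\<^sub>R norm x)) * indicator (ball 0 1) x \<partial>lborel)"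
    by (rule nn_integral_sphere_measure) simp
  also have "(\<integral>\<^sup>+x. ennreal (F (x /\<^sub>R norm x)) * indicator (ball 0 1) x \<partial>(lborel :: (real, 'n) vec measure)) = c"
    unfolding c_def using AE_lborel_singleton [of "0 :: (real, 'n) vec"]
    by (intro nn_integral_cong_AE) (auto elim!: eventually_mono simp: hom)
  finally have S: "(\<integral>\<^sup>+x. ennreal (F x) \<partial>?S) = ennreal (C * real CARD('n))"
    by (simp add: C ennreal_of_nat_eq_real_of_nat ennreal_mult' mult.commute)
  then show Si: "integrable ?S F"
    using F0 by (intro integrableI_bounded) auto
  have SI: "(LINT x|sphere_measure. F x) = C * real CARD('n)"
    using S F0 C by (subst (asm) nn_integral_eq_integral [OF Si]) auto
  have eq: "distr (density lborel (\<lambda>x. ennreal (F x))) borel norm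
    = density lborel (\<lambda>r. ennreal (indicator {0..} r * (C * real CARD('n) * r ^ (CARD('n) - 1))))" (is "?M = ?N")
  proof -
    have i: "indicator {0..} r * ennreal z = ennreal (indicator {0..} r * z)" for r z :: real
      by (simp add: indicator_def)
    have "?M = density lborel (\<lambda>r. indicator {0..} r * ennreal (C * real DIM((real, 'n) vec) * r ^ (DIM((real, 'n) vec) - 1)))"
      by (rule distr_norm_homogeneous) (use C hom in \<open>auto simp: c_def\<close>)
    then show ?thesis unfolding i by simp
  qed
  have "indicator {0..} r *\<^sub>R ((C * real CARD('n) * r ^ (CARD('n) - 1)) *\<^sub>R g r)
      = (C * real CARD('n)) *\<^sub>R (indicator {0<..} r *\<^sub>R (r ^ (CARD('n) - 1) *\<^sub>R g r))" if "r \<noteq> 0" for r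
    using that by (auto simp: indicator_def)
  have ae: "AE r in lborel. (indicator {0..} r * (C * real CARD('n) * r ^ (CARD('n) - 1))) *\<^sub>R g r
      = (C * real CARD('n)) *\<^sub>R (indicator {0<..} r *\<^sub>R (r ^ (CARD('n) - 1) *\<^sub>R g r))"
    using AE_lborel_singleton [of "0::real"]
  proof eventually_elim
    case (elim r)
    then show ?case by (simp add: indicator_def)
  qed
  have pos: "AE r in lborel. 0 \<le> indicator {0..} r * (C * real CARD('n) * r ^ (CARD('n) - 1))"
    using C by (auto simp: indicator_def)
  have "integrable lborel (\<lambda>r. (C * real CARD('n)) *\<^sub>R (indicator {0<..} r *\<^sub>R (r ^ (CARD('n) - 1) *\<^sub>R g r)))"
    using int by (rule integrable_scaleR_right)
  then have "integrable lborel (\<lambda>r. (indicator {0..} r * (C * real CARD('n) * r ^ (CARD('n) - 1))) *\<^sub>R g r)"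
    by (subst integrable_cong_AE [OF _ _ ae]) auto
  then have "integrable ?N g" by (subst integrable_density) (use pos in auto)
  then have "integrable ?M g" by (simp only: eq)
  then have "integrable (density lborel (\<lambda>x. ennreal (F x))) (\<lambda>x. g (norm x))"
    by (subst (asm) integrable_distr_eq) auto
  then show "integrable lborel (\<lambda>x. F x *\<^sub>R g (norm x))"
    using F0 by (subst (asm) integrable_density) auto
  have "(LINT x|lborel. F x *\<^sub>R g (norm x)) = integral\<^sup>L (density lborel (\<lambda>x. ennreal (F x))) (\<lambda>x. g (norm x))"
    using F0 by (subst integral_density) auto
  also have "\<dots> = integral\<^sup>L ?M g" by (subst integral_distr) auto
  also have "\<dots> = integral\<^sup>L ?N g" by (simp only: eq)
  also have "\<dots> = (LINT r|lborel. (indicator {0..} r * (C * real CARD('n) * r ^ (CARD('n) - 1))) *\<^sub>R g r)"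
    by (subst integral_density) (use pos in auto)
  also have "\<dots> = (LINT r|lborel. (C * real CARD('n)) *\<^sub>R (indicator {0<..} r *\<^sub>R (r ^ (CARD('n) - 1) *\<^sub>R g r)))"
    by (rule integral_cong_AE) (use ae in auto)
  also have "\<dots> = (C * real CARD('n)) *\<^sub>R (LINT r|lborel. indicator {0<..} r *\<^sub>R (r ^ (CARD('n) - 1) *\<^sub>R g r))"
    by (rule integral_scaleR_right)
  finally show "(LINT x|lborel. F x *\<^sub>R g (norm x))
      = (LINT x|sphere_measure. F x) *\<^sub>R (LINT r|lborel. indicator {0<..} r *\<^sub>R (r ^ (CARD('n) - 1) *\<^sub>R g r))"
    by (simp only: SI)
qed

text \<open>Dividing by r^k leaves an angular part of degree 0, bounded by compactness of the
  sphere; \<open>polar_nonneg\<close> applies to its real and imaginary parts once they are shifted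
  to be nonnegative.\<close>

lemma polar_complex:
  fixes Y :: "real ^ 'n::{finite,linorder} \<Rightarrow> complex" and g :: "real \<Rightarrow> real"
  assumes Y: "continuous_on UNIV Y" and hom: "\<And>s x. Y (s *\<^sub>R x) = s ^ k *\<^sub>R Y x"
    and g [measurable]: "g \<in> borel_measurable borel"
    and int: "integrable lborel (\<lambda>r. indicator {0<..} r * (r ^ (CARD('n) - 1) * (g r * r ^ k)))"
  shows "integrable lborel (\<lambda>x. g (norm x) *\<^sub>R Y x)" (is ?I)
    and "(LINT x|lborel. g (norm x) *\<^sub>R Y x)
      = (LINT r|lborel. indicator {0<..} r * (r ^ (CARD('n) - 1) * (g r * r ^ k))) *\<^sub>R (LINT x|sphere_measure. Y x)" (is ?E)
    and "integrable sphere_measure Y" (is ?S)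
proof -
  note [measurable] = borel_measurable_continuous_onI [OF Y]
  define K where "K = (LINT r|lborel. indicator {0<..} r * (r ^ (CARD('n) - 1) * (g r * r ^ k)))"
  have "compact (Y ` sphere 0 1)"
    by (intro compact_continuous_image continuous_on_subset [OF Y] compact_sphere) auto
  from compact_imp_bounded [OF this] obtain B0 where "\<forall>y\<in>Y ` sphere 0 1. cmod y \<le> B0"
    unfolding bounded_iff by blast
  then have B0: "\<And>x. norm x = 1 \<Longrightarrow> cmod (Y x) \<le> B0" by simp
  define Y0 where "Y0 x = (if x = 0 then 0 else (1 / norm x ^ k) *\<^sub>R Y x)" for x
  have Y0_meas [measurable]: "Y0 \<in> borel_measurable borel" unfolding Y0_def by measurable
  have Y0_hom: "Y0 (s *\<^sub>R x) = Y0 x" if "s > 0" for s x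
    using that by (simp add: Y0_def hom power_mult_distrib)
  define B where "B = max B0 0"
  have Y0_B: "cmod (Y0 x) \<le> B" for x
  proof (cases "x = 0")
    case False
    have "(1 / norm x ^ k) *\<^sub>R Y x = Y ((1 / norm x) *\<^sub>R x)" by (simp only: hom power_one_over)
    with B0 [of "(1 / norm x) *\<^sub>R x"] False show ?thesis by (simp add: Y0_def B_def)
  qed (simp add: Y0_def B_def)
  have Y0_S: "AE x in sphere_measure. Y0 x = Y x"
    using AE_sphere_measure by eventually_elim (auto simp: Y0_def)
  have real: "integrable lborel (\<lambda>x. g (norm x) * T (Y x)) \<and> (LINT x|lborel. g (norm x) * T (Y x)) = K * (LINT x|sphere_measure. T (Y x))
     \<and> integrable sphere_measure (\<lambda>x. T (Y x))"
    if T: "bounded_linear T" "\<And>z. \<bar>T z\<bar> \<le> cmod z" for T :: "complex \<Rightarrow> real"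
  proof -
    have [measurable]: "T \<in> borel_measurable borel"
      by (intro borel_measurable_continuous_onI linear_continuous_on T)
    let ?g = "\<lambda>r. g r * r ^ k"
    \<comment> \<open>The shift by the bound \<open>B\<close> makes the density nonnegative; the
      contribution of the constant \<open>B\<close> is computed separately and subtracted.\<close>
    let ?F = "\<lambda>x. T (Y0 x) + B"
    have TB: "\<bar>T (Y0 x)\<bar> \<le> B" for x using T(2) [of "Y0 x"] Y0_B [of x] by linarith
    have b: "0 \<le> ?F x" "?F x \<le> 2 * B" "0 \<le> B" for x using TB [of x] by (auto simp: B_def)
    have int': "integrable lborel (\<lambda>r. indicator {0<..} r *\<^sub>R (r ^ (CARD('n) - 1) *\<^sub>R (g r * r ^ k)))"
      using int by simp
    have F: "integrable lborel (\<lambda>x. ?F x *\<^sub>R ?g (norm x))" "(LINT x|lborel. ?F x *\<^sub>R ?g (norm x)) = (LINT x|sphere_measure. ?F x) *\<^sub>R K"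
      "integrable sphere_measure ?F"
    proof -
      have m: "?F \<in> borel_measurable borel" "?g \<in> borel_measurable borel" by measurable
      have h: "?F (s *\<^sub>R x) = ?F x" if "s > 0" for s x using Y0_hom [OF that] by simp
      note P = polar_nonneg [where F = ?F and g = ?g and B = "2 * B", OF m h b(1,2) int']
      show "integrable lborel (\<lambda>x. ?F x *\<^sub>R ?g (norm x))" using P(1) by blast
      show "integrable sphere_measure ?F" using P(3) by blast
      show "(LINT x|lborel. ?F x *\<^sub>R ?g (norm x)) = (LINT x|sphere_measure. ?F x) *\<^sub>R K"
        unfolding K_def using P(2) by simp
    qed
    have C: "integrable lborel (\<lambda>x :: (real, 'n) vec. B *\<^sub>R ?g (norm x))" "(LINT x|lborel. B *\<^sub>R ?g (norm (x :: (real, 'n) vec))) = (LINT x|(sphere_measure :: (real, 'n) vec measure). B) *\<^sub>R K"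
      "integrable (sphere_measure :: (real, 'n) vec measure) (\<lambda>x. B)"
    proof -
      have m: "(\<lambda>x :: (real, 'n) vec. B) \<in> borel_measurable borel" "?g \<in> borel_measurable borel" by measurable
      note P = polar_nonneg [where F = "\<lambda>x. B" and g = ?g and B = B, OF m refl b(3) order_refl int']
      show "integrable lborel (\<lambda>x :: (real, 'n) vec. B *\<^sub>R ?g (norm x))" using P(1) by blast
      show "integrable (sphere_measure :: (real, 'n) vec measure) (\<lambda>x. B)" using P(3) by blast
      show "(LINT x|lborel. B *\<^sub>R ?g (norm (x :: (real, 'n) vec))) = (LINT x|(sphere_measure :: (real, 'n) vec measure). B) *\<^sub>R K"
        unfolding K_def using P(2) by simp
    qed
    have e: "AE x in lborel. ?F x *\<^sub>R ?g (norm x) - B *\<^sub>R ?g (norm x) = g (norm x) * T (Y x)"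
      using AE_lborel_singleton [of "0 :: (real, 'n) vec"]
    proof eventually_elim
      case (elim x)
      then have "T (Y0 x) = (1 / norm x ^ k) * T (Y x)"
        by (simp add: Y0_def linear_scale [OF bounded_linear.linear [OF T(1)]])
      with elim show ?case by (simp add: field_simps)
    qed
    have "integrable lborel (\<lambda>x. g (norm x) * T (Y x))"
      using Bochner_Integration.integrable_diff [OF F(1) C(1)]
      by (subst (asm) integrable_cong_AE [OF _ _ e]) auto
    moreover have "(LINT x|lborel. g (norm x) * T (Y x)) = (LINT x|lborel. ?F x *\<^sub>R ?g (norm x) - B *\<^sub>R ?g (norm x))"
      by (rule integral_cong_AE [symmetric]) (use e in auto)
    moreover have "\<dots> = (LINT x|sphere_measure. ?F x) *\<^sub>R K - (LINT x|(sphere_measure :: (real, 'n) vec measure). B) *\<^sub>R K"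
      by (subst Bochner_Integration.integral_diff [OF F(1) C(1)]) (simp only: F(2) C(2))
    moreover have "\<dots> = K * ((LINT x|sphere_measure. ?F x) - (LINT x|(sphere_measure :: (real, 'n) vec measure). B))"
      by (simp add: algebra_simps)
    moreover have "(LINT x|sphere_measure. ?F x) - (LINT x|(sphere_measure :: (real, 'n) vec measure). B) = (LINT x|sphere_measure. ?F x - B)"
      by (rule Bochner_Integration.integral_diff [OF F(3) C(3), symmetric])
    moreover have "(LINT x|sphere_measure. ?F x - B) = (LINT x|sphere_measure. T (Y x))"
      by (rule integral_cong_AE) (use Y0_S in auto)
    moreover have "integrable sphere_measure (\<lambda>x. T (Y x))"
    proof -
      have "AE x in sphere_measure. ?F x - B = T (Y x)" using Y0_S by eventually_elim simp
      then show ?thesis using Bochner_Integration.integrable_diff [OF F(3) C(3)]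
        by (subst (asm) integrable_cong_AE) auto
    qed
    ultimately show ?thesis by simp
  qed
  note Re = real [OF bounded_linear_Re abs_Re_le_cmod] and Im = real [OF bounded_linear_Im abs_Im_le_cmod]
  have "integrable lborel (\<lambda>x. complex_of_real (g (norm x) * Re (Y x)) + \<i> * complex_of_real (g (norm x) * Im (Y x)))"
    using Re Im by (intro Bochner_Integration.integrable_add integrable_mult_right integrable_of_real) auto
  moreover have "complex_of_real (g (norm x) * Re (Y x)) + \<i> * complex_of_real (g (norm x) * Im (Y x)) = g (norm x) *\<^sub>R Y x" for x
    by (simp add: complex_eq_iff)
  ultimately show I: ?I by simp
  have "integrable sphere_measure (\<lambda>x. complex_of_real (Re (Y x)) + \<i> * complex_of_real (Im (Y x)))"
    using Re Im by (intro Bochner_Integration.integrable_add integrable_mult_right integrable_of_real) auto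
  then show S: ?S by (simp add: complex_eq [symmetric])
  show ?E
  proof (rule complex_eqI)
    show "Re (LINT x|lborel. g (norm x) *\<^sub>R Y x) = Re ((LINT r|lborel. indicator {0<..} r * (r ^ (CARD('n) - 1) * (g r * r ^ k))) *\<^sub>R (LINT x|sphere_measure. Y x))"
      using Re by (simp add: integral_Re [OF I, symmetric] integral_Re [OF S, symmetric] K_def)
    show "Im (LINT x|lborel. g (norm x) *\<^sub>R Y x) = Im ((LINT r|lborel. indicator {0<..} r * (r ^ (CARD('n) - 1) * (g r * r ^ k))) *\<^sub>R (LINT x|sphere_measure. Y x))"
      using Im by (simp add: integral_Im [OF I, symmetric] integral_Im [OF S, symmetric] K_def)
  qed
qed

section \<open>The basis functions as eigenfunctions of L\<close>

lemma partial_cong_open: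
  assumes "g differentiable (at x)" "open S" "x \<in> S" "\<And>y. y \<in> S \<Longrightarrow> f y = g y"
  shows "partial i f x = partial i g x" and "f differentiable (at x)"
proof -
  obtain g' where g': "(g has_derivative g') (at x)" using assms(1) by (auto simp: differentiable_def)
  have "(f has_derivative g') (at x)"
    by (rule has_derivative_transform_within_open [OF g' assms(2,3)]) (simp add: assms(4))
  then show "partial i f x = partial i g x" "f differentiable (at x)"
    by (auto simp: partial_eqI [OF g'] partial_eqI differentiable_def)
qed

text \<open>Formulas for D hold off the origin only; locality allows a second D to be applied to
  them.\<close>

lemma op_D_cong_open:
  assumes "g differentiable (at x)" "open S" "x \<in> S" "\<And>y. y \<in> S \<Longrightarrow> f y = g y"
  shows "op_D c f x = op_D c g x"
  by (simp add: op_D_def dirac_def euler_def partial_cong_open(1) [OF assms])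

lemma has_derivative_radial:
  fixes f :: "('n::{finite,linorder}) cl_fun"
  assumes A: "(A has_real_derivative A') (at (x \<bullet> x))" and f: "(f has_derivative f') (at x)"
  shows "((\<lambda>x. A (x \<bullet> x) *\<^sub>R f x) has_derivative (\<lambda>h. A (x \<bullet> x) *\<^sub>R f' h + (A' * (2 * (x \<bullet> h))) *\<^sub>R f x)) (at x)"
proof -
  have 1: "((\<lambda>x. x \<bullet> x) has_derivative (\<lambda>h. x \<bullet> h + h \<bullet> x)) (at x)"
    by (auto intro!: derivative_eq_intros)
  have "(A has_derivative (\<lambda>h. A' * h)) (at (x \<bullet> x))"
    using A by (simp add: has_field_derivative_def)
  from diff_chain_at [OF 1 this] have "((\<lambda>x. A (x \<bullet> x)) has_derivative (\<lambda>h. A' * (x \<bullet> h + h \<bullet> x))) (at x)"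
    by (simp add: o_def)
  from has_derivative_scaleR [OF this f] show ?thesis by (simp add: inner_commute)
qed

lemma differentiable_radial:
  "(A has_real_derivative A') (at (x \<bullet> x)) \<Longrightarrow> f differentiable (at x) \<Longrightarrow> (\<lambda>x. A (x \<bullet> x) *\<^sub>R f x) differentiable (at x)"
  for f :: "('n::{finite,linorder}) cl_fun"
  unfolding differentiable_def using has_derivative_radial by blast

lemma partial_radial:
  fixes f :: "('n::{finite,linorder}) cl_fun"
  assumes "(A has_real_derivative A') (at (x \<bullet> x))" "f differentiable (at x)"
  shows "partial i (\<lambda>x. A (x \<bullet> x) *\<^sub>R f x) x = A (x \<bullet> x) *\<^sub>R partial i f x + (2 * A' * x $ i) *\<^sub>R f x"
proof -
  obtain f' where f': "(f has_derivative f') (at x)" using assms(2) by (auto simp: differentiable_def)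
  show ?thesis
    by (simp add: partial_eqI [OF f'] partial_eqI [OF has_derivative_radial [OF assms(1) f']] inner_axis mult_ac)
qed

lemma dirac_radial:
  fixes f :: "('n::{finite,linorder}) cl_fun"
  assumes "(A has_real_derivative A') (at (x \<bullet> x))" "f differentiable (at x)"
  shows "dirac (\<lambda>x. A (x \<bullet> x) *\<^sub>R f x) x = A (x \<bullet> x) *\<^sub>R dirac f x + (2 * A') *\<^sub>R (cl_vec x \<odot> f x)"
  by (simp add: dirac_def partial_radial [OF assms] cl_mult_add_right cl_mult_scaleR_right sum.distrib
      scaleR_sum_right cl_vec_def cl_mult_sum_left cl_mult_scaleR_left)

lemma euler_radial:
  fixes f :: "('n::{finite,linorder}) cl_fun"
  assumes "(A has_real_derivative A') (at (x \<bullet> x))" "f differentiable (at x)"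
  shows "euler (\<lambda>x. A (x \<bullet> x) *\<^sub>R f x) x = A (x \<bullet> x) *\<^sub>R euler f x + (2 * A' * (x \<bullet> x)) *\<^sub>R f x"
proof -
  have "(\<Sum>i\<in>UNIV. (x $ i * (2 * A' * x $ i)) *\<^sub>R f x) = (2 * A' * (x \<bullet> x)) *\<^sub>R f x"
    by (simp add: inner_vec_def sum_distrib_left mult_ac flip: scaleR_sum_left)
  then show ?thesis
    by (simp add: euler_def partial_radial [OF assms] scaleR_add_right sum.distrib scaleR_sum_right mult_ac)
qed

text \<open>The functions \<open>r\<^sup>\<beta> a(r\<^sup>2) x\<^sup>k M\<close>, with \<open>r\<^sup>\<beta>\<close> written as a power of \<open>r\<^sup>2\<close>.\<close>

definition radial :: "real \<Rightarrow> nat \<Rightarrow> ('n::{finite,linorder}) cl_fun \<Rightarrow> nat \<Rightarrow> (real \<Rightarrow> real) \<Rightarrow> 'n cl_fun" where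
  "radial c l M k a x = ((x \<bullet> x) powr (beta c l / 2) * a (x \<bullet> x)) *\<^sub>R vpow k M x"

lemma radial_factor_deriv:
  assumes "(a has_real_derivative a') (at u)" "u > 0"
  shows "((\<lambda>u. u powr b * a u) has_real_derivative (u powr b * (a' + b / u * a u))) (at u)"
proof -
  have "((\<lambda>u. u powr b * a u) has_real_derivative (b * u powr (b - 1) * a u + a' * u powr b)) (at u)"
    using assms by (auto intro!: derivative_eq_intros)
  moreover have "u powr (b - 1) = u powr b / u" using assms by (simp add: powr_diff)
  ultimately show ?thesis by (simp add: algebra_simps)
qed

lemma differentiable_radial_fun:
  assumes "M \<in> monogenics l" "x \<noteq> 0" "(a has_real_derivative a') (at (x \<bullet> x))"
  shows "radial c l M k a differentiable (at x)"
proof -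
  have "hom_poly (k + l) (vpow k M)"
    using assms(1) by (intro hom_poly_vpow) (simp add: monogenics_iff)
  then have "vpow k M differentiable (at x)" by (rule hom_poly_differentiable)
  with radial_factor_deriv [OF assms(3), of "beta c l / 2"] assms(2) show ?thesis
    unfolding radial_def [abs_def] by (intro differentiable_radial) auto
qed

lemma gamma_eq:
  assumes "1 + c \<noteq> 0"
  shows "gamma m c l = (2 * real l + real m + c) / (1 + c)"
proof -
  have "gamma m c l = (2 * (real l + (real m - 2) / 2) + (c + 2)) / (1 + c)"
    by (simp add: gamma_def add_divide_distrib)
  also have "2 * (real l + (real m - 2) / 2) + (c + 2) = 2 * real l + real m + c"
    by (simp add: field_simps)
  finally show ?thesis .
qed

text \<open>\<open>beta\<close> is the exponent for which the terms without \<open>a'\<close>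
  cancel. \<open>a'\<close> is the derivative at the single point \<open>x \<bullet> x\<close>, so
  the constant profile on the right is meant at this \<open>x\<close> only.\<close>

lemma op_D_radial_even:
  assumes M: "M \<in> monogenics l" and x: "x \<noteq> 0" and a: "(a has_real_derivative a') (at (x \<bullet> x))"
    and c: "1 + c \<noteq> 0"
  shows "op_D c (radial c l M 0 a) x = radial c l M 1 (\<lambda>_. 2 * (1 + c) * a') x"
proof -
  define u where "u = x \<bullet> x"
  define b where "b = beta c l / 2"
  have u: "u > 0" using x by (simp add: u_def)
  have n: "norm x powi (- 2) = 1 / u" using x by (simp add: u_def power_int_minus power2_norm_eq_inner divide_inverse)
  have h: "hom_poly l M" and d0: "dirac M x = 0" using M by (auto simp: monogenics_iff)
  have A: "((\<lambda>u. u powr b * a u) has_real_derivative (u powr b * (a' + b / u * a u))) (at (x \<bullet> x))"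
    using radial_factor_deriv [OF a] u unfolding u_def by blast
  have r: "radial c l M 0 a = (\<lambda>x. ((\<lambda>u. u powr b * a u) (x \<bullet> x)) *\<^sub>R M x)"
    by (simp add: radial_def fun_eq_iff vpow_0 b_def)
  note dM = hom_poly_differentiable [OF h, of x]
  \<comment> \<open>The equation that defines \<open>beta\<close>: the derivative of the power of r
    balances the term c l from the Euler operator.\<close>
  have b2: "2 * b * (1 + c) = - c * real l"
  proof -
    define p where "p = c / (1 + c)"
    have p: "p * (1 + c) = c" using c by (simp add: p_def)
    have "2 * b = beta c l" by (simp add: b_def)
    also have "\<dots> = - (p * real l)" by (simp add: beta_def p_def)
    finally have "2 * b = - (p * real l)" .
    then have "2 * b * (1 + c) = - (p * (1 + c)) * real l" by (simp add: algebra_simps)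
    then show ?thesis using p by simp
  qed
  have "op_D c (radial c l M 0 a) x = (2 * (u powr b * (a' + b / u * a u))) *\<^sub>R (cl_vec x \<odot> M x)
    + (c / u) *\<^sub>R (cl_vec x \<odot> ((u powr b * a u * real l + 2 * (u powr b * (a' + b / u * a u)) * u) *\<^sub>R M x))"
    unfolding op_D_def r dirac_radial [OF A dM] euler_radial [OF A dM] d0 euler_hom_poly [OF h] n u_def [symmetric]
    by (simp add: scaleR_add_left)
  also have "\<dots> = (2 * (u powr b * (a' + b / u * a u)) + c / u * (u powr b * a u * real l + 2 * (u powr b * (a' + b / u * a u)) * u)) *\<^sub>R (cl_vec x \<odot> M x)"
    by (simp only: cl_mult_scaleR_right scaleR_add_left [symmetric] scaleR_scaleR)
  also have "2 * (u powr b * (a' + b / u * a u)) + c / u * (u powr b * a u * real l + 2 * (u powr b * (a' + b / u * a u)) * u)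
    = u powr b * (2 * (1 + c) * a') + u powr b * a u / u * (2 * b * (1 + c) + c * real l)"
    using u by (simp add: field_simps)
  also have "2 * b * (1 + c) + c * real l = 0" using b2 by simp
  finally show ?thesis unfolding radial_def [where k = 1] by (simp add: u_def b_def vpow_def)
qed

text \<open>Here the undifferentiated terms do not cancel: 2 l + m comes from the Dirac operator on
  x M and c from the extra degree of x M under the Euler operator. Their sum is (1 + c) gamma, which
  is where \<open>gamma\<close> originates.\<close>

lemma op_D_radial_odd:
  fixes M :: "('n::{finite,linorder}) cl_fun"
  assumes M: "M \<in> monogenics l" and x: "x \<noteq> 0" and a: "(a has_real_derivative a') (at (x \<bullet> x))"
    and c: "1 + c \<noteq> 0"
  shows "op_D c (radial c l M 1 a) x
    = radial c l M 0 (\<lambda>u. - (1 + c) * (2 * u * a' + gamma CARD('n) c l * a u)) x"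
proof -
  define u where "u = x \<bullet> x"
  define b where "b = beta c l / 2"
  have u: "u > 0" using x by (simp add: u_def)
  have n: "norm x powi (- 2) = 1 / u" using x by (simp add: u_def power_int_minus power2_norm_eq_inner divide_inverse)
  have M': "hom_poly l M" using M by (auto simp: monogenics_iff)
  then have h: "hom_poly (Suc l) (\<lambda>x. cl_vec x \<odot> M x)" by (rule hom_poly_cl_vec_mult)
  have d: "dirac (\<lambda>x. cl_vec x \<odot> M x) x = - (2 * real l + real CARD('n)) *\<^sub>R M x"
    using dirac_vpow(2) [OF M, of 0 x] by (simp add: vpow_0 vpow_Suc)
  have A: "((\<lambda>u. u powr b * a u) has_real_derivative (u powr b * (a' + b / u * a u))) (at (x \<bullet> x))"
    using radial_factor_deriv [OF a] u unfolding u_def by blast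
  have r: "radial c l M 1 a = (\<lambda>x. ((\<lambda>u. u powr b * a u) (x \<bullet> x)) *\<^sub>R (cl_vec x \<odot> M x))"
    by (simp add: radial_def fun_eq_iff vpow_def b_def)
  note dM = hom_poly_differentiable [OF h, of x]
  have vv: "cl_vec x \<odot> (cl_vec x \<odot> M x) = (- u) *\<^sub>R M x"
    by (simp only: cl_vec_mult_vec u_def power2_norm_eq_inner)
  have b2: "2 * b * (1 + c) = - c * real l"
  proof -
    define p where "p = c / (1 + c)"
    have p: "p * (1 + c) = c" using c by (simp add: p_def)
    have "2 * b = beta c l" by (simp add: b_def)
    also have "\<dots> = - (p * real l)" by (simp add: beta_def p_def)
    finally have "2 * b = - (p * real l)" .
    then have "2 * b * (1 + c) = - (p * (1 + c)) * real l" by (simp add: algebra_simps)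
    then show ?thesis using p by simp
  qed
  have g: "(1 + c) * gamma CARD('n) c l = 2 * real l + real CARD('n) + c"
    using c by (simp add: gamma_eq)
  have "op_D c (radial c l M 1 a) x = ((u powr b * a u * - (2 * real l + real CARD('n)))) *\<^sub>R M x
      + (2 * (u powr b * (a' + b / u * a u)) * (- u)) *\<^sub>R M x
      + (c / u * ((u powr b * a u * real (Suc l) + 2 * (u powr b * (a' + b / u * a u)) * u) * (- u))) *\<^sub>R M x"
  proof -
    have "op_D c (radial c l M 1 a) x = (u powr b * a u) *\<^sub>R (- (2 * real l + real CARD('n)) *\<^sub>R M x)
      + (2 * (u powr b * (a' + b / u * a u))) *\<^sub>R ((- u) *\<^sub>R M x)
      + (c * (1 / u)) *\<^sub>R (cl_vec x \<odot> ((u powr b * a u * real (Suc l) + 2 * (u powr b * (a' + b / u * a u)) * u) *\<^sub>R (cl_vec x \<odot> M x)))"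
      unfolding op_D_def r dirac_radial [OF A dM] euler_radial [OF A dM] d euler_hom_poly [OF h] n u_def [symmetric] vv
      by (simp only: scaleR_scaleR scaleR_add_left [symmetric])
    then show ?thesis
      by (simp only: cl_mult_scaleR_right vv scaleR_scaleR mult.assoc divide_inverse mult_1_left)
  qed
  also have "\<dots> = ((u powr b * a u * - (2 * real l + real CARD('n))) + 2 * (u powr b * (a' + b / u * a u)) * (- u)
     + c / u * ((u powr b * a u * real (Suc l) + 2 * (u powr b * (a' + b / u * a u)) * u) * (- u))) *\<^sub>R M x"
    by (simp only: scaleR_add_left)
  also have "(u powr b * a u * - (2 * real l + real CARD('n))) + 2 * (u powr b * (a' + b / u * a u)) * (- u)
     + c / u * ((u powr b * a u * real (Suc l) + 2 * (u powr b * (a' + b / u * a u)) * u) * (- u))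
    = - (u powr b) * (2 * (1 + c) * u * a' + (2 * real l + real CARD('n) + c + (c * real l + 2 * b * (1 + c))) * a u)"
    using u by (simp add: field_simps)
  also have "\<dots> = u powr b * (- (1 + c) * (2 * u * a' + gamma CARD('n) c l * a u))"
  proof -
    have e: "2 * real l + real CARD('n) + c + (c * real l + - c * real l) = (1 + c) * gamma CARD('n) c l"
      using g by simp
    show ?thesis unfolding b2 e by (simp add: algebra_simps)
  qed
  finally show ?thesis unfolding radial_def [where k = 0] by (simp add: u_def b_def vpow_def)
qed

lemma radial_cong: "a (x \<bullet> x) = a2 (x \<bullet> x) \<Longrightarrow> radial c l M k a x = radial c l M k a2 x"
  by (simp add: radial_def)

lemma radial_scale: "radial c l M k (\<lambda>u. s * a u) x = s *\<^sub>R radial c l M k a x"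
  by (simp add: radial_def mult_ac)

lemma open_nonzero: "open (- {0 :: 'a::real_normed_vector})"
  by (simp add: open_Compl)

section \<open>Eigenvalues and the action of L on the basis functions\<close>

definition eigenvalue :: "nat \<Rightarrow> real \<Rightarrow> nat \<Rightarrow> nat \<Rightarrow> real" where
  "eigenvalue m c n l = (1 + c)\<^sup>2 * (delta m c + 2 * real n + 2 * real l / (1 + c))"

text \<open>Translates the formula in n and l into the energy 4 t + g of \<open>lag_ode\<close>,
  with t = n div 2 and g the effective dimension of the parity of n.\<close>

lemma eigenvalue_eq:
  assumes "1 + c \<noteq> 0"
  shows "eigenvalue m c n l = (1 + c)\<^sup>2 * (4 * real (n div 2) + (gamma m c l + 2 * real (n mod 2)))"
proof -
  have "gamma m c l = delta m c + 2 * real l / (1 + c)"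
  proof -
    have "gamma m c l = ((1 + c) + (real m - 1) + 2 * real l) / (1 + c)"
      using assms by (simp add: gamma_eq add_ac)
    also have "((1 + c) + (real m - 1) + 2 * real l) / (1 + c) = (1 + c) / (1 + c) + (real m - 1) / (1 + c) + 2 * real l / (1 + c)"
      by (simp only: add_divide_distrib)
    also have "\<dots> = delta m c + 2 * real l / (1 + c)" using assms by (simp add: delta_def)
    finally show ?thesis .
  qed
  moreover have "2 * real n = 4 * real (n div 2) + 2 * real (n mod 2)"
  proof -
    have "real n = real (2 * (n div 2) + n mod 2)" by simp
    then show ?thesis unfolding of_nat_add of_nat_mult by simp
  qed
  ultimately show ?thesis by (simp add: eigenvalue_def algebra_simps)
qed

definition phi_const :: "real \<Rightarrow> nat \<Rightarrow> real" where
  "phi_const c n = (if even n then 1 else - 1) * 2 ^ n * (1 + c) ^ n * fact (n div 2)"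

definition phi_profile :: "real \<Rightarrow> nat \<Rightarrow> nat \<Rightarrow> nat \<Rightarrow> real \<Rightarrow> real" where
  "phi_profile c m n l u = phi_const c n * lag (n div 2) (gamma m c l + 2 * real (n mod 2)) u"

lemma phi_eq_radial:
  fixes M :: "nat \<Rightarrow> nat \<Rightarrow> ('n::{finite,linorder}) cl_fun"
  assumes "1 + c \<noteq> 0"
  shows "phi c M n l j = radial c l (M l j) (n mod 2) (phi_profile c CARD('n) n l)"
proof
  fix x :: "(real, 'n) vec"
  have "norm x powr beta c l = (x \<bullet> x) powr (beta c l / 2)"
  proof (cases "x = 0")
    case False
    have "(x \<bullet> x) powr (beta c l / 2) = (norm x powr 2) powr (beta c l / 2)"
      using False by (simp add: power2_norm_eq_inner)
    then show ?thesis unfolding powr_powr by simp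
  qed simp
  then show "phi c M n l j x = radial c l (M l j) (n mod 2) (phi_profile c CARD('n) n l) x"
  proof (cases "even n")
    case True
    then have "2 * (n div 2) = n" by simp
    with True \<open>norm x powr _ = _\<close> show ?thesis
      by (simp add: phi_def radial_def phi_profile_def phi_const_def lag_def Let_def vpow_0 power2_norm_eq_inner mult_ac)
  next
    case False
    then obtain t where n: "n = Suc (2 * t)" by (metis oddE Suc_eq_plus1)
    have g: "(gamma CARD('n) c l + 2) / 2 - 1 = gamma CARD('n) c l / 2" by (simp add: add_divide_distrib)
    show ?thesis using \<open>norm x powr _ = _\<close>
      by (simp add: n phi_def radial_def phi_profile_def phi_const_def lag_def Let_def vpow_def power2_norm_eq_inner g)
  qed
qed

text \<open>At the origin \<open>phi\<close> need not be differentiable and \<open>op_L\<close> has a junk value; a null set does not matter.\<close>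

lemma op_D_op_D_phi:
  fixes M :: "nat \<Rightarrow> nat \<Rightarrow> ('n::{finite,linorder}) cl_fun"
  assumes M: "M l j \<in> monogenics l" and c: "1 + c \<noteq> 0"
  shows "\<exists>v. (\<forall>x. x \<noteq> 0 \<longrightarrow> phi c M n l j differentiable (at x) \<and> v differentiable (at x)
      \<and> op_D c (phi c M n l j) x = v x
      \<and> op_D c v x = (eigenvalue CARD('n) c n l - (1 + c)\<^sup>2 * (x \<bullet> x)) *\<^sub>R phi c M n l j x)"
proof -
  let ?m = "CARD('n)"
  define t where "t = n div 2"
  define K where "K = phi_const c n"
  have xx: "x \<bullet> x > 0" if "x \<noteq> 0" for x :: "(real, 'n) vec" using that by simp
  show ?thesis
  proof (cases "even n")
    case True
    let ?g = "gamma ?m c l"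
    define a where "a = (\<lambda>u. K * lag t ?g u)"
    define b where "b = (\<lambda>u. 2 * (1 + c) * (K * lag' t ?g u))"
    have a: "(a has_real_derivative K * lag' t ?g u) (at u)" for u
      unfolding a_def by (intro DERIV_cmult lag_deriv)
    have b: "(b has_real_derivative 2 * (1 + c) * (K * lag'' t ?g u)) (at u)" for u
      unfolding b_def by (intro DERIV_cmult lag'_deriv)
    have phi: "phi c M n l j = radial c l (M l j) 0 a"
      using True by (simp add: phi_eq_radial [OF c] a_def phi_profile_def [abs_def] K_def t_def)
    \<comment> \<open>The witness is D applied to the basis function off the origin, kept as a
      function because the second D needs it on a neighbourhood.\<close>
    show ?thesis unfolding phi
    proof (intro exI [of _ "radial c l (M l j) 1 b"] allI impI conjI)
      fix x :: "(real, 'n) vec" assume x: "x \<noteq> 0"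
      show "radial c l (M l j) 0 a differentiable at x" "radial c l (M l j) 1 b differentiable at x"
        using differentiable_radial_fun [OF M x] a b by blast+
      show "op_D c (radial c l (M l j) 0 a) x = radial c l (M l j) 1 b x"
        unfolding op_D_radial_even [OF M x a c] by (rule radial_cong) (simp add: b_def)
      have "op_D c (radial c l (M l j) 1 b) x = radial c l (M l j) 0 (\<lambda>u. (eigenvalue ?m c n l - (1 + c)\<^sup>2 * (x \<bullet> x)) * a u) x"
        unfolding op_D_radial_odd [OF M x b c]
      proof (rule radial_cong)
        define u where "u = x \<bullet> x"
        have "- (1 + c) * (2 * u * (2 * (1 + c) * (K * lag'' t ?g u)) + ?g * b u)
          = - (1 + c)\<^sup>2 * K * (4 * u * lag'' t ?g u + 2 * ?g * lag' t ?g u)"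
          by (simp add: b_def power2_eq_square algebra_simps)
        also have "4 * u * lag'' t ?g u + 2 * ?g * lag' t ?g u = u * lag t ?g u - (4 * real t + ?g) * lag t ?g u"
          using lag_ode [of u t ?g] unfolding mult_minus_left by linarith
        also have "- (1 + c)\<^sup>2 * K * (u * lag t ?g u - (4 * real t + ?g) * lag t ?g u) = ((1 + c)\<^sup>2 * (4 * real t + ?g) - (1 + c)\<^sup>2 * u) * a u"
          by (simp add: a_def algebra_simps)
        also have "(1 + c)\<^sup>2 * (4 * real t + ?g) = eigenvalue ?m c n l"
          using True by (simp add: eigenvalue_eq [OF c] t_def)
        finally show "- (1 + c) * (2 * (x \<bullet> x) * (2 * (1 + c) * (K * lag'' t ?g (x \<bullet> x))) + ?g * b (x \<bullet> x))
           = (eigenvalue ?m c n l - (1 + c)\<^sup>2 * (x \<bullet> x)) * a (x \<bullet> x)" by (simp only: u_def)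
      qed
      then show "op_D c (radial c l (M l j) 1 b) x = (eigenvalue ?m c n l - (1 + c)\<^sup>2 * (x \<bullet> x)) *\<^sub>R radial c l (M l j) 0 a x"
        by (simp only: radial_scale)
    qed
  next
    case False
    \<comment> \<open>Multiplication by x raises the effective dimension by 2. Differentiating 2 u
      a' + ?g a gives 2 u a'' + (2 + ?g) a', half of the second-order operator of
      \<open>lag_ode\<close> in dimension \<open>?h\<close>.\<close>
    let ?g = "gamma ?m c l" and ?h = "gamma ?m c l + 2"
    have n1: "n mod 2 = 1" using False by presburger
    define a where "a = (\<lambda>u. K * lag t ?h u)"
    define b where "b = (\<lambda>u. - (1 + c) * (2 * u * (K * lag' t ?h u) + ?g * (K * lag t ?h u)))"
    have a: "(a has_real_derivative K * lag' t ?h u) (at u)" for u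
      unfolding a_def by (intro DERIV_cmult lag_deriv)
    have b: "(b has_real_derivative - (1 + c) * K * (2 * u * lag'' t ?h u + (2 + ?g) * lag' t ?h u)) (at u)" for u
      unfolding b_def by (auto intro!: derivative_eq_intros lag_deriv lag'_deriv simp: algebra_simps)
    have phi: "phi c M n l j = radial c l (M l j) 1 a"
      using n1 by (simp add: phi_eq_radial [OF c] a_def phi_profile_def [abs_def] K_def t_def)
    show ?thesis unfolding phi
    proof (intro exI [of _ "radial c l (M l j) 0 b"] allI impI conjI)
      fix x :: "(real, 'n) vec" assume x: "x \<noteq> 0"
      show "radial c l (M l j) 1 a differentiable at x" "radial c l (M l j) 0 b differentiable at x"
        using differentiable_radial_fun [OF M x] a b by blast+
      show "op_D c (radial c l (M l j) 1 a) x = radial c l (M l j) 0 b x"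
        unfolding op_D_radial_odd [OF M x a c] by (rule radial_cong) (simp add: b_def a_def)
      have "op_D c (radial c l (M l j) 0 b) x = radial c l (M l j) 1 (\<lambda>u. (eigenvalue ?m c n l - (1 + c)\<^sup>2 * (x \<bullet> x)) * a u) x"
        unfolding op_D_radial_even [OF M x b c]
      proof (rule radial_cong)
        define u where "u = x \<bullet> x"
        have "2 * (1 + c) * (- (1 + c) * K * (2 * u * lag'' t ?h u + (2 + ?g) * lag' t ?h u))
          = - (1 + c)\<^sup>2 * K * (4 * u * lag'' t ?h u + 2 * ?h * lag' t ?h u)"
          by (simp add: power2_eq_square algebra_simps)
        also have "4 * u * lag'' t ?h u + 2 * ?h * lag' t ?h u = u * lag t ?h u - (4 * real t + ?h) * lag t ?h u"
          using lag_ode [of u t ?h] unfolding mult_minus_left by linarith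
        also have "- (1 + c)\<^sup>2 * K * (u * lag t ?h u - (4 * real t + ?h) * lag t ?h u) = ((1 + c)\<^sup>2 * (4 * real t + ?h) - (1 + c)\<^sup>2 * u) * a u"
          by (simp add: a_def algebra_simps)
        also have "(1 + c)\<^sup>2 * (4 * real t + ?h) = eigenvalue ?m c n l"
          using n1 by (simp add: eigenvalue_eq [OF c] t_def)
        finally show "2 * (1 + c) * (- (1 + c) * K * (2 * (x \<bullet> x) * lag'' t ?h (x \<bullet> x) + (2 + ?g) * lag' t ?h (x \<bullet> x)))
           = (eigenvalue ?m c n l - (1 + c)\<^sup>2 * (x \<bullet> x)) * a (x \<bullet> x)" by (simp only: u_def)
      qed
      then show "op_D c (radial c l (M l j) 0 b) x = (eigenvalue ?m c n l - (1 + c)\<^sup>2 * (x \<bullet> x)) *\<^sub>R radial c l (M l j) 1 a x"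
        by (simp only: radial_scale)
    qed
  qed
qed

lemma scale_scaleR_commute: "a *s (s *\<^sub>R (u :: ('n::finite) cl)) = s *\<^sub>R (a *s u)"
  by (simp add: vec_eq_iff)

lemma scale_sum_right: "a *s (\<Sum>i\<in>I. f i) = (\<Sum>i\<in>I. a *s (f i :: ('n::finite) cl))"
  by (simp add: vec_eq_iff sum_distrib_left)

lemma partial_sum:
  "(\<And>k. k \<in> K \<Longrightarrow> F k differentiable (at x)) \<Longrightarrow> partial i (\<lambda>x. \<Sum>k\<in>K. F k x) x = (\<Sum>k\<in>K. partial i (F k) x)"
proof (induction K rule: infinite_finite_induct)
  case (insert k K)
  then have "partial i (\<lambda>x. F k x + (\<Sum>k\<in>K. F k x)) x = partial i (F k) x + partial i (\<lambda>x. \<Sum>k\<in>K. F k x) x"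
    by (intro partial_add differentiable_sum) auto
  with insert show ?case by simp
qed (simp_all add: partial_const)

lemma op_D_linear_combination:
  assumes "\<And>k. k \<in> K \<Longrightarrow> F k differentiable (at x)"
  shows "op_D c (\<lambda>x. \<Sum>k\<in>K. a k *s F k x) x = (\<Sum>k\<in>K. a k *s op_D c (F k) x)"
proof -
  have p: "partial i (\<lambda>x. \<Sum>k\<in>K. a k *s F k x) x = (\<Sum>k\<in>K. a k *s partial i (F k) x)" for i
    using assms by (subst partial_sum) (auto intro: differentiable_cl_scale simp: partial_scale)
  have d: "dirac (\<lambda>x. \<Sum>k\<in>K. a k *s F k x) x = (\<Sum>k\<in>K. a k *s dirac (F k) x)"
    unfolding dirac_def p cl_mult_sum_right cl_mult_scale_right scale_sum_right by (rule sum.swap)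
  have e: "euler (\<lambda>x. \<Sum>k\<in>K. a k *s F k x) x = (\<Sum>k\<in>K. a k *s euler (F k) x)"
    unfolding euler_def p scaleR_sum_right scale_sum_right scale_scaleR_commute by (rule sum.swap)
  show ?thesis
    unfolding op_D_def d e
    by (simp add: cl_mult_sum_right cl_mult_scale_right scaleR_sum_right sum.distrib vector_add_ldistrib scale_scaleR_commute)
qed

text \<open>With a total derivative operator linearity is available only for differentiable
  summands, hence the restriction to combinations away from the origin.\<close>

theorem op_L_phi_combination:
  fixes M :: "nat \<Rightarrow> nat \<Rightarrow> ('n::{finite,linorder}) cl_fun"
  assumes K: "finite K" and M: "\<And>k. k \<in> K \<Longrightarrow> M (l k) (j k) \<in> monogenics (l k)" and c: "1 + c \<noteq> 0" and x: "x \<noteq> 0"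
  shows "op_L c (\<lambda>x. \<Sum>k\<in>K. a k *s phi c M (n k) (l k) (j k) x) x
    = (\<Sum>k\<in>K. (a k * of_real (eigenvalue CARD('n) c (n k) (l k))) *s phi c M (n k) (l k) (j k) x)"
proof -
  let ?f = "\<lambda>k. phi c M (n k) (l k) (j k)" and ?e = "\<lambda>k. eigenvalue CARD('n) c (n k) (l k)"
  have "\<forall>k\<in>K. \<exists>v. (\<forall>x. x \<noteq> 0 \<longrightarrow> ?f k differentiable (at x) \<and> v differentiable (at x)
      \<and> op_D c (?f k) x = v x \<and> op_D c v x = (?e k - (1 + c)\<^sup>2 * (x \<bullet> x)) *\<^sub>R ?f k x)"
  proof
    fix k assume k: "k \<in> K"
    show "\<exists>v. (\<forall>x. x \<noteq> 0 \<longrightarrow> ?f k differentiable (at x) \<and> v differentiable (at x)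
      \<and> op_D c (?f k) x = v x \<and> op_D c v x = (?e k - (1 + c)\<^sup>2 * (x \<bullet> x)) *\<^sub>R ?f k x)"
      by (rule op_D_op_D_phi [where M = M and l = "l k" and j = "j k", OF M [OF k] c])
  qed
  from bchoice [OF this] obtain v where v: "\<And>k x. k \<in> K \<Longrightarrow> x \<noteq> 0 \<Longrightarrow> ?f k differentiable (at x) \<and> v k differentiable (at x)
      \<and> op_D c (?f k) x = v k x \<and> op_D c (v k) x = (?e k - (1 + c)\<^sup>2 * (x \<bullet> x)) *\<^sub>R ?f k x" by blast
  have D: "op_D c (\<lambda>x. \<Sum>k\<in>K. a k *s ?f k x) y = (\<Sum>k\<in>K. a k *s v k y)" if "y \<noteq> 0" for y
    using v that by (subst op_D_linear_combination) auto
  have "op_D c (op_D c (\<lambda>x. \<Sum>k\<in>K. a k *s ?f k x)) x = op_D c (\<lambda>y. \<Sum>k\<in>K. a k *s v k y) x"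
  proof (rule op_D_cong_open [OF _ open_nonzero])
    show "(\<lambda>y. \<Sum>k\<in>K. a k *s v k y) differentiable at x"
      by (intro differentiable_sum K ballI differentiable_cl_scale) (use v x in blast)
  qed (use x D in auto)
  also have "\<dots> = (\<Sum>k\<in>K. a k *s ((?e k - (1 + c)\<^sup>2 * (x \<bullet> x)) *\<^sub>R ?f k x))"
    using v [OF _ x] by (subst op_D_linear_combination) auto
  finally have DD: "op_D c (op_D c (\<lambda>x. \<Sum>k\<in>K. a k *s ?f k x)) x
    = (\<Sum>k\<in>K. a k *s ((?e k - (1 + c)\<^sup>2 * (x \<bullet> x)) *\<^sub>R ?f k x))" .
  \<comment> \<open>As x x = - r^2, subtracting this term from D D cancels the potential - (1 + c)^2
    r^2 left by \<open>op_D_op_D_phi\<close>.\<close>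
  have "(1 + c)\<^sup>2 *\<^sub>R (cl_vec x \<odot> (cl_vec x \<odot> (\<Sum>k\<in>K. a k *s ?f k x))) = (\<Sum>k\<in>K. a k *s ((- (1 + c)\<^sup>2 * (x \<bullet> x)) *\<^sub>R ?f k x))"
    unfolding cl_vec_mult_vec power2_norm_eq_inner scaleR_scaleR scaleR_sum_right
    by (intro sum.cong refl) (simp add: scale_scaleR_commute)
  then show ?thesis
    unfolding op_L_def DD
    by (simp add: sum_subtractf [symmetric]) (intro sum.cong refl, simp add: vec_eq_iff scaleR_conv_of_real [where 'a = complex] algebra_simps)
qed

section \<open>Monogenics on the sphere\<close>

text \<open>Translation invariance: the integral of the difference quotients of \<open>G\<close> vanishes.\<close>

lemma integral_directional_derivative_eq_0:
  fixes G G' :: "'a::euclidean_space \<Rightarrow> complex"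
  assumes der: "\<And>x. ((\<lambda>s. G (x + s *\<^sub>R e)) has_vector_derivative G' x) (at 0)"
    and G: "continuous_on UNIV G" and G': "continuous_on UNIV G'"
    and supp: "\<And>x. norm x \<ge> 1 \<Longrightarrow> G x = 0" "\<And>x. norm x \<ge> 1 \<Longrightarrow> G' x = 0"
    and e: "norm e = 1"
  shows "(LINT x|lborel. G' x) = 0"
proof -
  note [measurable] = borel_measurable_continuous_onI [OF G] borel_measurable_continuous_onI [OF G']
  have "compact (G' ` cball 0 1)"
    by (intro compact_continuous_image continuous_on_subset [OF G'] compact_cball) auto
  from compact_imp_bounded [OF this] obtain B0 where B0: "\<forall>y\<in>G' ` cball 0 1. cmod y \<le> B0"
    unfolding bounded_iff by blast
  define B where "B = max B0 0"
  have B: "cmod (G' x) \<le> B" for x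
  proof (cases "norm x \<le> 1")
    case True
    then have "cmod (G' x) \<le> B0" using B0 by simp
    then show ?thesis by (simp add: B_def)
  next
    case False
    then show ?thesis using supp(2) [of x] by (simp add: B_def)
  qed
  have ders: "((\<lambda>s. G (x + s *\<^sub>R e)) has_vector_derivative G' (x + t *\<^sub>R e)) (at t)" for x t
  proof -
    have 1: "((\<lambda>s. G ((x + t *\<^sub>R e) + s *\<^sub>R e)) has_vector_derivative G' (x + t *\<^sub>R e)) (at (t - t))"
      using der [of "x + t *\<^sub>R e"] by simp
    have "((\<lambda>s. s - t) has_vector_derivative 1) (at t)" by (auto intro!: derivative_eq_intros)
    from vector_diff_chain_at [OF this 1] show ?thesis by (simp add: o_def algebra_simps)
  qed
  \<comment> \<open>The mean value inequality bounds all difference quotients by \<open>B\<close>,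
    which supplies the majorant for dominated convergence.\<close>
  have lip: "cmod (G (x + s *\<^sub>R e) - G x) \<le> B * s" if "s > 0" for x s
  proof -
    have "\<exists>t\<in>{0<..<s}. norm (G (x + s *\<^sub>R e) - G (x + 0 *\<^sub>R e)) \<le> norm ((s - 0) *\<^sub>R G' (x + t *\<^sub>R e))"
    proof (rule mvt_general [OF that, of "\<lambda>t. G (x + t *\<^sub>R e)" "\<lambda>t h. h *\<^sub>R G' (x + t *\<^sub>R e)"])
      show "continuous_on {0..s} (\<lambda>t. G (x + t *\<^sub>R e))"
        by (intro continuous_on_compose2 [OF G] continuous_intros) auto
    qed (use ders in \<open>simp add: has_vector_derivative_def\<close>)
    then obtain t where "norm (G (x + s *\<^sub>R e) - G x) \<le> s * cmod (G' (x + t *\<^sub>R e))"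
      using that by auto
    also have "\<dots> \<le> s * B" using that B by (intro mult_left_mono) auto
    finally show ?thesis by (simp add: mult.commute)
  qed
  \<comment> \<open>Increments of at most 1 keep all difference quotients supported in the ball of
    radius 2.\<close>
  define h where "h n = 1 / real (Suc n)" for n
  have h: "0 < h n" "h n \<le> 1" for n by (auto simp: h_def)
  define Q where "Q n x = (1 / h n) *\<^sub>R (G (x + h n *\<^sub>R e) - G x)" for n x
  have [measurable]: "Q n \<in> borel_measurable borel" for n unfolding Q_def by measurable
  have int_G: "integrable lborel G"
  proof -
    have "integrable lborel (\<lambda>x. indicator (cball 0 1) x *\<^sub>R G x)"
      by (rule borel_integrable_compact) (auto intro: continuous_on_subset [OF G])
    moreover have "indicator (cball 0 1) x *\<^sub>R G x = G x" for x
      using supp(1) [of x] by (auto simp: indicator_def)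
    ultimately show ?thesis by simp
  qed
  have Q0: "(LINT x|lborel. Q n x) = 0" for n
  proof -
    have d: "distr lborel borel (\<lambda>x. h n *\<^sub>R e + x) = lborel" by (rule lborel_distr_plus)
    have "integrable (distr lborel borel (\<lambda>x. h n *\<^sub>R e + x)) G" unfolding d by (rule int_G)
    then have 1: "integrable lborel (\<lambda>x. G (h n *\<^sub>R e + x))"
      by (subst (asm) integrable_distr_eq) auto
    have "(LINT x|lborel. G (h n *\<^sub>R e + x)) = integral\<^sup>L (distr lborel borel (\<lambda>x. h n *\<^sub>R e + x)) G"
      by (subst integral_distr) auto
    also have "\<dots> = integral\<^sup>L lborel G" unfolding d ..
    finally have "(LINT x|lborel. G (h n *\<^sub>R e + x) - G x) = 0"
      by (simp add: Bochner_Integration.integral_diff [OF 1 int_G])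
    then have "(1 / h n) *\<^sub>R (LINT x|lborel. G (h n *\<^sub>R e + x) - G x) = 0" by simp
    then show ?thesis unfolding Q_def by (simp add: add.commute)
  qed
  have "(\<lambda>n. LINT x|lborel. Q n x) \<longlonglongrightarrow> (LINT x|lborel. G' x)"
  proof (rule integral_dominated_convergence)
    show "integrable lborel (\<lambda>x. B * indicator (cball 0 2) (x :: 'a))"
      using emeasure_lborel_cball_finite [of "0 :: 'a" 2] by (intro integrable_mult_right) auto
    show "AE x in lborel. (\<lambda>n. Q n x) \<longlonglongrightarrow> G' x"
    proof (rule AE_I2)
      fix x
      have "((\<lambda>s. (1 / s) *\<^sub>R (G (x + s *\<^sub>R e) - G x)) \<longlongrightarrow> G' x) (at 0)"
      proof -
        have "((\<lambda>s. G (x + s *\<^sub>R e)) has_derivative (\<lambda>s. s *\<^sub>R G' x)) (at 0)"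
          using der [of x] by (simp add: has_vector_derivative_def)
        then have "((\<lambda>s. norm (G (x + (0 + s) *\<^sub>R e) - G (x + 0 *\<^sub>R e) - s *\<^sub>R G' x) / norm s) \<longlongrightarrow> 0) (at 0)"
          unfolding has_derivative_at by blast
        moreover
        have "norm (G (x + (0 + s) *\<^sub>R e) - G (x + 0 *\<^sub>R e) - s *\<^sub>R G' x) / norm s
           = norm ((1 / s) *\<^sub>R (G (x + s *\<^sub>R e) - G x) - G' x)" if "s \<noteq> 0" for s
        proof -
          have "(1 / s) *\<^sub>R (G (x + s *\<^sub>R e) - G x) - G' x = (1 / s) *\<^sub>R (G (x + s *\<^sub>R e) - G x - s *\<^sub>R G' x)"
            using that by (simp add: scaleR_diff_right)
          then show ?thesis by (simp add: divide_inverse mult.commute)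
        qed
        then have "\<forall>\<^sub>F s in at 0. norm (G (x + (0 + s) *\<^sub>R e) - G (x + 0 *\<^sub>R e) - s *\<^sub>R G' x) / norm s
           = norm ((1 / s) *\<^sub>R (G (x + s *\<^sub>R e) - G x) - G' x)"
          unfolding eventually_at_filter by (intro always_eventually) blast
        ultimately have "((\<lambda>s. norm ((1 / s) *\<^sub>R (G (x + s *\<^sub>R e) - G x) - G' x)) \<longlongrightarrow> 0) (at 0)"
          by (rule Lim_transform_eventually)
        then show "((\<lambda>s. (1 / s) *\<^sub>R (G (x + s *\<^sub>R e) - G x)) \<longlongrightarrow> G' x) (at 0)"
          by (rule LIM_zero_cancel [OF tendsto_norm_zero_cancel])
      qed
      moreover have "filterlim h (at 0) sequentially"
        unfolding filterlim_at h_def using LIMSEQ_inverse_real_of_nat by (auto simp: inverse_eq_divide)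
      ultimately show "(\<lambda>n. Q n x) \<longlonglongrightarrow> G' x"
        unfolding Q_def by (rule filterlim_compose)
    qed
    show "AE x in lborel. norm (Q n x) \<le> B * indicator (cball 0 2) x" for n
    proof (rule AE_I2)
      fix x
      have "cmod (G (x + h n *\<^sub>R e) - G x) \<le> B * h n" by (rule lip [OF h(1)])
      then have *: "norm (Q n x) \<le> B" using h(1) [of n] unfolding Q_def norm_scaleR by (simp add: field_simps)
      have "Q n x = 0" if "norm x > 2"
      proof -
        have "norm x \<le> norm (x + h n *\<^sub>R e) + norm (h n *\<^sub>R e)"
          using norm_triangle_ineq4 [of "x + h n *\<^sub>R e" "h n *\<^sub>R e"] by simp
        then have "norm (x + h n *\<^sub>R e) \<ge> 1" using that h [of n] e by simp
        then show ?thesis using supp(1) that by (simp add: Q_def)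
      qed
      with * show "norm (Q n x) \<le> B * indicator (cball 0 2) x" by (cases "norm x > 2") auto
    qed
  qed simp_all
  then have "(\<lambda>n::nat. 0::complex) \<longlonglongrightarrow> (LINT x|lborel. G' x)" unfolding Q0 .
  then show ?thesis by (simp add: LIMSEQ_const_iff)
qed

text \<open>Its square is continuously differentiable across the unit sphere, and the derivative is
  again a multiple of \<open>bump\<close>; this suffices for integration by parts without a boundary
  term.\<close>

definition bump :: "real ^ 'n::{finite,linorder} \<Rightarrow> real" where
  "bump x = max 0 (1 - x \<bullet> x)"

lemma bump_continuous: "continuous_on UNIV bump"
  unfolding bump_def [abs_def] by (intro continuous_intros)

text \<open>At 0 the difference quotient is \<open>max 0 h\<close>, which tends to 0; squaring
  removes the corner of the positive part.\<close>

lemma max_0_square_deriv: "((\<lambda>s. (max 0 s)\<^sup>2) has_real_derivative 2 * max 0 s) (at s)"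
proof -
  consider "s > 0" | "s < 0" | "s = 0" by linarith
  then show ?thesis
  proof cases
    case 1
    have "((\<lambda>s. s\<^sup>2) has_real_derivative 2 * s) (at s)" by (auto intro!: derivative_eq_intros)
    then have "((\<lambda>s. (max 0 s)\<^sup>2) has_real_derivative 2 * s) (at s)"
      by (rule has_field_derivative_transform_within_open [of _ _ _ "{0<..}"]) (use 1 in auto)
    with 1 show ?thesis by simp
  next
    case 2
    have "((\<lambda>s::real. 0) has_real_derivative 0) (at s)" by simp
    then have "((\<lambda>s. (max 0 s)\<^sup>2) has_real_derivative 0) (at s)"
      by (rule has_field_derivative_transform_within_open [of _ _ _ "{..<0}"]) (use 2 in auto)
    with 2 show ?thesis by simp
  next
    case 3
    have "((\<lambda>h. max 0 h) \<longlongrightarrow> max 0 (0::real)) (at 0)" by (intro tendsto_intros)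
    then have "((\<lambda>h. max 0 h) \<longlongrightarrow> 0) (at (0::real))" by simp
    then have "((\<lambda>h. ((max 0 h)\<^sup>2 - 0) / h) \<longlongrightarrow> 0) (at (0::real))"
      by (rule Lim_transform_eventually) (auto simp: eventually_at_filter max_def power2_eq_square)
    then show ?thesis using 3 by (simp add: has_field_derivative_iff)
  qed
qed

lemma bump_square_deriv:
  "((\<lambda>s. (bump (x + s *\<^sub>R axis i 1))\<^sup>2) has_vector_derivative (- 4 * x $ i * bump x)) (at 0)"
proof -
  have 1: "((\<lambda>s. 1 - (x + s *\<^sub>R axis i 1) \<bullet> (x + s *\<^sub>R axis i (1::real))) has_real_derivative (- 2 * x $ i)) (at 0)"
    by (auto intro!: derivative_eq_intros simp: inner_axis inner_add_left inner_add_right inner_commute)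
  have "((\<lambda>s. (max 0 s)\<^sup>2) has_real_derivative 2 * max 0 (1 - x \<bullet> x)) (at (1 - (x + 0 *\<^sub>R axis i 1) \<bullet> (x + 0 *\<^sub>R axis i (1::real))))"
    using max_0_square_deriv [of "1 - x \<bullet> x"] by simp
  from DERIV_chain2 [OF this 1] show ?thesis
    by (simp add: bump_def has_real_derivative_iff_has_vector_derivative mult_ac)
qed

lemma hom_poly_continuous: "hom_poly k P \<Longrightarrow> continuous_on S P"
  by (simp add: hom_poly_def continuous_on_polymonial_function)

lemma polynomial_partial_deriv:
  assumes "polynomial_function P"
  shows "((\<lambda>s. P (x + s *\<^sub>R axis i 1)) has_vector_derivative partial i P x) (at 0)"
proof -
  have "P differentiable (at (x + 0 *\<^sub>R axis i 1))"
    using assms by (intro differentiable_at_polynomial_function)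
  moreover have "(\<lambda>s. x + s *\<^sub>R axis i (1::real)) differentiable (at (0::real))"
    by (auto intro!: derivative_intros)
  ultimately have "(\<lambda>s. P (x + s *\<^sub>R axis i 1)) differentiable (at 0)"
    using differentiable_chain_at [of "\<lambda>s. x + s *\<^sub>R axis i 1" 0 P] by (simp add: o_def)
  then show ?thesis unfolding partial_def by (simp add: vector_derivative_works)
qed

lemma bounded_bilinear_cl_dot: "bounded_bilinear cl_dot"
proof
  show "\<exists>K. \<forall>a b. norm (cl_dot a b) \<le> norm a * norm b * K"
    by (intro exI [of _ 1] allI) (simp add: norm_cl_dot_le)
qed (simp_all add: cl_dot_add_left cl_dot_add_right cl_dot_scaleR_left cl_dot_scaleR_right)

lemma continuous_on_cl_dot [continuous_intros]:
  "continuous_on S f \<Longrightarrow> continuous_on S g \<Longrightarrow> continuous_on S (\<lambda>x. cl_dot (f x) (g x))"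
  by (rule bounded_bilinear.continuous_on [OF bounded_bilinear_cl_dot])

lemma integrable_bump:
  assumes "continuous_on UNIV F"
  shows "integrable lborel (\<lambda>x. (bump x) ^ Suc k *\<^sub>R (F x :: complex))"
proof -
  have "integrable lborel (\<lambda>x. indicator (cball 0 1) x *\<^sub>R ((bump x) ^ Suc k *\<^sub>R F x))"
    by (rule borel_integrable_compact)
      (auto intro!: continuous_intros continuous_on_subset [OF assms] continuous_on_subset [OF bump_continuous])
  moreover have "indicator (cball 0 1) x *\<^sub>R ((bump x) ^ Suc k *\<^sub>R F x) = (bump x) ^ Suc k *\<^sub>R F x" for x
  proof (cases "norm x \<le> 1")
    case False
    then have "1 < (norm x)\<^sup>2" by (simp add: one_less_power)
    then have "bump x = 0" by (simp add: bump_def power2_norm_eq_inner)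
    then show ?thesis by simp
  qed simp
  ultimately show ?thesis by (simp only:)
qed

text \<open>Gauss--Stokes for the Dirac operator, with the smooth cutoff \<open>bump\<^sup>2\<close> in place of a domain.\<close>

theorem Clifford_Stokes:
  fixes P Q :: "('n::{finite,linorder}) cl_fun"
  assumes P: "polynomial_function P" and Q: "polynomial_function Q"
  shows "(LINT x|lborel. (bump x)\<^sup>2 *\<^sub>R (cl_dot (P x) (dirac Q x) - cl_dot (dirac P x) (Q x)))
    = 4 * (LINT x|lborel. bump x *\<^sub>R cl_dot (P x) (cl_vec x \<odot> Q x))"
proof -
  define F where "F i x = cl_dot (P x) (cl_gen i \<odot> Q x)" for i x
  define F' where "F' i x = cl_dot (P x) (cl_gen i \<odot> partial i Q x) + cl_dot (partial i P x) (cl_gen i \<odot> Q x)" for i x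
  have cP: "continuous_on UNIV P" and cQ: "continuous_on UNIV Q"
    and cP': "continuous_on UNIV (partial i P)" and cQ': "continuous_on UNIV (partial i Q)" for i
    using P Q by (auto intro: continuous_on_polymonial_function polynomial_function_partial)
  have cg: "continuous_on UNIV (\<lambda>x. cl_gen i \<odot> f x)" if "continuous_on UNIV f" for i and f :: "'n cl_fun"
    by (intro bounded_linear.continuous_on [OF bounded_linear_cl_mult_right] that)
  have cF: "continuous_on UNIV (F i)" and cF': "continuous_on UNIV (F' i)" for i
    unfolding F_def [abs_def] F'_def [abs_def] by (intro continuous_intros cP cQ cP' cQ' cg)+
  have dF: "((\<lambda>s. F i (x + s *\<^sub>R axis i 1)) has_vector_derivative F' i x) (at 0)" for i x
    using bounded_bilinear.has_vector_derivative [OF bounded_bilinear_cl_dot polynomial_partial_deriv [OF P, of x i]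
       bounded_linear.has_vector_derivative [OF bounded_linear_cl_mult_right [of "cl_gen i"] polynomial_partial_deriv [OF Q, of x i]]]
    by (simp add: F_def F'_def)
  have b0: "bump x = 0" if "norm x \<ge> 1" for x :: "(real, 'n) vec"
  proof -
    have "1 \<le> (norm x)\<^sup>2" using that by (simp add: one_le_power)
    then show ?thesis by (simp add: bump_def power2_norm_eq_inner)
  qed
  have zero: "(LINT x|lborel. (bump x)\<^sup>2 *\<^sub>R F' i x + (- 4 * x $ i * bump x) *\<^sub>R F i x) = 0" for i
  proof (rule integral_directional_derivative_eq_0 [where G = "\<lambda>x. (bump x)\<^sup>2 *\<^sub>R F i x" and e = "axis i 1"])
    show "((\<lambda>s. (bump (x + s *\<^sub>R axis i 1))\<^sup>2 *\<^sub>R F i (x + s *\<^sub>R axis i 1)) has_vector_derivative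
       (bump x)\<^sup>2 *\<^sub>R F' i x + (- 4 * x $ i * bump x) *\<^sub>R F i x) (at 0)" for x
      using has_vector_derivative_scaleR [OF bump_square_deriv [of x i, folded has_real_derivative_iff_has_vector_derivative] dF [of i x]]
      by simp
    show "continuous_on UNIV (\<lambda>x. (bump x)\<^sup>2 *\<^sub>R F i x)"
      "continuous_on UNIV (\<lambda>x. (bump x)\<^sup>2 *\<^sub>R F' i x + (- 4 * x $ i * bump x) *\<^sub>R F i x)"
      by (intro continuous_intros bump_continuous cF cF')+
  qed (auto simp: b0 norm_axis_1)
  have i1: "integrable lborel (\<lambda>x. (bump x)\<^sup>2 *\<^sub>R F' i x)" for i
    using integrable_bump [OF cF' [of i], where k = 1] by (simp add: numeral_2_eq_2)
  have i2: "integrable lborel (\<lambda>x. (x $ i * bump x) *\<^sub>R F i x)" for i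
  proof -
    have "continuous_on UNIV (\<lambda>x. (x $ i) *\<^sub>R F i x)" by (intro continuous_intros cF)
    from integrable_bump [OF this, where k = 0] show ?thesis by (simp add: mult.commute)
  qed
  have eq: "(LINT x|lborel. (bump x)\<^sup>2 *\<^sub>R F' i x) = 4 * (LINT x|lborel. (x $ i * bump x) *\<^sub>R F i x)" for i
  proof -
    have "(bump x)\<^sup>2 *\<^sub>R F' i x + (- 4 * x $ i * bump x) *\<^sub>R F i x
      = (bump x)\<^sup>2 *\<^sub>R F' i x - 4 * ((x $ i * bump x) *\<^sub>R F i x)" for x
      by (simp add: scaleR_conv_of_real)
    then have "0 = (LINT x|lborel. (bump x)\<^sup>2 *\<^sub>R F' i x - 4 * ((x $ i * bump x) *\<^sub>R F i x))"
      using zero [of i] by simp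
    also have "\<dots> = (LINT x|lborel. (bump x)\<^sup>2 *\<^sub>R F' i x) - 4 * (LINT x|lborel. (x $ i * bump x) *\<^sub>R F i x)"
      unfolding Bochner_Integration.integral_diff [OF i1 [of i] Bochner_Integration.integrable_mult_right [of 4, OF i2 [of i]]]
      by (simp only: Bochner_Integration.integral_mult_right_zero)
    finally show ?thesis by simp
  qed
  have "(\<Sum>i\<in>UNIV. LINT x|lborel. (bump x)\<^sup>2 *\<^sub>R F' i x) = (LINT x|lborel. (\<Sum>i\<in>UNIV. (bump x)\<^sup>2 *\<^sub>R F' i x))"
    by (rule Bochner_Integration.integral_sum [symmetric]) (rule i1)
  moreover have "(\<Sum>i\<in>UNIV. (bump x)\<^sup>2 *\<^sub>R F' i x) = (bump x)\<^sup>2 *\<^sub>R (cl_dot (P x) (dirac Q x) - cl_dot (dirac P x) (Q x))" for x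
  proof -
    have "(\<Sum>i\<in>UNIV. F' i x) = cl_dot (P x) (dirac Q x) - cl_dot (dirac P x) (Q x)"
      unfolding F'_def dirac_def cl_dot_sum_left cl_dot_sum_right
      by (simp add: sum.distrib cl_dot_gen_left sum_negf)
    then show ?thesis by (simp flip: scaleR_sum_right)
  qed
  moreover have "(\<Sum>i\<in>UNIV. LINT x|lborel. (x $ i * bump x) *\<^sub>R F i x) = (LINT x|lborel. (\<Sum>i\<in>UNIV. (x $ i * bump x) *\<^sub>R F i x))"
    by (rule Bochner_Integration.integral_sum [symmetric]) (rule i2)
  moreover have "(\<Sum>i\<in>UNIV. (x $ i * bump x) *\<^sub>R F i x) = bump x *\<^sub>R cl_dot (P x) (cl_vec x \<odot> Q x)" for x
    by (simp add: F_def cl_vec_def cl_mult_sum_left cl_dot_sum_right cl_mult_scaleR_left cl_dot_scaleR_right scaleR_sum_right mult.commute)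
  moreover have "(\<Sum>i\<in>UNIV. LINT x|lborel. (bump x)\<^sup>2 *\<^sub>R F' i x) = 4 * (\<Sum>i\<in>UNIV. LINT x|lborel. (x $ i * bump x) *\<^sub>R F i x)"
    by (simp only: eq sum_distrib_left)
  ultimately show ?thesis by simp
qed

text \<open>The integrand is positive on the interval (0, 1). Strict positivity lets the vanishing
  of a cut-off volume integral pass to the sphere.\<close>

lemma radial_bump_integral:
  fixes p q k :: nat
  defines "f \<equiv> \<lambda>r::real. indicator {0<..} r * (r ^ p * ((max 0 (1 - r\<^sup>2)) ^ Suc q * r ^ k))"
  shows "integrable lborel f" and "(LINT r|lborel. f r) > 0"
proof -
  let ?g = "\<lambda>r::real. r ^ p * ((max 0 (1 - r\<^sup>2)) ^ Suc q * r ^ k)"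
  have [measurable]: "f \<in> borel_measurable borel" unfolding f_def by measurable
  have "integrable lborel (\<lambda>r. indicator {0..1} r *\<^sub>R ?g r)"
    by (rule borel_integrable_compact) (auto intro!: continuous_intros)
  moreover have "AE r in lborel. indicator {0..1} r *\<^sub>R ?g r = f r"
    using AE_lborel_singleton [of "0::real"]
  proof eventually_elim
    case (elim r)
    have "max 0 (1 - r\<^sup>2) = 0" if "r > 1" using that by (simp add: one_le_power)
    with elim show ?case by (cases "r > 1") (auto simp: f_def indicator_def)
  qed
  ultimately show int: "integrable lborel f"
    by (subst (asm) integrable_cong_AE) auto
  have nonneg: "0 \<le> f r" for r by (simp add: f_def indicator_def)
  have "(LINT r|lborel. f r) \<noteq> 0"
  proof
    assume "(LINT r|lborel. f r) = 0"
    then have "AE r in lborel. f r = 0"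
      using nonneg by (subst (asm) integral_nonneg_eq_0_iff_AE [OF int]) auto
    moreover have "f r > 0" if "r \<in> {0<..<1}" for r
      using that by (simp add: f_def power_less_one_iff zero_less_power)
    ultimately have "AE r in lborel. r \<notin> {0<..<1::real}"
      by (elim eventually_mono) (metis less_irrefl)
    then have "emeasure lborel {0<..<1::real} = 0"
      by (subst (asm) AE_iff_measurable [of "{0<..<1::real}"]) auto
    then show False by simp
  qed
  moreover have "(LINT r|lborel. f r) \<ge> 0" using nonneg by (intro integral_nonneg_AE) auto
  ultimately show "(LINT r|lborel. f r) > 0" by simp
qed

text \<open>Polar coordinates split the cut-off integral into a positive radial constant and the
  spherical integral.\<close>

lemma sphere_integral_eq_0:
  fixes P Q :: "('n::{finite,linorder}) cl_fun"
  assumes P: "hom_poly k P" and Q: "hom_poly l Q"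
    and zero: "(LINT x|lborel. (bump x) ^ Suc q *\<^sub>R cl_dot (P x) (Q x)) = 0"
  shows "(LINT x|sphere_measure. cl_dot (P x) (Q x)) = 0"
proof -
  let ?Y = "\<lambda>x. cl_dot (P x) (Q x)"
  have "?Y (s *\<^sub>R x) = s ^ (k + l) *\<^sub>R ?Y x" for s x
    using P Q by (simp add: hom_poly_def cl_dot_scaleR_left cl_dot_scaleR_right power_add)
  moreover have "continuous_on UNIV ?Y" by (intro continuous_intros hom_poly_continuous [OF P] hom_poly_continuous [OF Q])
  moreover have "(\<lambda>r. (max 0 (1 - r\<^sup>2)) ^ Suc q) \<in> borel_measurable (borel :: real measure)" by measurable
  moreover have "integrable lborel (\<lambda>r. indicator {0<..} r * (r ^ (CARD('n) - 1) * ((max 0 (1 - r\<^sup>2)) ^ Suc q * r ^ (k + l))) :: real)"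
    by (rule radial_bump_integral)
  ultimately have "(LINT x|lborel. (max 0 (1 - (norm x)\<^sup>2)) ^ Suc q *\<^sub>R ?Y x)
      = (LINT r|lborel. indicator {0<..} r * (r ^ (CARD('n) - 1) * ((max 0 (1 - r\<^sup>2)) ^ Suc q * r ^ (k + l)))) *\<^sub>R (LINT x|sphere_measure. ?Y x)"
    by (intro polar_complex(2))
  moreover have "(max 0 (1 - (norm x)\<^sup>2)) ^ Suc q = (bump x) ^ Suc q" for x :: "(real, 'n) vec"
    by (simp add: bump_def power2_norm_eq_inner)
  ultimately show ?thesis using zero radial_bump_integral(2) [of "CARD('n) - 1" q "k + l"] by simp
qed

text \<open>With both functions monogenic the volume side of \<open>Clifford_Stokes\<close>
  vanishes, and the other side is the cut-off form of this integral.\<close>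

theorem sphere_orthogonal_vec:
  assumes M: "M \<in> monogenics l" and N: "N \<in> monogenics l'"
  shows "(LINT x|sphere_measure. cl_dot (M x) (cl_vec x \<odot> N x)) = 0"
proof -
  have hM: "hom_poly l M" "\<And>x. dirac M x = 0" and hN: "hom_poly l' N" "\<And>x. dirac N x = 0"
    using M N by (auto simp: monogenics_iff)
  have "(LINT x|lborel. bump x *\<^sub>R cl_dot (M x) (cl_vec x \<odot> N x)) = 0"
    using Clifford_Stokes [of M N] hM hN by (simp add: hom_poly_def)
  then have "(LINT x|lborel. (bump x) ^ Suc 0 *\<^sub>R cl_dot (M x) (cl_vec x \<odot> N x)) = 0" by simp
  then show ?thesis by (rule sphere_integral_eq_0 [OF hM(1) hom_poly_cl_vec_mult [OF hN(1)]])
qed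

text \<open>\<open>Clifford_Stokes\<close> for P and x Q gives a linear relation between two cut-off
  integrals whose factor depends on the degree of Q. Exchanging the functions conjugates the
  integrals and changes the factor, so different degrees force the integral to vanish.\<close>

theorem sphere_orthogonal_degree:
  fixes M N :: "('n::{finite,linorder}) cl_fun"
  assumes M: "M \<in> monogenics l" and N: "N \<in> monogenics l'" and "l \<noteq> l'"
  shows "(LINT x|sphere_measure. cl_dot (M x) (N x)) = 0"
proof -
  have key: "(2 * real k' + real CARD('n)) *\<^sub>R (LINT x|lborel. (bump x)\<^sup>2 *\<^sub>R cl_dot (P x) (Q x))
      = 4 * (LINT x|lborel. (bump x * (x \<bullet> x)) *\<^sub>R cl_dot (P x) (Q x))"
    if P: "P \<in> monogenics k" and Q: "Q \<in> monogenics k'" for P Q :: "'n cl_fun" and k k'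
  proof -
    have hP: "hom_poly k P" "\<And>x. dirac P x = 0" and hQ: "hom_poly k' Q"
      using P Q by (auto simp: monogenics_iff)
    have d: "dirac (\<lambda>x. cl_vec x \<odot> Q x) x = - (2 * real k' + real CARD('n)) *\<^sub>R Q x" for x
      using dirac_vpow(2) [OF Q, of 0 x] by (simp add: vpow_0 vpow_Suc)
    have "(LINT x|lborel. (bump x)\<^sup>2 *\<^sub>R (cl_dot (P x) (- (2 * real k' + real CARD('n)) *\<^sub>R Q x)))
      = 4 * (LINT x|lborel. bump x *\<^sub>R cl_dot (P x) ((- (x \<bullet> x)) *\<^sub>R Q x))"
      using Clifford_Stokes [of P "\<lambda>x. cl_vec x \<odot> Q x"] hP hom_poly_cl_vec_mult [OF hQ]
      by (simp add: hom_poly_def d cl_vec_mult_vec power2_norm_eq_inner)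
    moreover have "(bump x)\<^sup>2 *\<^sub>R (cl_dot (P x) (- (2 * real k' + real CARD('n)) *\<^sub>R Q x))
      = (- (2 * real k' + real CARD('n))) *\<^sub>R ((bump x)\<^sup>2 *\<^sub>R cl_dot (P x) (Q x))" for x
      unfolding cl_dot_scaleR_right by (simp only: scaleR_scaleR mult.commute)
    moreover have "bump x *\<^sub>R cl_dot (P x) ((- (x \<bullet> x)) *\<^sub>R Q x) = (- 1) *\<^sub>R ((bump x * (x \<bullet> x)) *\<^sub>R cl_dot (P x) (Q x))" for x
      unfolding cl_dot_scaleR_right by simp
    ultimately have "(- (2 * real k' + real CARD('n))) *\<^sub>R (LINT x|lborel. (bump x)\<^sup>2 *\<^sub>R cl_dot (P x) (Q x))
      = 4 * ((- 1) *\<^sub>R (LINT x|lborel. (bump x * (x \<bullet> x)) *\<^sub>R cl_dot (P x) (Q x)))"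
      by (simp only: integral_scaleR_right)
    then show ?thesis by (simp add: scaleR_conv_of_real) (metis (no_types, lifting) add.commute minus_add_distrib mult_minus_left neg_equal_iff_equal uminus_add_conv_diff)
  qed
  have cn: "(LINT x|lborel. f x *\<^sub>R cl_dot (N x) (M x)) = cnj (LINT x|lborel. f x *\<^sub>R cl_dot (M x) (N x))" for f
    by (simp add: cl_dot_commute [of "N _" "M _"] flip: Bochner_Integration.integral_cnj)
  define J where "J = (LINT x|lborel. (bump x)\<^sup>2 *\<^sub>R cl_dot (M x) (N x))"
  define I where "I = (LINT x|lborel. (bump x * (x \<bullet> x)) *\<^sub>R cl_dot (M x) (N x))"
  have "(2 * real l' + real CARD('n)) *\<^sub>R J = 4 * I" using key [OF M N] by (simp add: J_def I_def)
  moreover have "(2 * real l + real CARD('n)) *\<^sub>R cnj J = 4 * cnj I" using key [OF N M] unfolding cn J_def I_def .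
  then have "cnj ((2 * real l + real CARD('n)) *\<^sub>R cnj J) = cnj (4 * cnj I)" by simp
  then have "(2 * real l + real CARD('n)) *\<^sub>R J = 4 * I" by simp
  ultimately have "(2 * real l' + real CARD('n) - (2 * real l + real CARD('n))) *\<^sub>R J = 0"
    unfolding scaleR_diff_left by simp
  then have "J = 0" using \<open>l \<noteq> l'\<close> by simp
  then have "(LINT x|lborel. (bump x) ^ Suc 1 *\<^sub>R cl_dot (M x) (N x)) = 0" by (simp add: J_def numeral_2_eq_2)
  then show ?thesis using M N by (intro sphere_integral_eq_0 [of l M l' N 1]) (auto simp: monogenics_iff)
qed

section \<open>Orthogonality of the basis functions\<close>

lemma gamma_pos:
  fixes l m :: nat
  assumes "c > - 1" "m \<ge> 1"
  shows "gamma m c l > 0"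
proof -
  have "1 + c \<noteq> 0" "1 + c > 0" using assms by auto
  moreover have "2 * real l + real m + c > 0" using assms by auto
  ultimately show ?thesis by (simp add: gamma_eq)
qed

lemma inner_powr_half: "(x \<bullet> x) powr (b / 2) = norm (x :: 'a::real_inner) powr b"
proof (cases "x = 0")
  case False
  have "(x \<bullet> x) powr (b / 2) = (norm x powr 2) powr (b / 2)"
    using False by (simp add: power2_norm_eq_inner)
  then show ?thesis unfolding powr_powr by simp
qed simp

lemma exponent_identity:
  assumes "1 + c \<noteq> 0"
  shows "(real m - 1) + (1 - (1 + real m * c) / (1 + c) + beta c l + beta c l') + (real l + real l')
    = (gamma m c l + gamma m c l') / 2 - 1"
proof -
  define p where "p = c / (1 + c)"
  define q where "q = 1 / (1 + c)"
  have pq: "p = 1 - q" using assms by (simp add: p_def q_def field_simps)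
  have 1: "(1 + real m * c) / (1 + c) = q + real m * p" by (simp add: p_def q_def add_divide_distrib)
  have 2: "beta c i = - p * real i" for i by (simp add: beta_def p_def)
  have 3: "gamma m c i = (2 * real i + real m) * q + p" for i
    using assms by (simp add: gamma_eq p_def q_def add_divide_distrib)
  show ?thesis unfolding 1 2 3 pq by (simp add: algebra_simps add_divide_distrib diff_divide_distrib)
qed

lemma radial_measurable:
  fixes M :: "('n::{finite,linorder}) cl_fun"
  assumes "M \<in> monogenics l" and [measurable]: "a \<in> borel_measurable borel"
  shows "radial c l M k a \<in> borel_measurable borel"
proof -
  have "hom_poly (k + l) (vpow k M)" using assms by (intro hom_poly_vpow) (simp add: monogenics_iff)
  then have [measurable]: "vpow k M \<in> borel_measurable borel"
    by (intro borel_measurable_continuous_onI hom_poly_continuous)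
  show ?thesis unfolding radial_def by measurable
qed

text \<open>Polar coordinates; \<open>exponent_identity\<close> collects the powers of \<open>r\<close> coming from the weight,
  from \<open>r\<^sup>\<beta>\<close>, from the homogeneity of the monogenics and from the volume element.\<close>

lemma radial_polar:
  fixes M N :: "('n::{finite,linorder}) cl_fun"
  assumes c: "c > - 1" and M: "M \<in> monogenics l" and N: "N \<in> monogenics l'" and b: "b > 0"
    and a: "\<And>u. a u * a' u = poly p u * exp (- b * u)" and [measurable]: "a \<in> borel_measurable borel" "a' \<in> borel_measurable borel"
  shows "integrable lborel (\<lambda>x. weight c x *\<^sub>R cl_dot (radial c l M k a x) (radial c l' N k' a' x))"
    and "(LINT x|lborel. weight c x *\<^sub>R cl_dot (radial c l M k a x) (radial c l' N k' a' x))
      = (LINT r|lborel. indicator {0<..} r * (r powr ((gamma CARD('n) c l + gamma CARD('n) c l') / 2 + real k + real k' - 1) * a (r\<^sup>2) * a' (r\<^sup>2)))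
        *\<^sub>R (LINT x|sphere_measure. cl_dot (vpow k M x) (vpow k' N x))"
proof -
  have c1: "1 + c \<noteq> 0" using c by simp
  let ?Y = "\<lambda>x. cl_dot (vpow k M x) (vpow k' N x)"
  let ?w = "1 - (1 + real CARD('n) * c) / (1 + c)"
  define g where "g r = r powr (?w + beta c l + beta c l') * (a (r\<^sup>2) * a' (r\<^sup>2))" for r
  define s where "s = (gamma CARD('n) c l + gamma CARD('n) c l') / 2 + real k + real k'"
  have g_meas: "g \<in> borel_measurable borel" unfolding g_def by measurable
  have hM: "hom_poly (k + l) (vpow k M)" and hN: "hom_poly (k' + l') (vpow k' N)"
    using M N by (auto intro!: hom_poly_vpow simp: monogenics_iff)
  have cont: "continuous_on UNIV ?Y" by (intro continuous_intros hom_poly_continuous [OF hM] hom_poly_continuous [OF hN])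
  have hom: "?Y (s *\<^sub>R x) = s ^ ((k + l) + (k' + l')) *\<^sub>R ?Y x" for s x
    using hM hN by (simp add: hom_poly_def cl_dot_scaleR_left cl_dot_scaleR_right power_add)
  have eq: "indicator {0<..} r * (r ^ (CARD('n) - 1) * (g r * r ^ ((k + l) + (k' + l'))))
    = indicator {0<..} r * (r powr (s - 1) * a (r\<^sup>2) * a' (r\<^sup>2))" for r :: real
  proof (cases "r > 0")
    case True
    have e: "(real CARD('n) - 1) + (?w + beta c l + beta c l') + real ((k + l) + (k' + l')) = s - 1"
      using exponent_identity [OF c1, of "CARD('n)" l l'] by (simp add: s_def)
    have n1: "real (CARD('n) - 1) = real CARD('n) - 1" by (simp add: of_nat_diff Suc_leI)
    have "r ^ (CARD('n) - 1) * r powr (?w + beta c l + beta c l') * r ^ ((k + l) + (k' + l')) = r powr (s - 1)"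
      unfolding powr_realpow [OF True, symmetric] n1 powr_add [symmetric] e ..
    then show ?thesis by (simp add: g_def)
  qed simp
  have "integrable lborel (\<lambda>r. indicator {0<..} r * (r powr (s - 1) * poly p (r\<^sup>2) * exp (- b * r\<^sup>2)))"
  proof (rule integrable_powr_poly_exp [OF _ b])
    show "s > 0" using gamma_pos [OF c, of "CARD('n)" l] gamma_pos [OF c, of "CARD('n)" l']
      unfolding s_def by (intro add_pos_nonneg) auto
  qed
  then have int: "integrable lborel (\<lambda>r. indicator {0<..} r * (r ^ (CARD('n) - 1) * (g r * r ^ ((k + l) + (k' + l')))))"
    unfolding eq by (simp add: mult.assoc a)
  note P = polar_complex [OF cont hom g_meas int]
  have ae: "weight c x *\<^sub>R cl_dot (radial c l M k a x) (radial c l' N k' a' x) = g (norm x) *\<^sub>R ?Y x" for x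
    by (simp add: radial_def inner_powr_half cl_dot_scaleR_left cl_dot_scaleR_right weight_def g_def powr_add power2_norm_eq_inner mult_ac)
  show "integrable lborel (\<lambda>x. weight c x *\<^sub>R cl_dot (radial c l M k a x) (radial c l' N k' a' x))"
    unfolding ae by (rule P(1))
  show "(LINT x|lborel. weight c x *\<^sub>R cl_dot (radial c l M k a x) (radial c l' N k' a' x))
      = (LINT r|lborel. indicator {0<..} r * (r powr ((gamma CARD('n) c l + gamma CARD('n) c l') / 2 + real k + real k' - 1) * a (r\<^sup>2) * a' (r\<^sup>2)))
        *\<^sub>R (LINT x|sphere_measure. cl_dot (vpow k M x) (vpow k' N x))"
    unfolding ae P(2) eq s_def ..
qed

text \<open>The rate \<open>b\<close> stays free because completeness also uses profiles with exp (-
  u / 4).\<close>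

lemma radial_L2:
  fixes M :: "('n::{finite,linorder}) cl_fun"
  assumes c: "c > - 1" and M: "M \<in> monogenics l" and b: "b > 0"
    and a: "\<And>u. a u = poly p u * exp (- b * u)"
  shows "radial c l M k a \<in> L2 c"
proof -
  have [measurable]: "a \<in> borel_measurable borel" unfolding a [abs_def]
    by (intro borel_measurable_continuous_onI continuous_intros)
  have aa: "a u * a u = poly (p * p) u * exp (- (2 * b) * u)" for u
    by (simp add: a exp_add [symmetric] mult_ac)
  have "integrable lborel (\<lambda>x. weight c x *\<^sub>R cl_dot (radial c l M k a x) (radial c l M k a x))"
    using b by (intro radial_polar(1) [OF c M M _ aa]) auto
  then have "integrable lborel (\<lambda>x. Re (weight c x *\<^sub>R cl_dot (radial c l M k a x) (radial c l M k a x)))"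
    by (rule integrable_Re)
  then show ?thesis
    using radial_measurable [OF M, of a c k] by (simp add: L2_iff cl_dot_self)
qed

lemma lag_eq_poly: "lag t g u = poly (laguerre_poly t (g / 2 - 1)) u * exp (- (1 / 2) * u)"
  by (simp add: lag_def laguerre_poly_poly)

lemma phi_profile_eq_poly: "phi_profile c m n l u
    = poly (smult (phi_const c n) (laguerre_poly (n div 2) ((gamma m c l + 2 * real (n mod 2)) / 2 - 1))) u * exp (- (1 / 2) * u)"
  by (simp add: phi_profile_def lag_eq_poly)

lemma phi_L2:
  fixes M :: "nat \<Rightarrow> nat \<Rightarrow> ('n::{finite,linorder}) cl_fun"
  assumes c: "c > - 1" and M: "M l j \<in> monogenics l"
  shows "phi c M n l j \<in> L2 c"
proof -
  have c1: "1 + c \<noteq> 0" using c by simp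
  show ?thesis
    unfolding phi_eq_radial [OF c1] by (rule radial_L2 [OF c M _ phi_profile_eq_poly]) simp
qed

text \<open>A by-product of polar coordinates: \<open>polar_complex\<close> asks for some integrable
  radial profile, and the cutoff provides one.\<close>

lemma sphere_integrable:
  fixes Y :: "real ^ 'n::{finite,linorder} \<Rightarrow> complex"
  assumes "continuous_on UNIV Y" "\<And>s x. Y (s *\<^sub>R x) = s ^ k *\<^sub>R Y x"
  shows "integrable sphere_measure Y"
proof (rule polar_complex(3) [OF assms])
  show "(\<lambda>r. (max 0 (1 - r\<^sup>2)) ^ Suc 0) \<in> borel_measurable (borel :: real measure)" by measurable
  show "integrable lborel (\<lambda>r. indicator {0<..} r * (r ^ (CARD('n) - 1) * ((max 0 (1 - r\<^sup>2)) ^ Suc 0 * r ^ k)) :: real)"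
    by (rule radial_bump_integral)
qed

text \<open>\<open>sphere_inner\<close> contains no complex conjugation; it agrees with the
  Hermitian form because the coefficients of \<open>P\<close> are real.\<close>

lemma sphere_inner_eq:
  fixes P Q :: "('n::{finite,linorder}) cl_fun"
  assumes P: "hom_poly k P" and Q: "hom_poly l Q"
  shows "sphere_inner P Q = (LINT x|sphere_measure. cl_dot (P x) (Q x))"
proof -
  have cnjP: "cl_cnj (P x) = P x" for x
    using P by (auto simp: hom_poly_def cl_cnj_def vec_eq_iff Reals_cnj_iff)
  have "integrable sphere_measure (\<lambda>x. cl_bar (P x) \<odot> Q x)"
  proof (subst cl_integrable_iff, intro allI)
    fix A
    have c: "continuous_on UNIV (\<lambda>x. P x $ B)" "continuous_on UNIV (\<lambda>x. Q x $ B)" for B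
      by (intro continuous_intros hom_poly_continuous [OF P] hom_poly_continuous [OF Q])+
    show "integrable sphere_measure (\<lambda>x. (cl_bar (P x) \<odot> Q x) $ A)"
    proof (rule sphere_integrable)
      have "continuous_on UNIV (\<lambda>x. if sym_diff B C = A then cl_sign B C * ((- 1) ^ (card B * (card B + 1) div 2) * P x $ B) * Q x $ C else 0)" for B C
        by (cases "sym_diff B C = A") (simp_all add: continuous_intros c)
      then have "continuous_on UNIV (\<lambda>x. \<Sum>B\<in>UNIV. \<Sum>C\<in>UNIV. if sym_diff B C = A then cl_sign B C * ((- 1) ^ (card B * (card B + 1) div 2) * P x $ B) * Q x $ C else 0)"
        by (intro continuous_on_sum)
      then show "continuous_on UNIV (\<lambda>x. (cl_bar (P x) \<odot> Q x) $ A)"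
        by (simp add: cl_mult_nth cl_bar_def cong: if_cong sum.cong)
      show "(cl_bar (P (s *\<^sub>R x)) \<odot> Q (s *\<^sub>R x)) $ A = s ^ (k + l) *\<^sub>R (cl_bar (P x) \<odot> Q x) $ A" for s x
      proof -
        have "cl_bar (a *\<^sub>R u) = a *\<^sub>R cl_bar u" for a and u :: "'n cl" by (simp add: cl_bar_def vec_eq_iff)
        then show ?thesis
          using P Q by (simp add: hom_poly_def cl_mult_scaleR_left cl_mult_scaleR_right power_add)
      qed
    qed
  qed
  then show ?thesis
    unfolding sphere_inner_def cl_scalar_def
    using cl_scalar_bar_cnj_mult [of "P _" "Q _", unfolded cl_scalar_def cnjP] by (simp add: cl_integral_nth)
qed

text \<open>On the unit sphere multiplication by x is an isometry, so two factors x cancel; a single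
  one gives 0 by \<open>sphere_orthogonal_vec\<close>.\<close>

lemma sphere_integral_vpow:
  fixes M N :: "('n::{finite,linorder}) cl_fun"
  assumes M: "M \<in> monogenics l" and N: "N \<in> monogenics l'" and k: "k \<le> 1" "k' \<le> 1"
  shows "(LINT x|sphere_measure. cl_dot (vpow k M x) (vpow k' N x)) = (if k = k' then sphere_inner M N else 0)"
    and "l \<noteq> l' \<Longrightarrow> sphere_inner M N = 0"
proof -
  have h: "hom_poly l M" "hom_poly l' N" using M N by (auto simp: monogenics_iff)
  note [measurable] = borel_measurable_continuous_onI [OF hom_poly_continuous [OF h(1)]]
    borel_measurable_continuous_onI [OF hom_poly_continuous [OF h(2)]]
  have 1: "(LINT x|sphere_measure. cl_dot (M x) (cl_vec x \<odot> N x)) = 0" by (rule sphere_orthogonal_vec [OF M N])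
  then have 2: "(LINT x|sphere_measure. cl_dot (cl_vec x \<odot> M x) (N x)) = 0" by (simp add: cl_dot_vec_left)
  have [measurable]: "cl_vec \<in> borel_measurable borel"
    by (intro borel_measurable_continuous_onI linear_continuous_on) (simp add: linear_cl_vec linear_linear)
  have 3: "(LINT x|sphere_measure. cl_dot (cl_vec x \<odot> M x) (cl_vec x \<odot> N x)) = sphere_inner M N"
    unfolding sphere_inner_eq [OF h]
    by (rule integral_cong_AE) (use AE_sphere_measure in \<open>auto simp: cl_dot_vec_vec elim!: eventually_mono\<close>)
  from k have "k = 0 \<or> k = 1" "k' = 0 \<or> k' = 1" by auto
  then show "(LINT x|sphere_measure. cl_dot (vpow k M x) (vpow k' N x)) = (if k = k' then sphere_inner M N else 0)"
    using 1 2 3 sphere_inner_eq [OF h] by (auto simp: vpow_def)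
  show "sphere_inner M N = 0" if "l \<noteq> l'"
    unfolding sphere_inner_eq [OF h] by (rule sphere_orthogonal_degree [OF M N that])
qed

lemma inner_phi:
  fixes M :: "nat \<Rightarrow> nat \<Rightarrow> ('n::{finite,linorder}) cl_fun"
  assumes c: "c > - 1" and M: "M l j \<in> monogenics l" "M l' j' \<in> monogenics l'"
  shows "inner_c c (phi c M n l j) (phi c M n' l' j')
    = (LINT r|lborel. indicator {0<..} r * (r powr ((gamma CARD('n) c l + gamma CARD('n) c l') / 2 + real (n mod 2) + real (n' mod 2) - 1)
         * phi_profile c CARD('n) n l (r\<^sup>2) * phi_profile c CARD('n) n' l' (r\<^sup>2)))
      *\<^sub>R (if n mod 2 = n' mod 2 then sphere_inner (M l j) (M l' j') else 0)"
proof -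
  have c1: "1 + c \<noteq> 0" using c by simp
  have "\<exists>p. \<forall>u. phi_profile c CARD('n) n l u * phi_profile c CARD('n) n' l' u = poly p u * exp (- 1 * u)"
  proof -
    have e: "exp (- (1 / 2) * u) * exp (- (1 / 2) * u) = exp (- 1 * u)" for u :: real by (simp add: exp_add [symmetric])
    have E: "(a * exp (- (1 / 2) * u)) * (b * exp (- (1 / 2) * u)) = a * b * exp (- 1 * u)" for a b u :: real
      unfolding e [symmetric] by (simp only: mult_ac)
    show ?thesis
      unfolding phi_profile_eq_poly E poly_mult [symmetric] by blast
  qed
  then obtain p where p: "\<And>u. phi_profile c CARD('n) n l u * phi_profile c CARD('n) n' l' u = poly p u * exp (- 1 * u)" by blast
  have [measurable]: "phi_profile c CARD('n) n l \<in> borel_measurable borel" for n l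
    unfolding phi_profile_eq_poly [abs_def] by (intro borel_measurable_continuous_onI continuous_intros)
  have k: "n mod 2 \<le> 1" "n' mod 2 \<le> 1" by auto
  show ?thesis
    unfolding phi_eq_radial [OF c1] inner_c_eq [OF phi_L2 [where M = M, OF c M(1), of n, unfolded phi_eq_radial [OF c1]]
      phi_L2 [where M = M, OF c M(2), of n', unfolded phi_eq_radial [OF c1]]]
    by (subst radial_polar(2) [OF c M _ p]) (simp_all only: sphere_integral_vpow(1) [OF M k] zero_less_one, simp_all)
qed

text \<open>Different parities and different pairs (l, j) are separated on the sphere. If they
  agree, the halves n div 2 differ and the Laguerre functions have the same parameter, so the radial
  factor vanishes.\<close>

lemma phi_orthogonal:
  fixes M :: "nat \<Rightarrow> nat \<Rightarrow> ('n::{finite,linorder}) cl_fun"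
  assumes c: "c > - 1" and M: "\<And>l. monogenic_orthonormal_basis l (d l) (M l)"
    and j: "j \<in> {1..d l}" "j' \<in> {1..d l'}" and ne: "(n, l, j) \<noteq> (n', l', j')"
  shows "inner_c c (phi c M n l j) (phi c M n' l' j') = 0"
proof -
  have m: "M l j \<in> monogenics l" "M l' j' \<in> monogenics l'"
    using M j by (auto simp: monogenic_orthonormal_basis_def)
  have S: "sphere_inner (M l j) (M l' j') = 0" if "(l, j) \<noteq> (l', j')"
  proof (cases "l = l'")
    case True
    then show ?thesis using M [of l] j that by (auto simp: monogenic_orthonormal_basis_def)
  next
    case False
    then show ?thesis by (rule sphere_integral_vpow(2) [OF m, of 0 0, simplified])
  qed
  show ?thesis
  proof (cases "(l, j) = (l', j') \<and> n mod 2 = n' mod 2")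
    case False
    then show ?thesis unfolding inner_phi [OF c m] using S by auto
  next
    case True
    then have t: "n div 2 \<noteq> n' div 2" using ne by (metis div_mult_mod_eq prod.inject)
    let ?g = "gamma CARD('n) c l + 2 * real (n mod 2)"
    have "?g > 0" using gamma_pos [OF c, of "CARD('n)" l] by (intro add_pos_nonneg) auto
    from laguerre_orthogonal [OF this t [symmetric]]
    have z: "(LINT r|lborel. indicator {0<..} r * (r powr (?g - 1) * lag (n div 2) ?g (r\<^sup>2) * lag (n' div 2) ?g (r\<^sup>2))) = 0" .
    have e: "(gamma CARD('n) c l + gamma CARD('n) c l') / 2 + real (n mod 2) + real (n' mod 2) - 1 = ?g - 1" using True by simp
    have "indicator {0<..} r * (r powr (?g - 1) * phi_profile c CARD('n) n l (r\<^sup>2) * phi_profile c CARD('n) n' l' (r\<^sup>2))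
      = (phi_const c n * phi_const c n') * (indicator {0<..} r * (r powr (?g - 1) * lag (n div 2) ?g (r\<^sup>2) * lag (n' div 2) ?g (r\<^sup>2)))" for r :: real
      using True by (simp add: phi_profile_def mult_ac)
    then have "(LINT r|lborel. indicator {0<..} r * (r powr (?g - 1) * phi_profile c CARD('n) n l (r\<^sup>2) * phi_profile c CARD('n) n' l' (r\<^sup>2))) = 0"
      by (simp only: integral_mult_right_zero z mult_zero_right)
    then show ?thesis unfolding inner_phi [OF c m] e by simp
  qed
qed

text \<open>The squared norm integrates the square of a nonzero polynomial times an exponential
  against a positive density, and such a profile vanishes at finitely many radii only.\<close>

lemma phi_norm_nonzero:
  fixes M :: "nat \<Rightarrow> nat \<Rightarrow> ('n::{finite,linorder}) cl_fun"
  assumes c: "c > - 1" and M: "\<And>l. monogenic_orthonormal_basis l (d l) (M l)" and j: "j \<in> {1..d l}"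
  shows "norm_c c (phi c M n l j) \<noteq> 0"
proof
  assume z: "norm_c c (phi c M n l j) = 0"
  have m: "M l j \<in> monogenics l" using M j by (auto simp: monogenic_orthonormal_basis_def)
  have S: "sphere_inner (M l j) (M l j) = 1" using M [of l] j by (auto simp: monogenic_orthonormal_basis_def)
  have c1: "1 + c \<noteq> 0" using c by simp
  let ?m = "CARD('n)"
  let ?p = "smult (phi_const c n) (laguerre_poly (n div 2) ((gamma ?m c l + 2 * real (n mod 2)) / 2 - 1))"
  define f where "f r = indicator {0<..} r * (r powr ((gamma ?m c l + gamma ?m c l) / 2 + real (n mod 2) + real (n mod 2) - 1)
         * phi_profile c ?m n l (r\<^sup>2) * phi_profile c ?m n l (r\<^sup>2))" for r :: real
  have f_eq: "f r = indicator {0<..} r * (r powr ((gamma ?m c l + 2 * real (n mod 2)) - 1) * poly (?p * ?p) (r\<^sup>2) * exp (- 1 * r\<^sup>2))" for r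
  proof -
    have "exp (- 1 * r\<^sup>2) = exp (- (1 / 2) * r\<^sup>2) * exp (- (1 / 2) * r\<^sup>2)" by (simp add: exp_add [symmetric])
    moreover have "(gamma ?m c l + gamma ?m c l) / 2 + real (n mod 2) + real (n mod 2) - 1 = (gamma ?m c l + 2 * real (n mod 2)) - 1"
      by simp
    ultimately show ?thesis unfolding f_def phi_profile_eq_poly by (simp only: poly_mult mult_ac)
  qed
  have int: "integrable lborel f"
    unfolding f_eq [abs_def] using gamma_pos [OF c, of ?m l]
    by (intro integrable_powr_poly_exp) (auto intro!: add_pos_nonneg)
  have nonneg: "0 \<le> f r" for r by (simp add: f_def mult.assoc)
  have "inner_c c (phi c M n l j) (phi c M n l j) = 0"
    using inner_c_self_norm [OF phi_L2 [where M = M, OF c m], of n] z by simp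
  then have "(LINT r|lborel. f r) = 0"
    unfolding inner_phi [where M = M, OF c m m] S f_def by simp
  then have "AE r in lborel. f r = 0"
    using nonneg by (subst (asm) integral_nonneg_eq_0_iff_AE [OF int]) auto
  moreover have "?p \<noteq> 0"
  proof -
    have "coeff (laguerre_poly (n div 2) ((gamma ?m c l + 2 * real (n mod 2)) / 2 - 1)) (n div 2) \<noteq> 0"
      by (simp add: coeff_laguerre_poly)
    moreover have "phi_const c n \<noteq> 0" using c1 by (simp add: phi_const_def)
    ultimately show ?thesis by (metis coeff_0 smult_eq_0_iff)
  qed
  then have "finite {u. poly ?p u = 0}" by (rule poly_roots_finite)
  \<comment> \<open>The roots are roots in u = r^2; the corresponding radii still form a null
    set.\<close>
  then have "finite (sqrt ` {u. poly ?p u = 0})" by simp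
  then have "AE r in lborel. r \<notin> sqrt ` {u. poly ?p u = 0}"
    by (intro AE_not_in) (simp add: finite_imp_null_set_lborel)
  ultimately have "AE r in lborel. r \<notin> {0<..<1::real}"
  proof eventually_elim
    case (elim r)
    show ?case
    proof
      assume r: "r \<in> {0<..<1}"
      then have "poly ?p (r\<^sup>2) = 0" using elim(1) by (simp add: f_eq)
      moreover have "r = sqrt (r\<^sup>2)" using r by simp
      ultimately show False using elim(2) by blast
    qed
  qed
  then have "emeasure lborel {0<..<1::real} = 0"
    by (subst (asm) AE_iff_measurable [of "{0<..<1::real}"]) auto
  then show False by simp
qed

section \<open>Completeness of the basis functions\<close>

text \<open>Stone--Weierstrass passes from polynomials to continuous functions, distance functions
  approximate indicators of closed sets, and a Dynkin argument reaches all Borel sets. Uniqueness of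
  densities then applies to the real and imaginary parts.\<close>

lemma AE_zero_if_orthogonal_to_polynomials:
  fixes F :: "'a::euclidean_space \<Rightarrow> complex"
  assumes F: "integrable lborel F" and S: "compact S" and supp: "\<And>x. x \<notin> S \<Longrightarrow> F x = 0"
    and zero: "\<And>p. real_polynomial_function p \<Longrightarrow> (LINT x|lborel. p x *\<^sub>R F x) = 0"
  shows "AE x in lborel. F x = 0"
proof -
  note [measurable] = borel_measurable_integrable [OF F]
  have int: "integrable lborel (\<lambda>x. g x *\<^sub>R F x)" if "g \<in> borel_measurable borel" "\<And>x. \<bar>g x\<bar> \<le> B" for g B
  proof (rule Bochner_Integration.integrable_bound)
    show "integrable lborel (\<lambda>x. B *\<^sub>R F x)" using F by simp
    show "(\<lambda>x. g x *\<^sub>R F x) \<in> borel_measurable lborel" using that by measurable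
    show "AE x in lborel. norm (g x *\<^sub>R F x) \<le> norm (B *\<^sub>R F x)"
      using that(2) by (intro AE_I2) (auto intro!: mult_right_mono order_trans [OF that(2)])
  qed
  have cont: "(LINT x|lborel. g x *\<^sub>R F x) = 0" if g: "continuous_on UNIV g" for g
  proof -
    have "cmod (LINT x|lborel. g x *\<^sub>R F x) \<le> 0"
    proof (rule field_le_epsilon)
      fix e :: real assume "e > 0"
      \<comment> \<open>The tolerance is divided by I + 1, which is positive even if
        \<open>F\<close> vanishes almost everywhere.\<close>
      define I where "I = (LINT x|lborel. cmod (F x))"
      have I: "I \<ge> 0" by (simp add: I_def)
      obtain p where p: "real_polynomial_function p" "\<And>x. x \<in> S \<Longrightarrow> \<bar>g x - p x\<bar> < e / (I + 1)"
        using Stone_Weierstrass_real_polynomial_function [OF S continuous_on_subset [OF g], of "e / (I + 1)"] I \<open>e > 0\<close>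
        by (auto simp: add_nonneg_pos)
      have cp: "continuous_on UNIV p" using p(1) by (simp add: continuous_on_polymonial_function flip: real_polynomial_function_eq)
      have ints: "integrable lborel (\<lambda>x. h x *\<^sub>R F x)" if h: "continuous_on UNIV h" for h
      proof -
        have "compact (h ` S)" by (intro compact_continuous_image continuous_on_subset [OF h] S) auto
        from compact_imp_bounded [OF this] obtain B where B: "\<forall>y\<in>h ` S. \<bar>y\<bar> \<le> B" unfolding bounded_iff by auto
        have [measurable]: "S \<in> sets borel" using S by (intro borel_compact)
        have "integrable lborel (\<lambda>x. (indicator S x * h x) *\<^sub>R F x)"
          using B borel_measurable_continuous_onI [OF h]
          by (intro int [where B = "max B 0"]) (auto simp: indicator_def le_max_iff_disj)
        moreover have "(indicator S x * h x) *\<^sub>R F x = h x *\<^sub>R F x" for x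
          using supp [of x] by (auto simp: indicator_def)
        ultimately show ?thesis by (simp only:)
      qed
      have "(LINT x|lborel. g x *\<^sub>R F x) = (LINT x|lborel. g x *\<^sub>R F x - p x *\<^sub>R F x)"
        using zero [OF p(1)] by (simp add: Bochner_Integration.integral_diff ints g cp)
      also have "cmod \<dots> \<le> (LINT x|lborel. e / (I + 1) * cmod (F x))"
      proof (rule order_trans [OF integral_norm_bound integral_mono])
        show "integrable lborel (\<lambda>x. norm (g x *\<^sub>R F x - p x *\<^sub>R F x))" by (intro integrable_norm Bochner_Integration.integrable_diff ints g cp)
        show "integrable lborel (\<lambda>x. e / (I + 1) * cmod (F x))" using F by (intro integrable_mult_right integrable_norm)
        show "norm (g x *\<^sub>R F x - p x *\<^sub>R F x) \<le> e / (I + 1) * cmod (F x)" for x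
        proof (cases "x \<in> S")
          case True
          have "norm (g x *\<^sub>R F x - p x *\<^sub>R F x) = \<bar>g x - p x\<bar> * cmod (F x)" by (simp flip: scaleR_diff_left)
          also have "\<dots> \<le> e / (I + 1) * cmod (F x)" using p(2) [OF True] by (intro mult_right_mono) auto
          finally show ?thesis .
        qed (use supp in simp)
      qed
      also have "\<dots> = e / (I + 1) * I" by (simp add: I_def)
      also have "\<dots> \<le> e" using I \<open>e > 0\<close> by (simp add: field_simps)
      finally show "cmod (LINT x|lborel. g x *\<^sub>R F x) \<le> 0 + e" by simp
    qed
    then show ?thesis by simp
  qed
  have closed: "(LINT x|lborel. indicator C x *\<^sub>R F x) = 0" if C: "closed C" for C :: "'a set"
  proof (cases "C = {}")
    case False
    have [measurable]: "C \<in> sets borel" using C by (rule borel_closed)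
    \<comment> \<open>A continuous function equal to 1 on \<open>C\<close> that dies out at distance
      1 / n; closedness of \<open>C\<close> makes the distance positive outside.\<close>
    define g where "g n x = max 0 (1 - real n * infdist x C)" for n x
    have gc: "continuous_on UNIV (g n)" for n unfolding g_def by (intro continuous_intros)
    have "(\<lambda>n. LINT x|lborel. g n x *\<^sub>R F x) \<longlonglongrightarrow> (LINT x|lborel. indicator C x *\<^sub>R F x)"
    proof (rule integral_dominated_convergence)
      show "integrable lborel (\<lambda>x. cmod (F x))" using F by (rule integrable_norm)
      show "AE x in lborel. norm (g n x *\<^sub>R F x) \<le> cmod (F x)" for n
        by (intro AE_I2) (auto simp: g_def infdist_nonneg intro!: mult_left_le_one_le)
      show "AE x in lborel. (\<lambda>n. g n x *\<^sub>R F x) \<longlonglongrightarrow> indicator C x *\<^sub>R F x"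
      proof (intro AE_I2 tendsto_scaleR tendsto_const)
        fix x
        show "(\<lambda>n. g n x) \<longlonglongrightarrow> indicator C x"
        proof (cases "x \<in> C")
          case True
          then show ?thesis by (simp add: g_def)
        next
          case False
          then have d: "infdist x C > 0" using C \<open>C \<noteq> {}\<close> infdist_pos_not_in_closed by blast
          obtain n0 where n0: "1 / infdist x C < real n0" using reals_Archimedean2 by blast
          have "g n x = 0" if "n \<ge> n0" for n
          proof -
            have "1 < real n0 * infdist x C" using n0 d by (simp add: field_simps)
            also have "\<dots> \<le> real n * infdist x C" using that d by (intro mult_right_mono) auto
            finally show ?thesis by (simp add: g_def)
          qed
          then show ?thesis using False
            by (intro tendsto_eventually eventually_sequentiallyI [of n0]) simp
        qed
      qed
      show "(\<lambda>x. indicator C x *\<^sub>R F x) \<in> borel_measurable lborel" by measurable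
      show "(\<lambda>x. g n x *\<^sub>R F x) \<in> borel_measurable lborel" for n
        using borel_measurable_continuous_onI [OF gc [of n]] by measurable
    qed
    then show ?thesis unfolding cont [OF gc] by (simp add: LIMSEQ_const_iff)
  qed simp
  have all: "(LINT x|lborel. indicator A x *\<^sub>R F x) = 0" if "A \<in> sets borel" for A
  proof -
    have "Int_stable (Collect closed :: 'a set set)" "Collect closed \<subseteq> Pow (UNIV :: 'a set)"
      by (auto simp: Int_stable_def)
    moreover have "A \<in> sigma_sets UNIV (Collect closed)" using that by (simp add: borel_eq_closed)
    ultimately show ?thesis
    proof (induction rule: sigma_sets_induct_disjoint)
      fix A :: "'a set" assume "A \<in> Collect closed" then show "(LINT x|lborel. indicator A x *\<^sub>R F x) = 0" by (simp add: closed)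
    next
      show "(LINT x|lborel. indicator {} x *\<^sub>R F x) = 0" by simp
    next
      fix A :: "'a set" assume "A \<in> sigma_sets UNIV (Collect closed)" and IH: "(LINT x|lborel. indicator A x *\<^sub>R F x) = 0"
      then have [measurable]: "A \<in> sets borel" by (simp add: borel_eq_closed)
      have "indicator (UNIV - A) x *\<^sub>R F x = F x - indicator A x *\<^sub>R F x" for x by (simp add: indicator_def)
      then have "(LINT x|lborel. indicator (UNIV - A) x *\<^sub>R F x) = (LINT x|lborel. F x) - (LINT x|lborel. indicator A x *\<^sub>R F x)"
        using int [of "indicator A" 1] F by (simp add: Bochner_Integration.integral_diff indicator_def)
      then show "(LINT x|lborel. indicator (UNIV - A) x *\<^sub>R F x) = 0"
        using IH cont [of "\<lambda>_. 1"] by simp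
    next
      fix A :: "nat \<Rightarrow> 'a set"
      assume d: "disjoint_family A" and r: "range A \<subseteq> sigma_sets UNIV (Collect closed)"
        and IH: "\<And>i. (LINT x|lborel. indicator (A i) x *\<^sub>R F x) = 0"
      have A [measurable]: "A i \<in> sets borel" for i using r by (auto simp: borel_eq_closed)
      have "(\<lambda>n. LINT x|lborel. indicator (\<Union>i<n. A i) x *\<^sub>R F x) \<longlonglongrightarrow> (LINT x|lborel. indicator (\<Union>i. A i) x *\<^sub>R F x)"
      proof (rule integral_dominated_convergence)
        show "integrable lborel (\<lambda>x. cmod (F x))" using F by (rule integrable_norm)
        show "AE x in lborel. norm (indicator (\<Union>i<n. A i) x *\<^sub>R F x) \<le> cmod (F x)" for n
          by (intro AE_I2) (auto simp: indicator_def)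
        show "AE x in lborel. (\<lambda>n. indicator (\<Union>i<n. A i) x *\<^sub>R F x) \<longlonglongrightarrow> indicator (\<Union>i. A i) x *\<^sub>R F x"
          by (intro AE_I2 tendsto_scaleR tendsto_const LIMSEQ_indicator_UN)
      qed measurable
      moreover have "(LINT x|lborel. indicator (\<Union>i<n. A i) x *\<^sub>R F x) = 0" for n
      proof -
        have e: "indicator (\<Union>i<n. A i) x *\<^sub>R F x = (\<Sum>i<n. indicator (A i) x *\<^sub>R F x)" for x
        proof -
          have "(indicator (\<Union>i<n. A i) x :: real) = (\<Sum>i<n. indicator (A i) x)"
            by (rule indicator_UN_disjoint) (use d in \<open>auto simp: disjoint_family_on_def\<close>)
          then show ?thesis by (simp add: scaleR_sum_left)
        qed
        have "integrable lborel (\<lambda>x. indicator (A i) x *\<^sub>R F x)" for i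
          by (rule int [where B = 1]) (auto simp: indicator_def)
        then have "(LINT x|lborel. (\<Sum>i<n. indicator (A i) x *\<^sub>R F x)) = (\<Sum>i<n. (LINT x|lborel. indicator (A i) x *\<^sub>R F x))"
          by (rule Bochner_Integration.integral_sum)
        then show ?thesis unfolding e IH by (simp only: sum.neutral_const)
      qed
      ultimately show "(LINT x|lborel. indicator (\<Union>i. A i) x *\<^sub>R F x) = 0" by (simp add: LIMSEQ_const_iff)
    qed
  qed
  have part: "AE x in lborel. T (F x) = 0" if T: "bounded_linear T" for T :: "complex \<Rightarrow> real"
  proof (rule density_unique_real)
    show "integrable lborel (\<lambda>x. T (F x))" using T F by (rule integrable_bounded_linear)
    fix A assume "A \<in> sets (lborel :: 'a measure)"
    then have A [measurable]: "A \<in> sets borel" by simp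
    have i: "integrable lborel (\<lambda>x. indicator A x *\<^sub>R F x)"
      by (rule int [where B = 1]) (auto simp: indicator_def)
    have "(LINT x|lborel. T (indicator A x *\<^sub>R F x)) = T (LINT x|lborel. indicator A x *\<^sub>R F x)"
      by (rule integral_bounded_linear [OF T i])
    then have "(LINT x|lborel. T (indicator A x *\<^sub>R F x)) = 0"
      using all [OF A] T by (simp add: linear_0 bounded_linear.linear)
    then show "(LINT x:A|lborel. T (F x)) = (LINT x:A|lborel. 0)"
      by (simp add: set_lebesgue_integral_def linear_scale [OF bounded_linear.linear [OF T]])
  qed simp
  from part [OF bounded_linear_Re] part [OF bounded_linear_Im] show ?thesis
    by eventually_elim (simp add: complex_eq_iff)
qed

text \<open>Vanishing exponential moments propagate: expanding \<open>exp (- u / 4)\<close> in powers of \<open>u\<close> shifts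
  the exponent by \<open>1 / 4\<close>.\<close>

lemma exponential_moments_zero:
  fixes G :: "'a::euclidean_space \<Rightarrow> complex" and u :: "'a \<Rightarrow> real"
  assumes G [measurable]: "G \<in> borel_measurable borel" and u [measurable]: "u \<in> borel_measurable borel" and u0: "\<And>x. 0 \<le> u x"
    and int: "\<And>i. integrable lborel (\<lambda>x. (u x ^ i * exp (u x / 4)) *\<^sub>R G x)"
    and zero: "\<And>i. (LINT x|lborel. u x ^ i *\<^sub>R G x) = 0"
  shows "(LINT x|lborel. (u x ^ i * exp (- real n * (u x / 4))) *\<^sub>R G x) = 0"
proof (induction n arbitrary: i)
  case 0
  then show ?case using zero by simp
next
  case (Suc n)
  have dom: "integrable lborel (\<lambda>x. (u x ^ i * h x) *\<^sub>R G x)"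
    if [measurable]: "h \<in> borel_measurable borel" and h: "\<And>x. \<bar>h x\<bar> \<le> exp (u x / 4)" for h i
  proof (rule Bochner_Integration.integrable_bound [OF int [of i]])
    show "AE x in lborel. norm ((u x ^ i * h x) *\<^sub>R G x) \<le> norm ((u x ^ i * exp (u x / 4)) *\<^sub>R G x)"
      using h u0 by (intro AE_I2) (auto simp: abs_mult intro!: mult_right_mono mult_left_mono)
  qed measurable
  let ?e = "\<lambda>x. exp (- real n * (u x / 4))"
  define p where "p N x = (\<Sum>j<N. (- (u x / 4)) ^ j / fact j)" for N x
  have p_meas [measurable]: "p N \<in> borel_measurable borel" for N unfolding p_def by measurable
  have e1: "0 \<le> ?e x" "?e x \<le> 1" for x using u0 by auto
  have exp_sums: "(\<lambda>j. z ^ j / fact j) sums exp z" for z :: real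
    using exp_converges [of z] by (simp add: divide_inverse mult.commute)
  \<comment> \<open>All partial sums of the series lie below exp (u / 4) in modulus, exactly the
    growth that \<open>int\<close> permits.\<close>
  have p_bound: "\<bar>p N x\<bar> \<le> exp (u x / 4)" for N x
  proof -
    have "\<bar>p N x\<bar> \<le> (\<Sum>j<N. \<bar>(- (u x / 4)) ^ j / fact j\<bar>)" unfolding p_def by (rule sum_abs)
    also have "\<dots> = (\<Sum>j<N. (u x / 4) ^ j / fact j)" using u0 by (simp add: power_abs)
    also have "\<dots> \<le> (\<Sum>j. (u x / 4) ^ j / fact j)"
      by (rule sum_le_suminf [OF sums_summable [OF exp_sums]]) (use u0 in simp_all)
    also have "\<dots> = exp (u x / 4)" by (rule sums_unique [OF exp_sums, symmetric])
    finally show ?thesis .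
  qed
  have lim: "(\<lambda>N. LINT x|lborel. (u x ^ i * (?e x * p N x)) *\<^sub>R G x)
      \<longlonglongrightarrow> (LINT x|lborel. (u x ^ i * (?e x * exp (- (u x / 4)))) *\<^sub>R G x)"
  proof (rule integral_dominated_convergence)
    show "integrable lborel (\<lambda>x. norm ((u x ^ i * exp (u x / 4)) *\<^sub>R G x))" using int by (rule integrable_norm)
    show "AE x in lborel. norm ((u x ^ i * (?e x * p N x)) *\<^sub>R G x) \<le> norm ((u x ^ i * exp (u x / 4)) *\<^sub>R G x)" for N
    proof (rule AE_I2)
      fix x
      have "\<bar>?e x * p N x\<bar> \<le> 1 * exp (u x / 4)" unfolding abs_mult using e1 [of x] p_bound [of N x] by (intro mult_mono) auto
      then show "norm ((u x ^ i * (?e x * p N x)) *\<^sub>R G x) \<le> norm ((u x ^ i * exp (u x / 4)) *\<^sub>R G x)"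
        using u0 [of x] by (auto simp: abs_mult intro!: mult_right_mono mult_left_mono)
    qed
    show "AE x in lborel. (\<lambda>N. (u x ^ i * (?e x * p N x)) *\<^sub>R G x) \<longlonglongrightarrow> (u x ^ i * (?e x * exp (- (u x / 4)))) *\<^sub>R G x"
    proof (intro AE_I2 tendsto_intros)
      fix x
      have "(\<lambda>j. (- (u x / 4)) ^ j / fact j) sums exp (- (u x / 4))"
        by (rule exp_sums)
      then show "(\<lambda>N. p N x) \<longlonglongrightarrow> exp (- (u x / 4))" by (simp add: sums_def p_def)
    qed
  qed measurable
  moreover have "(LINT x|lborel. (u x ^ i * (?e x * p N x)) *\<^sub>R G x) = 0" for N
  proof -
    have e: "(u x ^ i * (?e x * p N x)) *\<^sub>R G x = (\<Sum>j<N. ((- 1 / 4) ^ j / fact j) *\<^sub>R ((u x ^ (i + j) * ?e x) *\<^sub>R G x))" for x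
    proof -
      have "u x ^ i * (?e x * p N x) = (\<Sum>j<N. ((- 1 / 4) ^ j / fact j) * (u x ^ (i + j) * ?e x))"
        unfolding p_def sum_distrib_left
      proof (intro sum.cong refl)
        fix j
        have "(- (u x / 4)) ^ j = (- 1 / 4) ^ j * u x ^ j" by (simp add: power_mult_distrib [symmetric])
        then show "u x ^ i * (?e x * ((- (u x / 4)) ^ j / fact j)) = ((- 1 / 4) ^ j / fact j) * (u x ^ (i + j) * ?e x)"
          by (simp add: power_add)
      qed
      then show ?thesis by (simp add: scaleR_sum_left)
    qed
    have i: "integrable lborel (\<lambda>x. (u x ^ j * ?e x) *\<^sub>R G x)" for j
    proof (rule dom)
      show "\<bar>?e x\<bar> \<le> exp (u x / 4)" for x using e1 [of x] u0 [of x] one_le_exp_iff [of "u x / 4"] by linarith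
    qed measurable
    have "(LINT x|lborel. (\<Sum>j<N. ((- 1 / 4) ^ j / fact j) *\<^sub>R ((u x ^ (i + j) * ?e x) *\<^sub>R G x)))
      = (\<Sum>j<N. (LINT x|lborel. ((- 1 / 4) ^ j / fact j) *\<^sub>R ((u x ^ (i + j) * ?e x) *\<^sub>R G x)))"
      by (rule Bochner_Integration.integral_sum) (intro integrable_scaleR_right i)
    then show ?thesis
      unfolding e by (simp only: integral_scaleR_right Suc.IH scaleR_zero_right sum.neutral_const)
  qed
  ultimately have "(LINT x|lborel. (u x ^ i * (?e x * exp (- (u x / 4)))) *\<^sub>R G x) = 0"
    by (simp add: LIMSEQ_const_iff)
  moreover have "?e x * exp (- (u x / 4)) = exp (- real (Suc n) * (u x / 4))" for x
    by (simp add: exp_add [symmetric] algebra_simps)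
  ultimately show ?case by simp
qed

text \<open>By Weierstrass a continuous function of y = exp (- u / 4) on [0, 1] is a uniform limit
  of polynomials in y, and \<open>exponential_moments_zero\<close> annihilates every power of
  y.\<close>

lemma compact_support_moments_zero:
  fixes G :: "'a::euclidean_space \<Rightarrow> complex" and u :: "'a \<Rightarrow> real"
  assumes G [measurable]: "G \<in> borel_measurable borel" and u [measurable]: "u \<in> borel_measurable borel" and u0: "\<And>x. 0 \<le> u x"
    and int: "\<And>i. integrable lborel (\<lambda>x. (u x ^ i * exp (u x / 4)) *\<^sub>R G x)"
    and zero: "\<And>i. (LINT x|lborel. u x ^ i *\<^sub>R G x) = 0"
    and X: "continuous_on UNIV X" and b: "\<And>v. v \<ge> b \<Longrightarrow> X v = 0"
  shows "(LINT x|lborel. X (u x) *\<^sub>R G x) = 0"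
proof -
  \<comment> \<open>\<open>q\<close> is \<open>X\<close> in the variable y = exp (- v / 4). The
    \<open>max\<close> keeps the logarithm away from 0; it freezes the argument at \<open>b\<close>,
    where \<open>X\<close> is already 0, so \<open>q\<close> is continuous on all of [0, 1].\<close>
  define q where "q y = X (- 4 * ln (max y (exp (- b / 4))))" for y
  have q: "continuous_on {0..1} q" unfolding q_def
    by (intro continuous_on_compose2 [OF X] continuous_intros) (auto simp: max_def)
  have qX: "q (exp (- (u x / 4))) = X (u x)" for x
  proof (cases "u x \<le> b")
    case True
    then have "max (exp (- (u x / 4))) (exp (- b / 4)) = exp (- (u x / 4))" by (simp add: max_def)
    then show ?thesis by (simp add: q_def)
  next
    case False
    then have "max (exp (- (u x / 4))) (exp (- b / 4)) = exp (- b / 4)" by (simp add: max_def)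
    then have "q (exp (- (u x / 4))) = X b" by (simp add: q_def)
    then show ?thesis using b [of b] b [of "u x"] False by simp
  qed
  have intG: "integrable lborel G"
  proof (rule Bochner_Integration.integrable_bound [OF int [of 0]])
    show "AE x in lborel. norm (G x) \<le> norm ((u x ^ 0 * exp (u x / 4)) *\<^sub>R G x)"
      using u0 by (intro AE_I2) (auto intro!: mult_left_le_imp_le simp: mult_le_cancel_right1)
  qed simp
  have ints: "integrable lborel (\<lambda>x. h (exp (- (u x / 4))) *\<^sub>R G x)" if h: "continuous_on {0..1} h" for h
  proof -
    have "compact (h ` {0..1})" using h by (intro compact_continuous_image) auto
    from compact_imp_bounded [OF this] obtain B where B: "\<forall>y\<in>h ` {0..1}. \<bar>y\<bar> \<le> B" unfolding bounded_iff by auto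
    have "continuous_on UNIV (\<lambda>v. h (min (max v 0) 1))"
      by (intro continuous_on_compose2 [OF h] continuous_intros) auto
    note m = borel_measurable_continuous_onI [OF this]
    have e: "exp (- (u x / 4)) \<in> {0..1}" for x using u0 [of x] by simp
    have "h (exp (- (u x / 4))) = h (min (max (exp (- (u x / 4))) 0) 1)" for x using e [of x] by (simp add: max_def min_def)
    then have meas [measurable]: "(\<lambda>x. h (exp (- (u x / 4)))) \<in> borel_measurable borel"
      using measurable_compose [OF _ m, of "\<lambda>x. exp (- (u x / 4))" borel] by simp
    show ?thesis
    proof (rule Bochner_Integration.integrable_bound)
      show "integrable lborel (\<lambda>x. B *\<^sub>R G x)" using intG by simp
      show "AE x in lborel. norm (h (exp (- (u x / 4))) *\<^sub>R G x) \<le> norm (B *\<^sub>R G x)"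
      proof (rule AE_I2)
        fix x
        have "\<bar>h (exp (- (u x / 4)))\<bar> \<le> \<bar>B\<bar>" using B [rule_format, OF imageI [OF e [of x]]] by linarith
        then show "norm (h (exp (- (u x / 4))) *\<^sub>R G x) \<le> norm (B *\<^sub>R G x)" by (simp add: mult_right_mono)
      qed
    qed measurable
  qed
  have "cmod (LINT x|lborel. q (exp (- (u x / 4))) *\<^sub>R G x) \<le> 0"
  proof (rule field_le_epsilon)
    fix e :: real assume "e > 0"
    define I where "I = (LINT x|lborel. cmod (G x))"
    have I: "I \<ge> 0" by (simp add: I_def)
    obtain p where p: "real_polynomial_function p" "\<And>y. y \<in> {0..1} \<Longrightarrow> \<bar>q y - p y\<bar> < e / (I + 1)"
      using Stone_Weierstrass_real_polynomial_function [OF _ q, of "e / (I + 1)"] I \<open>e > 0\<close>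
      by (auto simp: add_nonneg_pos)
    then obtain a n where a: "p = (\<lambda>y. \<Sum>i\<le>n. a i * y ^ i)"
      using real_polynomial_function_imp_sum by blast
    have cp: "continuous_on {0..1} p" unfolding a by (intro continuous_intros)
    have e: "p (exp (- (u x / 4))) *\<^sub>R G x = (\<Sum>i\<le>n. a i *\<^sub>R ((u x ^ 0 * exp (- real i * (u x / 4))) *\<^sub>R G x))" for x
      unfolding a by (simp add: scaleR_sum_left exp_of_nat_mult [symmetric])
    have i: "integrable lborel (\<lambda>x. (u x ^ 0 * exp (- real i * (u x / 4))) *\<^sub>R G x)" for i
    proof -
      have "continuous_on {0..1} (\<lambda>y::real. y ^ i)" by (intro continuous_intros)
      from ints [OF this] show ?thesis by (simp add: exp_of_nat_mult [symmetric])
    qed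
    have z: "(LINT x|lborel. (u x ^ 0 * exp (- real i * (u x / 4))) *\<^sub>R G x) = 0" for i
      by (rule exponential_moments_zero [OF G u u0 int zero])
    have "(LINT x|lborel. (\<Sum>i\<le>n. a i *\<^sub>R ((u x ^ 0 * exp (- real i * (u x / 4))) *\<^sub>R G x)))
      = (\<Sum>i\<le>n. (LINT x|lborel. a i *\<^sub>R ((u x ^ 0 * exp (- real i * (u x / 4))) *\<^sub>R G x)))"
      by (rule Bochner_Integration.integral_sum) (intro integrable_scaleR_right i)
    then have pz: "(LINT x|lborel. p (exp (- (u x / 4))) *\<^sub>R G x) = 0"
      unfolding e by (simp only: integral_scaleR_right z scaleR_zero_right sum.neutral_const)
    have "(LINT x|lborel. q (exp (- (u x / 4))) *\<^sub>R G x) = (LINT x|lborel. q (exp (- (u x / 4))) *\<^sub>R G x - p (exp (- (u x / 4))) *\<^sub>R G x)"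
      using pz by (simp add: Bochner_Integration.integral_diff ints q cp)
    also have "cmod \<dots> \<le> (LINT x|lborel. e / (I + 1) * cmod (G x))"
    proof (rule order_trans [OF integral_norm_bound integral_mono])
      show "integrable lborel (\<lambda>x. norm (q (exp (- (u x / 4))) *\<^sub>R G x - p (exp (- (u x / 4))) *\<^sub>R G x))"
        by (intro integrable_norm Bochner_Integration.integrable_diff ints q cp)
      show "integrable lborel (\<lambda>x. e / (I + 1) * cmod (G x))" using intG by (intro integrable_mult_right integrable_norm)
      show "norm (q (exp (- (u x / 4))) *\<^sub>R G x - p (exp (- (u x / 4))) *\<^sub>R G x) \<le> e / (I + 1) * cmod (G x)" for x
      proof -
        have "exp (- (u x / 4)) \<in> {0..1}" using u0 [of x] by simp
        from p(2) [OF this] have "\<bar>q (exp (- (u x / 4))) - p (exp (- (u x / 4)))\<bar> * cmod (G x) \<le> e / (I + 1) * cmod (G x)"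
          by (intro mult_right_mono) auto
        then show ?thesis by (simp flip: scaleR_diff_left)
      qed
    qed
    also have "\<dots> = e / (I + 1) * I" by (simp add: I_def)
    also have "\<dots> \<le> e" using I \<open>e > 0\<close> by (simp add: field_simps)
    finally show "cmod (LINT x|lborel. q (exp (- (u x / 4))) *\<^sub>R G x) \<le> 0 + e" by simp
  qed
  then show ?thesis by (simp add: qX)
qed

lemma scaleR_eq_scale: "a *\<^sub>R (v :: ('n::{finite,linorder}) cl) = of_real a *s v"
  by (simp add: vec_eq_iff) (simp add: scaleR_conv_of_real)

lemma vpow_sum: "vpow k (\<lambda>x. \<Sum>j\<in>J. b j *\<^sub>R F j x) x = (\<Sum>j\<in>J. b j *\<^sub>R vpow k (F j) x)"
proof -
  have "((\<odot>) v ^^ k) (\<Sum>j\<in>J. b j *\<^sub>R w j) = (\<Sum>j\<in>J. b j *\<^sub>R ((\<odot>) v ^^ k) (w j))" for v :: "'a cl" and w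
    by (induction k) (simp_all add: cl_mult_sum_right cl_mult_scaleR_right)
  then show ?thesis by (simp add: vpow_def)
qed

text \<open>The Laguerre polynomials up to degree \<open>i\<close> span u^i and the
  \<open>M l j\<close> span the monogenics of degree \<open>l\<close>, so the left factor is a
  finite combination of basis functions.\<close>

lemma inner_radial_eq_0:
  fixes M :: "nat \<Rightarrow> nat \<Rightarrow> ('n::{finite,linorder}) cl_fun"
  assumes c: "c > - 1" and M: "\<And>l. monogenic_orthonormal_basis l (d l) (M l)" and f: "f \<in> L2 c"
    and orth: "\<And>n l j. j \<in> {1..d l} \<Longrightarrow> inner_c c (phi c M n l j) f = 0"
    and N: "N \<in> monogenics l" and k: "k \<le> 1"
  shows "inner_c c (radial c l N k (\<lambda>u. u ^ i * exp (- (1 / 2) * u))) f = 0"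
proof -
  let ?m = "CARD('n)"
  have c1: "1 + c \<noteq> 0" using c by simp
  have m: "M l j \<in> monogenics l" if "j \<in> {1..d l}" for j
    using M that by (auto simp: monogenic_orthonormal_basis_def)
  obtain b where b: "N = (\<lambda>x. \<Sum>j=1..d l. b j *\<^sub>R M l j x)"
    using M [of l] N by (auto simp: monogenic_orthonormal_basis_def)
  obtain a where a: "monom 1 i = (\<Sum>t\<le>i. smult (a t) (laguerre_poly t ((gamma ?m c l + 2 * real k) / 2 - 1)))"
    using laguerre_poly_span by blast
  have km: "k mod 2 = k" using k by simp
  \<comment> \<open>With \<open>k \<le> 1\<close> the index of the basis function with Laguerre
    degree \<open>t\<close> and parity \<open>k\<close> is \<open>2 * t + k\<close>.\<close>
  have dm: "(2 * t + k) div 2 = t" "(2 * t + k) mod 2 = k" for t using k by auto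
  have K: "phi_const c n \<noteq> 0" for n using c1 by (simp add: phi_const_def)
  have prof: "u ^ i * exp (- (1 / 2) * u) = (\<Sum>t\<le>i. (a t / phi_const c (2 * t + k)) * phi_profile c ?m (2 * t + k) l u)" for u
  proof -
    have "u ^ i = poly (monom 1 i) u" by (simp add: poly_monom)
    then have "u ^ i * exp (- (1 / 2) * u) = (\<Sum>t\<le>i. a t * poly (laguerre_poly t ((gamma ?m c l + 2 * real k) / 2 - 1)) u * exp (- (1 / 2) * u))"
      unfolding a by (simp add: poly_sum sum_distrib_right)
    also have "\<dots> = (\<Sum>t\<le>i. (a t / phi_const c (2 * t + k)) * phi_profile c ?m (2 * t + k) l u)"
      by (intro sum.cong refl) (simp add: phi_profile_eq_poly dm km K)
    finally show ?thesis .
  qed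
  have "radial c l N k (\<lambda>u. u ^ i * exp (- (1 / 2) * u)) x
    = (\<Sum>j=1..d l. \<Sum>t\<le>i. of_real (b j * (a t / phi_const c (2 * t + k))) *s phi c M (2 * t + k) l j x)" for x
  proof -
    have "radial c l N k (\<lambda>u. u ^ i * exp (- (1 / 2) * u)) x
      = (\<Sum>t\<le>i. (x \<bullet> x) powr (beta c l / 2) * ((a t / phi_const c (2 * t + k)) * phi_profile c ?m (2 * t + k) l (x \<bullet> x)))
         *\<^sub>R (\<Sum>j=1..d l. b j *\<^sub>R vpow k (M l j) x)"
      unfolding radial_def prof sum_distrib_left b vpow_sum ..
    also have "\<dots> = (\<Sum>j=1..d l. \<Sum>t\<le>i. (b j * (a t / phi_const c (2 * t + k))) *\<^sub>R
       (((x \<bullet> x) powr (beta c l / 2) * phi_profile c ?m (2 * t + k) l (x \<bullet> x)) *\<^sub>R vpow k (M l j) x))"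
      unfolding scaleR_sum_right scaleR_sum_left by (intro sum.cong refl) (simp add: mult_ac)
    also have "\<dots> = (\<Sum>j=1..d l. \<Sum>t\<le>i. of_real (b j * (a t / phi_const c (2 * t + k))) *s phi c M (2 * t + k) l j x)"
      unfolding phi_eq_radial [OF c1] dm radial_def scaleR_eq_scale [of "b _ * _"] ..
    finally show ?thesis .
  qed
  then have eq: "radial c l N k (\<lambda>u. u ^ i * exp (- (1 / 2) * u))
    = (\<lambda>x. \<Sum>j=1..d l. \<Sum>t\<le>i. of_real (b j * (a t / phi_const c (2 * t + k))) *s phi c M (2 * t + k) l j x)" by (rule ext)
  have L: "phi c M n l j \<in> L2 c" if "j \<in> {1..d l}" for n j by (rule phi_L2 [where M = M, OF c m [OF that]])
  have "inner_c c (\<lambda>x. \<Sum>j=1..d l. \<Sum>t\<le>i. of_real (b j * (a t / phi_const c (2 * t + k))) *s phi c M (2 * t + k) l j x) f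
    = (\<Sum>j=1..d l. \<Sum>t\<le>i. cnj (of_real (b j * (a t / phi_const c (2 * t + k)))) * inner_c c (phi c M (2 * t + k) l j) f)"
    using L f by (subst inner_c_sum_left, (intro L2_sum L2_scale; simp), simp, intro sum.cong refl,
       subst inner_c_sum_left, (intro L2_scale; simp), simp, intro sum.cong refl inner_c_scale_left) auto
  also have "\<dots> = 0" using orth by (intro sum.neutral ballI) simp
  finally show ?thesis unfolding eq .
qed

text \<open>A tent over [a, b]. For \<open>a > 0\<close> it confines x to an annulus, where the
  weight and the powers of r are continuous and bounded.\<close>

definition cutoff :: "real \<Rightarrow> real \<Rightarrow> real \<Rightarrow> real" where
  "cutoff a b v = max 0 (min (v - a) (b - v))"

lemma cutoff_L2:
  fixes P :: "('n::{finite,linorder}) cl_fun"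
  assumes a: "a > 0" and P: "continuous_on UNIV P"
  shows "(\<lambda>x. cutoff a b (x \<bullet> x) *\<^sub>R P x) \<in> L2 c"
proof -
  let ?Q = "\<lambda>x. cutoff a b (x \<bullet> x) *\<^sub>R P x"
  define S where "S = {x :: (real, 'n) vec. a \<le> x \<bullet> x} \<inter> {x. x \<bullet> x \<le> b}"
  have cQ: "continuous_on UNIV ?Q" unfolding cutoff_def by (intro continuous_intros P)
  have "closed {x :: (real, 'n) vec. a \<le> x \<bullet> x}" "closed {x :: (real, 'n) vec. x \<bullet> x \<le> b}"
    by (intro closed_Collect_le continuous_intros)+
  moreover have "bounded S"
  proof (rule boundedI)
    fix x assume "x \<in> S"
    then have "(norm x)\<^sup>2 \<le> b" by (simp add: S_def power2_norm_eq_inner)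
    then show "norm x \<le> sqrt b" by (rule real_le_rsqrt)
  qed
  ultimately have "compact S" unfolding compact_eq_bounded_closed S_def by (simp add: closed_Int)
  moreover have "continuous_on S (\<lambda>x. weight c x * (norm (?Q x))\<^sup>2)"
    unfolding weight_def using a
    by (intro continuous_intros continuous_on_subset [OF cQ]) (auto simp: S_def)
  ultimately have "integrable lborel (\<lambda>x. indicator S x *\<^sub>R (weight c x * (norm (?Q x))\<^sup>2))"
    by (rule borel_integrable_compact)
  moreover have "indicator S x *\<^sub>R (weight c x * (norm (?Q x))\<^sup>2) = weight c x * (norm (?Q x))\<^sup>2" for x
    by (auto simp: S_def cutoff_def indicator_def)
  ultimately have "integrable lborel (\<lambda>x. weight c x * (norm (?Q x))\<^sup>2)" by (simp only:)
  then show ?thesis using borel_measurable_continuous_onI [OF cQ] by (simp add: L2_iff)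
qed

lemma cutoff_integrable:
  fixes P :: "('n::{finite,linorder}) cl_fun"
  assumes a: "a > 0" and P: "continuous_on UNIV P" and f: "f \<in> L2 c"
  shows "integrable lborel (\<lambda>x. (cutoff a b (x \<bullet> x) * weight c x) *\<^sub>R cl_dot (P x) (f x))"
  using L2_integrable_dot [OF cutoff_L2 [OF a P, of b] f] by (simp add: cl_dot_scaleR_left mult.commute)

lemma vpow_double: "vpow (2 * q + k) F x = ((- 1) ^ q * (x \<bullet> x) ^ q) *\<^sub>R vpow k F x"
  by (induction q) (simp_all add: vpow_def cl_mult_scaleR_right cl_vec_mult_vec power2_norm_eq_inner)

text \<open>The factors \<open>r\<^sup>\<beta> exp (- r\<^sup>2 / 2)\<close>, which depend on the degree, are absorbed into the test function
  of the radial variable; only then can different degrees be combined.\<close>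

lemma cutoff_monogenic_eq_0:
  fixes M :: "nat \<Rightarrow> nat \<Rightarrow> ('n::{finite,linorder}) cl_fun"
  assumes c: "c > - 1" and M: "\<And>l. monogenic_orthonormal_basis l (d l) (M l)" and f: "f \<in> L2 c"
    and orth: "\<And>n l j. j \<in> {1..d l} \<Longrightarrow> inner_c c (phi c M n l j) f = 0"
    and N: "N \<in> monogenics l" and a: "a > 0"
  shows "(LINT x|lborel. (cutoff a b (x \<bullet> x) * weight c x) *\<^sub>R cl_dot (vpow s N x) (f x)) = 0"
proof -
  define k where "k = s mod 2"
  define q where "q = s div 2"
  have s: "s = 2 * q + k" and k: "k \<le> 1" by (auto simp: k_def q_def)
  note [measurable] = f
  define G where "G x = weight c x *\<^sub>R cl_dot (radial c l N k (\<lambda>u. exp (- (1 / 2) * u)) x) (f x)" for x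
  \<comment> \<open>The factors undo r^beta and the Gaussian contained in \<open>G\<close>; (-1)^q
    v^q accounts for x^(2 q). \<open>max v a\<close> agrees with \<open>v\<close> on the support of
    the cutoff and makes the power continuous everywhere.\<close>
  define X where "X v = cutoff a b v * max v a powr (- beta c l / 2) * exp (v / 2) * ((- 1) ^ q * v ^ q)" for v
  have rL: "radial c l N k (\<lambda>u. u ^ i * exp (- e * u)) \<in> L2 c" if "e > 0" for i e
    by (rule radial_L2 [OF c N that, of _ "monom 1 i"]) (simp add: poly_monom)
  have [measurable]: "radial c l N k (\<lambda>u. exp (- (1 / 2) * u)) \<in> borel_measurable borel"
    using rL [of "1 / 2" 0] by (simp add: L2_iff)
  have Gm: "G \<in> borel_measurable borel" unfolding G_def by measurable
  have "(LINT x|lborel. X (x \<bullet> x) *\<^sub>R G x) = 0"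
  proof (rule compact_support_moments_zero [where u = "\<lambda>x. x \<bullet> x" and X = X and b = b, OF Gm])
    show "(\<lambda>x. x \<bullet> x) \<in> borel_measurable (borel :: (real, 'n) vec measure)" by measurable
    show "0 \<le> x \<bullet> x" for x :: "(real, 'n) vec" by simp
    have g: "((x \<bullet> x) ^ i * h (x \<bullet> x)) *\<^sub>R G x = weight c x *\<^sub>R cl_dot (radial c l N k (\<lambda>u. u ^ i * (h u * exp (- (1 / 2) * u))) x) (f x)" for x i h
      by (simp add: G_def radial_def cl_dot_scaleR_left mult_ac)
    show "integrable lborel (\<lambda>x. ((x \<bullet> x) ^ i * exp (x \<bullet> x / 4)) *\<^sub>R G x)" for i
    proof -
      have e: "exp (u / 4) * exp (- (1 / 2) * u) = exp (- (1 / 4) * u)" for u :: real by (simp add: exp_add [symmetric])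
      show ?thesis unfolding g [of _ i "\<lambda>u. exp (u / 4)"] e by (intro L2_integrable_dot rL f) simp
    qed
    show "(LINT x|lborel. (x \<bullet> x) ^ i *\<^sub>R G x) = 0" for i
      using inner_radial_eq_0 [OF c M f orth N k, of i] g [of _ i "\<lambda>u. 1"]
        inner_c_eq [OF rL [of "1 / 2" i] f] by simp
    show "continuous_on UNIV X"
      unfolding X_def cutoff_def using a by (intro continuous_intros) (auto simp: max_def)
    show "X v = 0" if "v \<ge> b" for v using that by (simp add: X_def cutoff_def)
  qed
  moreover have "X (x \<bullet> x) *\<^sub>R G x = (cutoff a b (x \<bullet> x) * weight c x) *\<^sub>R cl_dot (vpow s N x) (f x)" for x
  proof (cases "x \<bullet> x \<le> a")
    case True
    then show ?thesis by (simp add: X_def cutoff_def)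
  next
    case False
    then have u: "x \<bullet> x > 0" "max (x \<bullet> x) a = x \<bullet> x" using a by auto
    have 1: "(x \<bullet> x) powr (- beta c l / 2) * (x \<bullet> x) powr (beta c l / 2) = 1"
      using u by (simp add: powr_add [symmetric])
    have 2: "exp (x \<bullet> x / 2) * exp (- (1 / 2) * (x \<bullet> x)) = 1" by (simp add: exp_add [symmetric])
    have "X (x \<bullet> x) *\<^sub>R G x = (cutoff a b (x \<bullet> x) * weight c x * ((- 1) ^ q * (x \<bullet> x) ^ q) *
       ((x \<bullet> x) powr (- beta c l / 2) * (x \<bullet> x) powr (beta c l / 2)) * (exp (x \<bullet> x / 2) * exp (- (1 / 2) * (x \<bullet> x)))) *\<^sub>R cl_dot (vpow k N x) (f x)"
      unfolding X_def G_def radial_def cl_dot_scaleR_left u(2) scaleR_scaleR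
      by (rule arg_cong [where f = "\<lambda>t. t *\<^sub>R _"]) (simp only: mult_ac)
    then show ?thesis unfolding 1 2 s vpow_double cl_dot_scaleR_left scaleR_scaleR by simp
  qed
  ultimately show ?thesis by (simp only:)
qed

text \<open>Once the degree-dependent factor is gone, the summands of a Fischer decomposition may be
  added. Testing with a real polynomial times a basis element e_A isolates one coefficient of
  \<open>f\<close>.\<close>

theorem phi_complete:
  fixes M :: "nat \<Rightarrow> nat \<Rightarrow> ('n::{finite,linorder}) cl_fun"
  assumes c: "c > - 1" and M: "\<And>l. monogenic_orthonormal_basis l (d l) (M l)" and f: "f \<in> L2 c"
    and orth: "\<And>n l j. j \<in> {1..d l} \<Longrightarrow> inner_c c (phi c M n l j) f = 0"
  shows "ae_eq f (\<lambda>x. 0)"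
proof -
  have hom: "(LINT x|lborel. (cutoff a b (x \<bullet> x) * weight c x) *\<^sub>R cl_dot (P x) (f x)) = 0"
    if a: "a > 0" and P: "hom_poly k P" for a b k P
  proof -
    obtain N where N: "\<And>s. s \<le> k \<Longrightarrow> N s \<in> monogenics (k - s)" and eq: "P = (\<lambda>x. \<Sum>s\<le>k. vpow s (N s) x)"
      using Fischer_decomposition [OF P] by blast
    have h: "hom_poly (s + (k - s)) (vpow s (N s))" if "s \<le> k" for s
      using N [OF that] by (intro hom_poly_vpow) (simp add: monogenics_iff)
    have "(LINT x|lborel. (\<Sum>s\<le>k. (cutoff a b (x \<bullet> x) * weight c x) *\<^sub>R cl_dot (vpow s (N s) x) (f x)))
      = (\<Sum>s\<le>k. (LINT x|lborel. (cutoff a b (x \<bullet> x) * weight c x) *\<^sub>R cl_dot (vpow s (N s) x) (f x)))"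
      by (rule Bochner_Integration.integral_sum) (auto intro!: cutoff_integrable a f hom_poly_continuous [OF h])
    also have "\<dots> = 0"
      by (intro sum.neutral ballI cutoff_monogenic_eq_0 [OF c M f orth N a]) auto
    finally show ?thesis unfolding eq cl_dot_sum_left scaleR_sum_right .
  qed
  have ax: "hom_poly k (\<lambda>x. p x *\<^sub>R axis A 1)"
    if "real_polynomial_function p" "\<And>s x. p (s *\<^sub>R x) = s ^ k * p x" for k A and p :: "(real, 'n) vec \<Rightarrow> real"
    using that by (auto simp: hom_poly_def axis_def real_polynomial_function_eq Reals_scaleR intro!: polynomial_function_mult)
  have dot: "cl_dot (r *\<^sub>R axis A 1) v = r *\<^sub>R v $ A" for r A and v :: "'n cl"
    by (simp add: cl_dot_scaleR_left) (simp add: cl_dot_def axis_def if_distrib [of cnj] if_distrib [of "\<lambda>t. t * _"] cong: if_cong)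
  have zero: "AE x in lborel. (cutoff a b (x \<bullet> x) * weight c x) *\<^sub>R f x $ A = 0" if a: "a > 0" for a b A
  proof (rule AE_zero_if_orthogonal_to_polynomials [of _ "cball 0 (sqrt (max b 0))"])
    have int: "integrable lborel (\<lambda>x. (cutoff a b (x \<bullet> x) * weight c x) *\<^sub>R (p x *\<^sub>R f x $ A))" if "continuous_on UNIV p" for p
    proof -
      have "continuous_on UNIV (\<lambda>x. p x *\<^sub>R (axis A 1 :: 'n cl))" using that by (intro continuous_intros)
      from cutoff_integrable [OF a this f, of b] show ?thesis by (simp add: dot)
    qed
    show "integrable lborel (\<lambda>x. (cutoff a b (x \<bullet> x) * weight c x) *\<^sub>R f x $ A)"
      using int [of "\<lambda>_. 1"] by simp
    show "compact (cball (0 :: (real, 'n) vec) (sqrt (max b 0)))" by (rule compact_cball)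
    show "(cutoff a b (x \<bullet> x) * weight c x) *\<^sub>R f x $ A = 0" if "x \<notin> cball 0 (sqrt (max b 0))" for x
    proof -
      have "sqrt (max b 0) < norm x" using that by simp
      then have "(sqrt (max b 0))\<^sup>2 < (norm x)\<^sup>2" by (intro power_strict_mono) auto
      then have "b < x \<bullet> x" by (simp add: power2_norm_eq_inner)
      then show ?thesis by (simp add: cutoff_def)
    qed
    fix p :: "(real, 'n) vec \<Rightarrow> real" assume "real_polynomial_function p"
    then obtain n q where q: "\<And>k. real_polynomial_function (q k)" "\<And>k s x. q k (s *\<^sub>R x) = s ^ k * q k x"
      and p: "\<And>x. p x = (\<Sum>k\<le>n. q k x)"
      using real_polynomial_function_homogeneous by metis
    have cq: "continuous_on UNIV (q k)" for k
      using q(1) by (simp add: continuous_on_polymonial_function flip: real_polynomial_function_eq)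
    have e: "p x *\<^sub>R ((cutoff a b (x \<bullet> x) * weight c x) *\<^sub>R f x $ A)
      = (\<Sum>k\<le>n. (cutoff a b (x \<bullet> x) * weight c x) *\<^sub>R (q k x *\<^sub>R f x $ A))" for x
      unfolding p scaleR_sum_left by (intro sum.cong refl) (simp add: mult_ac)
    have "(LINT x|lborel. (\<Sum>k\<le>n. (cutoff a b (x \<bullet> x) * weight c x) *\<^sub>R (q k x *\<^sub>R f x $ A)))
      = (\<Sum>k\<le>n. (LINT x|lborel. (cutoff a b (x \<bullet> x) * weight c x) *\<^sub>R (q k x *\<^sub>R f x $ A)))"
      by (rule Bochner_Integration.integral_sum) (rule int [OF cq])
    also have "\<dots> = 0"
      using hom [OF a ax [OF q]] by (intro sum.neutral ballI) (simp add: dot)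
    finally show "(LINT x|lborel. p x *\<^sub>R ((cutoff a b (x \<bullet> x) * weight c x) *\<^sub>R f x $ A)) = 0" unfolding e .
  qed
  \<comment> \<open>Countably many annuli exhaust the complement of the origin, so one null set
    serves all of them.\<close>
  have "AE x in lborel. \<forall>A. \<forall>n::nat. (cutoff (1 / real (Suc n)) (real (Suc n)) (x \<bullet> x) * weight c x) *\<^sub>R f x $ A = 0"
    by (intro AE_finite_allI AE_all_countable [THEN iffD2] allI zero) auto
  moreover have "AE x in lborel. x \<noteq> (0 :: (real, 'n) vec)" by (rule AE_lborel_singleton)
  ultimately show ?thesis
    unfolding ae_eq_def
  proof eventually_elim
    case (elim x)
    have u: "x \<bullet> x > 0" using elim by simp
    obtain n1 where n1: "1 / (x \<bullet> x) < real n1" using reals_Archimedean2 by blast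
    obtain n2 where n2: "x \<bullet> x < real n2" using reals_Archimedean2 by blast
    define n where "n = n1 + n2"
    have "1 / (x \<bullet> x) < real (Suc n)" "x \<bullet> x < real (Suc n)" using n1 n2 by (auto simp: n_def)
    then have "cutoff (1 / real (Suc n)) (real (Suc n)) (x \<bullet> x) > 0"
      using u by (simp add: cutoff_def field_simps)
    then have "f x $ A = 0" for A using elim weight_pos [of x c] by (metis mult_pos_pos order_less_irrefl scaleR_eq_0_iff)
    then show ?case by (simp add: vec_eq_iff)
  qed
qed

section \<open>The dimension of the space of monogenics\<close>

text \<open>Gaussian elimination, one equation at a time: a pivot \<open>j0\<close> is removed from
  the unknowns and recovered by back substitution.\<close>

lemma homogeneous_system:
  fixes a :: "'j \<Rightarrow> 'i \<Rightarrow> real"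
  assumes "finite I" "finite D" "card I < card D"
  shows "\<exists>b. (\<exists>j\<in>D. b j \<noteq> 0) \<and> (\<forall>i\<in>I. (\<Sum>j\<in>D. b j * a j i) = 0)"
  using assms
proof (induction I arbitrary: D a rule: finite_induct)
  case empty
  then obtain j where "j \<in> D" by fastforce
  then show ?case by (intro exI [of _ "\<lambda>_. 1"]) auto
next
  case (insert i I)
  show ?case
  proof (cases "\<forall>j\<in>D. a j i = 0")
    case True
    have "card I < card D" using insert by simp
    from insert.IH [OF insert.prems(1) this, of a] obtain b where b: "\<exists>j\<in>D. b j \<noteq> 0" "\<forall>i\<in>I. (\<Sum>j\<in>D. b j * a j i) = 0" by blast
    then show ?thesis using True by (intro exI [of _ b]) auto
  next
    case False
    then obtain j0 where j0: "j0 \<in> D" "a j0 i \<noteq> 0" by blast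
    define a' where "a' j k = a j k - a j i / a j0 i * a j0 k" for j k
    have "card I < card (D - {j0})" using insert j0 by simp
    from insert.IH [OF _ this, of a'] insert.prems(1) obtain b where b: "\<exists>j\<in>D - {j0}. b j \<noteq> 0"
      "\<And>k. k \<in> I \<Longrightarrow> (\<Sum>j\<in>D - {j0}. b j * a' j k) = 0" by blast
    \<comment> \<open>The value of the pivot variable dictated by equation \<open>i\<close>.\<close>
    define b0 where "b0 = - (\<Sum>j\<in>D - {j0}. b j * a j i) / a j0 i"
    let ?b = "\<lambda>j. if j = j0 then b0 else b j"
    have sum: "(\<Sum>j\<in>D. ?b j * a j k) = b0 * a j0 k + (\<Sum>j\<in>D - {j0}. b j * a j k)" for k
      using insert.prems(1) j0 by (subst sum.remove [of D j0]) (auto intro!: sum.cong)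
    have "(\<Sum>j\<in>D. ?b j * a j k) = 0" if "k \<in> I" for k
    proof -
      have "(\<Sum>j\<in>D - {j0}. b j * a' j k) = (\<Sum>j\<in>D - {j0}. b j * a j k) - (\<Sum>j\<in>D - {j0}. b j * a j i) * (a j0 k / a j0 i)"
        unfolding a'_def sum_distrib_right sum_subtractf [symmetric] by (intro sum.cong refl) (simp add: algebra_simps)
      then show ?thesis unfolding sum unfolding b0_def using b(2) [OF that] by simp
    qed
    moreover have "(\<Sum>j\<in>D. ?b j * a j i) = 0" unfolding sum unfolding b0_def using j0 by simp
    ultimately show ?thesis using b(1) by (intro exI [of _ ?b]) auto
  qed
qed

section \<open>Monomials and a bound for the number of basis monogenics\<close>

definition monomial_fun :: "('n::finite \<Rightarrow> nat) \<Rightarrow> real ^ 'n \<Rightarrow> real" where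
  "monomial_fun \<alpha> x = (\<Prod>i\<in>UNIV. (x $ i) ^ \<alpha> i)"

lemma monomial_fun_mult: "monomial_fun \<alpha> x * monomial_fun \<beta> x = monomial_fun (\<lambda>i. \<alpha> i + \<beta> i) x"
  by (simp add: monomial_fun_def prod.distrib power_add)

lemma monomial_fun_scaleR: "monomial_fun \<alpha> (s *\<^sub>R x) = s ^ (\<Sum>i\<in>UNIV. \<alpha> i) * monomial_fun \<alpha> x"
  by (simp add: monomial_fun_def power_mult_distrib prod.distrib power_sum)

text \<open>Sums and products of monomial expansions repeat exponents; grouping by the exponent
  restores a sum over a set of multi-indices.\<close>

lemma monomial_combination:
  fixes g :: "'b \<Rightarrow> real" and h :: "'b \<Rightarrow> 'n::finite \<Rightarrow> nat"
  assumes "finite S" and f: "\<And>x. f x = (\<Sum>p\<in>S. g p * monomial_fun (h p) x)"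
  shows "\<exists>K a. finite K \<and> (\<forall>x. f x = (\<Sum>\<alpha>\<in>K. a \<alpha> * monomial_fun \<alpha> x))"
proof (intro exI conjI allI)
  show "finite (h ` S)" using assms by simp
  fix x
  have "(\<Sum>p\<in>S. g p * monomial_fun (h p) x) = (\<Sum>\<alpha>\<in>h ` S. \<Sum>p\<in>{p \<in> S. h p = \<alpha>}. g p * monomial_fun (h p) x)"
    by (rule sum.image_gen [OF assms(1)])
  also have "\<dots> = (\<Sum>\<alpha>\<in>h ` S. (\<Sum>p\<in>{p \<in> S. h p = \<alpha>}. g p) * monomial_fun \<alpha> x)"
    unfolding sum_distrib_right by (intro sum.cong refl) simp
  finally show "f x = (\<Sum>\<alpha>\<in>h ` S. (\<Sum>p\<in>{p \<in> S. h p = \<alpha>}. g p) * monomial_fun \<alpha> x)" unfolding f .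
qed

lemma real_polynomial_function_monomials:
  fixes p :: "real ^ 'n::finite \<Rightarrow> real"
  assumes "real_polynomial_function p"
  shows "\<exists>K a. finite K \<and> (\<forall>x. p x = (\<Sum>\<alpha>\<in>K. a \<alpha> * monomial_fun \<alpha> x))"
  using assms
proof (induction p rule: real_polynomial_function.induct)
  case (linear f)
  have "f x = (\<Sum>i\<in>UNIV. f (axis i 1) * monomial_fun (\<lambda>k. if k = i then 1 else 0) x)" for x
  proof -
    have "monomial_fun (\<lambda>k. if k = i then 1 else 0) x = x $ i" for i
      by (simp add: monomial_fun_def if_distrib [of "\<lambda>n. _ ^ n"] cong: if_cong)
    moreover have "f x = f (\<Sum>i\<in>UNIV. x $ i *\<^sub>R axis i 1)"
      by (rule arg_cong [of _ _ f]) (simp add: vec_eq_iff axis_def if_distrib cong: if_cong)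
    ultimately show ?thesis
      using linear by (simp add: bounded_linear.linear linear_sum linear_scale mult.commute)
  qed
  then show ?case by (rule monomial_combination [OF finite])
next
  case (const b)
  show ?case by (intro exI [of _ "{\<lambda>_. 0}"] exI [of _ "\<lambda>_. b"]) (simp add: monomial_fun_def)
next
  case (add f g)
  from add.IH obtain K a L b where K: "finite K" "\<And>x. f x = (\<Sum>\<alpha>\<in>K. a \<alpha> * monomial_fun \<alpha> x)"
    and L: "finite L" "\<And>x. g x = (\<Sum>\<alpha>\<in>L. b \<alpha> * monomial_fun \<alpha> x)" by blast
  have "f x + g x = (\<Sum>p\<in>K <+> L. (case p of Inl \<alpha> \<Rightarrow> a \<alpha> | Inr \<beta> \<Rightarrow> b \<beta>) * monomial_fun (case p of Inl \<alpha> \<Rightarrow> \<alpha> | Inr \<beta> \<Rightarrow> \<beta>) x)" for x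
    using K L by (simp add: sum.Plus)
  then show ?case by (rule monomial_combination [rotated]) (simp add: K L)
next
  case (mult f g)
  from mult.IH obtain K a L b where K: "finite K" "\<And>x. f x = (\<Sum>\<alpha>\<in>K. a \<alpha> * monomial_fun \<alpha> x)"
    and L: "finite L" "\<And>x. g x = (\<Sum>\<alpha>\<in>L. b \<alpha> * monomial_fun \<alpha> x)" by blast
  have "f x * g x = (\<Sum>p\<in>K \<times> L. (a (fst p) * b (snd p)) * monomial_fun (\<lambda>i. fst p i + snd p i) x)" for x
    unfolding K(2) L(2) sum_product sum.cartesian_product
    by (intro sum.cong refl) (auto simp: monomial_fun_mult [symmetric])
  then show ?case by (rule monomial_combination [rotated]) (simp add: K L)
qed

text \<open>A crude box, each exponent at most \<open>l\<close> instead of total degree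
  \<open>l\<close>. It is easy to count, and polynomial growth is all that the Hilbert--Schmidt
  property asks for.\<close>

definition multi_indices :: "nat \<Rightarrow> ('n::finite \<Rightarrow> nat) set" where
  "multi_indices l = {\<alpha>. \<forall>i. \<alpha> i \<le> l}"

lemma finite_multi_indices: "finite (multi_indices l :: ('n::finite \<Rightarrow> nat) set)"
  and card_multi_indices: "card (multi_indices l :: ('n::finite \<Rightarrow> nat) set) = (l + 1) ^ CARD('n)"
proof -
  have "(multi_indices l :: ('n \<Rightarrow> nat) set) = PiE UNIV (\<lambda>_. {..l})"
    by (auto simp: multi_indices_def PiE_def Pi_def)
  then show "finite (multi_indices l :: ('n \<Rightarrow> nat) set)" "card (multi_indices l :: ('n \<Rightarrow> nat) set) = (l + 1) ^ CARD('n)"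
    by (simp_all add: card_PiE finite_PiE)
qed

text \<open>Only the monomials of degree \<open>l\<close> contribute: compare the coefficients of \<open>s\<^sup>l\<close> in
  \<open>p (s x) = s\<^sup>l p x\<close>.\<close>

lemma homogeneous_monomials:
  fixes p :: "real ^ 'n::finite \<Rightarrow> real"
  assumes p: "real_polynomial_function p" and hom: "\<And>s x. p (s *\<^sub>R x) = s ^ l * p x"
  shows "\<exists>a. \<forall>x. p x = (\<Sum>\<alpha>\<in>multi_indices l. a \<alpha> * monomial_fun \<alpha> x)"
proof -
  obtain K a where K: "finite K" and a: "\<And>x. p x = (\<Sum>\<alpha>\<in>K. a \<alpha> * monomial_fun \<alpha> x)"
    using real_polynomial_function_monomials [OF p] by blast
  let ?d = "\<lambda>\<alpha> :: 'n \<Rightarrow> nat. \<Sum>i\<in>UNIV. \<alpha> i"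
  have "p x = (\<Sum>\<alpha>\<in>multi_indices l. (if \<alpha> \<in> K \<and> ?d \<alpha> = l then a \<alpha> else 0) * monomial_fun \<alpha> x)" for x
  proof -
    have "poly (monom (p x) l) s = poly (\<Sum>\<alpha>\<in>K. monom (a \<alpha> * monomial_fun \<alpha> x) (?d \<alpha>)) s" for s
      using hom [of s x] unfolding a [of "s *\<^sub>R x"] by (simp add: poly_monom poly_sum monomial_fun_scaleR mult_ac)
    then have "monom (p x) l = (\<Sum>\<alpha>\<in>K. monom (a \<alpha> * monomial_fun \<alpha> x) (?d \<alpha>))"
      by (simp add: poly_eq_poly_eq_iff [symmetric] fun_eq_iff)
    from arg_cong [OF this, of "\<lambda>q. coeff q l"]
    have "p x = (\<Sum>\<alpha>\<in>K. if ?d \<alpha> = l then a \<alpha> * monomial_fun \<alpha> x else 0)" by (simp add: coeff_sum)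
    also have "\<dots> = (\<Sum>\<alpha>\<in>{\<alpha> \<in> K. ?d \<alpha> = l}. a \<alpha> * monomial_fun \<alpha> x)" using K by (simp add: sum.inter_filter)
    also have "\<dots> = (\<Sum>\<alpha>\<in>multi_indices l. (if \<alpha> \<in> K \<and> ?d \<alpha> = l then a \<alpha> else 0) * monomial_fun \<alpha> x)"
    proof (rule sum.mono_neutral_cong_left [OF finite_multi_indices])
      show "{\<alpha> \<in> K. ?d \<alpha> = l} \<subseteq> multi_indices l" by (auto simp: multi_indices_def intro!: member_le_sum)
    qed auto
    finally show ?thesis .
  qed
  then show ?thesis
    by (intro exI [of _ "\<lambda>\<alpha>. if \<alpha> \<in> K \<and> ?d \<alpha> = l then a \<alpha> else 0"] allI)
qed

text \<open>A monogenic is fixed by the real monomial coefficients of its 2^m components. More basis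
  elements than such coefficients would satisfy a nontrivial linear relation by
  \<open>homogeneous_system\<close>, against independence.\<close>

lemma monogenic_basis_card_le:
  fixes M :: "nat \<Rightarrow> ('n::{finite,linorder}) cl_fun"
  assumes M: "monogenic_orthonormal_basis l d M"
  shows "d \<le> (l + 1) ^ CARD('n) * 2 ^ CARD('n)"
proof (rule ccontr)
  assume neg: "\<not> d \<le> (l + 1) ^ CARD('n) * 2 ^ CARD('n)"
  let ?I = "(multi_indices l :: ('n \<Rightarrow> nat) set) \<times> (UNIV :: 'n set set)"
  have I: "finite ?I" "card ?I < card {1..d}"
    using neg by (simp_all add: finite_multi_indices card_cartesian_product card_multi_indices card_UNIV_set)
  have "\<exists>a. \<forall>x. Re (M j x $ A) = (\<Sum>\<alpha>\<in>multi_indices l. a \<alpha> * monomial_fun \<alpha> x)" if "j \<in> {1..d}" for j A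
  proof (rule homogeneous_monomials)
    have h: "hom_poly l (M j)" using M that by (auto simp: monogenic_orthonormal_basis_def monogenics_iff)
    have "bounded_linear (\<lambda>v :: 'n cl. Re (v $ A))"
      using bounded_linear_compose [OF bounded_linear_Re bounded_linear_vec_nth] .
    moreover have "polynomial_function (M j)" using h by (simp add: hom_poly_def)
    ultimately show "real_polynomial_function (\<lambda>x. Re (M j x $ A))"
      unfolding polynomial_function_def by (auto simp: o_def)
    show "Re (M j (s *\<^sub>R x) $ A) = s ^ l * Re (M j x $ A)" for s x using h by (simp add: hom_poly_def)
  qed
  note ex = someI_ex [OF this]
  define a where "a j A = (SOME a. \<forall>x. Re (M j x $ A) = (\<Sum>\<alpha>\<in>multi_indices l. a \<alpha> * monomial_fun \<alpha> x))" for j A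
  have a: "Re (M j x $ A) = (\<Sum>\<alpha>\<in>multi_indices l. a j A \<alpha> * monomial_fun \<alpha> x)" if "j \<in> {1..d}" for j A x
    using ex [OF that, of A] unfolding a_def by blast
  from homogeneous_system [OF I(1) finite_atLeastAtMost I(2), of "\<lambda>j i. a j (snd i) (fst i)"]
  obtain b where b: "\<exists>j\<in>{1..d}. b j \<noteq> 0" "\<forall>i\<in>?I. (\<Sum>j\<in>{1..d}. b j * a j (snd i) (fst i)) = 0" by blast
  have "(\<lambda>x. \<Sum>j=1..d. b j *\<^sub>R M j x) = (\<lambda>x. 0)"
  proof (rule ext, subst vec_eq_iff, rule allI)
    fix x A
    have real: "M j x $ A = of_real (Re (M j x $ A))" if "j \<in> {1..d}" for j
      using M that by (auto simp: monogenic_orthonormal_basis_def monogenics_def)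
    have "(\<Sum>j=1..d. b j * Re (M j x $ A)) = (\<Sum>\<alpha>\<in>multi_indices l. (\<Sum>j=1..d. b j * a j A \<alpha>) * monomial_fun \<alpha> x)"
      by (simp add: a sum_distrib_left sum_distrib_right mult.assoc) (rule sum.swap)
    also have "\<dots> = 0"
    proof (intro sum.neutral ballI)
      fix \<alpha> :: "'n \<Rightarrow> nat" assume "\<alpha> \<in> multi_indices l"
      then show "(\<Sum>j=1..d. b j * a j A \<alpha>) * monomial_fun \<alpha> x = 0" using bspec [OF b(2), of "(\<alpha>, A)"] by simp
    qed
    finally have "(\<Sum>j=1..d. b j * Re (M j x $ A)) = 0" .
    moreover have "(\<Sum>j=1..d. b j *\<^sub>R M j x) $ A = of_real (\<Sum>j=1..d. b j * Re (M j x $ A))"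
      by (simp, intro sum.cong refl) (subst real, auto simp: scaleR_conv_of_real)
    ultimately show "(\<Sum>j=1..d. b j *\<^sub>R M j x) $ A = 0 $ A" by simp
  qed
  then have "\<forall>j\<in>{1..d}. b j = 0" using M by (simp add: monogenic_orthonormal_basis_def)
  with b(1) show False by blast
qed

section \<open>The fractional transform\<close>

context L2_basis begin

lemma diag_op_contraction:
  assumes a: "\<And>i. i \<in> J \<Longrightarrow> cmod (a i) \<le> 1" and fk: "(f, k) \<in> diag_op a"
  shows "norm_c c k \<le> norm_c c f"
proof (rule power2_le_imp_le)
  have f: "f \<in> L2 c" and k: "k \<in> L2 c" and ck: "\<And>i. coef k i = a i * coef f i" using diag_opD [OF fk] by auto
  have "(cmod (coef k i))\<^sup>2 \<le> (cmod (coef f i))\<^sup>2" for i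
  proof (cases "i \<in> J")
    case True
    then have "cmod (a i) * cmod (coef f i) \<le> 1 * cmod (coef f i)" using a by (intro mult_right_mono) auto
    then show ?thesis unfolding ck norm_mult by (intro power_mono) auto
  qed (simp add: ck coef_outside f)
  then show "(norm_c c k)\<^sup>2 \<le> (norm_c c f)\<^sup>2"
    by (rule sums_le [OF _ Parseval [OF k] Parseval [OF f]])
  show "0 \<le> norm_c c f" by (rule norm_c_nonneg [OF f])
qed

lemma diag_op_combination:
  assumes "(f, k) \<in> diag_op a" "(g, l) \<in> diag_op a"
  shows "(\<lambda>x. r *s f x + s *s g x, \<lambda>x. r *s k x + s *s l x) \<in> diag_op a"
proof -
  note D = diag_opD [OF assms(1)] diag_opD [OF assms(2)]
  show ?thesis
    using D by (intro diag_opI) (auto simp: L2_add L2_scale coef_add coef_scale algebra_simps)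
qed

lemma diag_op_everywhere_defined:
  assumes a: "\<And>i. i \<in> J \<Longrightarrow> cmod (a i) \<le> 1"
  shows "everywhere_defined_operator c (diag_op a)"
  unfolding everywhere_defined_operator_def
proof (intro conjI ballI allI impI diag_op_combination)
  show "diag_op a \<subseteq> L2 c \<times> L2 c" by (auto simp: diag_op_def)
  fix f :: "'n cl_fun" assume f: "f \<in> L2 c"
  \<comment> \<open>The bound is assumed on \<open>J\<close> only, while
    \<open>diag_op_total\<close> asks for it at every index; \<open>diag_op\<close> does not see the
    change.\<close>
  define a' where "a' i = (if i \<in> J then a i else 0)" for i
  have "cmod (a' i) \<le> 1" for i using a by (simp add: a'_def)
  then obtain k where "(f, k) \<in> diag_op a'" using diag_op_total [OF _ f] by blast
  then show "\<exists>k. (f, k) \<in> diag_op a" by (auto simp: diag_op_def a'_def)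
next
  fix f g k l assume fk: "(f, k) \<in> diag_op a" and gl: "(g, l) \<in> diag_op a" and "ae_eq f g"
  then have "coef f i = coef g i" for i using diag_opD [OF fk] diag_opD [OF gl] by (intro coef_cong_AE) auto
  then show "ae_eq k l" using diag_opD [OF fk] diag_opD [OF gl] by (intro ae_eqI) auto
qed

lemma diag_op_continuous:
  assumes a: "\<And>i. i \<in> J \<Longrightarrow> cmod (a i) \<le> 1"
  shows "continuous_operator c (diag_op a)"
  unfolding continuous_operator_def
proof (intro conjI diag_op_everywhere_defined, erule a, clarify)
  fix f k and e :: real assume fk: "(f, k) \<in> diag_op a" and e: "e > 0"
  have "norm_c c (\<lambda>x. l x - k x) < e" if gl: "(g, l) \<in> diag_op a" and n: "norm_c c (\<lambda>x. g x - f x) < e" for g l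
  proof -
    have "1 *s g x + (- 1) *s f x = g x - f x" "1 *s l x + (- 1) *s k x = l x - k x" for x
      by (simp_all add: vec_eq_iff)
    then have "(\<lambda>x. g x - f x, \<lambda>x. l x - k x) \<in> diag_op a"
      using diag_op_combination [OF gl fk, of 1 "- 1"] by simp
    from diag_op_contraction [OF a this] n show ?thesis by simp
  qed
  then show "\<exists>\<delta>>0. \<forall>(g, l)\<in>diag_op a. norm_c c (\<lambda>x. g x - f x) < \<delta> \<longrightarrow> norm_c c (\<lambda>x. l x - k x) < e"
    using e by (intro exI [of _ e]) auto
qed

lemma diag_op_unitary:
  assumes a: "\<And>i. i \<in> J \<Longrightarrow> cmod (a i) = 1"
  shows "unitary_operator c (diag_op a)"
  unfolding unitary_operator_def
proof (intro conjI diag_op_everywhere_defined)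
  show "cmod (a i) \<le> 1" if "i \<in> J" for i using a [OF that] by simp
  show "\<forall>(f, k)\<in>diag_op a. \<forall>(g, l)\<in>diag_op a. inner_c c k l = inner_c c f g"
  proof clarify
    fix f k g l assume fk: "(f, k) \<in> diag_op a" and gl: "(g, l) \<in> diag_op a"
    have L: "f \<in> L2 c" "k \<in> L2 c" "g \<in> L2 c" "l \<in> L2 c" using diag_opD [OF fk] diag_opD [OF gl] by auto
    have "cnj (coef k i) * coef l i = cnj (coef f i) * coef g i" for i
    proof (cases "i \<in> J")
      case True
      have "a i * cnj (a i) = 1" using a [OF True] complex_norm_square [of "a i"] by simp
      moreover have "cnj (coef k i) * coef l i = (a i * cnj (a i)) * (cnj (coef f i) * coef g i)"
        using diag_opD [OF fk, of i] diag_opD [OF gl, of i] by (simp add: mult_ac)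
      ultimately show ?thesis by simp
    qed (simp add: coef_outside L)
    then show "inner_c c k l = inner_c c f g"
      using Parseval_inner [OF L(2,4)] Parseval_inner [OF L(1,3)] by (simp add: sums_iff)
  qed
  show "\<forall>k\<in>L2 c. \<exists>f. (f, k) \<in> diag_op a"
  proof
    fix k :: "'n cl_fun" assume k: "k \<in> L2 c"
    \<comment> \<open>The preimage comes from the reciprocal multipliers, again of modulus 1 on
      \<open>J\<close> and set to 0 elsewhere.\<close>
    define b where "b i = (if i \<in> J then 1 / a i else 0)" for i
    have "cmod (b i) \<le> 1" for i using a by (simp add: b_def norm_divide)
    then obtain f where f: "(k, f) \<in> diag_op b" using diag_op_total [OF _ k] by blast
    have "a i \<noteq> 0" if "i \<in> J" for i using a [OF that] by auto
    then have "(f, k) \<in> diag_op a" using f by (auto simp: diag_op_def b_def)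
    then show "\<exists>f. (f, k) \<in> diag_op a" by blast
  qed
qed

lemma psi_inj: "inj_on \<psi> J"
proof (rule inj_onI, rule ccontr)
  fix i j assume "i \<in> J" "j \<in> J" "\<psi> i = \<psi> j" "i \<noteq> j"
  then show False using ortho [of i j] ortho [of i i] by simp
qed

lemma psi_orthonormal_basis: "orthonormal_basis c (\<psi> ` J)"
  unfolding orthonormal_basis_def
proof (intro conjI ballI allI impI)
  show "\<psi> ` J \<subseteq> L2 c" using psi_L2 by auto
  fix f g assume "f \<in> \<psi> ` J" "g \<in> \<psi> ` J"
  then show "inner_c c f g = (if f = g then 1 else 0)"
    using psi_inj by (auto simp: ortho inj_on_eq_iff)
next
  fix f :: "'n cl_fun" and e :: real assume f: "f \<in> L2 c" and "e > 0"
  then obtain n where "norm (norm_c c (\<lambda>x. expan (coef f) {..<n} x - f x) - 0) < e"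
    using LIMSEQ_D [OF expansion [OF f]] by blast
  then have n: "norm_c c (\<lambda>x. f x - expan (coef f) {..<n} x) < e"
    by (subst norm_c_minus_commute) simp
  \<comment> \<open>\<open>lspan\<close> attaches coefficients to vectors rather than to indices, so
    the index is recovered from the vector; \<open>psi_inj\<close> makes this unambiguous.\<close>
  have "expan (coef f) {..<n} x = (\<Sum>u\<in>\<psi> ` ({..<n} \<inter> J). coef f (the_inv_into J \<psi> u) *s u x)" for x
  proof -
    have "expan (coef f) {..<n} x = (\<Sum>k\<in>{..<n} \<inter> J. coef f k *s \<psi> k x)"
      unfolding expan_def by (rule sum.mono_neutral_right) (auto simp: coef_outside f)
    also have "\<dots> = (\<Sum>u\<in>\<psi> ` ({..<n} \<inter> J). coef f (the_inv_into J \<psi> u) *s u x)"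
      by (subst sum.reindex) (auto intro: inj_on_subset [OF psi_inj] simp: the_inv_into_f_f [OF psi_inj])
    finally show ?thesis .
  qed
  then have "expan (coef f) {..<n} \<in> lspan (\<psi> ` J)"
    unfolding lspan_def by (intro CollectI exI [of _ "\<psi> ` ({..<n} \<inter> J)"] exI [of _ "\<lambda>u. coef f (the_inv_into J \<psi> u)"]) auto
  with n show "\<exists>g\<in>lspan (\<psi> ` J). norm_c c (\<lambda>x. f x - g x) < e" by blast
qed

lemma diag_op_eigenvector: "i \<in> J \<Longrightarrow> (\<psi> i, \<lambda>x. a i *s \<psi> i x) \<in> diag_op a"
  by (intro diag_opI psi_L2 L2_scale) (auto simp: coef_scale psi_L2 coef_psi)

lemma diag_op_Hilbert_Schmidt:
  assumes a: "\<And>i. i \<in> J \<Longrightarrow> cmod (a i) \<le> 1" and s: "(\<lambda>i. (cmod (a i))\<^sup>2) summable_on J"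
  shows "hilbert_schmidt_operator c (diag_op a)"
  unfolding hilbert_schmidt_operator_def
proof (intro conjI diag_op_continuous a exI [of _ "\<psi> ` J"] exI [of _ "\<lambda>f x. a (the_inv_into J \<psi> f) *s f x"] psi_orthonormal_basis ballI)
  show "(f, \<lambda>x. a (the_inv_into J \<psi> f) *s f x) \<in> diag_op a" if f: "f \<in> \<psi> ` J" for f
  proof -
    obtain i where i: "i \<in> J" "f = \<psi> i" using f by blast
    then show ?thesis using diag_op_eigenvector [OF i(1), of a] by (simp add: the_inv_into_f_f [OF psi_inj])
  qed
  have "(norm_c c (\<lambda>x. a (the_inv_into J \<psi> (\<psi> i)) *s \<psi> i x))\<^sup>2 = (cmod (a i))\<^sup>2" if "i \<in> J" for i
  proof -
    have "norm_c c (\<psi> i) = 1" using that by (simp add: norm_c_def ortho)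
    then show ?thesis using that by (simp add: the_inv_into_f_f [OF psi_inj] norm_c_scale psi_L2)
  qed
  then show "(\<lambda>f. (norm_c c (\<lambda>x. a (the_inv_into J \<psi> f) *s f x))\<^sup>2) summable_on \<psi> ` J"
    using s by (subst summable_on_reindex [OF psi_inj]) (simp add: o_def cong: summable_on_cong)
qed

end

section \<open>Enumeration of the triples (n, l, j) by iterated pairing, and sums over them\<close>

definition n_of :: "nat \<Rightarrow> nat" where "n_of k = fst (prod_decode k)"
definition l_of :: "nat \<Rightarrow> nat" where "l_of k = fst (prod_decode (snd (prod_decode k)))"
definition j_of :: "nat \<Rightarrow> nat" where "j_of k = snd (prod_decode (snd (prod_decode k)))"

lemma index_eqI: "n_of k = n_of k' \<Longrightarrow> l_of k = l_of k' \<Longrightarrow> j_of k = j_of k' \<Longrightarrow> k = k'"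
  unfolding n_of_def l_of_def j_of_def by (metis prod_decode_inverse prod_eq_iff)

lemma index_exists: "\<exists>k. n_of k = n \<and> l_of k = l \<and> j_of k = j"
  by (intro exI [of _ "prod_encode (n, prod_encode (l, j))"]) (simp add: n_of_def l_of_def j_of_def)

definition index_set :: "(nat \<Rightarrow> nat) \<Rightarrow> nat set" where
  "index_set d = {k. j_of k \<in> {1..d (l_of k)}}"

text \<open>Half of the exponential absorbs the polynomial; the other half is a geometric
  series.\<close>

lemma summable_polynomial_geometric:
  fixes q :: real
  assumes "q > 0"
  shows "summable (\<lambda>l. (real l + 1) ^ m * exp (- q * real l))"
proof (rule summable_comparison_test_ev)
  have "((\<lambda>l. (real l + 1) ^ m * exp (- (q / 2) * real l)) \<longlongrightarrow> 0) sequentially" using assms by real_asymp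
  then have "\<forall>\<^sub>F l in sequentially. (real l + 1) ^ m * exp (- (q / 2) * real l) < 1" by (rule order_tendstoD) simp
  then show "\<forall>\<^sub>F l in sequentially. norm ((real l + 1) ^ m * exp (- q * real l)) \<le> exp (- (q / 2)) ^ l"
  proof eventually_elim
    case (elim l)
    have "(real l + 1) ^ m * exp (- q * real l) = ((real l + 1) ^ m * exp (- (q / 2) * real l)) * exp (- (q / 2) * real l)"
      by (simp add: mult.assoc exp_add [symmetric])
    also have "\<dots> \<le> 1 * exp (- (q / 2) * real l)" using elim by (intro mult_right_mono) auto
    finally show ?case by (simp add: exp_of_nat_mult [symmetric] mult.commute)
  qed
  show "summable (\<lambda>l. exp (- (q / 2)) ^ l)" using assms by (intro summable_geometric) simp
qed

text \<open>Every finite partial sum sits in a box of triples, where it factors into a geometric sum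
  over n and a sum over l in which \<open>d l\<close> counts the admissible j.\<close>

lemma index_set_summable:
  fixes p q :: real
  assumes p: "p > 0" and q: "q > 0" and d: "\<And>l. real (d l) \<le> C * (real l + 1) ^ m"
  shows "(\<lambda>k. exp (- p * real (n_of k)) * exp (- q * real (l_of k))) summable_on index_set d"
proof (rule nonneg_bdd_above_summable_on)
  have C: "C \<ge> 0" using d [of 0] by simp
  have s1: "summable (\<lambda>n. exp (- p * real n))"
    using summable_polynomial_geometric [OF p, of 0] by simp
  have s2: "summable (\<lambda>l. real (d l) * exp (- q * real l))"
  proof (rule summable_comparison_test')
    show "summable (\<lambda>l. C * ((real l + 1) ^ m * exp (- q * real l)))" by (intro summable_mult summable_polynomial_geometric q)
    show "norm (real (d l) * exp (- q * real l)) \<le> C * ((real l + 1) ^ m * exp (- q * real l))" for l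
      using d [of l] by (simp add: mult.assoc [symmetric] mult_right_mono)
  qed
  let ?f = "\<lambda>k. exp (- p * real (n_of k)) * exp (- q * real (l_of k))"
  have "sum ?f F \<le> (\<Sum>n. exp (- p * real n)) * (\<Sum>l. real (d l) * exp (- q * real l))"
    if F: "F \<subseteq> index_set d" "finite F" for F
  proof -
    \<comment> \<open>\<open>insert 0\<close> keeps \<open>Max\<close> meaningful for empty
      \<open>F\<close>, and \<open>Suc\<close> makes the bounds strict.\<close>
    define N where "N = Suc (Max (insert 0 (n_of ` F \<union> l_of ` F)))"
    have N: "n_of k < N" "l_of k < N" if "k \<in> F" for k
      unfolding N_def less_Suc_eq_le using that F(2) by (auto intro!: Max_ge)
    let ?\<iota> = "\<lambda>k. (n_of k, (l_of k, j_of k))"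
    let ?B = "{..<N} \<times> (SIGMA l:{..<N}. {1..d l})"
    let ?g = "\<lambda>(n, (l, j)). exp (- p * real n) * exp (- q * real l)"
    have inj: "inj_on ?\<iota> F" by (auto intro!: inj_onI index_eqI)
    have "sum ?f F = sum ?g (?\<iota> ` F)" by (subst sum.reindex [OF inj]) (simp add: o_def)
    also have "\<dots> \<le> sum ?g ?B"
      using F N by (intro sum_mono2) (auto simp: index_set_def)
    also have "\<dots> = (\<Sum>n<N. \<Sum>l<N. \<Sum>j=1..d l. exp (- p * real n) * exp (- q * real l))"
      by (simp add: sum.cartesian_product [symmetric] sum.Sigma [symmetric])
    also have "\<dots> = (\<Sum>n<N. exp (- p * real n)) * (\<Sum>l<N. real (d l) * exp (- q * real l))"
      by (simp add: sum_product mult_ac)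
    also have "\<dots> \<le> (\<Sum>n. exp (- p * real n)) * (\<Sum>l. real (d l) * exp (- q * real l))"
      by (intro mult_mono sum_le_suminf s1 s2 sum_nonneg suminf_nonneg) auto
    finally show ?thesis .
  qed
  then show "bdd_above (sum ?f ` {F. F \<subseteq> index_set d \<and> finite F})"
    by (intro bdd_aboveI2 [of _ _ "(\<Sum>n. exp (- p * real n)) * (\<Sum>l. real (d l) * exp (- q * real l))"]) auto
qed auto

definition phi_at :: "real \<Rightarrow> (nat \<Rightarrow> nat \<Rightarrow> ('n::{finite,linorder}) cl_fun) \<Rightarrow> nat \<Rightarrow> 'n cl_fun" where
  "phi_at c M k = phi c M (n_of k) (l_of k) (j_of k)"

text \<open>Triples with j outside {1..d l} are sent to 0, because \<open>M l j\<close> is arbitrary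
  there.\<close>

definition psi :: "real \<Rightarrow> (nat \<Rightarrow> nat) \<Rightarrow> (nat \<Rightarrow> nat \<Rightarrow> ('n::{finite,linorder}) cl_fun) \<Rightarrow> nat \<Rightarrow> 'n cl_fun" where
  "psi c d M k = (\<lambda>x. (if k \<in> index_set d then of_real (1 / norm_c c (phi_at c M k)) else 0) *s phi_at c M k x)"

lemma fourier_D_diagonal:
  fixes M :: "nat \<Rightarrow> nat \<Rightarrow> ('n::{finite,linorder}) cl_fun"
  assumes c: "c > - 1" and M: "\<And>l. monogenic_orthonormal_basis l (d l) (M l)"
  shows "L2_basis c (psi c d M) (index_set d)"
    and "fourier_D c d M \<omega> = L2_basis.diag_op c (psi c d M) (index_set d)
      (\<lambda>k. exp (- \<omega> * of_nat (n_of k)) * exp (- (\<omega> * of_nat (l_of k) / (1 + of_real c))))"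
proof -
  have c1: "1 + c \<noteq> 0" using c by simp
  let ?J = "index_set d" and ?\<psi> = "psi c d M" and ?\<phi> = "phi_at c M"
  have mon: "M (l_of k) (j_of k) \<in> monogenics (l_of k)" if "k \<in> ?J" for k
    using M that by (auto simp: monogenic_orthonormal_basis_def index_set_def)
  have phiL: "?\<phi> k \<in> L2 c" if "k \<in> ?J" for k
    unfolding phi_at_def by (rule phi_L2 [where M = M, OF c mon [OF that]])
  have nz: "norm_c c (?\<phi> k) \<noteq> 0" if "k \<in> ?J" for k
    unfolding phi_at_def using that by (intro phi_norm_nonzero [OF c M]) (simp add: index_set_def)
  have psi_out: "?\<psi> k = (\<lambda>x. 0)" if "k \<notin> ?J" for k using that by (simp add: psi_def fun_eq_iff)
  have psi_in: "?\<psi> k = (\<lambda>x. of_real (1 / norm_c c (?\<phi> k)) *s ?\<phi> k x)" if "k \<in> ?J" for k using that by (simp add: psi_def)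
  have psiL: "?\<psi> k \<in> L2 c" for k
    by (cases "k \<in> ?J") (simp_all add: psi_out psi_in L2_zero L2_scale phiL)
  have phi_orth: "inner_c c (?\<phi> i) (?\<phi> j) = 0" if "i \<in> ?J" "j \<in> ?J" "i \<noteq> j" for i j
    unfolding phi_at_def using that index_eqI [of i j] by (intro phi_orthogonal [OF c M]) (auto simp: index_set_def)
  show basis: "L2_basis c ?\<psi> ?J"
  proof
    show "?\<psi> k \<in> L2 c" for k by (rule psiL)
    show "inner_c c (?\<psi> i) (?\<psi> j) = (if i = j \<and> i \<in> ?J then 1 else 0)" for i j
    proof (cases "i \<in> ?J \<and> j \<in> ?J")
      case True
      then have "inner_c c (?\<psi> i) (?\<psi> j) = of_real (1 / norm_c c (?\<phi> i)) * (of_real (1 / norm_c c (?\<phi> j)) * inner_c c (?\<phi> i) (?\<phi> j))"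
        by (simp add: psi_in inner_c_scale_left inner_c_scale_right phiL L2_scale)
      then show ?thesis
        using True phi_orth [of i j] nz [of i]
        by (cases "i = j") (simp_all add: inner_c_self_norm phiL power2_eq_square)
    next
      case False
      then show ?thesis
        by (auto simp: psi_out inner_c_zero_left inner_c_zero_right psiL L2_zero)
    qed
    fix f assume f: "f \<in> L2 c" and orth: "\<And>k. inner_c c (?\<psi> k) f = 0"
    show "ae_eq f (\<lambda>x. 0)"
    proof (rule phi_complete [OF c M f])
      fix n l j assume j: "j \<in> {1..d l}"
      obtain k where k: "n_of k = n" "l_of k = l" "j_of k = j" using index_exists by blast
      then have J: "k \<in> ?J" using j by (simp add: index_set_def)
      have "inner_c c (?\<psi> k) f = of_real (1 / norm_c c (?\<phi> k)) * inner_c c (?\<phi> k) f"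
        by (simp add: psi_in [OF J] inner_c_scale_left phiL [OF J] f)
      then show "inner_c c (phi c M n l j) f = 0"
        using orth [of k] nz [OF J] k by (simp add: phi_at_def)
    qed
  qed
  interpret L2_basis c ?\<psi> ?J by (rule basis)
  define lam where "lam k = eigenvalue CARD('n) c (n_of k) (l_of k)" for k
  have phi_psi: "?\<phi> k = (\<lambda>x. of_real (norm_c c (?\<phi> k)) *s ?\<psi> k x)" if "k \<in> ?J" for k
    using nz [OF that] by (simp add: psi_in [OF that] vec_eq_iff fun_eq_iff)
  have coef_phi: "coef (?\<phi> k) i = (if i = k then of_real (norm_c c (?\<phi> k)) else 0)" if "k \<in> ?J" for k i
    by (subst phi_psi [OF that]) (simp add: coef_scale psi_L2 coef_psi that)
  have phi_inj: "inj_on ?\<phi> ?J"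
  proof (rule inj_onI, rule ccontr)
    fix i j assume ij: "i \<in> ?J" "j \<in> ?J" "?\<phi> i = ?\<phi> j" "i \<noteq> j"
    then show False using coef_phi [of i i] coef_phi [of j i] nz [of i] by simp
  qed
  \<comment> \<open>The diagonal formula may fail at the origin. One exceptional point affects
    neither measurability nor the class of the function, so the image is still in
    \<open>L2 c\<close>.\<close>
  have op_L: "op_L c (\<lambda>x. \<Sum>k\<in>K. a k *s ?\<phi> k x) \<in> L2 c
      \<and> ae_eq (op_L c (\<lambda>x. \<Sum>k\<in>K. a k *s ?\<phi> k x)) (\<lambda>x. \<Sum>k\<in>K. (a k * of_real (lam k)) *s ?\<phi> k x)"
    if K: "finite K" "K \<subseteq> ?J" for K a
  proof -
    let ?h = "op_L c (\<lambda>x. \<Sum>k\<in>K. a k *s ?\<phi> k x)" and ?h' = "\<lambda>x. \<Sum>k\<in>K. (a k * of_real (lam k)) *s ?\<phi> k x"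
    have off0: "?h x = ?h' x" if "x \<noteq> 0" for x
      unfolding phi_at_def lam_def
      by (rule op_L_phi_combination [where M = M and n = n_of and l = l_of and j = j_of, OF K(1) _ c1 that]) (use mon K(2) in blast)
    have h'L: "?h' \<in> L2 c" using K by (intro L2_sum L2_scale phiL) auto
    note [measurable] = h'L
    have "?h = (\<lambda>x. if x = 0 then ?h 0 else ?h' x)" using off0 by auto
    moreover have "(\<lambda>x. if x = 0 then ?h 0 else ?h' x) \<in> borel_measurable borel" by measurable
    ultimately have m: "?h \<in> borel_measurable borel" by (simp only:)
    have ae: "AE x in lborel. ?h x = ?h' x"
      using AE_lborel_singleton [of "0 :: (real, 'n) vec"] by eventually_elim (rule off0)
    then have "?h \<in> L2 c"
      by (intro L2_bound [OF h'L m, of 1]) (auto elim!: eventually_mono)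
    with ae show ?thesis by (simp add: ae_eq_def)
  qed
  \<comment> \<open>One inclusion passes the coefficient relation to limits; the other approximates
    by partial expansions. Together they say that the span of the basis functions is a core for the
    maximal diagonal operator.\<close>
  have closure: "closure_L c d M = diag_op (\<lambda>k. of_real (lam k))"
  proof (intro set_eqI iffI; clarify)
    fix f g assume "(f, g) \<in> closure_L c d M"
    then obtain p where f: "f \<in> L2 c" and g: "g \<in> L2 c"
      and p: "\<And>n::nat. p n \<in> {(f, op_L c f) |f. f \<in> phi_span c d M}"
      and lim: "(\<lambda>n. norm_c c (\<lambda>x. fst (p n) x - f x)) \<longlonglongrightarrow> 0" "(\<lambda>n. norm_c c (\<lambda>x. snd (p n) x - g x)) \<longlonglongrightarrow> 0"
      unfolding closure_L_def op_closure_def by blast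
    have pn: "fst (p n) \<in> L2 c \<and> snd (p n) \<in> L2 c \<and> (\<forall>i. coef (snd (p n)) i = of_real (lam i) * coef (fst (p n)) i)" for n
    proof -
      obtain h where h: "h \<in> phi_span c d M" "p n = (h, op_L c h)" using p by blast
      obtain T a where T: "finite T" "T \<subseteq> {phi c M t l j |t l j. j \<in> {1..d l}}" "h = (\<lambda>x. \<Sum>u\<in>T. a u *s u x)"
        using h(1) unfolding phi_span_def lspan_def by blast
      \<comment> \<open>The span is over a set of functions; it is rewritten over indices, which
        \<open>phi_inj\<close> permits.\<close>
      have "T \<subseteq> ?\<phi> ` ?J"
      proof
        fix u assume "u \<in> T"
        then obtain t l j where u: "u = phi c M t l j" "j \<in> {1..d l}" using T(2) by blast
        obtain k where "n_of k = t" "l_of k = l" "j_of k = j" using index_exists by blast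
        then show "u \<in> ?\<phi> ` ?J" using u by (intro image_eqI [of _ _ k]) (auto simp: phi_at_def index_set_def)
      qed
      then obtain K where K: "K \<subseteq> ?J" "finite K" "T = ?\<phi> ` K" using finite_subset_image [OF T(1)] by blast
      have hK: "h = (\<lambda>x. \<Sum>k\<in>K. a (?\<phi> k) *s ?\<phi> k x)"
        unfolding T(3) K(3) by (subst sum.reindex [OF inj_on_subset [OF phi_inj K(1)]]) simp
      note L = op_L [OF K(2,1), of "\<lambda>k. a (?\<phi> k)", folded hK]
      have hL: "h \<in> L2 c" unfolding hK using K by (intro L2_sum L2_scale phiL) auto
      have "coef (op_L c h) i = of_real (lam i) * coef h i" for i
      proof -
        have "coef (op_L c h) i = coef (\<lambda>x. \<Sum>k\<in>K. (a (?\<phi> k) * of_real (lam k)) *s ?\<phi> k x) i"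
          using L K by (intro coef_cong_AE L2_sum L2_scale phiL) auto
        also have "\<dots> = (\<Sum>k\<in>K. (a (?\<phi> k) * of_real (lam k)) * coef (?\<phi> k) i)"
          using K by (subst coef_sum) (auto intro!: L2_scale phiL sum.cong simp: coef_scale phiL subset_iff)
        also have "\<dots> = of_real (lam i) * (\<Sum>k\<in>K. a (?\<phi> k) * coef (?\<phi> k) i)"
          unfolding sum_distrib_left using K by (intro sum.cong refl) (auto simp: coef_phi subset_iff)
        also have "(\<Sum>k\<in>K. a (?\<phi> k) * coef (?\<phi> k) i) = coef h i"
          unfolding hK using K by (subst coef_sum) (auto intro!: L2_scale phiL sum.cong simp: coef_scale phiL subset_iff)
        finally show ?thesis .
      qed
      with hL L h(2) show ?thesis by simp
    qed
    show "(f, g) \<in> diag_op (\<lambda>k. of_real (lam k))"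
    proof (rule diag_opI [OF f g])
      fix i
      have "(\<lambda>n. coef (fst (p n)) i) \<longlonglongrightarrow> coef f i"
        unfolding coef_def by (rule inner_c_tendsto) (use pn f psi_L2 lim in auto)
      from tendsto_mult_left [OF this, of "of_real (lam i)"]
      have "(\<lambda>n. coef (snd (p n)) i) \<longlonglongrightarrow> of_real (lam i) * coef f i" using pn by simp
      moreover have "(\<lambda>n. coef (snd (p n)) i) \<longlonglongrightarrow> coef g i"
        unfolding coef_def by (rule inner_c_tendsto) (use pn g psi_L2 lim in auto)
      ultimately show "coef g i = of_real (lam i) * coef f i" by (rule LIMSEQ_unique [rotated])
    qed
  next
    fix f g assume fg: "(f, g) \<in> diag_op (\<lambda>k. of_real (lam k))"
    then have f: "f \<in> L2 c" and g: "g \<in> L2 c" and cg: "\<And>i. coef g i = of_real (lam i) * coef f i"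
      using diag_opD [OF fg] by auto
    define K where "K n = {..<n} \<inter> ?J" for n
    have K: "finite (K n)" "K n \<subseteq> ?J" for n by (auto simp: K_def)
    define b where "b k = coef f k / of_real (norm_c c (?\<phi> k))" for k
    have ex: "expan a {..<n} = (\<lambda>x. \<Sum>k\<in>K n. (a k / of_real (norm_c c (?\<phi> k))) *s ?\<phi> k x)" for a n
    proof
      fix x
      have "expan a {..<n} x = (\<Sum>k\<in>K n. a k *s ?\<psi> k x)"
        unfolding expan_def K_def by (rule sum.mono_neutral_right) (auto simp: psi_out)
      also have "\<dots> = (\<Sum>k\<in>K n. (a k / of_real (norm_c c (?\<phi> k))) *s ?\<phi> k x)"
        by (intro sum.cong refl) (auto simp: K_def psi_in vec_eq_iff)
      finally show "expan a {..<n} x = (\<Sum>k\<in>K n. (a k / of_real (norm_c c (?\<phi> k))) *s ?\<phi> k x)" .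
    qed
    \<comment> \<open>The partial expansions of \<open>f\<close> lie in the initial domain, and L
      maps them almost everywhere to the partial expansions of \<open>g\<close>, because the
      coefficients of \<open>g\<close> are \<open>lam\<close> times those of \<open>f\<close>. Both
      sequences converge by \<open>expansion\<close>.\<close>
    let ?p = "\<lambda>n. (expan (coef f) {..<n}, op_L c (expan (coef f) {..<n}))"
    have span: "expan (coef f) {..<n} \<in> phi_span c d M" for n
    proof -
      have "expan (coef f) {..<n} = (\<lambda>x. \<Sum>u\<in>?\<phi> ` K n. b (the_inv_into ?J ?\<phi> u) *s u x)"
        unfolding ex using K [of n] inj_on_subset [OF phi_inj, of "K n"]
        by (subst sum.reindex) (auto intro!: sum.cong simp: b_def the_inv_into_f_f [OF phi_inj] subset_iff)
      moreover have "?\<phi> ` K n \<subseteq> {phi c M t l j |t l j. j \<in> {1..d l}}"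
        using K(2) [of n] by (auto simp: phi_at_def index_set_def)
      ultimately show ?thesis unfolding phi_span_def lspan_def
        using K(1) [of n] by (intro CollectI exI [of _ "?\<phi> ` K n"] exI [of _ "\<lambda>u. b (the_inv_into ?J ?\<phi> u)"]) auto
    qed
    have ae: "op_L c (expan (coef f) {..<n}) \<in> L2 c \<and> ae_eq (op_L c (expan (coef f) {..<n})) (expan (coef g) {..<n})" for n
    proof -
      have "(\<Sum>k\<in>K n. (coef f k / of_real (norm_c c (?\<phi> k)) * of_real (lam k)) *s ?\<phi> k x) = expan (coef g) {..<n} x" for x
        unfolding ex by (intro sum.cong refl) (simp add: cg mult.commute)
      then show ?thesis using op_L [OF K, of "\<lambda>k. coef f k / of_real (norm_c c (?\<phi> k))" n] unfolding ex [of "coef f"] by simp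
    qed
    have "norm_c c (\<lambda>x. op_L c (expan (coef f) {..<n}) x - g x) = norm_c c (\<lambda>x. expan (coef g) {..<n} x - g x)" for n
      using ae [of n] by (intro norm_c_cong_AE L2_diff expan_L2 g) (auto simp: ae_eq_def elim!: eventually_mono)
    then have "(\<lambda>n. norm_c c (\<lambda>x. op_L c (expan (coef f) {..<n}) x - g x)) \<longlonglongrightarrow> 0"
      using expansion [OF g] by simp
    then show "(f, g) \<in> closure_L c d M"
      unfolding closure_L_def op_closure_def using f g span expansion [OF f]
      by (auto intro!: exI [of _ ?p])
  qed
  define e where "e = exp (\<omega> * of_real (delta CARD('n) c) / 2)"
  define \<mu> where "\<mu> k = exp (- \<omega> * of_nat (n_of k)) * exp (- (\<omega> * of_nat (l_of k) / (1 + of_real c)))" for k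
  let ?g = "\<lambda>u::real. exp (- (\<omega> / (2 * (1 + of_real c)\<^sup>2)) * of_real u)"
  have e0: "e \<noteq> 0" by (simp add: e_def)
  have mu: "\<mu> k = e * ?g (lam k)" for k
  proof -
    have c1': "(1 + of_real c :: complex) \<noteq> 0" using c1 by (metis of_real_1 of_real_add of_real_eq_0_iff)
    have "of_real (lam k) = (1 + of_real c)\<^sup>2 * (of_real (delta CARD('n) c) + 2 * of_nat (n_of k) + 2 * of_nat (l_of k) / (1 + of_real c :: complex))"
      by (simp add: lam_def eigenvalue_def)
    then have "\<omega> / (2 * (1 + of_real c)\<^sup>2) * of_real (lam k)
      = \<omega> / 2 * (of_real (delta CARD('n) c) + 2 * of_nat (n_of k) + 2 * of_nat (l_of k) / (1 + of_real c))"
      using c1' by simp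
    also have "\<dots> = \<omega> * of_real (delta CARD('n) c) / 2 + (\<omega> * of_nat (n_of k) + \<omega> * of_nat (l_of k) / (1 + of_real c))"
      by (simp add: distrib_left add_divide_distrib)
    finally have "\<omega> / (2 * (1 + of_real c)\<^sup>2) * of_real (lam k)
      = \<omega> * of_real (delta CARD('n) c) / 2 + (\<omega> * of_nat (n_of k) + \<omega> * of_nat (l_of k) / (1 + of_real c))" .
    then have "e * ?g (lam k) = exp (\<omega> * of_real (delta CARD('n) c) / 2 + - (\<omega> * of_real (delta CARD('n) c) / 2 + (\<omega> * of_nat (n_of k) + \<omega> * of_nat (l_of k) / (1 + of_real c))))"
      unfolding e_def exp_add by simp
    also have "\<dots> = \<mu> k" by (simp add: \<mu>_def exp_add [symmetric])
    finally show ?thesis by simp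
  qed
  have g_meas: "?g \<in> borel_measurable borel"
    by (intro borel_measurable_continuous_onI continuous_intros)
  have "fourier_D c d M \<omega> = {(f, \<lambda>x. e *s k x) |f k. (f, k) \<in> diag_op (\<lambda>k. ?g (lam k))}"
    unfolding fourier_D_def closure functional_calculus_diag [OF g_meas] e_def ..
  also have "\<dots> = diag_op \<mu>"
  proof (intro set_eqI iffI)
    fix q assume "q \<in> {(f, \<lambda>x. e *s k x) |f k. (f, k) \<in> diag_op (\<lambda>k. ?g (lam k))}"
    then obtain f k where q: "q = (f, \<lambda>x. e *s k x)" and fk: "(f, k) \<in> diag_op (\<lambda>k. ?g (lam k))" by blast
    show "q \<in> diag_op \<mu>" unfolding q using diag_opD [OF fk]
      by (intro diag_opI) (auto simp: L2_scale coef_scale mu)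
  next
    fix q assume "q \<in> diag_op \<mu>"
    then obtain f k where q: "q = (f, k)" "(f, k) \<in> diag_op \<mu>" by (cases q) auto
    have "(f, \<lambda>x. (1 / e) *s k x) \<in> diag_op (\<lambda>k. ?g (lam k))"
      using diag_opD [OF q(2)] e0 by (intro diag_opI) (auto simp: L2_scale coef_scale mu)
    moreover have "(f, k) = (f, \<lambda>x. e *s ((1 / e) *s k x))" using e0 by (simp add: vec_eq_iff fun_eq_iff)
    ultimately show "q \<in> {(f, \<lambda>x. e *s k x) |f k. (f, k) \<in> diag_op (\<lambda>k. ?g (lam k))}"
      unfolding q(1) by (intro CollectI exI [of _ f] exI [of _ "\<lambda>x. (1 / e) *s k x"] conjI)
  qed
  finally show "fourier_D c d M \<omega> = diag_op (\<lambda>k. exp (- \<omega> * of_nat (n_of k)) * exp (- (\<omega> * of_nat (l_of k) / (1 + of_real c))))"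
    unfolding \<mu>_def [abs_def] .
qed

theorem theorem6p1:
  fixes c :: real and \<omega> :: complex
    and d :: "nat \<Rightarrow> nat"
    and M :: "nat \<Rightarrow> nat \<Rightarrow> ('n::{finite,linorder}) cl_fun"
  assumes "CARD('n) \<ge> 2" and "c > - 1"
    and "\<And>l. monogenic_orthonormal_basis l (d l) (M l)"
    and "Re \<omega> \<ge> 0"
  shows "(\<forall>t l. \<forall>j\<in>{1..d l}.
            eigenfunction c (fourier_D c d M \<omega>)
              (exp (- \<omega> * of_nat t) * exp (- (\<omega> * of_nat l / (1 + of_real c))))
              (phi c M t l j))
       \<and> continuous_operator c (fourier_D c d M \<omega>)
       \<and> (\<forall>(f, k)\<in>fourier_D c d M \<omega>. norm_c c k \<le> norm_c c f)
       \<and> (Re \<omega> > 0 \<longrightarrow> hilbert_schmidt_operator c (fourier_D c d M \<omega>))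
       \<and> (Re \<omega> = 0 \<longrightarrow> unitary_operator c (fourier_D c d M \<omega>))"
proof -
  note c = assms(2) and M = assms(3)
  interpret L2_basis c "psi c d M" "index_set d" by (rule fourier_D_diagonal(1) [OF c M])
  define \<mu> where "\<mu> k = exp (- \<omega> * of_nat (n_of k)) * exp (- (\<omega> * of_nat (l_of k) / (1 + of_real c)))" for k
  have F: "fourier_D c d M \<omega> = diag_op \<mu>" unfolding \<mu>_def [abs_def] by (rule fourier_D_diagonal(2) [OF c M])
  have mu: "cmod (\<mu> k) = exp (- Re \<omega> * real (n_of k)) * exp (- (Re \<omega> / (1 + c)) * real (l_of k))" for k
  proof -
    \<comment> \<open>The quotient is rewritten as \<omega> times a real number, so that its real
      part involves \<open>Re \<omega>\<close> alone.\<close>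
    have "\<omega> * of_nat (l_of k) / (1 + of_real c) = \<omega> * of_real (real (l_of k) / (1 + c))" by simp
    then have "Re (\<omega> * of_nat (l_of k) / (1 + of_real c)) = Re \<omega> * (real (l_of k) / (1 + c))" by (simp only: times_complex.simps complex_of_real_def complex.sel)
    then show ?thesis unfolding \<mu>_def norm_mult norm_exp_eq_Re by simp
  qed
  have mu1: "cmod (\<mu> k) \<le> 1" for k
  proof -
    have "exp (- Re \<omega> * real (n_of k)) \<le> 1" "exp (- (Re \<omega> / (1 + c)) * real (l_of k)) \<le> 1"
      using assms(2,4) by simp_all
    then show ?thesis unfolding mu by (intro mult_le_one) auto
  qed
  have "eigenfunction c (diag_op \<mu>) (exp (- \<omega> * of_nat t) * exp (- (\<omega> * of_nat l / (1 + of_real c)))) (phi c M t l j)"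
    if j: "j \<in> {1..d l}" for t l j
  proof -
    obtain k where k: "n_of k = t" "l_of k = l" "j_of k = j" using index_exists by blast
    then have J: "k \<in> index_set d" using j by (simp add: index_set_def)
    have m: "M l j \<in> monogenics l" using M j by (auto simp: monogenic_orthonormal_basis_def)
    have L: "phi c M t l j \<in> L2 c" by (rule phi_L2 [where M = M, OF c m])
    have nz: "norm_c c (phi c M t l j) \<noteq> 0" by (rule phi_norm_nonzero [OF c M j])
    have "psi c d M k = (\<lambda>x. of_real (1 / norm_c c (phi c M t l j)) *s phi c M t l j x)"
      using J k by (simp add: psi_def phi_at_def)
    then have eq: "phi c M t l j = (\<lambda>x. of_real (norm_c c (phi c M t l j)) *s psi c d M k x)"
      using nz by (simp add: vec_eq_iff fun_eq_iff)
    have cf: "coef (phi c M t l j) i = (if i = k then of_real (norm_c c (phi c M t l j)) else 0)" for i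
      by (subst eq) (simp add: coef_scale psi_L2 coef_psi J)
    have "(phi c M t l j, \<lambda>x. \<mu> k *s phi c M t l j x) \<in> diag_op \<mu>"
      by (intro diag_opI L L2_scale) (auto simp: coef_scale L cf)
    moreover have "\<not> ae_eq (phi c M t l j) (\<lambda>x. 0)" using nz norm_c_eq_0_iff [OF L] by blast
    ultimately show ?thesis using L k by (simp add: eigenfunction_def \<mu>_def)
  qed
  moreover have "continuous_operator c (diag_op \<mu>)" by (intro diag_op_continuous mu1)
  moreover have "\<forall>(f, k)\<in>diag_op \<mu>. norm_c c k \<le> norm_c c f" using diag_op_contraction mu1 by blast
  moreover have "hilbert_schmidt_operator c (diag_op \<mu>)" if "Re \<omega> > 0"
  proof (rule diag_op_Hilbert_Schmidt [OF mu1])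
    \<comment> \<open>Polynomial growth of the multiplicities meets exponential decay in both n and
      l; squaring the modulus doubles the rates, which are positive as
      \<open>Re \<omega> > 0\<close> and \<open>c > - 1\<close>.\<close>
    have "real (d l) \<le> 2 ^ CARD('n) * (real l + 1) ^ CARD('n)" for l
      using of_nat_mono [OF monogenic_basis_card_le [OF M [of l]], where 'a = real] by (simp add: mult.commute add.commute)
    then have "(\<lambda>k. exp (- (2 * Re \<omega>) * real (n_of k)) * exp (- (2 * (Re \<omega> / (1 + c))) * real (l_of k))) summable_on index_set d"
      using that c by (intro index_set_summable) auto
    moreover have "(cmod (\<mu> k))\<^sup>2 = exp (- (2 * Re \<omega>) * real (n_of k)) * exp (- (2 * (Re \<omega> / (1 + c))) * real (l_of k))" for k
      unfolding mu by (simp add: power2_eq_square exp_add [symmetric])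
    ultimately show "(\<lambda>k. (cmod (\<mu> k))\<^sup>2) summable_on index_set d" by simp
  qed
  moreover have "unitary_operator c (diag_op \<mu>)" if "Re \<omega> = 0"
    by (intro diag_op_unitary) (simp add: mu that)
  ultimately show ?thesis unfolding F by blast
qed

end
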